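(* Let $(U_1,U_2,A)$ be strip-admissible analytic data with values in $U(2)$ and $GL(2,\mathbb C)$, admitting a dominated splitting $E^s\oplus E^u$, over a translation $\tau\in\mathrm{DC}(c,\nu)$ for some $c>0$, $\nu\ge1$. Let $L$ be any continuous invariant line (necessarily $L=E^s$ or $L=E^u$), and let $k\in\mathbb Z^2$ be the winding vector of the periodic phase of its multiplier. Then $L$ carries a nonzero measurable eigensection if and only if $c_1(L)=0$ and $k=0$. When both vanish, the eigenvalues realised on $L$ (i.e. those $\lambda$ for which there is a measurable eigensection with eigenvalue $\lambda$ carried by $L$) are exactly the elements of $$\lambda_0\{\mathrm e^{-2\pi\mathrm i\nu\cdot\tau}:\nu\in\mathbb Z^2\},\qquad \lambda_0=\exp\bigl(\langle\log|q|\rangle+2\pi\mathrm i\langle g\rangle\bigr),$$ a dense subset of the circle of radius $\mathrm e^{\lambda_L}$; each of these eigenvalues is geometrically simple within $L$, i.e. the space of measurable sections $F$ carried by $L$ with $A(w)F(w)=\lambda F(Sw)$ a.e. is one-dimensional; and every measurable eigensection carried by $L$ agrees a.e. with a real-analytic nowhere-vanishing one.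
   Context: Notation. $\mathbb T^2=\mathbb R^2/\mathbb Z^2$, $w=(w_1,w_2)$, Haar probability measure $\mu$; $e_1=(1,0)$, $e_2=(0,1)$; $\langle h\rangle=\int_{\mathbb T^2}h\,d\mu$; the inner product on $\mathbb C^2$ is conjugate-linear in the first slot; $\tau=(\alpha,\beta)\in\mathbb R^2$, $Sw=w+\tau$. Sewing system and cocycle. A continuous unitary sewing system is a pair of continuous $U_1,U_2\colon\mathbb R^2\to U(2)$ with (K1) $U_1(w+e_2)U_2(w)=U_2(w+e_1)U_1(w)$; it presents the rank-two Hermitian bundle $V\to\mathbb T^2$ given as the quotient of $\mathbb R^2\times\mathbb C^2$ by the action generated by $(w,\xi)\mapsto(w+e_j,U_j(w)\xi)$. Measurable sections of $V$ are measurable $F\colon\mathbb R^2\to\mathbb C^2$ with $F(w+e_j)=U_j(w)F(w)$ a.e. A continuous equivariant cocycle is a continuous $A\colon\mathbb R^2\to GL(2,\mathbb C)$ with (K2) $A(w+e_j)U_j(w)=U_j(Sw)A(w)$. A measurable eigensection with eigenvalue $\lambda\in\mathbb C$ is a measurable section, not a.e. zero, with $A(w)F(w)=\lambda F(Sw)$ a.e. Invariant line. A continuous map $\ell\colon\mathbb R^2\to\mathbb{CP}^1$ with $\ell(w+e_j)=U_j(w)\ell(w)$ and $A(w)\ell(w)=\ell(Sw)$ for all $w$; it induces a line subbundle $L\subset V$, and we identify $L$ with $\ell$. $F$ is carried by $L$ if $F(w)\in\ell(w)$ a.e. Charge and multiplier. There are a continuous $e\colon\mathbb R^2\to\mathbb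 C^2$ with $|e|=1$, $e(w)\in\ell(w)$, and a unique integer $m$ with $e(w+e_1)=U_1(w)e(w)$, $e(w+e_2)=\mathrm e^{2\pi\mathrm i m w_1}U_2(w)e(w)$ (a normalized unit section). The multiplier is $q(w)=\langle e(Sw),A(w)e(w)\rangle$, so $A(w)e(w)=q(w)e(Sw)$; it is continuous, zero-free, and $|q|$ is $\mathbb Z^2$-periodic. Its periodic phase $p(w)=\frac{q(w)}{|q(w)|}\mathrm e^{2\pi\mathrm i m\alpha w_2}$ is continuous, $\mathbb Z^2$-periodic, unimodular; $k\in\mathbb Z^2$ is the winding vector of $p$ (independent of $e$) and $g\colon\mathbb T^2\to\mathbb R$ is continuous with $p(w)=\mathrm e^{2\pi\mathrm i(k\cdot w+g(w))}$ ($g$ is unique up to an additive integer). The Lyapunov exponent of $L$ is $\lambda_L=\langle\log|q|\rangle$. Strip-admissible. For $\delta>0$ let $\Omega_\delta=\{w\in\mathbb C^2:|\operatorname{Im}w_1|\le\delta,|\operatorname{Im}w_2|\le\delta\}$. $(U_1,U_2,A)$ is strip-admissible if for some $\delta_0>0$ the maps $U_1,U_2,A$ extend to matrix functions holomorphic on an open neighborhood of $\Omega_{\delta_0}$ and bounded on $\Omega_{\delta_0}$, with $U_j(w)$ unitary and $\det A(w)\ne0$ for real $w$, and (K1), (K2) holding on $\mathbb R^2$. Dominated splitting. A pair of invariant lines $\ell_s,\ell_u$ with $\ell_s(w)\ne\ell_u(w)$ for all $w$, inducing $E^s,E^u$ with $V=E^s\oplus E^u$, such that for some integer $N\ge1$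 and $0<\kappa_0<1$, $\|A^{(N)}(z)|_{\ell_s(z)}\|/\mathfrak m(A^{(N)}(z)|_{\ell_u(z)})\le\kappa_0^2$ for all $z\in\mathbb R^2$, where $A^{(N)}(w)=A(S^{N-1}w)\cdots A(w)$ and $\mathfrak m(M)=\min_{|v|=1}|Mv|$. Diophantine condition. $\tau\in\mathrm{DC}(c,\nu)$, $c>0,\nu\ge1$, means $\|\nu_1'\alpha+\nu_2'\beta\|_{\mathbb R/\mathbb Z}\ge c\,(|\nu_1'|+|\nu_2'|)^{-\nu}$ for all $(\nu_1',\nu_2')\in\mathbb Z^2\setminus\{0\}$, where $\|x\|_{\mathbb R/\mathbb Z}$ is the distance to the nearest integer. *)

theory Defs
  imports "HOL-Analysis.Analysis"
begin

definition conj_transpose :: "complex^'n^'m \<Rightarrow> complex^'m^'n" where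
  "conj_transpose M = (\<chi> i j. cnj (M $ j $ i))"

definition unitary_matrix :: "complex^'n^'n \<Rightarrow> bool" where
  "unitary_matrix M \<longleftrightarrow> conj_transpose M ** M = mat 1 \<and> M ** conj_transpose M = mat 1"

definition herm_inner :: "complex^'n \<Rightarrow> complex^'n \<Rightarrow> complex" where
  "herm_inner x y = (\<Sum>i\<in>UNIV. cnj (x $ i) * y $ i)"

definition unit_vectors :: "(complex^2) set \<Rightarrow> (complex^2) set" where
  "unit_vectors V = {v \<in> V. norm v = 1}"

definition restricted_norm :: "complex^2^2 \<Rightarrow> (complex^2) set \<Rightarrow> real" where
  "restricted_norm M V = (SUP v\<in>unit_vectors V. norm (M *v v))"

definition restricted_conorm :: "complex^2^2 \<Rightarrow> (complex^2) set \<Rightarrow> real" where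
  "restricted_conorm M V = (INF v\<in>unit_vectors V. norm (M *v v))"


text \<open>A point is a complex line through the origin of \<^typ>\<open>complex^2\<close>, as a set of vectors; the
  topology is the quotient topology.\<close>

definition complex_line :: "complex^2 \<Rightarrow> (complex^2) set" where
  "complex_line v = range (\<lambda>c. c *s v)"

definition CP1 :: "(complex^2) set set" where
  "CP1 = complex_line ` (- {0})"

definition CP1_topology :: "(complex^2) set topology" where
  "CP1_topology = topology (\<lambda>X. X \<subseteq> CP1 \<and> open {v. v \<noteq> 0 \<and> complex_line v \<in> X})"

lemma openin_CP1:
  "openin CP1_topology X \<longleftrightarrow> X \<subseteq> CP1 \<and> open {v. v \<noteq> 0 \<and> complex_line v \<in> X}"
proof -
  have "istopology (\<lambda>X. X \<subseteq> CP1 \<and> open {v. v \<noteq> 0 \<and> complex_line v \<in> X})"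
    unfolding istopology_def
  proof (intro conjI allI impI)
    fix S T
    assume S: "S \<subseteq> CP1 \<and> open {v. v \<noteq> 0 \<and> complex_line v \<in> S}"
      and T: "T \<subseteq> CP1 \<and> open {v. v \<noteq> 0 \<and> complex_line v \<in> T}"
    show "S \<inter> T \<subseteq> CP1" using S by auto
    have "{v. v \<noteq> 0 \<and> complex_line v \<in> S \<inter> T} =
      {v. v \<noteq> 0 \<and> complex_line v \<in> S} \<inter> {v. v \<noteq> 0 \<and> complex_line v \<in> T}" by auto
    then show "open {v. v \<noteq> 0 \<and> complex_line v \<in> S \<inter> T}" using S T by auto
  next
    fix \<K>
    assume K: "\<forall>K\<in>\<K>. K \<subseteq> CP1 \<and> open {v. v \<noteq> 0 \<and> complex_line v \<in> K}"
    show "\<Union>\<K> \<subseteq> CP1" using K by auto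
    have "{v. v \<noteq> 0 \<and> complex_line v \<in> \<Union>\<K>} =
      (\<Union>K\<in>\<K>. {v. v \<noteq> 0 \<and> complex_line v \<in> K})" by auto
    then show "open {v. v \<noteq> 0 \<and> complex_line v \<in> \<Union>\<K>}" using K by auto
  qed
  then show ?thesis by (simp add: CP1_topology_def)
qed

lemma topspace_CP1: "topspace CP1_topology = CP1"
proof -
  have "{v. v \<noteq> 0 \<and> complex_line v \<in> CP1} = - {0}" by (auto simp: CP1_def)
  then have "openin CP1_topology CP1" by (simp add: openin_CP1 open_delete Compl_eq_Diff_UNIV)
  then show ?thesis by (auto simp: topspace_def openin_CP1)
qed

lemma quotient_map_CP1: "quotient_map (top_of_set (- {0})) CP1_topology complex_line"
proof -
  have "{v \<in> - {0}. complex_line v \<in> X} = {v. v \<noteq> 0 \<and> complex_line v \<in> X}" for X by auto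
  moreover have "open (- {0 :: complex^2})" by (simp add: open_delete Compl_eq_Diff_UNIV)
  ultimately show ?thesis
    by (auto simp: quotient_map_def topspace_CP1 openin_CP1 openin_open_eq) (auto simp: CP1_def)
qed


text \<open>Functions on the torus are functions on \<^typ>\<open>real^2\<close> with period lattice \<open>\<int>\<^sup>2\<close>; the Haar mean is
  the Lebesgue integral over the fundamental domain.\<close>

definition lattice_periodic :: "(real^2 \<Rightarrow> 'a) \<Rightarrow> bool" where
  "lattice_periodic h \<longleftrightarrow> (\<forall>j w. h (w + axis j 1) = h w)"

definition torus_mean :: "(real^2 \<Rightarrow> real) \<Rightarrow> real" where
  "torus_mean h = (LINT w:cbox 0 1|lborel. h w)"

definition lattice_dot :: "int^2 \<Rightarrow> real^2 \<Rightarrow> real" where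
  "lattice_dot k w = (\<Sum>j\<in>UNIV. of_int (k $ j) * w $ j)"

definition diophantine :: "real^2 \<Rightarrow> real \<Rightarrow> real \<Rightarrow> bool" where
  "diophantine \<tau> c \<nu> \<longleftrightarrow> c > 0 \<and> \<nu> \<ge> 1 \<and>
    (\<forall>n :: int^2. n \<noteq> 0 \<longrightarrow>
      \<bar>lattice_dot n \<tau> - of_int (round (lattice_dot n \<tau>))\<bar>
        \<ge> c * (\<Sum>j\<in>UNIV. \<bar>of_int (n $ j)\<bar>) powr (- \<nu>))"


text \<open>The pair \<open>(U\<^sub>1, U\<^sub>2)\<close> is one function \<open>U\<close> on the two-element index type \<^typ>\<open>2\<close>, and \<open>e\<^sub>j\<close> is
  \<open>axis j 1\<close>. The numeral \<open>2\<close> of that type equals \<open>0\<close>; it is the second index.\<close>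

definition sewing_system :: "(2 \<Rightarrow> real^2 \<Rightarrow> complex^2^2) \<Rightarrow> bool" where
  "sewing_system U \<longleftrightarrow>
    (\<forall>j. continuous_on UNIV (U j)) \<and> (\<forall>j w. unitary_matrix (U j w)) \<and>
    (\<forall>w. U 1 (w + axis 2 1) ** U 2 w = U 2 (w + axis 1 1) ** U 1 w)"

definition equivariant_cocycle ::
  "real^2 \<Rightarrow> (2 \<Rightarrow> real^2 \<Rightarrow> complex^2^2) \<Rightarrow> (real^2 \<Rightarrow> complex^2^2) \<Rightarrow> bool" where
  "equivariant_cocycle \<tau> U A \<longleftrightarrow>
    continuous_on UNIV A \<and> (\<forall>w. det (A w) \<noteq> 0) \<and>
    (\<forall>j w. A (w + axis j 1) ** U j w = U j (w + \<tau>) ** A w)"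

definition measurable_section ::
  "(2 \<Rightarrow> real^2 \<Rightarrow> complex^2^2) \<Rightarrow> (real^2 \<Rightarrow> complex^2) \<Rightarrow> bool" where
  "measurable_section U F \<longleftrightarrow>
    F \<in> borel_measurable lebesgue \<and>
    (\<forall>j. AE w in lebesgue. F (w + axis j 1) = U j w *v F w)"

definition eigen_equation ::
  "real^2 \<Rightarrow> (real^2 \<Rightarrow> complex^2^2) \<Rightarrow> complex \<Rightarrow> (real^2 \<Rightarrow> complex^2) \<Rightarrow> bool" where
  "eigen_equation \<tau> A \<mu> F \<longleftrightarrow> (AE w in lebesgue. A w *v F w = \<mu> *s F (w + \<tau>))"

definition ae_zero :: "(real^2 \<Rightarrow> complex^2) \<Rightarrow> bool" where
  "ae_zero F \<longleftrightarrow> (AE w in lebesgue. F w = 0)"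

definition measurable_eigensection ::
  "real^2 \<Rightarrow> (2 \<Rightarrow> real^2 \<Rightarrow> complex^2^2) \<Rightarrow> (real^2 \<Rightarrow> complex^2^2) \<Rightarrow> complex
    \<Rightarrow> (real^2 \<Rightarrow> complex^2) \<Rightarrow> bool" where
  "measurable_eigensection \<tau> U A \<mu> F \<longleftrightarrow>
    measurable_section U F \<and> \<not> ae_zero F \<and> eigen_equation \<tau> A \<mu> F"


definition invariant_line ::
  "real^2 \<Rightarrow> (2 \<Rightarrow> real^2 \<Rightarrow> complex^2^2) \<Rightarrow> (real^2 \<Rightarrow> complex^2^2)
    \<Rightarrow> (real^2 \<Rightarrow> (complex^2) set) \<Rightarrow> bool" where
  "invariant_line \<tau> U A l \<longleftrightarrow>
    continuous_map euclidean CP1_topology l \<and>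
    (\<forall>j w. l (w + axis j 1) = (\<lambda>v. U j w *v v) ` l w) \<and>
    (\<forall>w. (\<lambda>v. A w *v v) ` l w = l (w + \<tau>))"

definition carried_by :: "(real^2 \<Rightarrow> (complex^2) set) \<Rightarrow> (real^2 \<Rightarrow> complex^2) \<Rightarrow> bool" where
  "carried_by l F \<longleftrightarrow> (AE w in lebesgue. F w \<in> l w)"

primrec cocycle_iterate ::
  "real^2 \<Rightarrow> (real^2 \<Rightarrow> complex^2^2) \<Rightarrow> nat \<Rightarrow> real^2 \<Rightarrow> complex^2^2" where
  "cocycle_iterate \<tau> A 0 w = mat 1"
| "cocycle_iterate \<tau> A (Suc n) w = A (w + of_nat n *\<^sub>R \<tau>) ** cocycle_iterate \<tau> A n w"

definition dominated_splitting ::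
  "real^2 \<Rightarrow> (2 \<Rightarrow> real^2 \<Rightarrow> complex^2^2) \<Rightarrow> (real^2 \<Rightarrow> complex^2^2)
    \<Rightarrow> (real^2 \<Rightarrow> (complex^2) set) \<Rightarrow> (real^2 \<Rightarrow> (complex^2) set) \<Rightarrow> bool" where
  "dominated_splitting \<tau> U A ls lu \<longleftrightarrow>
    invariant_line \<tau> U A ls \<and> invariant_line \<tau> U A lu \<and> (\<forall>w. ls w \<noteq> lu w) \<and>
    (\<exists>N \<kappa>. N \<ge> 1 \<and> 0 < \<kappa> \<and> \<kappa> < 1 \<and>
      (\<forall>z. restricted_norm (cocycle_iterate \<tau> A N z) (ls z) /
           restricted_conorm (cocycle_iterate \<tau> A N z) (lu z) \<le> \<kappa>\<^sup>2))"


definition complexify :: "real^2 \<Rightarrow> complex^2" where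
  "complexify w = (\<chi> j. complex_of_real (w $ j))"

definition closed_strip :: "real \<Rightarrow> (complex^2) set" where
  "closed_strip \<delta> = {z. \<forall>j. \<bar>Im (z $ j)\<bar> \<le> \<delta>}"

text \<open>Holomorphy in two variables: every entry has a complex-linear Frechet derivative.\<close>

definition matrix_holomorphic_on :: "(complex^2 \<Rightarrow> complex^2^2) \<Rightarrow> (complex^2) set \<Rightarrow> bool" where
  "matrix_holomorphic_on f G \<longleftrightarrow>
    (\<forall>z\<in>G. \<forall>i j. \<exists>D. ((\<lambda>x. f x $ i $ j) has_derivative D) (at z) \<and>
      (\<forall>a v. D (a *s v) = a * D v))"

definition extends_to_strip :: "real \<Rightarrow> (real^2 \<Rightarrow> complex^2^2) \<Rightarrow> bool" where
  "extends_to_strip \<delta> M \<longleftrightarrow>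
    (\<exists>f G. open G \<and> closed_strip \<delta> \<subseteq> G \<and> matrix_holomorphic_on f G \<and>
      bounded (f ` closed_strip \<delta>) \<and> (\<forall>w. f (complexify w) = M w))"

definition strip_admissible ::
  "real^2 \<Rightarrow> (2 \<Rightarrow> real^2 \<Rightarrow> complex^2^2) \<Rightarrow> (real^2 \<Rightarrow> complex^2^2) \<Rightarrow> bool" where
  "strip_admissible \<tau> U A \<longleftrightarrow>
    sewing_system U \<and> equivariant_cocycle \<tau> U A \<and>
    (\<exists>\<delta>>0. (\<forall>j. extends_to_strip \<delta> (U j)) \<and> extends_to_strip \<delta> A)"

definition real_analytic :: "(real^2 \<Rightarrow> complex^2) \<Rightarrow> bool" where
  "real_analytic F \<longleftrightarrow>
    (\<forall>a. \<exists>r>0. \<exists>c :: nat \<times> nat \<Rightarrow> complex^2. \<forall>w\<in>ball a r.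
      ((\<lambda>(i, j). ((w $ 1 - a $ 1) ^ i * (w $ 2 - a $ 2) ^ j) *\<^sub>R c (i, j)) has_sum F w) UNIV)"


text \<open>A continuous nowhere-vanishing lift \<open>v\<close> of \<open>l\<close> has factor of automorphy
  \<open>exp (2 \<pi> \<i> \<phi>\<^sub>j)\<close>. The first Chern class is the class in \<open>H\<^sup>2(\<int>\<^sup>2, \<int>) = \<int>\<close> of the coboundary
  of \<open>\<phi>\<close>, evaluated here on the fundamental class. A section \<open>f v\<close> of the line bundle satisfies
  \<open>f (w + e\<^sub>j) = exp (- 2 \<pi> \<i> \<phi>\<^sub>j w) f w\<close>, so with the sign below the number counts the zeros
  of a generic section for the orientation \<open>dw\<^sub>1 \<and> dw\<^sub>2\<close>.\<close>

definition has_first_chern_number ::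
  "(2 \<Rightarrow> real^2 \<Rightarrow> complex^2^2) \<Rightarrow> (real^2 \<Rightarrow> (complex^2) set) \<Rightarrow> int \<Rightarrow> bool" where
  "has_first_chern_number U l c \<longleftrightarrow>
    (\<exists>v (\<phi> :: 2 \<Rightarrow> real^2 \<Rightarrow> complex).
      continuous_on UNIV v \<and> (\<forall>w. v w \<in> l w \<and> v w \<noteq> 0) \<and>
      (\<forall>j. continuous_on UNIV (\<phi> j)) \<and>
      (\<forall>j w. v (w + axis j 1) = exp (2 * pi * \<i> * \<phi> j w) *s (U j w *v v w)) \<and>
      (\<forall>w. \<phi> 2 (w + axis 1 1) - \<phi> 2 w - \<phi> 1 (w + axis 2 1) + \<phi> 1 w = of_int c))"

definition first_chern_number ::
  "(2 \<Rightarrow> real^2 \<Rightarrow> complex^2^2) \<Rightarrow> (real^2 \<Rightarrow> (complex^2) set) \<Rightarrow> int" where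
  "first_chern_number U l = (THE c. has_first_chern_number U l c)"

definition normalized_unit_section ::
  "(2 \<Rightarrow> real^2 \<Rightarrow> complex^2^2) \<Rightarrow> (real^2 \<Rightarrow> (complex^2) set) \<Rightarrow> (real^2 \<Rightarrow> complex^2)
    \<Rightarrow> int \<Rightarrow> bool" where
  "normalized_unit_section U l e m \<longleftrightarrow>
    continuous_on UNIV e \<and> (\<forall>w. norm (e w) = 1 \<and> e w \<in> l w) \<and>
    (\<forall>w. e (w + axis 1 1) = U 1 w *v e w) \<and>
    (\<forall>w. e (w + axis 2 1) = exp (2 * pi * \<i> * of_int m * w $ 1) *s (U 2 w *v e w))"

definition multiplier ::
  "real^2 \<Rightarrow> (real^2 \<Rightarrow> complex^2^2) \<Rightarrow> (real^2 \<Rightarrow> complex^2) \<Rightarrow> real^2 \<Rightarrow> complex" where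
  "multiplier \<tau> A e w = herm_inner (e (w + \<tau>)) (A w *v e w)"

definition periodic_phase ::
  "real^2 \<Rightarrow> (real^2 \<Rightarrow> complex^2^2) \<Rightarrow> (real^2 \<Rightarrow> complex^2) \<Rightarrow> int \<Rightarrow> real^2 \<Rightarrow> complex" where
  "periodic_phase \<tau> A e m w =
    multiplier \<tau> A e w / norm (multiplier \<tau> A e w) * exp (2 * pi * \<i> * of_int m * \<tau> $ 1 * w $ 2)"

definition phase_representation ::
  "(real^2 \<Rightarrow> complex) \<Rightarrow> int^2 \<Rightarrow> (real^2 \<Rightarrow> real) \<Rightarrow> bool" where
  "phase_representation p k g \<longleftrightarrow>
    continuous_on UNIV g \<and> lattice_periodic g \<and>
    (\<forall>w. p w = exp (2 * pi * \<i> * (lattice_dot k w + g w)))"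

definition winding_vector ::
  "real^2 \<Rightarrow> (2 \<Rightarrow> real^2 \<Rightarrow> complex^2^2) \<Rightarrow> (real^2 \<Rightarrow> complex^2^2)
    \<Rightarrow> (real^2 \<Rightarrow> (complex^2) set) \<Rightarrow> int^2" where
  "winding_vector \<tau> U A l =
    (THE k. \<exists>e m g. normalized_unit_section U l e m \<and>
      phase_representation (periodic_phase \<tau> A e m) k g)"

definition lyapunov_exponent ::
  "real^2 \<Rightarrow> (real^2 \<Rightarrow> complex^2^2) \<Rightarrow> (real^2 \<Rightarrow> complex^2) \<Rightarrow> real" where
  "lyapunov_exponent \<tau> A e = torus_mean (\<lambda>w. ln (norm (multiplier \<tau> A e w)))"

lemma has_first_chern_number_unique:
  assumes line: "\<And>w. l w \<in> CP1"
    and c: "has_first_chern_number U l c" and c': "has_first_chern_number U l c'"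
  shows "c = c'"
proof -
  obtain v and \<phi> :: "2 \<Rightarrow> real^2 \<Rightarrow> complex" where v: "continuous_on UNIV v" "\<And>w. v w \<in> l w" "\<And>w. v w \<noteq> 0"
    and \<phi>: "\<And>j. continuous_on UNIV (\<phi> j)"
    and eq: "\<And>j w. v (w + axis j 1) = exp (2 * pi * \<i> * \<phi> j w) *s (U j w *v v w)"
    and sum: "\<And>w. \<phi> 2 (w + axis 1 1) - \<phi> 2 w - \<phi> 1 (w + axis 2 1) + \<phi> 1 w = of_int c"
    using c unfolding has_first_chern_number_def by blast
  obtain v' and \<phi>' :: "2 \<Rightarrow> real^2 \<Rightarrow> complex" where v': "continuous_on UNIV v'" "\<And>w. v' w \<in> l w" "\<And>w. v' w \<noteq> 0"
    and \<phi>': "\<And>j. continuous_on UNIV (\<phi>' j)"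
    and eq': "\<And>j w. v' (w + axis j 1) = exp (2 * pi * \<i> * \<phi>' j w) *s (U j w *v v' w)"
    and sum': "\<And>w. \<phi>' 2 (w + axis 1 1) - \<phi>' 2 w - \<phi>' 1 (w + axis 2 1) + \<phi>' 1 w = of_int c'"
    using c' unfolding has_first_chern_number_def by blast
  have inner_pos: "herm_inner x x \<noteq> 0" if "x \<noteq> 0" for x :: "complex^2"
  proof -
    have "herm_inner x x = of_real (\<Sum>i\<in>UNIV. (norm (x $ i))\<^sup>2)"
      by (simp add: herm_inner_def complex_norm_square mult.commute del: of_real_power)
    moreover have "(\<Sum>i\<in>UNIV. (norm (x $ i))\<^sup>2) \<noteq> 0"
      using that by (subst sum_nonneg_eq_0_iff) (auto simp: vec_eq_iff)
    ultimately show ?thesis by (metis of_real_eq_0_iff)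
  qed
  define h where "h w = herm_inner (v w) (v' w) / herm_inner (v w) (v w)" for w
  have hv: "v' w = h w *s v w" for w
  proof -
    obtain x where "l w = complex_line x"
      using line[of w] unfolding CP1_def by blast
    then obtain a b where ab: "v w = a *s x" "v' w = b *s x"
      using v(2)[of w] v'(2)[of w] unfolding complex_line_def by auto
    then have "a \<noteq> 0" using v(3)[of w] by auto
    then have d: "v' w = (b / a) *s v w" using ab by (simp add: vector_smult_assoc)
    have "herm_inner (v w) (v' w) = (b / a) * herm_inner (v w) (v w)"
      by (simp add: d herm_inner_def sum_distrib_left mult_ac)
    then have "h w = b / a" using inner_pos[OF v(3)[of w]] by (simp add: h_def)
    then show ?thesis using d by simp
  qed
  have h0: "h w \<noteq> 0" for w using hv[of w] v'(3)[of w] by auto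
  have "continuous_on UNIV h"
    unfolding h_def[abs_def] herm_inner_def
    using inner_pos v v' by (intro continuous_intros) (auto simp: herm_inner_def)
  then obtain \<eta>' where \<eta>': "continuous_on UNIV \<eta>'" "\<And>w. h w = exp (\<eta>' w)"
    using continuous_logarithm_on_contractible[of UNIV h] h0
    by (metis UNIV_I convex_imp_contractible convex_UNIV)
  define \<eta> where "\<eta> w = \<eta>' w / (2 * pi * \<i>)" for w
  have \<eta>: "continuous_on UNIV \<eta>" "\<And>w. h w = exp (2 * pi * \<i> * \<eta> w)"
    unfolding \<eta>_def[abs_def] using \<eta>' by (auto intro!: continuous_intros)
  have "\<exists>d. \<forall>w. \<phi>' j w + \<eta> w - \<phi> j w - \<eta> (w + axis j 1) = d" for j
  proof -
    define f where "f w = \<phi>' j w + \<eta> w - \<phi> j w - \<eta> (w + axis j 1)" for w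
    have "exp (2 * pi * \<i> * f w) = 1" for w
    proof -
      have "U j w *v v' w = h w *s (U j w *v v w)"
        by (simp add: hv vec_eq_iff matrix_vector_mult_def sum_distrib_left mult_ac)
      then have "h (w + axis j 1) * exp (2 * pi * \<i> * \<phi> j w) *s (U j w *v v w)
          = exp (2 * pi * \<i> * \<phi>' j w) * h w *s (U j w *v v w)"
        using hv[of "w + axis j 1"] eq[of w j] eq'[of w j] by (auto simp: vector_smult_assoc)
      moreover have "U j w *v v w \<noteq> 0"
        using eq[of w j] v(3)[of "w + axis j 1"] by auto
      ultimately have "h (w + axis j 1) * exp (2 * pi * \<i> * \<phi> j w) = exp (2 * pi * \<i> * \<phi>' j w) * h w"
        by simp
      then show ?thesis
        by (simp add: f_def \<eta>(2) exp_add exp_diff ring_distribs right_diff_distrib mult.commute)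
    qed
    then have int: "\<exists>n::int. f w = of_int n" for w
      using exp_eq_1[of "2 * pi * \<i> * f w"] by (force simp: complex_eq_iff)
    have cont: "continuous_on UNIV f"
      unfolding f_def[abs_def] using \<phi> \<phi>' \<eta>(1)
      by (intro continuous_intros continuous_on_compose2[OF \<eta>(1)]) auto
    have "f constant_on UNIV"
    proof (rule continuous_discrete_range_constant[OF connected_UNIV cont])
      fix x
      have "1 \<le> norm (f y - f x)" if "f y \<noteq> f x" for y
      proof -
        obtain a b where "f y = of_int a" "f x = of_int b" using int by metis
        moreover from this have "a \<noteq> b" using that by auto
        ultimately show ?thesis
          by (metis eq_iff_diff_eq_0 norm_of_int of_int_1_le_iff of_int_abs of_int_diff zero_less_abs_iff int_one_le_iff_zero_less)
      qed
      then show "\<exists>e>0. \<forall>y. y \<in> UNIV \<and> f y \<noteq> f x \<longrightarrow> e \<le> norm (f y - f x)"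
        by (intro exI[of _ 1]) auto
    qed
    then show ?thesis by (auto simp: constant_on_def f_def)
  qed
  then obtain d where d: "\<And>j w. \<phi>' j w + \<eta> w - \<phi> j w - \<eta> (w + axis j 1) = d j" by metis
  have e: "\<phi>' j w = \<phi> j w + \<eta> (w + axis j 1) - \<eta> w + d j" for j w
    using d[of j w] by (simp add: algebra_simps)
  have "(of_int c' :: complex) = of_int c"
    using sum'[of 0] sum[of 0] unfolding e by (simp add: algebra_simps)
  then show ?thesis by simp
qed

lemma normalized_unit_section_imp_first_chern_number:
  assumes line: "\<And>w. l w \<in> CP1" and e: "normalized_unit_section U l e m"
  shows "first_chern_number U l = m"
proof -
  define \<phi> :: "2 \<Rightarrow> real^2 \<Rightarrow> complex" where
    "\<phi> = (\<lambda>j w. if j = 1 then 0 else of_int m * w $ 1)"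
  have "has_first_chern_number U l m"
    unfolding has_first_chern_number_def
  proof (intro exI[of _ e] exI[of _ \<phi>] conjI allI)
    fix j :: 2 and w
    show "continuous_on UNIV (\<phi> j)"
      by (cases "j = 1") (auto simp: \<phi>_def intro!: continuous_intros)
    show "e (w + axis j 1) = exp (2 * pi * \<i> * \<phi> j w) *s (U j w *v e w)"
      using e exhaust_2[of j]
      by (auto simp: normalized_unit_section_def \<phi>_def mult.assoc)
    show "\<phi> 2 (w + axis 1 1) - \<phi> 2 w - \<phi> 1 (w + axis 2 1) + \<phi> 1 w = of_int m"
      by (simp add: \<phi>_def axis_def algebra_simps)
    show "e w \<noteq> 0"
      using e unfolding normalized_unit_section_def by (metis norm_zero zero_neq_one)
  qed (use e in \<open>auto simp: normalized_unit_section_def\<close>)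
  then show ?thesis
    unfolding first_chern_number_def
    using has_first_chern_number_unique[of l U, OF line] by (intro the_equality) auto
qed


definition realised_eigenvalues ::
  "real^2 \<Rightarrow> (2 \<Rightarrow> real^2 \<Rightarrow> complex^2^2) \<Rightarrow> (real^2 \<Rightarrow> complex^2^2)
    \<Rightarrow> (real^2 \<Rightarrow> (complex^2) set) \<Rightarrow> complex set" where
  "realised_eigenvalues \<tau> U A l =
    {\<mu>. \<exists>F. measurable_eigensection \<tau> U A \<mu> F \<and> carried_by l F}"

definition eigenspace_within ::
  "real^2 \<Rightarrow> (2 \<Rightarrow> real^2 \<Rightarrow> complex^2^2) \<Rightarrow> (real^2 \<Rightarrow> complex^2^2)
    \<Rightarrow> (real^2 \<Rightarrow> (complex^2) set) \<Rightarrow> complex \<Rightarrow> (real^2 \<Rightarrow> complex^2) set" where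
  "eigenspace_within \<tau> U A l \<mu> =
    {F. measurable_section U F \<and> carried_by l F \<and> eigen_equation \<tau> A \<mu> F}"

text \<open>Dimension one over \<^typ>\<open>complex\<close>, functions that agree almost everywhere being identified.\<close>

definition ae_one_dimensional :: "(real^2 \<Rightarrow> complex^2) set \<Rightarrow> bool" where
  "ae_one_dimensional X \<longleftrightarrow>
    (\<exists>F\<^sub>0\<in>X. \<not> ae_zero F\<^sub>0 \<and> (\<forall>F\<in>X. \<exists>c. AE w in lebesgue. F w = c *s F\<^sub>0 w))"

definition base_eigenvalue ::
  "real^2 \<Rightarrow> (real^2 \<Rightarrow> complex^2^2) \<Rightarrow> (real^2 \<Rightarrow> complex^2) \<Rightarrow> (real^2 \<Rightarrow> real) \<Rightarrow> complex" where
  "base_eigenvalue \<tau> A e g =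
    exp (lyapunov_exponent \<tau> A e + 2 * pi * \<i> * torus_mean g)"

end

theory Submission
  imports Defs "HOL-Complex_Analysis.Conformal_Mappings"
begin

text \<open>A measurable section carried by \<open>l\<close> is a scalar multiple of a lift of \<open>l\<close>, so on \<open>l\<close> the statement is about
scalar functions over the translation by \<open>\<tau>\<close>, once a good lift is available.

The lift has to be analytic although \<open>l\<close> is only assumed continuous, and this is where domination enters. Averaging
a Gaussian approximation over the lattice gives holomorphic equivariant sections close to continuous lifts
of the two lines of the splitting (\<open>analytic_section_approx\<close>). In the frame of these sections, and in an adapted metric,
the cocycle acts on slopes by contracting fractional linear maps, also over a complex strip. The iterates of this graph
transform are holomorphic and converge uniformly, and at real points their limit is the slope of the line
(\<open>graph_transform\<close>, \<open>dominated_frame_sections\<close>). There are no further invariant lines: the angle of such a line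
to the splitting would decrease along orbits, while its mean is invariant (\<open>invariant_line_of_splitting\<close>).

The multiplier of a holomorphic lift of charge \<open>m\<close> and winding \<open>k\<close> is \<open>exp (2 \<pi> \<i> (k \<bullet> w - m \<tau>\<^sub>1 w\<^sub>2))\<close> times a function with a
holomorphic periodic logarithm. Over a Diophantine translation the logarithm is cohomologous to its mean, since
the small divisors cost only a polynomial factor against exponentially decaying Fourier coefficients
(\<open>sh_cohomological_equation\<close>). Rescaling the lift gives a section \<open>s\<close> with multiplier \<open>\<Lambda> exp (2 \<pi> \<i> (k \<bullet> w - m \<tau>\<^sub>1 w\<^sub>2))\<close>, where
\<open>\<Lambda>\<close> is the base eigenvalue up to the value of a character at \<open>\<tau>\<close> (\<open>normal_form_exists\<close>).

Let \<open>F = h s\<close> be an eigensection and \<open>u = h / |h|\<close>. If \<open>m\<close> or \<open>k\<close> were nonzero, the functions \<open>u (w + \<sigma>) / u w\<close>, for \<open>\<sigma>\<close> on a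
coordinate axis, would be periodic eigenfunctions of the translation for a continuum of eigenvalues. But the only
bounded eigenfunctions are multiples of the countably many characters (\<open>translation_eigenfunction\<close>). So \<open>m = 0\<close> and \<open>k = 0\<close>, and
then \<open>h\<close> itself is a multiple of a character \<open>\<chi>\<close>, with eigenvalue \<open>\<Lambda> / \<chi> \<tau>\<close> (\<open>twisted_eigenfunction\<close>). Conversely, if both vanish,
every \<open>\<chi> s\<close> is an analytic nowhere-vanishing eigensection. This gives the spectrum, its simplicity and the
regularity of all eigensections; density in the circle is Kronecker's theorem.\<close>

section \<open>Holomorphic functions on complex strips\<close>

type_synonym C2 = "complex \<times> complex"

abbreviation "lmeas_fns \<equiv> borel_measurable lebesgue"

definition band :: "real \<Rightarrow> complex set" where
 "band \<delta> = {a. \<bar>Im a\<bar> < \<delta>}"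

definition strip :: "real \<Rightarrow> C2 set" where
 "strip \<delta> = band \<delta> \<times> band \<delta>"

text \<open>Separate holomorphy with continuity is joint holomorphy, by Osgood's lemma; this form
 reduces every argument to one complex variable.\<close>

definition strip_hol :: "real \<Rightarrow> (C2 \<Rightarrow> complex) \<Rightarrow> bool" where
 "strip_hol \<delta> f \<longleftrightarrow> continuous_on (strip \<delta>) f \<and>
  (\<forall>b\<in>band \<delta>. (\<lambda>a. f (a, b)) holomorphic_on band \<delta>) \<and>
  (\<forall>a\<in>band \<delta>. (\<lambda>b. f (a, b)) holomorphic_on band \<delta>)"

text \<open>The complex side uses pairs instead of vectors, so that one variable can be held fixed.\<close>

definition cpt :: "real^2 \<Rightarrow> C2" where
 "cpt w = (complex_of_real (w $ 1), complex_of_real (w $ 2))"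

lemma band_eq: "band \<delta> = {a. Im a < \<delta>} \<inter> {a. Im a > - \<delta>}"
 by (auto simp: band_def abs_less_iff)

lemma open_band [simp, intro]: "open (band \<delta>)"
 unfolding band_eq by (intro open_Int open_halfspace_Im_lt open_halfspace_Im_gt)

lemma convex_band [simp, intro]: "convex (band \<delta>)"
 unfolding band_eq by (intro convex_Int convex_halfspace_Im_lt convex_halfspace_Im_gt)

lemma open_strip [simp, intro]: "open (strip \<delta>)"
 unfolding strip_def by (intro open_Times open_band)

lemma convex_strip [simp, intro]: "convex (strip \<delta>)"
 unfolding strip_def by (intro convex_Times convex_band)

lemma strip_iff: "z \<in> strip \<delta> \<longleftrightarrow> \<bar>Im (fst z)\<bar> < \<delta> \<and> \<bar>Im (snd z)\<bar> < \<delta>"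
 by (cases z) (auto simp: strip_def band_def)

lemma band_mono: "\<delta>' \<le> \<delta> \<Longrightarrow> band \<delta>' \<subseteq> band \<delta>"
 by (auto simp: band_def)

lemma strip_mono: "\<delta>' \<le> \<delta> \<Longrightarrow> strip \<delta>' \<subseteq> strip \<delta>"
 by (auto simp: strip_iff)

lemma of_real_band [simp]: "\<delta> > 0 \<Longrightarrow> complex_of_real x \<in> band \<delta>"
 by (simp add: band_def)

lemma cpt_strip [simp]: "\<delta> > 0 \<Longrightarrow> cpt w \<in> strip \<delta>"
 by (simp add: strip_iff cpt_def)

lemma cpt_add: "cpt (v + w) = cpt v + cpt w"
 by (simp add: cpt_def)

lemma cpt_diff: "cpt (v - w) = cpt v - cpt w"
 by (simp add: cpt_def)

lemma cpt_scaleR: "cpt (r *\<^sub>R w) = r *\<^sub>R cpt w"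
 by (simp add: cpt_def scaleR_complex.code complex_eq_iff)

lemma strip_add_cpt [simp]: "z + cpt s \<in> strip \<delta> \<longleftrightarrow> z \<in> strip \<delta>"
 by (simp add: strip_iff cpt_def)

lemma strip_diff_cpt [simp]: "z - cpt s \<in> strip \<delta> \<longleftrightarrow> z \<in> strip \<delta>"
 by (simp add: strip_iff cpt_def)

lemma continuous_cpt [continuous_intros]: "continuous_on S cpt"
 unfolding cpt_def[abs_def] by (intro continuous_intros)

lemma sh_cont: "strip_hol \<delta> f \<Longrightarrow> continuous_on (strip \<delta>) f"
 by (simp add: strip_hol_def)

lemma sh_cont_cpt:
 assumes "strip_hol \<delta> f" "\<delta> > 0"
 shows "continuous_on S (\<lambda>w. f (cpt w))"
 by (rule continuous_on_compose2[OF sh_cont[OF assms(1)] continuous_cpt]) (use assms in auto)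

lemma sh_mono: "strip_hol \<delta> f \<Longrightarrow> \<delta>' \<le> \<delta> \<Longrightarrow> strip_hol \<delta>' f"
 unfolding strip_hol_def
 using band_mono[of \<delta>' \<delta>] strip_mono[of \<delta>' \<delta>]
 by (meson continuous_on_subset holomorphic_on_subset subset_iff)

lemma sh_const [simp, intro]: "strip_hol \<delta> (\<lambda>z. c)"
 by (auto simp: strip_hol_def)

lemma sh_fst [simp, intro]: "strip_hol \<delta> fst"
 by (auto simp: strip_hol_def intro!: continuous_intros holomorphic_intros)

lemma sh_snd [simp, intro]: "strip_hol \<delta> snd"
 by (auto simp: strip_hol_def intro!: continuous_intros holomorphic_intros)

lemma sh_add: "strip_hol \<delta> f \<Longrightarrow> strip_hol \<delta> g \<Longrightarrow> strip_hol \<delta> (\<lambda>z. f z + g z)"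
 by (auto simp: strip_hol_def intro!: continuous_intros holomorphic_intros)

lemma sh_diff: "strip_hol \<delta> f \<Longrightarrow> strip_hol \<delta> g \<Longrightarrow> strip_hol \<delta> (\<lambda>z. f z - g z)"
 by (auto simp: strip_hol_def intro!: continuous_intros holomorphic_intros)

lemma sh_minus: "strip_hol \<delta> f \<Longrightarrow> strip_hol \<delta> (\<lambda>z. - f z)"
 by (auto simp: strip_hol_def intro!: continuous_intros holomorphic_intros)

lemma sh_mult: "strip_hol \<delta> f \<Longrightarrow> strip_hol \<delta> g \<Longrightarrow> strip_hol \<delta> (\<lambda>z. f z * g z)"
 by (auto simp: strip_hol_def intro!: continuous_intros holomorphic_intros)

lemma sh_power: "strip_hol \<delta> f \<Longrightarrow> strip_hol \<delta> (\<lambda>z. f z ^ n)"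
 by (auto simp: strip_hol_def intro!: continuous_intros holomorphic_intros)

lemma sh_exp: "strip_hol \<delta> f \<Longrightarrow> strip_hol \<delta> (\<lambda>z. exp (f z))"
 by (auto simp: strip_hol_def intro!: continuous_intros holomorphic_intros)

lemma sh_divide:
 assumes "strip_hol \<delta> f" "strip_hol \<delta> g" "\<And>z. z \<in> strip \<delta> \<Longrightarrow> g z \<noteq> 0"
 shows "strip_hol \<delta> (\<lambda>z. f z / g z)"
proof -
 have "g (a, b) \<noteq> 0" if "a \<in> band \<delta>" "b \<in> band \<delta>" for a b
  using that assms(3) by (auto simp: strip_def)
 then show ?thesis
  using assms by (auto simp: strip_hol_def intro!: continuous_intros holomorphic_intros)
qed

lemma sh_sum: "(\<And>i. i \<in> I \<Longrightarrow> strip_hol \<delta> (f i)) \<Longrightarrow> strip_hol \<delta> (\<lambda>z. \<Sum>i\<in>I. f i z)"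
 by (induction I rule: infinite_finite_induct) (auto intro!: sh_add)

lemma sh_translate:
 assumes "strip_hol \<delta> f"
 shows "strip_hol \<delta> (\<lambda>z. f (z + cpt s))"
 unfolding strip_hol_def
proof (intro conjI ballI)
 show "continuous_on (strip \<delta>) (\<lambda>z. f (z + cpt s))"
  by (rule continuous_on_compose2[OF sh_cont[OF assms]]) (auto intro!: continuous_intros)
next
 fix b assume "b \<in> band \<delta>"
 then have "(\<lambda>a. f (a, b + of_real (s $ 2))) holomorphic_on band \<delta>"
  using assms by (auto simp: strip_hol_def band_def)
 then have "((\<lambda>a. f (a, b + of_real (s $ 2))) \<circ> (\<lambda>a. a + of_real (s $ 1))) holomorphic_on band \<delta>"
  by (intro holomorphic_on_compose_gen holomorphic_intros) (auto simp: band_def)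
 then show "(\<lambda>a. f ((a, b) + cpt s)) holomorphic_on band \<delta>"
  by (simp add: cpt_def o_def)
next
 fix a assume "a \<in> band \<delta>"
 then have "(\<lambda>b. f (a + of_real (s $ 1), b)) holomorphic_on band \<delta>"
  using assms by (auto simp: strip_hol_def band_def)
 then have "((\<lambda>b. f (a + of_real (s $ 1), b)) \<circ> (\<lambda>b. b + of_real (s $ 2))) holomorphic_on band \<delta>"
  by (intro holomorphic_on_compose_gen holomorphic_intros) (auto simp: band_def)
 then show "(\<lambda>b. f ((a, b) + cpt s)) holomorphic_on band \<delta>"
  by (simp add: cpt_def o_def)
qed

lemma sh_translate_minus:
 assumes "strip_hol \<delta> f"
 shows "strip_hol \<delta> (\<lambda>z. f (z - cpt s))"
proof -
 have "z + cpt (- s) = z - cpt s" for z by (simp add: cpt_def)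
 then show ?thesis using sh_translate[OF assms, of "- s"] by simp
qed

definition conj_pair :: "C2 \<Rightarrow> C2" where
 "conj_pair z = (cnj (fst z), cnj (snd z))"

text \<open>The holomorphic extension of the conjugate of \<open>f\<close> at real points.\<close>

definition schwarz_reflect :: "(C2 \<Rightarrow> complex) \<Rightarrow> C2 \<Rightarrow> complex" where
 "schwarz_reflect f z = cnj (f (conj_pair z))"

lemma conj_pair_strip [simp]: "conj_pair z \<in> strip \<delta> \<longleftrightarrow> z \<in> strip \<delta>"
 by (simp add: conj_pair_def strip_iff)

lemma conj_pair_cpt [simp]: "conj_pair (cpt w) = cpt w"
 by (simp add: conj_pair_def cpt_def)

lemma schwarz_reflect_cpt [simp]: "schwarz_reflect f (cpt w) = cnj (f (cpt w))"
 by (simp add: schwarz_reflect_def)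

lemma sh_reflect:
 assumes "strip_hol \<delta> f"
 shows "strip_hol \<delta> (schwarz_reflect f)"
 unfolding strip_hol_def
proof (intro conjI ballI)
 have cont: "continuous_on (strip \<delta>) conj_pair"
  unfolding conj_pair_def[abs_def] by (intro continuous_intros)
 show "continuous_on (strip \<delta>) (schwarz_reflect f)"
  unfolding schwarz_reflect_def[abs_def]
  by (intro continuous_intros continuous_on_compose2[OF sh_cont[OF assms] cont]) auto
next
 have im: "cnj ` band \<delta> = band \<delta>"
  by (auto simp: band_def image_iff) (metis abs_minus_cancel cnj.sel(2) complex_cnj_cnj)
 fix b assume "b \<in> band \<delta>"
 then have "(\<lambda>a. f (a, cnj b)) holomorphic_on band \<delta>"
  using assms by (auto simp: strip_hol_def band_def)
 then have "(cnj \<circ> (\<lambda>a. f (a, cnj b)) \<circ> cnj) holomorphic_on band \<delta>"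
  by (intro holomorphic_on_compose_cnj_cnj) (auto simp: im)
 then show "(\<lambda>a. schwarz_reflect f (a, b)) holomorphic_on band \<delta>"
  by (simp add: schwarz_reflect_def conj_pair_def o_def)
next
 have im: "cnj ` band \<delta> = band \<delta>"
  by (auto simp: band_def image_iff) (metis abs_minus_cancel cnj.sel(2) complex_cnj_cnj)
 fix a assume "a \<in> band \<delta>"
 then have "(\<lambda>b. f (cnj a, b)) holomorphic_on band \<delta>"
  using assms by (auto simp: strip_hol_def band_def)
 then have "(cnj \<circ> (\<lambda>b. f (cnj a, b)) \<circ> cnj) holomorphic_on band \<delta>"
  by (intro holomorphic_on_compose_cnj_cnj) (auto simp: im)
 then show "(\<lambda>b. schwarz_reflect f (a, b)) holomorphic_on band \<delta>"
  by (simp add: schwarz_reflect_def conj_pair_def o_def)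
qed

lemma holomorphic_zero_on_reals:
 assumes f: "f holomorphic_on band \<delta>" and "\<delta> > 0" and z: "\<And>x::real. f (of_real x) = 0" and a: "a \<in> band \<delta>"
 shows "f a = 0"
proof (rule analytic_continuation[OF f, of "range of_real" 0])
 show "(0::complex) islimpt range of_real"
  unfolding islimpt_approachable
 proof (intro allI impI)
  fix e :: real assume "e > 0"
  then show "\<exists>x'\<in>range complex_of_real. x' \<noteq> 0 \<and> dist x' 0 < e"
   by (intro bexI[of _ "of_real (e / 2)"]) (auto simp del: of_real_divide)
 qed
 show "0 \<in> band \<delta>" using assms(2) by (simp add: band_def)
qed (use assms in \<open>auto intro: convex_connected\<close>)

text \<open>The identity theorem, applied in one variable after the other.\<close>

lemma sh_eqI:
 assumes f: "strip_hol \<delta> f" and g: "strip_hol \<delta> g" and "\<delta> > 0"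
  and eq: "\<And>w. f (cpt w) = g (cpt w)" and z: "z \<in> strip \<delta>"
 shows "f z = g z"
proof -
 define h where "h z = f z - g z" for z
 have h: "strip_hol \<delta> h" unfolding h_def[abs_def] using f g by (rule sh_diff)
 have h0: "h (of_real x, of_real y) = 0" for x y :: real
  using eq[of "\<chi> i. if i = 1 then x else y"] by (simp add: h_def cpt_def)
 have h1: "h (a, of_real y) = 0" if "a \<in> band \<delta>" for a and y :: real
  by (rule holomorphic_zero_on_reals[of "\<lambda>a. h (a, of_real y)" \<delta>])
   (use h \<open>\<delta> > 0\<close> that h0 in \<open>auto simp: strip_hol_def\<close>)
 have "h (a, b) = 0" if "a \<in> band \<delta>" "b \<in> band \<delta>" for a b
  by (rule holomorphic_zero_on_reals[of "\<lambda>b. h (a, b)" \<delta>])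
   (use h \<open>\<delta> > 0\<close> that h1 in \<open>auto simp: strip_hol_def\<close>)
 then show ?thesis using z by (cases z) (auto simp: strip_def h_def)
qed

lemma holomorphic_uniform_limit_open:
 assumes hol: "\<forall>\<^sub>F n in F. f n holomorphic_on S" and S: "open S"
  and lim: "\<And>z. z \<in> S \<Longrightarrow> \<exists>r>0. cball z r \<subseteq> S \<and> uniform_limit (cball z r) f g F"
  and F: "F \<noteq> bot"
 shows "g holomorphic_on S"
 unfolding holomorphic_on_open[OF S]
proof
 fix z assume "z \<in> S"
 then obtain r where r: "r > 0" "cball z r \<subseteq> S" "uniform_limit (cball z r) f g F" using lim by blast
 have "\<forall>\<^sub>F n in F. continuous_on (cball z r) (f n) \<and> f n holomorphic_on ball z r"
  using hol by eventually_elim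
   (meson ball_subset_cball holomorphic_on_imp_continuous_on holomorphic_on_subset r(2) continuous_on_subset)
 then obtain "g holomorphic_on ball z r"
  using holomorphic_uniform_limit[OF _ r(3) F] by blast
 then show "\<exists>f'. (g has_field_derivative f') (at z)"
  using r(1) holomorphic_on_open[OF open_ball] by (metis centre_in_ball)
qed

text \<open>The Weierstrass test. The majorant may depend on a bound for the real parts, because sums over lattice
 translates do not converge uniformly in real directions.\<close>

lemma sh_infsum:
 assumes sh: "\<And>i. i \<in> I \<Longrightarrow> strip_hol \<delta> (f i)"
  and bound: "\<And>R. \<exists>M. M summable_on I \<and>
   (\<forall>i\<in>I. \<forall>z\<in>strip \<delta>. \<bar>Re (fst z)\<bar> \<le> R \<longrightarrow> \<bar>Re (snd z)\<bar> \<le> R \<longrightarrow> norm (f i z) \<le> M i)"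
 shows "strip_hol \<delta> (\<lambda>z. \<Sum>\<^sub>\<infinity>i\<in>I. f i z)"
proof -
 define g where "g z = (\<Sum>\<^sub>\<infinity>i\<in>I. f i z)" for z
 define box where "box R = strip \<delta> \<inter> {z. \<bar>Re (fst z)\<bar> \<le> R \<and> \<bar>Re (snd z)\<bar> \<le> R}" for R
 have lim: "uniform_limit (box R) (\<lambda>X z. \<Sum>i\<in>X. f i z) g (finite_subsets_at_top I)" for R
 proof -
  obtain M where M: "M summable_on I" "\<And>i z. i \<in> I \<Longrightarrow> z \<in> box R \<Longrightarrow> norm (f i z) \<le> M i"
   using bound[of R] unfolding box_def by auto
  show ?thesis unfolding g_def[abs_def]
   by (rule Weierstrass_m_test_general[OF _ M(1)]) (use M(2) in auto)
 qed
 have ev: "\<forall>\<^sub>F X in finite_subsets_at_top I. strip_hol \<delta> (\<lambda>z. \<Sum>i\<in>X. f i z)"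
  by (rule eventually_finite_subsets_at_top_weakI) (auto intro!: sh_sum sh)
 show ?thesis unfolding g_def[symmetric] strip_hol_def
 proof (intro conjI ballI)
  have cb: "continuous_on (box R) g" for R
   by (rule uniform_limit_theorem[OF _ lim])
    (use ev in \<open>auto elim!: eventually_mono simp: box_def intro: continuous_on_subset dest: sh_cont\<close>)
  show "continuous_on (strip \<delta>) g"
  proof (rule continuous_at_imp_continuous_on, rule ballI)
   fix z assume z: "z \<in> strip \<delta>"
   define R where "R = norm z + 1"
   define T where "T = strip \<delta> \<inter> ball 0 R"
   have le: "\<bar>Re (fst y)\<bar> \<le> norm y" "\<bar>Re (snd y)\<bar> \<le> norm y" for y :: "C2"
    using abs_Re_le_cmod[of "fst y"] abs_Re_le_cmod[of "snd y"] norm_fst_le[of "fst y" "snd y"] norm_snd_le[of "snd y" "fst y"]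
    by auto
   have "T \<subseteq> box R"
   proof
    fix y assume "y \<in> T"
    then have "y \<in> strip \<delta>" "norm y < R" by (auto simp: T_def)
    then show "y \<in> box R" using le[of y] by (auto simp: box_def)
   qed
   then have "continuous_on T g" using cb continuous_on_subset by blast
   moreover have "open T" "z \<in> T" using z by (auto simp: T_def R_def)
   ultimately show "isCont g z" by (simp add: continuous_on_eq_continuous_at)
  qed
 next
  fix b assume b: "b \<in> band \<delta>"
  show "(\<lambda>a. g (a, b)) holomorphic_on band \<delta>"
  proof (rule holomorphic_uniform_limit_open[where f = "\<lambda>X a. \<Sum>i\<in>X. f i (a, b)" and F = "finite_subsets_at_top I"])
   show "\<forall>\<^sub>F X in finite_subsets_at_top I. (\<lambda>a. \<Sum>i\<in>X. f i (a, b)) holomorphic_on band \<delta>"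
    using ev by eventually_elim (use b in \<open>auto simp: strip_hol_def\<close>)
   fix a assume "a \<in> band \<delta>"
   then obtain r where r: "r > 0" "cball a r \<subseteq> band \<delta>" using open_contains_cball open_band by blast
   define R where "R = max (norm a + r) (norm b)"
   have "(x, b) \<in> box R" if "x \<in> cball a r" for x
   proof -
    have "norm x \<le> norm a + r" using that norm_triangle_ineq2[of x a] by (auto simp: dist_norm norm_minus_commute)
    then show ?thesis using that r b abs_Re_le_cmod[of x] abs_Re_le_cmod[of b]
     unfolding box_def R_def strip_def by force
   qed
   then have "uniform_limit (cball a r) (\<lambda>X a. \<Sum>i\<in>X. f i (a, b)) (\<lambda>a. g (a, b)) (finite_subsets_at_top I)"
    using lim[of R] by (auto simp: uniform_limit_iff elim!: eventually_mono)
   then show "\<exists>r>0. cball a r \<subseteq> band \<delta> \<and> uniform_limit (cball a r) (\<lambda>X a. \<Sum>i\<in>X. f i (a, b)) (\<lambda>a. g (a, b)) (finite_subsets_at_top I)"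
    using r by blast
  qed auto
 next
  fix a assume a: "a \<in> band \<delta>"
  show "(\<lambda>b. g (a, b)) holomorphic_on band \<delta>"
  proof (rule holomorphic_uniform_limit_open[where f = "\<lambda>X b. \<Sum>i\<in>X. f i (a, b)" and F = "finite_subsets_at_top I"])
   show "\<forall>\<^sub>F X in finite_subsets_at_top I. (\<lambda>b. \<Sum>i\<in>X. f i (a, b)) holomorphic_on band \<delta>"
    using ev by eventually_elim (use a in \<open>auto simp: strip_hol_def\<close>)
   fix b assume "b \<in> band \<delta>"
   then obtain r where r: "r > 0" "cball b r \<subseteq> band \<delta>" using open_contains_cball open_band by blast
   define R where "R = max (norm b + r) (norm a)"
   have "(a, x) \<in> box R" if "x \<in> cball b r" for x
   proof -
    have "norm x \<le> norm b + r" using that norm_triangle_ineq2[of x b] by (auto simp: dist_norm norm_minus_commute)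
    then show ?thesis using that r a abs_Re_le_cmod[of x] abs_Re_le_cmod[of a]
     unfolding box_def R_def strip_def by force
   qed
   then have "uniform_limit (cball b r) (\<lambda>X b. \<Sum>i\<in>X. f i (a, b)) (\<lambda>b. g (a, b)) (finite_subsets_at_top I)"
    using lim[of R] by (auto simp: uniform_limit_iff elim!: eventually_mono)
   then show "\<exists>r>0. cball b r \<subseteq> band \<delta> \<and> uniform_limit (cball b r) (\<lambda>X b. \<Sum>i\<in>X. f i (a, b)) (\<lambda>b. g (a, b)) (finite_subsets_at_top I)"
    using r by blast
  qed auto
 qed
qed

lemma continuous_log_holomorphic:
 assumes h: "continuous_on S h" and S: "open S" and f: "f holomorphic_on S" and eq: "\<And>z. z \<in> S \<Longrightarrow> f z = exp (h z)"
 shows "h holomorphic_on S"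
 unfolding holomorphic_on_open[OF S]
proof
 fix z assume z: "z \<in> S"
 have "open (h -` ball (h z) pi \<inter> S)"
  using continuous_on_open_vimage[OF S] h by blast
 then obtain r where r: "r > 0" "ball z r \<subseteq> h -` ball (h z) pi \<inter> S"
  using z openE[of "h -` ball (h z) pi \<inter> S" z] by (auto simp: pi_gt_zero)
 define k where "k y = h z + Ln (f y / exp (h z))" for y
 have hk: "h y = k y" if "y \<in> ball z r" for y
 proof -
  have "\<bar>Im (h y - h z)\<bar> < pi"
  proof -
   have "h y \<in> ball (h z) pi" using r(2) that by auto
   then have "cmod (h y - h z) < pi" by (simp add: dist_norm norm_minus_commute)
   then show ?thesis using abs_Im_le_cmod[of "h y - h z"] by linarith
  qed
  then have "Ln (exp (h y - h z)) = h y - h z" by (intro Ln_exp) auto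
  then show ?thesis using r(2) that eq by (auto simp: k_def exp_diff)
 qed
 have "f field_differentiable at z" using f S z holomorphic_on_imp_differentiable_at by blast
 then obtain f' where f': "(f has_field_derivative f') (at z)" by (auto simp: field_differentiable_def)
 have "((\<lambda>y. h z + Ln (f y / exp (h z))) has_field_derivative (f' / exp (h z)) / (f z / exp (h z))) (at z)"
  using f' eq[OF z] by (auto intro!: derivative_eq_intros)
 then have "(k has_field_derivative (f' / exp (h z)) / (f z / exp (h z))) (at z)"
  by (simp add: k_def[abs_def])
 then have "(h has_field_derivative (f' / exp (h z)) / (f z / exp (h z))) (at z)"
  by (rule has_field_derivative_transform_within_open[of _ _ _ "ball z r"]) (use r hk in auto)
 then show "\<exists>f'. (h has_field_derivative f') (at z)" by blast
qed

text \<open>The strip is convex, so there is a continuous logarithm, and a continuous logarithm of a holomorphic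
 function is holomorphic.\<close>

lemma sh_log:
 assumes f: "strip_hol \<delta> f" and nz: "\<And>z. z \<in> strip \<delta> \<Longrightarrow> f z \<noteq> 0"
 obtains h where "strip_hol \<delta> h" "\<And>z. z \<in> strip \<delta> \<Longrightarrow> f z = exp (h z)"
proof -
 obtain h where h: "continuous_on (strip \<delta>) h" "\<And>z. z \<in> strip \<delta> \<Longrightarrow> f z = exp (h z)"
  using continuous_logarithm_on_contractible[OF sh_cont[OF f] convex_imp_contractible nz] by auto
 have "strip_hol \<delta> h"
  unfolding strip_hol_def
 proof (intro conjI ballI h)
  fix b assume b: "b \<in> band \<delta>"
  show "(\<lambda>a. h (a, b)) holomorphic_on band \<delta>"
   by (rule continuous_log_holomorphic[of _ _ "\<lambda>a. f (a, b)"])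
    (use f b h in \<open>auto simp: strip_hol_def strip_def intro!: continuous_on_compose2[OF h(1)] continuous_intros\<close>)
 next
  fix a assume a: "a \<in> band \<delta>"
  show "(\<lambda>b. h (a, b)) holomorphic_on band \<delta>"
   by (rule continuous_log_holomorphic[of _ _ "\<lambda>b. f (a, b)"])
    (use f a h in \<open>auto simp: strip_hol_def strip_def intro!: continuous_on_compose2[OF h(1)] continuous_intros\<close>)
 qed
 then show ?thesis using that h by blast
qed

lemma difference_quotient_bound:
 assumes g: "g holomorphic_on ball b R" and M: "\<And>x. x \<in> ball b R \<Longrightarrow> norm (g x) \<le> M"
  and h: "h \<noteq> 0" "norm h < R / 2"
 shows "norm ((g (b + h) - g b) / h - deriv g b) \<le> 32 * M / R\<^sup>2 * norm h"
proof -
 have R: "R > 0" using h(2) norm_ge_zero[of h] by linarith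
 have sub: "ball b (R / 2) \<subseteq> ball b R" using R by auto
 have B: "norm ((deriv ^^ 2) g x) \<le> 32 * M / R\<^sup>2" if x: "x \<in> ball b (R / 2)" for x
 proof -
  have sub: "cball x (R / 4) \<subseteq> ball b R"
  proof
   fix y assume "y \<in> cball x (R / 4)"
   then show "y \<in> ball b R" using x R dist_triangle[of b y x] by (auto simp: dist_commute)
  qed
  have "norm ((deriv ^^ 2) g x) \<le> fact 2 * M / (R / 4) ^ 2"
  proof (rule Cauchy_inequality)
   show "g holomorphic_on ball x (R / 4)"
    using g sub by (meson ball_subset_cball holomorphic_on_subset)
   show "continuous_on (cball x (R / 4)) g"
    using g sub by (meson continuous_on_subset holomorphic_on_imp_continuous_on)
   show "norm (g y) \<le> M" if "norm (x - y) = R / 4" for y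
    using that sub by (intro M) (auto simp: dist_norm subset_iff)
  qed (use R in auto)
  then show ?thesis using R by (simp add: power2_eq_square field_simps)
 qed
 have der: "((deriv ^^ i) g has_field_derivative (deriv ^^ Suc i) g x) (at x within ball b (R / 2))"
  if "x \<in> ball b (R / 2)" for i x
  using has_field_derivative_higher_deriv[OF g open_ball, of x i] that sub
  by (meson has_field_derivative_at_within subset_iff)
 have "cmod ((deriv ^^ 0) g (b + h) - (\<Sum>i\<le>1. (deriv ^^ i) g b * (b + h - b) ^ i / fact i))
   \<le> 32 * M / R\<^sup>2 * cmod (b + h - b) ^ Suc 1 / fact 1"
  by (rule complex_Taylor[of "ball b (R / 2)" 1 "\<lambda>i. (deriv ^^ i) g"])
   (use der B h R in \<open>auto simp: numeral_2_eq_2 dist_norm\<close>)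
 then have *: "norm (g (b + h) - g b - deriv g b * h) \<le> 32 * M / R\<^sup>2 * norm h * norm h"
  by (simp add: power2_eq_square algebra_simps)
 have "(g (b + h) - g b) / h - deriv g b = (g (b + h) - g b - deriv g b * h) / h"
  using h(1) by (simp add: field_simps)
 then have "norm ((g (b + h) - g b) / h - deriv g b) = norm (g (b + h) - g b - deriv g b * h) / norm h"
  by (simp add: norm_divide)
 also have "\<dots> \<le> 32 * M / R\<^sup>2 * norm h"
  using * h(1) by (simp add: divide_le_eq)
 finally show ?thesis .
qed

text \<open>Difference quotients of a continuous family of holomorphic functions converge uniformly over a compact
 parameter space, by Cauchy's estimate for the second derivative.\<close>

lemma uniform_difference_quotient:
 fixes F :: "'a::topological_space \<Rightarrow> complex \<Rightarrow> complex"
 assumes K: "compact K" and S: "open S" and F: "continuous_on (K \<times> S) (\<lambda>p. F (fst p) (snd p))"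
  and hol: "\<And>x. x \<in> K \<Longrightarrow> F x holomorphic_on S" and b: "b \<in> S"
 shows "uniform_limit K (\<lambda>h x. (F x (b + h) - F x b) / h) (\<lambda>x. deriv (F x) b) (at 0)"
 unfolding uniform_limit_iff
proof (intro allI impI)
 fix e :: real assume e: "e > 0"
 obtain R where R: "R > 0" "cball b R \<subseteq> S" using b S open_contains_cball by blast
 have "compact ((\<lambda>p. F (fst p) (snd p)) ` (K \<times> cball b R))"
  by (intro compact_continuous_image compact_Times K compact_cball continuous_on_subset[OF F]) (use R in auto)
 then obtain M where M0: "\<And>x y. x \<in> K \<Longrightarrow> y \<in> cball b R \<Longrightarrow> norm (F x y) \<le> M"
  by (fastforce simp: bounded_iff dest: compact_imp_bounded)
 have M: "norm (F x y) \<le> \<bar>M\<bar>" if "x \<in> K" "y \<in> ball b R" for x y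
  using order_trans[OF M0[of x y] abs_ge_self[of M]] that by auto
 define L where "L = 32 * \<bar>M\<bar> / R\<^sup>2"
 have L: "L \<ge> 0" by (simp add: L_def)
 have "\<forall>\<^sub>F h in at (0::complex). h \<noteq> 0 \<and> norm h < min (R / 2) (e / (L + 1))"
  using R e L by (auto simp: eventually_at dist_norm intro!: exI[of _ "min (R / 2) (e / (L + 1))"])
 then show "\<forall>\<^sub>F h in at 0. \<forall>x\<in>K. dist ((F x (b + h) - F x b) / h) (deriv (F x) b) < e"
 proof (eventually_elim, intro ballI)
  fix h :: complex and x assume h: "h \<noteq> 0 \<and> norm h < min (R / 2) (e / (L + 1))" and x: "x \<in> K"
  have "F x holomorphic_on ball b R" using hol[OF x] R(2) ball_subset_cball[of b R] by (meson holomorphic_on_subset subset_trans)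
  then have "dist ((F x (b + h) - F x b) / h) (deriv (F x) b) \<le> L * norm h"
   unfolding dist_norm L_def by (rule difference_quotient_bound) (use h x M in auto)
  also have "\<dots> \<le> (L + 1) * norm h" by (simp add: algebra_simps)
  also have "\<dots> < e" using h L by (simp add: pos_less_divide_eq mult.commute)
  finally show "dist ((F x (b + h) - F x b) / h) (deriv (F x) b) < e" .
 qed
qed

text \<open>The Taylor coefficients in the first variable depend holomorphically on the second one, because
 derivatives in the first variable pass to the uniform limit of the difference quotients in the second.\<close>

lemma sh_taylor_coeff_holomorphic:
 assumes f: "strip_hol \<delta> f" and a: "a \<in> band \<delta>"
 shows "(\<lambda>b. (deriv ^^ i) (\<lambda>x. f (x, b)) a) holomorphic_on band \<delta>"
 unfolding holomorphic_on_open[OF open_band]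
proof
 fix b assume b: "b \<in> band \<delta>"
 obtain r where r: "r > 0" "cball a r \<subseteq> band \<delta>" using a open_contains_cball open_band by blast
 obtain R where R: "R > 0" "ball b R \<subseteq> band \<delta>" using b open_contains_ball open_band by blast
 have holx: "(\<lambda>x. f (x, y)) holomorphic_on ball a r" if "y \<in> band \<delta>" for y
  using f r(2) that ball_subset_cball[of a r] unfolding strip_hol_def by (meson holomorphic_on_subset subset_trans)
 define F where "F h x = (f (x, b + h) - f (x, b)) / h" for h x
 define G where "G x = deriv (\<lambda>y. f (x, y)) b" for x
 have "uniform_limit (cball a r) F G (at 0)"
  unfolding F_def G_def
 proof (rule uniform_difference_quotient[where F = "\<lambda>x y. f (x, y)", OF compact_cball open_band])
  show "continuous_on (cball a r \<times> band \<delta>) (\<lambda>p. f (fst p, snd p))"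
   using continuous_on_subset[OF sh_cont[OF f], of "cball a r \<times> band \<delta>"] r(2) by (auto simp: strip_def)
 qed (use f r(2) b in \<open>auto simp: strip_hol_def\<close>)
 then have lim: "uniform_limit (ball a r) F G (at 0)" by (rule uniform_limit_on_subset) auto
 have near: "\<forall>\<^sub>F h in at 0. h \<noteq> 0 \<and> b + h \<in> band \<delta>"
  using R by (auto simp: eventually_at dist_norm intro!: exI[of _ R])
 have "\<forall>\<^sub>F h in at 0. F h holomorphic_on ball a r"
  using near by eventually_elim (auto simp: F_def[abs_def] intro!: holomorphic_intros holx b)
 then have "((\<lambda>h. (deriv ^^ i) (F h) a) \<longlongrightarrow> (deriv ^^ i) G a) (at 0)"
  by (rule higher_deriv_complex_uniform_limit[OF lim]) (use r in auto)
 moreover have "\<forall>\<^sub>F h in at 0. (deriv ^^ i) (F h) a =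
   ((deriv ^^ i) (\<lambda>x. f (x, b + h)) a - (deriv ^^ i) (\<lambda>x. f (x, b)) a) / h"
  using near
 proof eventually_elim
  case (elim h)
  have "(deriv ^^ i) (F h) a = (deriv ^^ i) (\<lambda>x. (1 / h) * (f (x, b + h) - f (x, b))) a"
   by (simp add: F_def[abs_def] field_simps)
  also have "\<dots> = (1 / h) * (deriv ^^ i) (\<lambda>x. f (x, b + h) - f (x, b)) a"
   by (rule higher_deriv_cmult[of _ "ball a r"]) (use holx elim b r in \<open>auto intro: holomorphic_intros\<close>)
  also have "(deriv ^^ i) (\<lambda>x. f (x, b + h) - f (x, b)) a =
    (deriv ^^ i) (\<lambda>x. f (x, b + h)) a - (deriv ^^ i) (\<lambda>x. f (x, b)) a"
   by (rule higher_deriv_diff[of _ "ball a r"]) (use holx elim b r in auto)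
  finally show ?case by simp
 qed
 ultimately show "\<exists>f'. ((\<lambda>b. (deriv ^^ i) (\<lambda>x. f (x, b)) a) has_field_derivative f') (at b)"
  unfolding DERIV_def using tendsto_cong by force
qed

lemma summable_on_prod_nonneg:
 fixes f :: "'a \<Rightarrow> real" and g :: "'b \<Rightarrow> real"
 assumes "f summable_on A" "g summable_on B" "\<And>x. x \<in> A \<Longrightarrow> f x \<ge> 0" "\<And>y. y \<in> B \<Longrightarrow> g y \<ge> 0"
 shows "(\<lambda>(x, y). f x * g y) summable_on A \<times> B"
proof (rule summable_on_SigmaI)
 show "((\<lambda>y. case (x, y) of (x, y) \<Rightarrow> f x * g y) has_sum f x * infsum g B) B" for x
  using has_sum_cmult_right[OF has_sum_infsum[OF assms(2)]] by simp
 show "(\<lambda>x. f x * infsum g B) summable_on A"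
  using assms(1) by (rule summable_on_cmult_left)
qed (use assms in auto)

text \<open>Expand in the first variable and then the coefficients in the second. Cauchy's estimates majorize the double series by
 a product of two geometric series.\<close>

lemma sh_power_series:
 assumes f: "strip_hol \<delta> f" and d: "\<delta> > 0"
 obtains c where "\<And>w. w \<in> ball a (\<delta> / 2) \<Longrightarrow>
  ((\<lambda>(i, j). of_real ((w $ 1 - a $ 1) ^ i * (w $ 2 - a $ 2) ^ j) * c (i, j)) has_sum f (cpt w)) UNIV"
proof -
 define a1 a2 where "a1 = complex_of_real (a $ 1)" and "a2 = complex_of_real (a $ 2)"
 define r where "r = \<delta> / 2"
 have r: "r > 0" using d by (simp add: r_def)
 have sub: "cball (complex_of_real x) r \<subseteq> band \<delta>" for x
 proof
  fix y assume "y \<in> cball (complex_of_real x) r"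
  then show "y \<in> band \<delta>" using abs_Im_le_cmod[of "y - of_real x"] d
   by (auto simp: band_def r_def dist_norm norm_minus_commute)
 qed
 have "compact (f ` (cball a1 r \<times> cball a2 r))"
  by (rule compact_continuous_image)
   (use sh_cont[OF f] sub in \<open>auto intro!: compact_Times intro: continuous_on_subset simp: strip_def a1_def a2_def\<close>)
 then obtain M where M: "\<And>x y. x \<in> cball a1 r \<Longrightarrow> y \<in> cball a2 r \<Longrightarrow> norm (f (x, y)) \<le> M"
  by (fastforce simp: bounded_iff dest: compact_imp_bounded)
 have M0: "M \<ge> 0" using M[of a1 a2] r norm_ge_zero order_trans by (metis centre_in_cball less_imp_le)
 define k where "k i b = (deriv ^^ i) (\<lambda>x. f (x, b)) a1 / fact i" for i b
 define c where "c = (\<lambda>(i, j). (deriv ^^ j) (k i) a2 / fact j)"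
 have khol: "k i holomorphic_on band \<delta>" for i
  unfolding k_def[abs_def]
  by (intro holomorphic_intros sh_taylor_coeff_holomorphic[OF f]) (auto simp: a1_def d)
 have kb: "norm (k i b) \<le> M / r ^ i" if b: "b \<in> cball a2 r" for i b
 proof -
  have "b \<in> band \<delta>" using b sub[of "a $ 2"] unfolding a2_def by blast
  then have hol: "(\<lambda>x. f (x, b)) holomorphic_on band \<delta>" using f by (auto simp: strip_hol_def)
  have "norm ((deriv ^^ i) (\<lambda>x. f (x, b)) a1) \<le> fact i * M / r ^ i"
  proof (rule Cauchy_inequality)
   show "(\<lambda>x. f (x, b)) holomorphic_on ball a1 r"
    using hol sub[of "a $ 1"] unfolding a1_def by (meson ball_subset_cball holomorphic_on_subset)
   show "continuous_on (cball a1 r) (\<lambda>x. f (x, b))"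
    using hol sub[of "a $ 1"] unfolding a1_def by (meson continuous_on_subset holomorphic_on_imp_continuous_on)
   show "norm (f (x, b)) \<le> M" if "norm (a1 - x) = r" for x
    using that b by (intro M) (auto simp: dist_norm)
  qed (use r in auto)
  then show ?thesis by (simp add: k_def norm_divide divide_le_eq mult_ac)
 qed
 have cb: "norm (c (i, j)) \<le> M / (r ^ i * r ^ j)" for i j
 proof -
  have "norm ((deriv ^^ j) (k i) a2) \<le> fact j * (M / r ^ i) / r ^ j"
  proof (rule Cauchy_inequality)
   show "k i holomorphic_on ball a2 r"
    using khol sub[of "a $ 2"] unfolding a2_def by (meson ball_subset_cball holomorphic_on_subset)
   show "continuous_on (cball a2 r) (k i)"
    using khol sub[of "a $ 2"] unfolding a2_def by (meson continuous_on_subset holomorphic_on_imp_continuous_on)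
   show "norm (k i x) \<le> M / r ^ i" if "norm (a2 - x) = r" for x
    using that by (intro kb) (auto simp: dist_norm)
  qed (use r in auto)
  then show ?thesis by (simp add: c_def norm_divide divide_le_eq mult_ac)
 qed
 have "((\<lambda>(i, j). of_real ((w $ 1 - a $ 1) ^ i * (w $ 2 - a $ 2) ^ j) * c (i, j)) has_sum f (cpt w)) UNIV"
  if w: "w \<in> ball a r" for w
 proof -
  define X Y where "X = w $ 1 - a $ 1" and "Y = w $ 2 - a $ 2"
  have XY: "\<bar>X\<bar> < r" "\<bar>Y\<bar> < r"
   using w component_le_norm_cart[of "w - a" 1] component_le_norm_cart[of "w - a" 2]
   by (auto simp: X_def Y_def dist_norm norm_minus_commute)
  have geo: "(\<lambda>n::nat. (\<bar>x\<bar> / r) ^ n) summable_on UNIV" if "\<bar>x\<bar> < r" for x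
  proof -
   have "summable (\<lambda>n. norm ((\<bar>x\<bar> / r) ^ n))"
    using that r by (auto simp: power_abs intro!: summable_geometric)
   then show ?thesis by (rule norm_summable_imp_summable_on)
  qed
  have sumb: "(\<lambda>p. (case p of (i, j) \<Rightarrow> of_real (X ^ i * Y ^ j) * c (i, j))) summable_on UNIV \<times> UNIV"
  proof (rule abs_summable_summable)
   have "(\<lambda>p. M * (case p of (i, j) \<Rightarrow> (\<bar>X\<bar> / r) ^ i * (\<bar>Y\<bar> / r) ^ j)) summable_on UNIV \<times> UNIV"
    by (intro summable_on_cmult_right summable_on_prod_nonneg geo XY) (use r in auto)
   then show "(\<lambda>p. norm (case p of (i, j) \<Rightarrow> of_real (X ^ i * Y ^ j) * c (i, j))) summable_on UNIV \<times> UNIV"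
   proof (rule summable_on_comparison_test)
    fix p :: "nat \<times> nat"
    obtain i j where p: "p = (i, j)" by (cases p)
    have "norm (of_real (X ^ i * Y ^ j) * c (i, j)) \<le> \<bar>X\<bar> ^ i * \<bar>Y\<bar> ^ j * (M / (r ^ i * r ^ j))"
     unfolding norm_mult by (intro mult_mono cb) (auto simp: abs_mult power_abs norm_mult norm_power)
    then show "norm (case p of (i, j) \<Rightarrow> of_real (X ^ i * Y ^ j) * c (i, j)) \<le>
      M * (case p of (i, j) \<Rightarrow> (\<bar>X\<bar> / r) ^ i * (\<bar>Y\<bar> / r) ^ j)"
     by (simp add: p power_divide mult_ac)
   qed auto
  qed
  have wb: "complex_of_real (w $ 2) \<in> cball a2 r" "complex_of_real (w $ 2) \<in> ball a2 r"
    "complex_of_real (w $ 1) \<in> ball a1 r"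
   using XY by (simp_all add: a1_def a2_def dist_norm X_def Y_def norm_minus_commute
    flip: of_real_diff)
  have kb2: "k i holomorphic_on ball a2 r" for i
   using khol[of i] sub[of "a $ 2"] ball_subset_cball[of a2 r] unfolding a2_def
   by (meson holomorphic_on_subset subset_trans)
  have "(\<lambda>x. f (x, of_real (w $ 2))) holomorphic_on band \<delta>"
   using f d by (simp add: strip_hol_def)
  then have kb1: "(\<lambda>x. f (x, of_real (w $ 2))) holomorphic_on ball a1 r"
   using sub[of "a $ 1"] ball_subset_cball[of a1 r] unfolding a1_def
   by (meson holomorphic_on_subset subset_trans)
  have inner: "((\<lambda>j. of_real (X ^ i * Y ^ j) * c (i, j)) has_sum of_real (X ^ i) * k i (of_real (w $ 2))) UNIV" for i
  proof -
   have "(\<lambda>j. (deriv ^^ j) (k i) a2 / fact j * (of_real (w $ 2) - a2) ^ j) sums k i (of_real (w $ 2))"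
    by (rule holomorphic_power_series[of _ _ r])
     (use kb2[of i] wb in auto)
   then have s: "(\<lambda>j. of_real (Y ^ j) * c (i, j)) sums k i (of_real (w $ 2))"
    by (simp add: c_def a2_def Y_def mult_ac)
   have "summable (\<lambda>j. norm (of_real (Y ^ j) * c (i, j)))"
   proof (rule summable_comparison_test_ev)
    show "summable (\<lambda>j. M / r ^ i * (\<bar>Y\<bar> / r) ^ j)"
     using XY r by (intro summable_mult summable_geometric) auto
    have "norm (norm (of_real (Y ^ j) * c (i, j))) \<le> M / r ^ i * (\<bar>Y\<bar> / r) ^ j" for j
    proof -
     have "norm (of_real (Y ^ j) * c (i, j)) \<le> \<bar>Y\<bar> ^ j * (M / (r ^ i * r ^ j))"
      unfolding norm_mult by (intro mult_mono cb) (auto simp: power_abs norm_power)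
     then show ?thesis by (simp add: power_divide mult_ac)
    qed
    then show "\<forall>\<^sub>F j in sequentially. norm (norm (of_real (Y ^ j) * c (i, j))) \<le> M / r ^ i * (\<bar>Y\<bar> / r) ^ j"
     by simp
   qed
   then have "((\<lambda>j. of_real (Y ^ j) * c (i, j)) has_sum k i (of_real (w $ 2))) UNIV"
    using s by (rule norm_summable_imp_has_sum)
   from has_sum_cmult_right[OF this, of "of_real (X ^ i)"] show ?thesis by (simp add: mult_ac)
  qed
  have outer: "((\<lambda>i. of_real (X ^ i) * k i (of_real (w $ 2))) has_sum f (cpt w)) UNIV"
  proof -
   have "(\<lambda>i. (deriv ^^ i) (\<lambda>x. f (x, of_real (w $ 2))) a1 / fact i * (of_real (w $ 1) - a1) ^ i)
     sums f (of_real (w $ 1), of_real (w $ 2))"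
    by (rule holomorphic_power_series[of "\<lambda>x. f (x, of_real (w $ 2))" _ r])
     (use kb1 wb in auto)
   then have s: "(\<lambda>i. of_real (X ^ i) * k i (of_real (w $ 2))) sums f (cpt w)"
    by (simp add: k_def a1_def X_def cpt_def mult_ac)
   have "summable (\<lambda>i. norm (of_real (X ^ i) * k i (of_real (w $ 2))))"
   proof (rule summable_comparison_test_ev)
    show "summable (\<lambda>i. M * (\<bar>X\<bar> / r) ^ i)"
     using XY r by (intro summable_mult summable_geometric) auto
    have "norm (norm (of_real (X ^ i) * k i (of_real (w $ 2)))) \<le> M * (\<bar>X\<bar> / r) ^ i" for i
    proof -
     have "norm (of_real (X ^ i) * k i (of_real (w $ 2))) \<le> \<bar>X\<bar> ^ i * (M / r ^ i)"
      unfolding norm_mult by (intro mult_mono kb wb) (auto simp: power_abs norm_power)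
     then show ?thesis by (simp add: power_divide mult_ac)
    qed
    then show "\<forall>\<^sub>F i in sequentially. norm (norm (of_real (X ^ i) * k i (of_real (w $ 2)))) \<le> M * (\<bar>X\<bar> / r) ^ i"
     by simp
   qed
   then show ?thesis using s by (rule norm_summable_imp_has_sum)
  qed
  have "((\<lambda>(i, j). of_real (X ^ i * Y ^ j) * c (i, j)) has_sum f (cpt w)) (UNIV \<times> UNIV)"
   by (rule has_sum_SigmaI[OF _ outer]) (use inner sumb in auto)
  then show ?thesis by (simp add: X_def Y_def)
 qed
 then show ?thesis using that[of c] unfolding r_def by blast
qed

lemma sh_imp_real_analytic:
 fixes F :: "C2 \<Rightarrow> complex^2"
 assumes F: "\<And>i. strip_hol \<delta> (\<lambda>z. F z $ i)" and d: "\<delta> > 0"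
 shows "real_analytic (\<lambda>w. F (cpt w))"
 unfolding real_analytic_def
proof
 fix a :: "real^2"
 have "\<exists>c. \<forall>w\<in>ball a (\<delta> / 2). ((\<lambda>(i, j). of_real ((w $ 1 - a $ 1) ^ i * (w $ 2 - a $ 2) ^ j) * c (i, j))
   has_sum F (cpt w) $ k) UNIV" (is "\<exists>c. ?P k c") for k
  by (rule sh_power_series[OF F[of k] d, of a]) blast
 then obtain c where "\<forall>k. ?P k (c k)" using choice[of ?P] by blast
 then have c: "\<And>k w. w\<in>ball a (\<delta> / 2) \<Longrightarrow>
  ((\<lambda>(i, j). of_real ((w $ 1 - a $ 1) ^ i * (w $ 2 - a $ 2) ^ j) * c k (i, j)) has_sum F (cpt w) $ k) UNIV"
  by blast
 define C where "C p = (\<chi> k. c k p)" for p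
 have "((\<lambda>(i, j). ((w $ 1 - a $ 1) ^ i * (w $ 2 - a $ 2) ^ j) *\<^sub>R C (i, j)) has_sum F (cpt w)) UNIV"
  if w: "w\<in>ball a (\<delta> / 2)" for w
  unfolding has_sum_def
 proof (rule vec_tendstoI)
  fix k
  have "(\<Sum>p\<in>X. case p of (i, j) \<Rightarrow> ((w $ 1 - a $ 1) ^ i * (w $ 2 - a $ 2) ^ j) *\<^sub>R C (i, j)) $ k =
   (\<Sum>p\<in>X. case p of (i, j) \<Rightarrow> of_real ((w $ 1 - a $ 1) ^ i * (w $ 2 - a $ 2) ^ j) * c k (i, j))" for X
   unfolding sum_component by (intro sum.cong) (auto simp: C_def scaleR_conv_of_real[where 'a = complex])
  then show "((\<lambda>X. (\<Sum>p\<in>X. case p of (i, j) \<Rightarrow> ((w $ 1 - a $ 1) ^ i * (w $ 2 - a $ 2) ^ j) *\<^sub>R C (i, j)) $ k)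
    \<longlongrightarrow> F (cpt w) $ k) (finite_subsets_at_top UNIV)"
   using c[OF w, of k] by (simp add: has_sum_def)
 qed
 then show "\<exists>r>0. \<exists>c. \<forall>w\<in>ball a r.
   ((\<lambda>(i, j). ((w $ 1 - a $ 1) ^ i * (w $ 2 - a $ 2) ^ j) *\<^sub>R c (i, j)) has_sum F (cpt w)) UNIV"
  using d by (intro exI[of _ "\<delta> / 2"] conjI exI[of _ C]) auto
qed

lemma periodic_int_shift:
 fixes v :: "'a::real_vector"
 assumes D: "\<And>x. x + v \<in> D \<longleftrightarrow> x \<in> D" and per: "\<And>x. x \<in> D \<Longrightarrow> f (x + v) = f x" and x: "x \<in> D"
 shows "f (x + of_int n *\<^sub>R v) = f x"
proof -
 have nat: "x + of_nat m *\<^sub>R v \<in> D \<and> f (x + of_nat m *\<^sub>R v) = f x" if "x \<in> D" for m x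
 proof (induction m)
  case (Suc m)
  have "x + of_nat (Suc m) *\<^sub>R v = (x + of_nat m *\<^sub>R v) + v" by (simp add: algebra_simps)
  then show ?case using Suc D per by metis
 qed (use that in simp)
 show ?thesis
 proof (cases "n \<ge> 0")
  case True
  then show ?thesis using nat[OF x, of "nat n"] by simp
 next
  case False
  define y where "y = x + of_int n *\<^sub>R v"
  have xy: "x = y + of_nat (nat (- n)) *\<^sub>R v" using False by (simp add: y_def)
  have "y + of_nat m *\<^sub>R v \<in> D \<longleftrightarrow> y \<in> D" for m
  proof (induction m)
   case (Suc m)
   have "y + of_nat (Suc m) *\<^sub>R v = (y + of_nat m *\<^sub>R v) + v" by (simp add: algebra_simps)
   then show ?case using Suc D by metis
  qed simp
  then have "y \<in> D" using x xy by metis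
  then show ?thesis using nat[of y "nat (- n)"] xy y_def by metis
 qed
qed

lemma real2_eqI: "(v::'a^2) $ 1 = w $ 1 \<Longrightarrow> v $ 2 = w $ 2 \<Longrightarrow> v = w"
 by (simp add: vec_eq_iff forall_2)

text \<open>A tube lemma: the closed unit square is compact, and periodicity carries the neighbourhood
 obtained there to the whole strip.\<close>

lemma strip_tube:
 assumes S: "open S" and real: "\<And>w. cpt w \<in> S" and "\<delta> > 0"
  and per: "\<And>j z. z \<in> strip \<delta> \<Longrightarrow> z + cpt (axis j 1) \<in> S \<longleftrightarrow> z \<in> S"
 obtains \<delta>' where "\<delta>' > 0" "\<delta>' \<le> \<delta>" "strip \<delta>' \<subseteq> S"
proof -
 have "compact (cpt ` cbox 0 1)" by (intro compact_continuous_image continuous_cpt compact_cbox)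
 then obtain e where e: "e > 0" "(\<Union>x\<in>cpt ` cbox 0 1. ball x e) \<subseteq> S"
  using compact_subset_open_imp_ball_epsilon_subset S real by (metis image_subsetI)
 define d where "d = min \<delta> (e / 3)"
 have "z \<in> S" if z: "z \<in> strip d" for z
 proof -
  define n where "n = \<lfloor>Re (fst z)\<rfloor>"
  define m where "m = \<lfloor>Re (snd z)\<rfloor>"
  define w :: "real^2" where "w = (\<chi> i. if i = 1 then Re (fst z) - n else Re (snd z) - m)"
  define y where "y = z + of_int (- n) *\<^sub>R cpt (axis 1 1)"
  define x where "x = y + of_int (- m) *\<^sub>R cpt (axis 2 1)"
  have "w \<in> cbox 0 1"
   unfolding mem_box_cart w_def n_def m_def by (auto simp: forall_2) linarith+
  moreover have "dist (cpt w) x < e"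
  proof -
   have "cpt w - x = (- \<i> * Im (fst z), - \<i> * Im (snd z))"
    by (simp add: x_def y_def w_def cpt_def axis_def complex_eq_iff prod_eq_iff)
   then have "dist (cpt w) x \<le> \<bar>Im (fst z)\<bar> + \<bar>Im (snd z)\<bar>"
    using norm_Pair_le[of "- \<i> * Im (fst z)" "- \<i> * Im (snd z)"] by (simp add: dist_norm norm_mult)
   also have "\<dots> < e" using z e by (auto simp: strip_iff d_def)
   finally show ?thesis .
  qed
  ultimately have xS: "x \<in> S" using e(2) by (meson UN_I image_eqI mem_ball subset_iff)
  have zd: "z \<in> strip \<delta>" using z strip_mono[of d \<delta>] by (auto simp: d_def)
  have "y \<in> strip \<delta>" unfolding y_def cpt_scaleR[symmetric] using zd by simp
  then have "(x \<in> S) = (y \<in> S)" unfolding x_def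
   by (intro periodic_int_shift[where D = "strip \<delta>" and f = "\<lambda>z. z \<in> S"]) (auto simp: per)
  also have "\<dots> = (z \<in> S)" unfolding y_def using zd
   by (intro periodic_int_shift[where D = "strip \<delta>" and f = "\<lambda>z. z \<in> S"]) (auto simp: per)
  finally show ?thesis using xS by simp
 qed
 then have "strip d \<subseteq> S" by blast
 then show ?thesis using that[of d] e(1) \<open>\<delta> > 0\<close> by (simp add: d_def)
qed

section \<open>Fourier analysis on the torus\<close>

definition torus_char :: "int \<times> int \<Rightarrow> C2 \<Rightarrow> complex" where
 "torus_char n z = exp (2 * pi * \<i> * (of_int (fst n) * fst z + of_int (snd n) * snd z))"

definition mean :: "(real^2 \<Rightarrow> complex) \<Rightarrow> complex" where
 "mean f = (LINT w:cbox 0 1|lebesgue. f w)"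

lemma exp_2pi_int [simp]: "exp (2 * complex_of_real pi * \<i> * of_int n) = 1"
 using exp_eq_1 by (auto simp: mult_ac)

lemma torus_char_add: "torus_char n (z + y) = torus_char n z * torus_char n y"
 by (simp add: torus_char_def exp_add ring_distribs)

lemma torus_char_add': "torus_char (n + m) z = torus_char n z * torus_char m z"
 by (simp add: torus_char_def exp_add ring_distribs)

lemma torus_char_0 [simp]: "torus_char 0 z = 1" "torus_char (0, 0) z = 1" "torus_char n 0 = 1"
 by (simp_all add: torus_char_def)

lemma torus_char_nz [simp]: "torus_char n z \<noteq> 0"
 by (simp add: torus_char_def)

lemma torus_char_uminus: "torus_char (- n) z = inverse (torus_char n z)"
 by (simp add: torus_char_def exp_minus[symmetric] ring_distribs)

lemma torus_char_axis [simp]: "torus_char n (cpt (axis j 1)) = 1"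
proof -
 have "j = 1 \<or> j = 2" using exhaust_2 by blast
 then show ?thesis by (auto simp: torus_char_def cpt_def axis_def)
qed

lemma torus_char_periodic [simp]: "torus_char n (z + cpt (axis j 1)) = torus_char n z"
 by (simp add: torus_char_add)

lemma norm_torus_char: "norm (torus_char n z) = exp (- (2 * pi * (of_int (fst n) * Im (fst z) + of_int (snd n) * Im (snd z))))"
 by (simp add: torus_char_def)

lemma norm_torus_char_cpt [simp]: "norm (torus_char n (cpt w)) = 1"
 by (simp add: norm_torus_char cpt_def)

lemma sh_torus_char: "strip_hol \<delta> (torus_char n)"
 unfolding torus_char_def[abs_def] by (intro sh_exp sh_mult sh_add sh_const sh_fst sh_snd)

lemma continuous_torus_char [continuous_intros]: "continuous_on S (torus_char n)"
 unfolding torus_char_def[abs_def] by (intro continuous_intros)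

lemma measurable_lebesgue_cont:
 fixes f :: "real^2 \<Rightarrow> 'b::topological_space"
 assumes "continuous_on UNIV f" shows "f \<in> lmeas_fns"
 using borel_measurable_continuous_onI[OF assms] by (simp add: measurable_completion)

lemma torus_char_measurable [measurable]: "(\<lambda>w. torus_char n (cpt w)) \<in> lmeas_fns"
 by (intro measurable_lebesgue_cont continuous_on_compose2[OF continuous_torus_char continuous_cpt]) auto

lemma lebesgue_translate:
 fixes c :: "'a::euclidean_space"
 shows "(\<lambda>x. x + c) \<in> lebesgue \<rightarrow>\<^sub>M lebesgue" "distr lebesgue lebesgue (\<lambda>x. x + c) = lebesgue"
proof -
 have eq: "(\<lambda>x. c + (\<Sum>j\<in>Basis. (1 * (x \<bullet> j)) *\<^sub>R j)) = (\<lambda>x. x + c)"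
  by (simp add: euclidean_representation add.commute)
 show "(\<lambda>x. x + c) \<in> lebesgue \<rightarrow>\<^sub>M lebesgue"
  using lebesgue_affine_measurable[of "\<lambda>_. 1" c] unfolding eq by simp
 show "distr lebesgue lebesgue (\<lambda>x. x + c) = lebesgue"
  using lebesgue_affine_euclidean[of "\<lambda>_. 1" c] unfolding eq by (simp add: density_1)
qed

lemma AE_translate:
 fixes c :: "'a::euclidean_space"
 assumes "AE w in lebesgue. P w" shows "AE w in lebesgue. P (w + c)"
 using AE_distrD[OF lebesgue_translate(1)[of c], of P] assms unfolding lebesgue_translate(2) by blast

lemma measurable_translate:
 fixes c :: "'a::euclidean_space"
 assumes "f \<in> lebesgue \<rightarrow>\<^sub>M M" shows "(\<lambda>w. f (w + c)) \<in> lebesgue \<rightarrow>\<^sub>M M"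
 using measurable_compose[OF lebesgue_translate(1) assms] .

lemma integral_translate:
 fixes f :: "'a::euclidean_space \<Rightarrow> complex"
 assumes "f \<in> lmeas_fns"
 shows "integral\<^sup>L lebesgue (\<lambda>w. f (w + c)) = integral\<^sup>L lebesgue f"
 using integral_distr[OF lebesgue_translate(1) assms, of c] unfolding lebesgue_translate(2) by (rule sym)

lemma AE_int_shift:
 fixes v :: "'a::euclidean_space"
 assumes "AE w in lebesgue. f (w + v) = f w"
 shows "AE w in lebesgue. f (w + of_int n *\<^sub>R v) = f w"
proof -
 have nat: "AE w in lebesgue. f (w + of_nat m *\<^sub>R v) = f w" for m
 proof (induction m)
  case (Suc m)
  have "AE w in lebesgue. f (w + of_nat m *\<^sub>R v + v) = f (w + of_nat m *\<^sub>R v)"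
   using AE_translate[OF assms, of "of_nat m *\<^sub>R v"] by simp
  with Suc show ?case by eventually_elim (simp add: algebra_simps)
 qed simp
 show ?thesis
 proof (cases "n \<ge> 0")
  case True then show ?thesis using nat[of "nat n"] by simp
 next
  case False
  have "AE w in lebesgue. f (w + of_int n *\<^sub>R v + of_nat (nat (- n)) *\<^sub>R v) = f (w + of_int n *\<^sub>R v)"
   using AE_translate[OF nat[of "nat (- n)"], of "of_int n *\<^sub>R v"] by simp
  moreover have "w + of_int n *\<^sub>R v + of_nat (nat (- n)) *\<^sub>R v = w" for w
   using False by (simp add: algebra_simps flip: scaleR_add_left)
  ultimately show ?thesis by (metis (mono_tags, lifting) eventually_mono)
 qed
qed

text \<open>Countably many lattice translates of the unit square cover the plane.\<close>

lemma AE_periodic_from_unit_square: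
 fixes P :: "real^2 \<Rightarrow> bool"
 assumes per: "\<And>j. AE w in lebesgue. P (w + axis j 1) = P w"
  and sq: "AE w in lebesgue. w \<in> cbox 0 1 \<longrightarrow> P w"
 shows "AE w in lebesgue. P w"
proof -
 have "AE w in lebesgue. \<forall>n m :: int.
  P (w + of_int n *\<^sub>R axis 1 1 + of_int m *\<^sub>R axis 2 1) = P (w + of_int n *\<^sub>R axis 1 1) \<and>
  P (w + of_int n *\<^sub>R axis 1 1) = P w \<and>
  (w + of_int n *\<^sub>R axis 1 1 + of_int m *\<^sub>R axis 2 1 \<in> cbox 0 1 \<longrightarrow>
   P (w + of_int n *\<^sub>R axis 1 1 + of_int m *\<^sub>R axis 2 1))"
  unfolding AE_all_countable
 proof (intro allI AE_conjI)
  fix n m :: int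
  show "AE w in lebesgue. P (w + of_int n *\<^sub>R axis 1 1 + of_int m *\<^sub>R axis 2 1) = P (w + of_int n *\<^sub>R axis 1 1)"
   using AE_translate[OF AE_int_shift[OF per[of 2], of m], of "of_int n *\<^sub>R axis 1 1"] by simp
  show "AE w in lebesgue. P (w + of_int n *\<^sub>R axis 1 1) = P w"
   using AE_int_shift[OF per[of 1], of n] by simp
  show "AE w in lebesgue. w + of_int n *\<^sub>R axis 1 1 + of_int m *\<^sub>R axis 2 1 \<in> cbox 0 1 \<longrightarrow>
   P (w + of_int n *\<^sub>R axis 1 1 + of_int m *\<^sub>R axis 2 1)"
   using AE_translate[OF sq, of "of_int n *\<^sub>R axis 1 1 + of_int m *\<^sub>R axis 2 1"] by (simp add: add.assoc)
 qed
 then show ?thesis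
 proof eventually_elim
  case (elim w)
  have "w + of_int (- \<lfloor>w $ 1\<rfloor>) *\<^sub>R axis 1 1 + of_int (- \<lfloor>w $ 2\<rfloor>) *\<^sub>R axis 2 1 \<in> cbox 0 1"
   unfolding mem_box_cart by (auto simp: forall_2 axis_def) linarith+
  then show ?case using elim by blast
 qed
qed

lemma lebesgue_integrable_bounded:
 fixes f :: "real^2 \<Rightarrow> complex"
 assumes "f \<in> lmeas_fns" "\<And>w. norm (f w) \<le> C" "A \<in> sets lebesgue" "A \<subseteq> cbox 0 1"
 shows "set_integrable lebesgue A f"
 unfolding set_integrable_def
proof (rule Bochner_Integration.integrable_bound[where f = "\<lambda>w. C * indicator (cbox 0 1) w :: real"])
 have "integrable lebesgue (indicator (cbox 0 1 :: (real^2) set) :: _ \<Rightarrow> real)"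
  by (rule integrable_real_indicator) (auto simp: emeasure_lborel_cbox_eq)
 then show "integrable lebesgue (\<lambda>w::real^2. C * indicator (cbox 0 1) w :: real)"
  by (rule integrable_mult_right)
 have "0 \<le> C" using assms(2) norm_ge_zero order_trans by blast
 then show "AE w in lebesgue. norm (indicator A w *\<^sub>R f w) \<le> norm (C * indicator (cbox 0 1) w :: real)"
  using assms(2,4) by (auto simp: indicator_def)
qed (use assms in measurable)

lemma measure_unit_square: "measure lebesgue (cbox 0 1 :: (real^2) set) = 1"
proof -
 have "(cbox 0 1 :: (real^2) set) \<noteq> {}" by (simp add: interval_ne_empty_cart)
 then show ?thesis using content_cbox_cart[of "0::real^2" 1] by simp
qed

lemma indicator_scaleR_measurable:
 fixes f :: "'a::euclidean_space \<Rightarrow> complex"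
 assumes "f \<in> lmeas_fns" "A \<in> sets lebesgue"
 shows "(\<lambda>w. indicat_real A w *\<^sub>R f w) \<in> lmeas_fns"
 using assms by (intro borel_measurable_scaleR borel_measurable_indicator)

lemma norm_mean_le:
 assumes "f \<in> lmeas_fns" "\<And>w. w \<in> cbox 0 1 \<Longrightarrow> norm (f w) \<le> C"
 shows "norm (mean f) \<le> C"
proof -
 have ii: "integrable lebesgue (indicator (cbox 0 1 :: (real^2) set) :: _ \<Rightarrow> real)"
  by (rule integrable_real_indicator) (auto simp: emeasure_lborel_cbox_eq)
 have C: "C \<ge> 0"
  using order_trans[OF norm_ge_zero assms(2)[of 0]] by (simp add: mem_box_cart)
 have bd: "norm (indicat_real (cbox 0 1) w *\<^sub>R f w) \<le> C * indicator (cbox 0 1) w" for w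
  using assms(2)[of w] C by (auto simp: indicator_def)
 have "integrable lebesgue (\<lambda>w. indicat_real (cbox 0 1) w *\<^sub>R f w)"
  by (rule Bochner_Integration.integrable_bound[OF integrable_mult_right[OF ii, of C]])
   (use bd C assms(1) in \<open>auto intro!: indicator_scaleR_measurable\<close>)
 then have "norm (mean f) \<le> (\<integral>w. C * indicator (cbox 0 1) w \<partial>(lebesgue :: (real^2) measure))"
  unfolding mean_def set_lebesgue_integral_def
  by (intro order_trans[OF integral_norm_bound] integral_mono integrable_norm integrable_mult_right ii bd)
 also have "\<dots> = C" using measure_unit_square by simp
 finally show ?thesis .
qed

lemma mean_add:
 assumes "f \<in> lmeas_fns" "\<And>w. norm (f w) \<le> C" "g \<in> lmeas_fns" "\<And>w. norm (g w) \<le> C'"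
 shows "mean (\<lambda>w. f w + g w) = mean f + mean g"
 unfolding mean_def
 by (intro set_integral_add lebesgue_integrable_bounded[of f C] lebesgue_integrable_bounded[of g C'] assms) auto

lemma mean_cmult: "mean (\<lambda>w. c * f w) = c * mean f"
 unfolding mean_def by simp

lemma mean_AE_cong:
 assumes "AE w in lebesgue. f w = g w" "f \<in> lmeas_fns" "g \<in> lmeas_fns"
 shows "mean f = mean g"
 unfolding mean_def set_lebesgue_integral_def
 by (rule integral_cong_AE) (use assms in \<open>auto elim!: eventually_mono intro!: indicator_scaleR_measurable\<close>)

lemma mean_cong: "(\<And>w. w \<in> cbox 0 1 \<Longrightarrow> f w = g w) \<Longrightarrow> mean f = mean g"
 unfolding mean_def by (intro set_lebesgue_integral_cong) auto

text \<open>The mean over the unit square of a periodic function is translation invariant: a slab that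
 leaves the square on one side re-enters on the other.\<close>

lemma mean_shift_axis:
 assumes f: "f \<in> lmeas_fns" and C: "\<And>w. norm (f w) \<le> C"
  and per: "AE w in lebesgue. f (w + axis j 1) = f w"
 shows "mean (\<lambda>w. f (w + s *\<^sub>R axis j 1)) = mean f"
proof -
 define S where "S a b = {w::real^2. (\<forall>i. i \<noteq> j \<longrightarrow> 0 \<le> w $ i \<and> w $ i \<le> 1) \<and> a \<le> w $ j \<and> w $ j < b}" for a b
 define J where "J a b = (LINT w:S a b|lebesgue. f w)" for a b
 have S_sub: "S a b \<subseteq> cbox (\<chi> i. if i = j then a else 0) (\<chi> i. if i = j then b else 1)" for a b
  by (auto simp: S_def mem_box_cart)
 have [measurable]: "S a b \<in> sets borel" for a b
 proof -
  have "S a b = (\<Inter>i\<in>-{j}. {w. 0 \<le> w $ i} \<inter> {w. w $ i \<le> 1}) \<inter> {w. a \<le> w $ j} \<inter> {w. w $ j < b}"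
   by (auto simp: S_def)
  also have "\<dots> \<in> sets borel"
   by (intro sets.Int borel_closed[OF closed_INT] borel_closed[OF closed_Collect_le] borel_open[OF open_Collect_less]
    ballI closed_Int closed_Collect_le continuous_intros)
  finally show ?thesis .
 qed
 then have Sm: "S a b \<in> sets lebesgue" for a b by simp
 have ig: "set_integrable lebesgue (S a b) f" for a b
 proof -
  have "integrable lebesgue (indicator (S a b) :: _ \<Rightarrow> real)"
  proof (rule integrable_real_indicator[OF Sm])
   have "emeasure lebesgue (S a b) \<le> emeasure lebesgue (cbox (\<chi> i. if i = j then a else 0) (\<chi> i. if i = j then b else 1) :: (real^2) set)"
    by (rule emeasure_mono[OF S_sub]) simp
   also have "\<dots> = emeasure lborel (cbox (\<chi> i. if i = j then a else 0) (\<chi> i. if i = j then b else 1) :: (real^2) set)"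
    by simp
   also have "\<dots> < \<infinity>" by (rule emeasure_lborel_cbox_finite)
   finally show "emeasure lebesgue (S a b) < \<infinity>" .
  qed
  then have "integrable lebesgue (\<lambda>w. C * indicator (S a b) w :: real)" by (rule integrable_mult_right)
  then show ?thesis unfolding set_integrable_def
   by (rule Bochner_Integration.integrable_bound)
    (use C f Sm order_trans[OF norm_ge_zero C] in \<open>auto intro!: indicator_scaleR_measurable split: split_indicator\<close>)
 qed
 have split: "J a c = J a b + J b c" if "a \<le> b" "b \<le> c" for a b c
 proof -
  have "S a c = S a b \<union> S b c" "S a b \<inter> S b c = {}" using that by (auto simp: S_def)
  then show ?thesis unfolding J_def by (simp add: set_integral_Un ig)
 qed
 have trans: "(LINT w:S a b|lebesgue. f (w + s *\<^sub>R axis j 1)) = J (a + s) (b + s)" for a b s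
 proof -
  have "w + s *\<^sub>R axis j 1 \<in> S (a + s) (b + s) \<longleftrightarrow> w \<in> S a b" for w by (auto simp: S_def axis_def)
  then have "(\<lambda>w. indicat_real (S a b) w *\<^sub>R f (w + s *\<^sub>R axis j 1)) =
   (\<lambda>w. indicat_real (S (a + s) (b + s)) (w + s *\<^sub>R axis j 1) *\<^sub>R f (w + s *\<^sub>R axis j 1))"
   by (auto simp: indicator_def)
  then show ?thesis unfolding J_def set_lebesgue_integral_def
   using integral_translate[of "\<lambda>w. indicat_real (S (a + s) (b + s)) w *\<^sub>R f w" "s *\<^sub>R axis j 1"] f Sm by simp
 qed
 have shift: "J (a + of_int n) (b + of_int n) = J a b" for a b n
 proof -
  have "AE w in lebesgue. f (w + of_int n *\<^sub>R axis j 1) = f w" by (rule AE_int_shift[OF per])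
  then have "(LINT w:S a b|lebesgue. f (w + of_int n *\<^sub>R axis j 1)) = J a b"
   unfolding J_def set_lebesgue_integral_def
   by (intro integral_cong_AE) (use f Sm measurable_translate[OF f] in \<open>auto elim!: eventually_mono intro!: indicator_scaleR_measurable\<close>)
  then show ?thesis using trans[of a b "of_int n"] by simp
 qed
 have sq: "(LINT w:S 0 1|lebesgue. g w) = mean g" if g: "g \<in> lmeas_fns" for g
 proof -
  have all_split: "(\<forall>i. P i) \<longleftrightarrow> (\<forall>i. i \<noteq> j \<longrightarrow> P i) \<and> P j" for P :: "2 \<Rightarrow> bool"
   by metis
  have "w \<in> S 0 1 \<longleftrightarrow> w \<in> cbox 0 1 \<inter> {w. w $ j < 1}" for w
  proof -
   have "(\<forall>i. 0 \<le> w $ i \<and> w $ i \<le> 1) \<longleftrightarrow> (\<forall>i. i \<noteq> j \<longrightarrow> 0 \<le> w $ i \<and> w $ i \<le> 1) \<and> 0 \<le> w $ j \<and> w $ j \<le> 1"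
    using all_split[of "\<lambda>i. 0 \<le> w $ i \<and> w $ i \<le> 1"] by simp
   then have "w \<in> cbox 0 1 \<longleftrightarrow> (\<forall>i. i \<noteq> j \<longrightarrow> 0 \<le> w $ i \<and> w $ i \<le> 1) \<and> 0 \<le> w $ j \<and> w $ j \<le> 1"
    by (simp add: mem_box_cart)
   then show ?thesis unfolding S_def mem_Collect_eq Int_iff by auto
  qed
  then have "S 0 1 = cbox 0 1 \<inter> {w. w $ j < 1}" by (rule set_eqI)
  then have Sq: "S 0 1 = cbox 0 1 \<inter> {w. w $ j < 1}" .
  have "w $ j = 1" if "w \<in> cbox 0 1 - S 0 1" for w
  proof -
   have "w $ j \<le> 1" using that by (simp add: mem_box_cart)
   moreover have "\<not> w $ j < 1" using that unfolding Sq by blast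
   ultimately show ?thesis by linarith
  qed
  then have "cbox 0 1 - S 0 1 \<subseteq> {w::real^2. w $ j = 1}" by blast
  moreover have "S 0 1 \<subseteq> cbox 0 1" unfolding Sq by blast
  moreover have "negligible {w::real^2. w $ j = 1}"
   using negligible_standard_hyperplane[of "axis j (1::real) :: real^2" 1] by (simp add: axis_in_Basis_iff cart_eq_inner_axis)
  moreover have "AE w in lebesgue. w \<notin> {w::real^2. w $ j = 1}"
   using calculation(3) unfolding negligible_iff_null_sets by (rule AE_not_in)
  ultimately have "AE w in lebesgue. w \<in> S 0 1 \<longleftrightarrow> w \<in> cbox 0 1"
   by (auto elim!: eventually_mono)
  then show ?thesis unfolding mean_def set_lebesgue_integral_def
   by (intro integral_cong_AE) (use g Sm in \<open>auto elim!: eventually_mono intro!: indicator_scaleR_measurable split: split_indicator\<close>)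
 qed
 define n where "n = \<lfloor>s\<rfloor>"
 define r where "r = s - of_int n"
 have r: "0 \<le> r" "r \<le> 1" unfolding r_def n_def by linarith+
 have "mean (\<lambda>w. f (w + s *\<^sub>R axis j 1)) = J (0 + s) (1 + s)"
  unfolding sq[OF measurable_translate[OF f], symmetric] by (rule trans)
 also have "\<dots> = J r (1 + r)"
 proof -
  have "0 + s = r + of_int n" "1 + s = (1 + r) + of_int n" by (simp_all add: r_def)
  then show ?thesis by (simp only: shift)
 qed
 also have "\<dots> = J r 1 + J 1 (1 + r)" by (rule split) (use r in auto)
 also have "J 1 (1 + r) = J 0 r" using shift[of 0 1 r] by (simp add: add.commute[of r 1])
 also have "J r 1 + J 0 r = J 0 1" by (subst split[of 0 r 1]) (use r in auto)
 also have "\<dots> = mean f" unfolding J_def using sq[OF f] .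
 finally show ?thesis .
qed

lemma real2_axis_expand: "(c :: real^2) = c $ 1 *\<^sub>R axis 1 1 + c $ 2 *\<^sub>R axis 2 1"
 by (simp add: vec_eq_iff forall_2 axis_def)

lemma mean_shift:
 assumes f: "f \<in> lmeas_fns" and C: "\<And>w. norm (f w) \<le> C"
  and per: "\<And>j. AE w in lebesgue. f (w + axis j 1) = f w"
 shows "mean (\<lambda>w. f (w + c)) = mean f"
proof -
 have "mean (\<lambda>w. f (w + c)) = mean (\<lambda>w. f ((w + c $ 1 *\<^sub>R axis 1 1) + c $ 2 *\<^sub>R axis 2 1))"
  using real2_axis_expand[of c] by (simp only: add.assoc)
 also have "\<dots> = mean (\<lambda>w. f (w + c $ 2 *\<^sub>R axis 2 1))"
 proof (rule mean_shift_axis[of "\<lambda>w. f (w + c $ 2 *\<^sub>R axis 2 1)" C 1 "c $ 1"])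
  show "AE w in lebesgue. f (w + axis 1 1 + c $ 2 *\<^sub>R axis 2 1) = f (w + c $ 2 *\<^sub>R axis 2 1)"
   using AE_translate[OF per[of 1], of "c $ 2 *\<^sub>R axis 2 1"] by (simp add: add_ac)
 qed (use f C measurable_translate in auto)
 also have "\<dots> = mean f" by (rule mean_shift_axis) (use assms in auto)
 finally show ?thesis .
qed

inductive trig_poly :: "(real^2 \<Rightarrow> complex) \<Rightarrow> bool" where
 monom: "trig_poly (\<lambda>w. c * torus_char n (cpt w))"
| add: "trig_poly f \<Longrightarrow> trig_poly g \<Longrightarrow> trig_poly (\<lambda>w. f w + g w)"

lemma trig_poly_mult_monom: "trig_poly g \<Longrightarrow> trig_poly (\<lambda>w. c * torus_char n (cpt w) * g w)"
proof (induction rule: trig_poly.induct)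
 case (monom d m)
 have "(\<lambda>w. c * torus_char n (cpt w) * (d * torus_char m (cpt w))) = (\<lambda>w. (c * d) * torus_char (n + m) (cpt w))"
  by (simp add: torus_char_add' mult_ac)
 then show ?case by (simp only: trig_poly.monom)
next
 case (add f g)
 then show ?case by (simp add: ring_distribs trig_poly.add)
qed

lemma trig_poly_mult: "trig_poly f \<Longrightarrow> trig_poly g \<Longrightarrow> trig_poly (\<lambda>w. f w * g w)"
proof (induction rule: trig_poly.induct)
 case (monom c n) then show ?case by (rule trig_poly_mult_monom)
next
 case (add f h) then show ?case by (simp add: ring_distribs trig_poly.add)
qed

lemma trig_poly_const: "trig_poly (\<lambda>w. c)"
 using trig_poly.monom[of c 0] by simp

lemma trig_poly_bounded: "trig_poly f \<Longrightarrow> f \<in> lmeas_fns \<and> (\<exists>C. \<forall>w. norm (f w) \<le> C)"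
proof (induction rule: trig_poly.induct)
 case (monom c n)
 have "(\<lambda>w. c * torus_char n (cpt w)) \<in> lmeas_fns" by measurable
 then show ?case by (auto simp: norm_mult)
next
 case (add f g)
 then obtain C D where "\<And>w. norm (f w) \<le> C" "\<And>w. norm (g w) \<le> D" by blast
 then have "norm (f w + g w) \<le> C + D" for w by (meson add_mono norm_triangle_mono)
 then show ?case using add by (auto intro: borel_measurable_add)
qed

text \<open>Identifies the torus with a compact subset of \<open>\<complex>\<^sup>2\<close> on which polynomials are trigonometric polynomials.\<close>

definition torus_embed :: "real^2 \<Rightarrow> C2" where
 "torus_embed w = (torus_char (1, 0) (cpt w), torus_char (0, 1) (cpt w))"

lemma continuous_torus_embed: "continuous_on S torus_embed"
 unfolding torus_embed_def[abs_def]
 by (intro continuous_on_Pair continuous_on_compose2[OF continuous_torus_char continuous_cpt]) auto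

lemma trig_poly_Re_Im:
 "trig_poly (\<lambda>w. of_real (Re (torus_char n (cpt w))))" "trig_poly (\<lambda>w. of_real (Im (torus_char n (cpt w))))"
proof -
 have inv: "torus_char (- n) (cpt w) = cnj (torus_char n (cpt w))" for w
 proof -
  have "cnj (torus_char n (cpt w)) * torus_char n (cpt w) = 1"
   by (metis complex_norm_square mult.commute norm_torus_char_cpt of_real_1 one_power2)
  then show ?thesis unfolding torus_char_uminus by (simp add: field_simps)
 qed
 have "of_real (Re (torus_char n (cpt w))) = 1/2 * torus_char n (cpt w) + 1/2 * torus_char (- n) (cpt w)" for w
  unfolding inv by (simp add: complex_eq_iff)
 then show "trig_poly (\<lambda>w. of_real (Re (torus_char n (cpt w))))"
  by (simp only: trig_poly.intros)
 have "of_real (Im (torus_char n (cpt w))) = (- \<i>/2) * torus_char n (cpt w) + (\<i>/2) * torus_char (- n) (cpt w)" for w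
  unfolding inv by (simp add: complex_eq_iff)
 then show "trig_poly (\<lambda>w. of_real (Im (torus_char n (cpt w))))"
  by (simp only: trig_poly.intros)
qed

lemma trig_poly_real_polynomial:
 "real_polynomial_function p \<Longrightarrow> trig_poly (\<lambda>w. of_real (p (torus_embed w)))"
proof (induction rule: real_polynomial_function.induct)
 case (linear f)
 note lin = bounded_linear.linear[OF linear]
 define c1 c2 c3 c4 where "c1 = f (1, 0)" and "c2 = f (\<i>, 0)" and "c3 = f (0, 1)" and "c4 = f (0, \<i>)"
 have f: "f (a, b) = Re a * c1 + Im a * c2 + Re b * c3 + Im b * c4" for a b
 proof -
  have eq: "(a, b) = Re a *\<^sub>R (1, 0) + Im a *\<^sub>R (\<i>, 0) + Re b *\<^sub>R (0, 1) + Im b *\<^sub>R (0, \<i>)"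
   by (simp add: complex_eq_iff)
  show ?thesis by (subst eq) (simp only: linear_add[OF lin] linear_scale[OF lin] real_scaleR_def c1_def c2_def c3_def c4_def)
 qed
 have *: "trig_poly (\<lambda>w. of_real (Re (torus_char n (cpt w))) * of_real c)"
   "trig_poly (\<lambda>w. of_real (Im (torus_char n (cpt w))) * of_real c)" for n c
  by (rule trig_poly_mult[OF trig_poly_Re_Im(1) trig_poly_const], rule trig_poly_mult[OF trig_poly_Re_Im(2) trig_poly_const])
 show ?case unfolding torus_embed_def f of_real_add of_real_mult
  by (rule trig_poly.add[OF trig_poly.add[OF trig_poly.add[OF *(1) *(2)] *(1)] *(2)])
next
 case (const c) then show ?case by (rule trig_poly_const)
next
 case (add f g) show ?case unfolding of_real_add by (rule trig_poly.add[OF add.IH])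
next
 case (mult f g) show ?case unfolding of_real_mult by (rule trig_poly_mult[OF mult.IH])
qed

lemma sigma_finite_lebesgue: "sigma_finite_measure (lebesgue :: 'a::euclidean_space measure)"
proof
 obtain A :: "nat \<Rightarrow> 'a set" where "range A \<subseteq> sets lborel" "(\<Union>i. A i) = space lborel" "\<And>i. emeasure lborel (A i) \<noteq> \<infinity>"
  using lborel.sigma_finite by metis
 then show "\<exists>A. countable A \<and> A \<subseteq> sets lebesgue \<and> \<Union>A = space (lebesgue :: 'a measure) \<and> (\<forall>a\<in>A. emeasure lebesgue a \<noteq> \<infinity>)"
  by (intro exI[of _ "range A"]) (auto simp: subset_iff)
qed

lemma torus_embed_inj:
 assumes "torus_embed w = torus_embed v" "w \<in> box 0 1" "v \<in> cbox 0 1"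
 shows "w = v"
proof -
 have *: "x = y" if eq: "exp (2 * pi * \<i> * complex_of_real x) = exp (2 * pi * \<i> * complex_of_real y)" "0 < x" "x < 1" "0 \<le> y" "y \<le> 1" for x y :: real
 proof -
  obtain n :: int where "2 * pi * \<i> * complex_of_real x = 2 * pi * \<i> * complex_of_real y + (of_int (2 * n) * pi) * \<i>"
   using eq unfolding exp_eq by blast
  then have "2 * pi * \<i> * (complex_of_real x - complex_of_real y - of_int n) = 0"
   by (simp add: algebra_simps)
  then have "complex_of_real (x - y - of_int n) = 0" by simp
  then have "x - y = of_int n" by (metis diff_eq_diff_eq diff_zero eq_iff_diff_eq_0 of_real_eq_0_iff)
  then have "\<bar>real_of_int n\<bar> < 1" using that by linarith
  then have "n = 0" by linarith
  then show ?thesis using \<open>x - y = of_int n\<close> by simp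
 qed
 have "w $ 1 = v $ 1" "w $ 2 = v $ 2"
  using assms by (auto intro!: * simp: torus_embed_def torus_char_def cpt_def mem_box_cart)
 then show ?thesis by (rule real2_eqI)
qed

text \<open>Trigonometric polynomials approximate, by the theorem of Weierstrass on the product of two circles, indicators of open
 subsets of the square, and measurable sets are approximated from outside by open sets.\<close>

lemma fourier_uniqueness:
 assumes u[measurable]: "u \<in> lmeas_fns" and C: "\<And>w. norm (u w) \<le> C"
  and zero: "\<And>n. mean (\<lambda>w. u w * torus_char n (cpt w)) = 0"
 shows "AE w in lebesgue. w \<in> cbox 0 1 \<longrightarrow> u w = 0"
proof -
 have C0: "C \<ge> 0" using C norm_ge_zero order_trans by blast
 have tp: "mean (\<lambda>w. u w * f w) = 0" if "trig_poly f" for f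
  using that
 proof (induction rule: trig_poly.induct)
  case (monom c n)
  have "mean (\<lambda>w. u w * (c * torus_char n (cpt w))) = c * mean (\<lambda>w. u w * torus_char n (cpt w))"
   unfolding mean_cmult[symmetric] by (simp add: mult_ac)
  then show ?case using zero by simp
 next
  case (add f g)
  from trig_poly_bounded[OF add.hyps(1)] obtain D where D: "f \<in> lmeas_fns" "\<And>w. norm (f w) \<le> D" by blast
  from trig_poly_bounded[OF add.hyps(2)] obtain D' where D': "g \<in> lmeas_fns" "\<And>w. norm (g w) \<le> D'" by blast
  have "mean (\<lambda>w. u w * f w + u w * g w) = mean (\<lambda>w. u w * f w) + mean (\<lambda>w. u w * g w)"
   by (rule mean_add[where C = "C * D" and C' = "C * D'"])
    (use u D D' C C0 in \<open>auto simp: norm_mult intro!: mult_mono borel_measurable_times\<close>)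
  then show ?case using add.IH by (simp add: ring_distribs)
 qed
 have cont0: "mean (\<lambda>w. u w * of_real (\<Phi> (torus_embed w))) = 0" if \<Phi>: "continuous_on UNIV \<Phi>" for \<Phi> :: "C2 \<Rightarrow> real"
 proof -
  have mP: "(\<lambda>w. complex_of_real (\<Phi> (torus_embed w))) \<in> lmeas_fns"
   by (intro measurable_lebesgue_cont continuous_on_of_real continuous_on_compose2[OF \<Phi> continuous_torus_embed]) auto
  have "norm (mean (\<lambda>w. u w * of_real (\<Phi> (torus_embed w)))) \<le> C * e" if e: "e > 0" for e
  proof -
   have K: "compact (torus_embed ` cbox 0 1)"
    by (intro compact_continuous_image continuous_torus_embed compact_cbox)
   obtain p where p: "real_polynomial_function p" "\<And>x. x \<in> torus_embed ` cbox 0 1 \<Longrightarrow> \<bar>\<Phi> x - p x\<bar> < e"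
    using Stone_Weierstrass_real_polynomial_function[OF K _ e, of \<Phi>] \<Phi> continuous_on_subset by blast
   have tpp: "trig_poly (\<lambda>w. of_real (p (torus_embed w)))" by (rule trig_poly_real_polynomial[OF p(1)])
   then have mp: "(\<lambda>w. complex_of_real (p (torus_embed w))) \<in> lmeas_fns" using trig_poly_bounded by blast
   define d where "d w = (if w \<in> cbox 0 1 then complex_of_real (\<Phi> (torus_embed w)) - of_real (p (torus_embed w)) else 0)" for w
   have md: "d \<in> lmeas_fns"
    unfolding d_def[abs_def] by (rule measurable_If_set) (use mP mp in auto)
   have db: "norm (d w) \<le> e" for w
    using p(2)[of "torus_embed w"] e by (auto simp: d_def simp flip: of_real_diff)
   from trig_poly_bounded[OF tpp] obtain D where D: "\<And>w. norm (complex_of_real (p (torus_embed w))) \<le> D" by blast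
   have "mean (\<lambda>w. u w * of_real (\<Phi> (torus_embed w))) =
     mean (\<lambda>w. u w * d w + u w * of_real (p (torus_embed w)))"
    by (rule mean_cong) (simp add: d_def algebra_simps)
   also have "\<dots> = mean (\<lambda>w. u w * d w) + mean (\<lambda>w. u w * of_real (p (torus_embed w)))"
    by (rule mean_add[where C = "C * e" and C' = "C * D"])
     (use u md db mp D C C0 in \<open>auto simp: norm_mult simp del: norm_of_real intro!: mult_mono borel_measurable_times\<close>)
   also have "\<dots> = mean (\<lambda>w. u w * d w)" using tp[OF tpp] by simp
   also have "norm \<dots> \<le> C * e"
    by (rule norm_mean_le) (use u md db C C0 in \<open>auto simp: norm_mult intro!: mult_mono borel_measurable_times\<close>)
   finally show ?thesis .
  qed
  then have bd: "norm (mean (\<lambda>w. u w * of_real (\<Phi> (torus_embed w)))) \<le> C * e" if "e > 0" for e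
   using that by blast
  have "norm (mean (\<lambda>w. u w * of_real (\<Phi> (torus_embed w)))) \<le> 0 + e" if e: "e > 0" for e
  proof -
   have "norm (mean (\<lambda>w. u w * of_real (\<Phi> (torus_embed w)))) \<le> C * (e / (C + 1))"
    using C0 e by (intro bd) auto
   also have "C * (e / (C + 1)) \<le> e" using C0 e by (simp add: divide_le_eq)
   finally show ?thesis by simp
  qed
  then have "norm (mean (\<lambda>w. u w * of_real (\<Phi> (torus_embed w)))) \<le> 0" by (rule field_le_epsilon)
  then show ?thesis by simp
 qed
 have ii: "integrable lebesgue (indicator (cbox 0 1 :: (real^2) set) :: _ \<Rightarrow> real)"
  by (rule integrable_real_indicator) (auto simp: emeasure_lborel_cbox_eq)
 \<comment> \<open>The truncated distance functions \<open>\<Phi> k\<close> tend to the indicator of \<open>V\<close>: being open in the square without its boundary, \<open>V\<close> is saturated for the identification of opposite sides.\<close>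
 have open0: "(LINT w:V|lebesgue. u w) = 0" if V: "open V" "V \<subseteq> box 0 1" for V
 proof -
  define K where "K = torus_embed ` (cbox 0 1 - V)"
  have "compact K" unfolding K_def
   by (intro compact_continuous_image continuous_torus_embed) (use V in \<open>auto intro: compact_diff\<close>)
  then have Kc: "closed K" by (rule compact_imp_closed)
  have "0 \<in> cbox 0 1 - V" using V(2) by (auto simp: mem_box_cart forall_2)
  then have Kne: "K \<noteq> {}" by (auto simp: K_def)
  define \<Phi> where "\<Phi> k z = min 1 (real k * infdist z K)" for k z
  have \<Phi>c: "continuous_on UNIV (\<Phi> k)" for k
   unfolding \<Phi>_def by (intro continuous_intros)
  have lim: "(\<lambda>k. \<Phi> k (torus_embed w)) \<longlonglongrightarrow> indicator V w" if w: "w \<in> cbox 0 1" for w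
  proof (cases "w \<in> V")
   case False
   then have "infdist (torus_embed w) K = 0" using w by (auto simp: K_def)
   then show ?thesis using False by (simp add: \<Phi>_def)
  next
   case True
   have "torus_embed w \<notin> K"
   proof
    assume "torus_embed w \<in> K"
    then obtain v where v: "v \<in> cbox 0 1 - V" "torus_embed w = torus_embed v" by (auto simp: K_def)
    then have "w = v" using torus_embed_inj True V(2) by blast
    then show False using True v by blast
   qed
   then have pos: "infdist (torus_embed w) K > 0"
    using Kc Kne infdist_nonneg[of "torus_embed w" K] in_closed_iff_infdist_zero[OF Kc Kne]
    by (metis antisym_conv2)
   obtain N where N: "real N > 1 / infdist (torus_embed w) K" using reals_Archimedean2 by blast
   have "\<Phi> k (torus_embed w) = 1" if "k \<ge> N" for k
   proof -
    have "real k > 1 / infdist (torus_embed w) K" using N that by (meson less_le_trans of_nat_le_iff)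
    then have "real k * infdist (torus_embed w) K > 1" using pos by (simp add: divide_less_eq)
    then show ?thesis by (simp add: \<Phi>_def)
   qed
   then show ?thesis using True by (intro tendsto_eventually) (auto simp: eventually_sequentially)
  qed
  have "(\<lambda>k. \<integral>w. indicat_real (cbox 0 1) w *\<^sub>R (u w * of_real (\<Phi> k (torus_embed w))) \<partial>lebesgue) \<longlonglongrightarrow>
    (\<integral>w. indicat_real V w *\<^sub>R u w \<partial>lebesgue)"
  proof (rule integral_dominated_convergence[where w = "\<lambda>w. C * indicator (cbox 0 1) w"])
   show "integrable lebesgue (\<lambda>w::real^2. C * indicator (cbox 0 1) w :: real)"
    using ii by (rule integrable_mult_right)
   show "(\<lambda>w. indicat_real V w *\<^sub>R u w) \<in> lmeas_fns"
    by (intro indicator_scaleR_measurable u) (use V in auto)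
   show "(\<lambda>w. indicat_real (cbox 0 1) w *\<^sub>R (u w * of_real (\<Phi> k (torus_embed w)))) \<in> lmeas_fns" for k
    by (intro indicator_scaleR_measurable borel_measurable_times u measurable_lebesgue_cont continuous_on_of_real
      continuous_on_compose2[OF \<Phi>c continuous_torus_embed]) auto
   show "AE w in lebesgue. norm (indicat_real (cbox 0 1) w *\<^sub>R (u w * of_real (\<Phi> k (torus_embed w)))) \<le> C * indicat_real (cbox 0 1) w" for k
   proof (rule AE_I2)
    fix w :: "real^2"
    have "\<bar>\<Phi> k (torus_embed w)\<bar> \<le> 1" by (auto simp: \<Phi>_def infdist_nonneg)
    then have "norm (u w) * \<bar>\<Phi> k (torus_embed w)\<bar> \<le> C * 1" by (intro mult_mono C C0) auto
    then show "norm (indicat_real (cbox 0 1) w *\<^sub>R (u w * of_real (\<Phi> k (torus_embed w)))) \<le> C * indicat_real (cbox 0 1) w"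
     by (auto simp: indicator_def norm_mult)
   qed
   show "AE w in lebesgue. (\<lambda>k. indicat_real (cbox 0 1) w *\<^sub>R (u w * of_real (\<Phi> k (torus_embed w)))) \<longlonglongrightarrow> indicat_real V w *\<^sub>R u w"
   proof (rule AE_I2)
    fix w :: "real^2"
    show "(\<lambda>k. indicat_real (cbox 0 1) w *\<^sub>R (u w * of_real (\<Phi> k (torus_embed w)))) \<longlonglongrightarrow> indicat_real V w *\<^sub>R u w"
    proof (cases "w \<in> cbox 0 1")
     case True
     have "(\<lambda>k. u w * of_real (\<Phi> k (torus_embed w))) \<longlonglongrightarrow> u w * of_real (indicator V w)"
      by (intro tendsto_intros lim True)
     then show ?thesis using True by (simp add: scaleR_conv_of_real mult.commute)
    next
     case False
     then have "w \<notin> V" using V(2) box_subset_cbox by blast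
     then show ?thesis using False by simp
    qed
   qed
  qed
  moreover have "(\<integral>w. indicat_real (cbox 0 1) w *\<^sub>R (u w * of_real (\<Phi> k (torus_embed w))) \<partial>lebesgue) = 0" for k
   using cont0[OF \<Phi>c[of k]] by (simp add: mean_def set_lebesgue_integral_def)
  ultimately show ?thesis by (simp add: set_lebesgue_integral_def LIMSEQ_const_iff)
 qed
 have sint: "set_integrable lebesgue (A \<inter> box 0 1) u" if "A \<in> sets lebesgue" for A
  by (rule lebesgue_integrable_bounded[OF u C]) (use that box_subset_cbox in auto)
 have all0: "(LINT w:A \<inter> box 0 1|lebesgue. u w) = 0" if A: "A \<in> sets lebesgue" for A
 proof -
  have "norm (LINT w:A \<inter> box 0 1|lebesgue. u w) \<le> 0 + e" if e: "e > 0" for e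
  proof -
   have e': "e / (C + 1) > 0" using C0 e by simp
   obtain T where T: "open T" "A \<subseteq> T" "T - A \<in> lmeasurable" "emeasure lebesgue (T - A) < ennreal (e / (C + 1))"
    using sets_lebesgue_outer_open[OF A e'] by blast
   have TA: "T - A \<in> sets lebesgue" using T(3) by (rule fmeasurableD)
   have "T \<inter> box 0 1 = (A \<inter> box 0 1) \<union> ((T - A) \<inter> box 0 1)" "(A \<inter> box 0 1) \<inter> ((T - A) \<inter> box 0 1) = {}" using T(2) by auto
   then have "(LINT w:T \<inter> box 0 1|lebesgue. u w) = (LINT w:A \<inter> box 0 1|lebesgue. u w) + (LINT w:(T - A) \<inter> box 0 1|lebesgue. u w)"
    using set_integral_Un[OF _ sint[OF A] sint[OF TA]] by simp
   moreover have "(LINT w:T \<inter> box 0 1|lebesgue. u w) = 0" using T(1) by (intro open0) auto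
   ultimately have "norm (LINT w:A \<inter> box 0 1|lebesgue. u w) = norm (LINT w:(T - A) \<inter> box 0 1|lebesgue. u w)"
    by (metis add_eq_0_iff norm_minus_cancel)
   also have "\<dots> \<le> (LINT w|lebesgue. C * indicator (T - A) w)"
    unfolding set_lebesgue_integral_def
   proof (rule Bochner_Integration.integral_norm_bound_integral)
    show "integrable lebesgue (\<lambda>w. indicat_real ((T - A) \<inter> box 0 1) w *\<^sub>R u w)" using sint[OF TA] by (simp add: set_integrable_def)
    show "integrable lebesgue (\<lambda>w. C * indicat_real (T - A) w)" using T(3) by (intro integrable_mult_right) (auto simp: integrable_indicator_iff fmeasurable_def)
   qed (use C C0 in \<open>auto simp: indicator_def\<close>)
   also have "\<dots> = C * measure lebesgue (T - A)" using TA by simp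
   also have "\<dots> \<le> C * (e / (C + 1))"
   proof (rule mult_left_mono[OF _ C0])
    have "ennreal (measure lebesgue (T - A)) < ennreal (e / (C + 1))" using T(4) emeasure_eq_measure2[OF T(3)] by simp
    then show "measure lebesgue (T - A) \<le> e / (C + 1)" using e' by (simp add: ennreal_less_iff)
   qed
   also have "\<dots> \<le> e" using C0 e by (simp add: divide_le_eq)
   finally show ?thesis by simp
  qed
  then have "norm (LINT w:A \<inter> box 0 1|lebesgue. u w) \<le> 0" by (rule field_le_epsilon)
  then show ?thesis by simp
 qed
 define v where "v w = indicat_real (box 0 1) w *\<^sub>R u w" for w
 have "integrable lebesgue v"
  using sint[of UNIV] unfolding v_def[abs_def] set_integrable_def by simp
 moreover have "(LINT w:A|lebesgue. v w) = 0" if A: "A \<in> sets lebesgue" for A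
  using all0[OF A] by (simp add: set_lebesgue_integral_def v_def indicator_inter_arith)
 ultimately have "AE w in lebesgue. v w = 0"
  by (rule sigma_finite_measure.density_zero[OF sigma_finite_lebesgue])
 moreover have "AE w in lebesgue. w \<notin> cbox (0::real^2) 1 - box 0 1"
  using negligible_frontier_interval[of "0::real^2" 1] unfolding negligible_iff_null_sets by (rule AE_not_in)
 ultimately show ?thesis by eventually_elim (auto simp: v_def)
qed

lemma cpt_0 [simp]: "cpt 0 = 0"
 by (simp add: cpt_def zero_prod_def)

lemma lattice_reduce:
 assumes per: "\<And>j (w::real^2). f (w + axis j 1) = f w"
 shows "\<exists>v\<in>cbox 0 1. f w = f v"
proof -
 define v where "v = w + of_int (- \<lfloor>w $ 1\<rfloor>) *\<^sub>R axis 1 1 + of_int (- \<lfloor>w $ 2\<rfloor>) *\<^sub>R axis 2 1"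
 have "f v = f (w + of_int (- \<lfloor>w $ 1\<rfloor>) *\<^sub>R axis 1 1)" unfolding v_def
  by (rule periodic_int_shift[where D = UNIV]) (auto simp: per)
 also have "\<dots> = f w" by (rule periodic_int_shift[where D = UNIV]) (auto simp: per)
 finally have "f w = f v" by simp
 moreover have "v \<in> cbox 0 1"
  unfolding v_def mem_box_cart by (auto simp: forall_2 axis_def) linarith+
 ultimately show ?thesis by blast
qed

lemma periodic_continuous_bounded:
 fixes f :: "real^2 \<Rightarrow> 'b::real_normed_vector"
 assumes "continuous_on UNIV f" "\<And>j w. f (w + axis j 1) = f w"
 shows "\<exists>C>0. \<forall>w. norm (f w) \<le> C"
proof -
 have "compact (f ` cbox 0 1)"
  by (intro compact_continuous_image compact_cbox continuous_on_subset[OF assms(1)]) auto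
 then obtain C where "C > 0" "\<forall>x\<in>f ` cbox 0 1. norm x \<le> C"
  using compact_imp_bounded bounded_pos by metis
 then show ?thesis using lattice_reduce[of f, OF assms(2)] by (metis image_eqI)
qed

lemma sh_periodic_strip:
 assumes f: "strip_hol \<delta> f" "\<delta> > 0" and per: "\<And>j w. f (cpt (w + axis j 1)) = f (cpt w)"
  and z: "z \<in> strip \<delta>"
 shows "f (z + cpt (axis j 1)) = f z"
 by (rule sh_eqI[OF sh_translate[OF f(1)] f(1,2)]) (use per z in \<open>auto simp: cpt_add\<close>)

lemma sh_periodic_bounded:
 assumes f: "strip_hol \<delta> f" and d: "0 < \<delta>'" "\<delta>' < \<delta>" and per: "\<And>j w. f (cpt (w + axis j 1)) = f (cpt w)"
 obtains M where "M > 0" "\<And>z. z \<in> strip \<delta>' \<Longrightarrow> norm (f z) \<le> M"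
proof -
 define K where "K = cbox (Complex 0 (- \<delta>')) (Complex 1 \<delta>') \<times> cbox (Complex 0 (- \<delta>')) (Complex 1 \<delta>')"
 have K: "z \<in> K \<longleftrightarrow> 0 \<le> Re (fst z) \<and> Re (fst z) \<le> 1 \<and> \<bar>Im (fst z)\<bar> \<le> \<delta>' \<and> 0 \<le> Re (snd z) \<and> Re (snd z) \<le> 1 \<and> \<bar>Im (snd z)\<bar> \<le> \<delta>'" for z
  by (cases z) (auto simp: K_def in_cbox_complex_iff)
 have "K \<subseteq> strip \<delta>" using d by (auto simp: K strip_iff)
 moreover have "compact K" unfolding K_def by (intro compact_Times compact_cbox)
 ultimately have "compact (f ` K)"
  using sh_cont[OF f] by (intro compact_continuous_image) (auto intro: continuous_on_subset)
 then obtain M where M: "M > 0" "\<forall>x\<in>f ` K. norm x \<le> M"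
  using compact_imp_bounded bounded_pos by metis
 have "norm (f z) \<le> M" if z: "z \<in> strip \<delta>'" for z
 proof -
  have zd: "z \<in> strip \<delta>" using z strip_mono[of \<delta>' \<delta>] d by auto
  define g where "g w = f (z + cpt w)" for w
  have "f (z + cpt w + cpt (axis j 1)) = f (z + cpt w)" for w j
   by (rule sh_periodic_strip[OF f _ per]) (use d zd in auto)
  then have gper: "g (w + axis j 1) = g w" for w j
   by (simp add: g_def cpt_add add.assoc)
  define a where "a = - (of_int \<lfloor>Re (fst z)\<rfloor> :: real)"
  define b where "b = - (of_int \<lfloor>Re (snd z)\<rfloor> :: real)"
  define v :: "real^2" where "v = of_int (- \<lfloor>Re (fst z)\<rfloor>) *\<^sub>R axis 1 1 + of_int (- \<lfloor>Re (snd z)\<rfloor>) *\<^sub>R axis 2 1"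
  have "g v = g (0 + of_int (- \<lfloor>Re (fst z)\<rfloor>) *\<^sub>R axis 1 1)" unfolding v_def
   by (simp only: add_0) (rule periodic_int_shift[where D = UNIV]; auto simp: gper)
  also have "\<dots> = g 0" by (rule periodic_int_shift[where D = UNIV]) (auto simp: gper)
  finally have "f z = f (z + cpt v)" by (simp add: g_def)
  moreover have "z + cpt v \<in> K"
  proof -
   have c: "cpt v = (of_real a, of_real b)"
    by (simp add: v_def cpt_def a_def b_def axis_def)
   have "0 \<le> Re (fst z) + a" "Re (fst z) + a \<le> 1" "0 \<le> Re (snd z) + b" "Re (snd z) + b \<le> 1"
    unfolding a_def b_def by linarith+
   then show ?thesis using z unfolding K c by (simp add: strip_iff)
  qed
  ultimately show ?thesis using M(2) by auto
 qed
 then show ?thesis using that M(1) by blast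
qed

lemma mean_eq_integral:
 assumes "continuous_on (cbox 0 1) f"
 shows "mean f = integral (cbox 0 1) f"
 unfolding mean_def
 by (rule set_lebesgue_integral_eq_integral(2)) (use absolutely_integrable_continuous[OF assms] in simp)

lemma mean_const [simp]: "mean (\<lambda>w. c) = c"
proof -
 have "(cbox 0 1 :: (real^2) set) \<noteq> {}" by (simp add: interval_ne_empty_cart)
 then have "Henstock_Kurzweil_Integration.content (cbox 0 1 :: (real^2) set) = 1" using content_cbox_cart[of "0::real^2" 1] by simp
 then show ?thesis by (subst mean_eq_integral) auto
qed

lemma mean_torus_char: "n \<noteq> 0 \<Longrightarrow> mean (\<lambda>w. torus_char n (cpt w)) = 0"
proof -
 assume n: "n \<noteq> 0"
 obtain s where s: "torus_char n (cpt s) \<noteq> 1"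
 proof (cases "fst n = 0")
  case False
  then have "torus_char n (cpt (axis 1 (1 / (2 * of_int (fst n))))) = exp (\<i> * of_real pi)"
   by (simp add: torus_char_def cpt_def axis_def mult.commute)
  then show ?thesis using that by (metis exp_pi_i' one_neq_neg_one)
 next
  case True
  then have "snd n \<noteq> 0" using n by (auto simp: prod_eq_iff)
  then have "torus_char n (cpt (axis 2 (1 / (2 * of_int (snd n))))) = exp (\<i> * of_real pi)"
   using True by (simp add: torus_char_def cpt_def axis_def mult.commute)
  then show ?thesis using that by (metis exp_pi_i' one_neq_neg_one)
 qed
 have "mean (\<lambda>w. torus_char n (cpt (w + s))) = mean (\<lambda>w. torus_char n (cpt w))"
  by (rule mean_shift[where C = 1 and f = "\<lambda>w. torus_char n (cpt w)"]) (auto simp: cpt_add)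
 moreover have "mean (\<lambda>w. torus_char n (cpt (w + s))) = torus_char n (cpt s) * mean (\<lambda>w. torus_char n (cpt w))"
  unfolding mean_cmult[symmetric] by (simp add: cpt_add torus_char_add mult.commute)
 ultimately show ?thesis using s by simp
qed

lemma bounded_times_char:
 assumes "u \<in> lmeas_fns" "\<And>w. norm (u w) \<le> C"
 shows "(\<lambda>w. u w * torus_char n (cpt w)) \<in> lmeas_fns" "norm (u w * torus_char n (cpt w)) \<le> C"
 using assms by (auto simp: norm_mult intro!: borel_measurable_times)

text \<open>A translation by a rationally independent vector is ergodic with only characters as eigenfunctions:
 comparing Fourier coefficients leaves at most one of them.\<close>

lemma translation_eigenfunction:
 assumes u: "u \<in> lmeas_fns" and C: "\<And>w. norm (u w) \<le> C"
  and per: "\<And>j. AE w in lebesgue. u (w + axis j 1) = u w"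
  and irr: "\<And>n. n \<noteq> 0 \<Longrightarrow> torus_char n (cpt \<tau>) \<noteq> 1"
  and eig: "AE w in lebesgue. u (w + \<tau>) = \<omega> * u w"
 shows "(AE w in lebesgue. u w = 0) \<or>
  (\<exists>n c. \<omega> = torus_char n (cpt \<tau>) \<and> (AE w in lebesgue. u w = c * torus_char n (cpt w)))"
proof -
 define a where "a n = mean (\<lambda>w. u w * torus_char n (cpt w))" for n
 have perh: "AE w in lebesgue. u (w + axis j 1) * torus_char n (cpt (w + axis j 1)) = u w * torus_char n (cpt w)" for n j
  using per[of j] by eventually_elim (simp add: cpt_add)
 have eq: "a n = \<omega> * torus_char n (cpt \<tau>) * a n" for n
 proof -
  have "a n = mean (\<lambda>w. u (w + \<tau>) * torus_char n (cpt (w + \<tau>)))"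
   unfolding a_def
   by (rule mean_shift[of "\<lambda>w. u w * torus_char n (cpt w)" C, symmetric])
    (use bounded_times_char[of u C, OF u C] perh in auto)
  also have "\<dots> = mean (\<lambda>w. (\<omega> * torus_char n (cpt \<tau>)) * (u w * torus_char n (cpt w)))"
  proof (rule mean_AE_cong)
   show "AE w in lebesgue. u (w + \<tau>) * torus_char n (cpt (w + \<tau>)) = (\<omega> * torus_char n (cpt \<tau>)) * (u w * torus_char n (cpt w))"
    using eig by eventually_elim (simp add: cpt_add torus_char_add)
   show "(\<lambda>w. u (w + \<tau>) * torus_char n (cpt (w + \<tau>))) \<in> lmeas_fns"
    using measurable_translate[OF bounded_times_char(1)[of u C, OF u C]] .
   show "(\<lambda>w. \<omega> * torus_char n (cpt \<tau>) * (u w * torus_char n (cpt w))) \<in> lmeas_fns"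
    using bounded_times_char(1)[of u C, OF u C] by measurable
  qed
  also have "\<dots> = \<omega> * torus_char n (cpt \<tau>) * a n" unfolding mean_cmult a_def ..
  finally show ?thesis .
 qed
 have all0: "AE w in lebesgue. v w = 0"
  if "v \<in> lmeas_fns" "\<And>w. norm (v w) \<le> D" "\<And>n. mean (\<lambda>w. v w * torus_char n (cpt w)) = 0"
   "\<And>j. AE w in lebesgue. v (w + axis j 1) = v w" for v D
 proof (rule AE_periodic_from_unit_square)
  show "AE w in lebesgue. (v (w + axis j 1) = 0) = (v w = 0)" for j
   using that(4)[of j] by eventually_elim simp
  show "AE w in lebesgue. w \<in> cbox 0 1 \<longrightarrow> v w = 0"
   by (rule fourier_uniqueness[OF that(1-3)])
 qed
 show ?thesis
 proof (cases "\<forall>n. a n = 0")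
  case True
  have z: "mean (\<lambda>w. u w * torus_char n (cpt w)) = 0" for n
   using True unfolding a_def by blast
  have "AE w in lebesgue. u w = 0" by (rule all0[OF u C z per])
  then show ?thesis ..
 next
  case False
  then obtain n where n: "a n \<noteq> 0" by blast
  have om: "\<omega> * torus_char n (cpt \<tau>) = 1" using eq[of n] n by simp
  have other: "a m = 0" if "m \<noteq> n" for m
  proof (rule ccontr)
   assume "a m \<noteq> 0"
   then have "\<omega> * torus_char m (cpt \<tau>) = 1" using eq[of m] by simp
   then have "torus_char m (cpt \<tau>) = torus_char n (cpt \<tau>)" using om by (metis mult_cancel_left mult_zero_left zero_neq_one)
   then have "torus_char (m - n) (cpt \<tau>) = 1"
    using torus_char_add'[of m "- n" "cpt \<tau>"] by (simp add: torus_char_uminus)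
   then show False using irr[of "m - n"] that by simp
  qed
  define v where "v w = u w - a n * torus_char (- n) (cpt w)" for w
  have vb: "norm (v w) \<le> C + norm (a n)" for w
  proof -
   have "norm (v w) \<le> norm (u w) + norm (a n * torus_char (- n) (cpt w))" unfolding v_def by (rule norm_triangle_ineq4)
   then show ?thesis using C[of w] by (simp add: norm_mult)
  qed
  have vm: "v \<in> lmeas_fns" unfolding v_def[abs_def] using u by measurable
  have "mean (\<lambda>w. v w * torus_char m (cpt w)) = 0" for m
  proof -
   have "mean (\<lambda>w. v w * torus_char m (cpt w)) =
    mean (\<lambda>w. u w * torus_char m (cpt w) + (- a n) * torus_char (m - n) (cpt w))"
    by (rule mean_cong) (use torus_char_add'[of m "- n"] in \<open>simp add: v_def algebra_simps\<close>)
   also have "\<dots> = a m + (- a n) * mean (\<lambda>w. torus_char (m - n) (cpt w))"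
    unfolding a_def mean_cmult[symmetric]
    by (rule mean_add[where C = C and C' = "norm (a n)"])
     (use bounded_times_char[of u C, OF u C] in \<open>auto simp: norm_mult a_def\<close>)
   also have "\<dots> = 0" using other[of m] mean_torus_char[of "m - n"] by (cases "m = n") auto
   finally show ?thesis .
  qed
  moreover have "AE w in lebesgue. v (w + axis j 1) = v w" for j
   using per[of j] by eventually_elim (simp add: v_def cpt_add)
  ultimately have "AE w in lebesgue. v w = 0" by (intro all0[OF vm vb]) auto
  then have "AE w in lebesgue. u w = a n * torus_char (- n) (cpt w)" by eventually_elim (simp add: v_def)
  moreover have "\<omega> = torus_char (- n) (cpt \<tau>)" using om by (simp add: torus_char_uminus field_simps)
  ultimately show ?thesis by blast
 qed
qed

lemma holomorphic_parameter_integral: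
 fixes F :: "real^2 \<Rightarrow> complex \<Rightarrow> complex"
 assumes S: "open S" and F: "continuous_on (cbox 0 1 \<times> S) (\<lambda>p. F (fst p) (snd p))"
  and hol: "\<And>x. x \<in> cbox 0 1 \<Longrightarrow> F x holomorphic_on S"
 shows "(\<lambda>b. integral (cbox 0 1) (\<lambda>x. F x b)) holomorphic_on S"
 unfolding holomorphic_on_open[OF S]
proof
 fix b assume b: "b \<in> S"
 obtain R where R: "R > 0" "ball b R \<subseteq> S" using b S open_contains_ball by blast
 have Fc: "continuous_on (cbox 0 1) (\<lambda>x. F x y)" if "y \<in> S" for y
 proof -
  have "continuous_on (cbox 0 1) (\<lambda>x::real^2. (x, y))" by (intro continuous_intros)
  from continuous_on_compose2[OF F this] that show ?thesis by auto
 qed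
 have inS: "b + h \<in> S" if "norm h < R" for h using R(2) that by (auto simp: dist_norm)
 define Q where "Q h x = (if norm h < R then (F x (b + h) - F x b) / h else 0)" for h x
 define I where "I y = integral (cbox 0 1) (\<lambda>x. F x y)" for y
 have near: "\<forall>\<^sub>F h in at (0::complex). norm h < R"
  using R by (auto simp: eventually_at dist_norm intro!: exI[of _ R])
 have "uniform_limit (cbox 0 1) Q (\<lambda>x. deriv (F x) b) (at 0)"
  using uniform_difference_quotient[OF compact_cbox S F hol b]
  by (rule uniform_limit_cong[THEN iffD1, rotated 2]) (use near in \<open>auto simp: Q_def elim!: eventually_mono\<close>)
 moreover have "continuous_on (cbox 0 1) (Q h)" for h
  unfolding Q_def using Fc[OF inS, of h] Fc[OF b] R(1) by (cases "norm h < R"; cases "h = 0") (auto intro!: continuous_intros)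
 ultimately obtain J D where J: "\<And>h. (Q h has_integral J h) (cbox 0 1)" "(J \<longlongrightarrow> D) (at 0)"
  using uniform_limit_integral_cbox[OF _ _ at_neq_bot] by metis
 have "\<forall>\<^sub>F h in at 0. J h = (I (b + h) - I b) / h"
  using near
 proof eventually_elim
  case (elim h)
  have "((\<lambda>x. (F x (b + h) - F x b) / h) has_integral (I (b + h) - I b) / h) (cbox 0 1)"
   unfolding I_def by (intro has_integral_divide has_integral_diff integrable_integral integrable_continuous Fc inS elim b)
  moreover have "Q h = (\<lambda>x. (F x (b + h) - F x b) / h)" using elim by (auto simp: Q_def)
  ultimately show ?case using J(1)[of h] has_integral_unique by metis
 qed
 then have "((\<lambda>h. (I (b + h) - I b) / h) \<longlongrightarrow> D) (at 0)" using J(2) by (rule Lim_transform_eventually[rotated])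
 then show "\<exists>f'. ((\<lambda>b. integral (cbox 0 1) (\<lambda>x. F x b)) has_field_derivative f') (at b)"
  unfolding DERIV_def I_def by blast
qed

lemma sh_translated_mean:
 assumes f: "strip_hol \<delta> f"
 shows "strip_hol \<delta> (\<lambda>\<zeta>. integral (cbox 0 1) (\<lambda>w. f (cpt w + \<zeta>)))"
 unfolding strip_hol_def
proof (intro conjI ballI)
 have st: "cpt w + \<zeta> \<in> strip \<delta> \<longleftrightarrow> \<zeta> \<in> strip \<delta>" for w \<zeta> using strip_add_cpt[of \<zeta> w] by (simp add: add.commute)
 have tr: "strip_hol \<delta> (\<lambda>\<zeta>. f (cpt w + \<zeta>))" for w using sh_translate[OF f, of w] by (simp add: add.commute)
 show "continuous_on (strip \<delta>) (\<lambda>\<zeta>. integral (cbox 0 1) (\<lambda>w. f (cpt w + \<zeta>)))"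
  by (rule integral_continuous_on_param, unfold case_prod_unfold,
    intro continuous_on_compose2[OF sh_cont[OF f]] continuous_intros continuous_on_compose2[OF continuous_cpt])
   (auto simp: st)
 have cont: "continuous_on (cbox 0 1 \<times> band \<delta>) (\<lambda>p. f (cpt (fst p) + g (snd p)))"
  if "continuous_on (band \<delta>) g" "\<And>a. a \<in> band \<delta> \<Longrightarrow> g a \<in> strip \<delta>" for g
  by (intro continuous_on_compose2[OF sh_cont[OF f]] continuous_intros continuous_on_compose2[OF continuous_cpt] continuous_on_compose2[OF that(1)])
   (use that(2) in \<open>auto simp: st\<close>)
 show "(\<lambda>a. integral (cbox 0 1) (\<lambda>w. f (cpt w + (a, b)))) holomorphic_on band \<delta>" if "b \<in> band \<delta>" for b
  by (rule holomorphic_parameter_integral[OF open_band cont])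
   (use that tr in \<open>auto simp: strip_hol_def strip_def intro!: continuous_intros\<close>)
 show "(\<lambda>b. integral (cbox 0 1) (\<lambda>w. f (cpt w + (a, b)))) holomorphic_on band \<delta>" if "a \<in> band \<delta>" for a
  by (rule holomorphic_parameter_integral[OF open_band cont])
   (use that tr in \<open>auto simp: strip_hol_def strip_def intro!: continuous_intros\<close>)
qed

text \<open>The mean over a square translated into the complex domain depends holomorphically on the translation and is constant
 for real ones, hence constant.\<close>

lemma mean_complex_shift:
 assumes f: "strip_hol \<delta> f" "\<delta> > 0" and per: "\<And>j w. f (cpt (w + axis j 1)) = f (cpt w)"
  and z: "\<zeta> \<in> strip \<delta>"
 shows "mean (\<lambda>w. f (cpt w)) = mean (\<lambda>w. f (cpt w + \<zeta>))"
proof -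
 have st: "cpt w + \<zeta> \<in> strip \<delta> \<longleftrightarrow> \<zeta> \<in> strip \<delta>" for w \<zeta> using strip_add_cpt[of \<zeta> w] by (simp add: add.commute)
 have eq: "mean (\<lambda>w. f (cpt w + \<zeta>)) = integral (cbox 0 1) (\<lambda>w. f (cpt w + \<zeta>))" if "\<zeta> \<in> strip \<delta>" for \<zeta>
  by (intro mean_eq_integral continuous_on_compose2[OF sh_cont[OF f(1)]] continuous_intros) (use that in \<open>auto simp: st\<close>)
 have fc: "continuous_on UNIV (\<lambda>w. f (cpt w))" by (rule sh_cont_cpt[OF f])
 then obtain C where C: "\<And>w. norm (f (cpt w)) \<le> C" using periodic_continuous_bounded[OF fc per] by blast
 have "integral (cbox 0 1) (\<lambda>w. f (cpt w + \<zeta>)) = mean (\<lambda>w. f (cpt w))"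
 proof (rule sh_eqI[OF sh_translated_mean[OF f(1)] sh_const f(2) _ z])
  fix s
  have "mean (\<lambda>w. f (cpt (w + s))) = mean (\<lambda>w. f (cpt w))"
   by (rule mean_shift[where f = "\<lambda>w. f (cpt w)", OF measurable_lebesgue_cont[OF fc] C]) (simp add: per)
  then show "integral (cbox 0 1) (\<lambda>w. f (cpt w + cpt s)) = mean (\<lambda>w. f (cpt w))"
   using eq[of "cpt s"] f(2) by (simp add: cpt_add)
 qed
 then show ?thesis using eq[OF z] by simp
qed

text \<open>Translate the square of integration by \<open>\<delta> / 2\<close> into the imaginary direction in which the character decays.\<close>

lemma fourier_coeff_decay:
 assumes f: "strip_hol \<delta> f" "\<delta> > 0" and per: "\<And>j w. f (cpt (w + axis j 1)) = f (cpt w)"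
 obtains M where "M > 0" "\<And>n. norm (mean (\<lambda>w. f (cpt w) * torus_char (- n) (cpt w)))
   \<le> M * exp (- (2 * pi * (\<delta> / 2) * (\<bar>of_int (fst n)\<bar> + \<bar>of_int (snd n)\<bar>)))"
proof -
 obtain M where M: "M > 0" "\<And>z. z \<in> strip (3 * \<delta> / 4) \<Longrightarrow> norm (f z) \<le> M"
  by (rule sh_periodic_bounded[OF f(1), of "3 * \<delta> / 4"]) (use f(2) per in auto)
 have "norm (mean (\<lambda>w. f (cpt w) * torus_char (- n) (cpt w)))
   \<le> M * exp (- (2 * pi * (\<delta> / 2) * (\<bar>of_int (fst n)\<bar> + \<bar>of_int (snd n)\<bar>)))" for n
 proof -
  define \<zeta> where "\<zeta> = (- \<i> * of_real (sgn (of_int (fst n)) * (\<delta> / 2)), - \<i> * of_real (sgn (of_int (snd n)) * (\<delta> / 2)))"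
  have Im: "Im (fst \<zeta>) = - (sgn (of_int (fst n)) * (\<delta> / 2))" "Im (snd \<zeta>) = - (sgn (of_int (snd n)) * (\<delta> / 2))"
   by (simp_all add: \<zeta>_def)
  have b: "\<bar>sgn (of_int i :: real) * (\<delta> / 2)\<bar> \<le> \<delta> / 2" for i using f(2) by (simp add: abs_mult abs_sgn_eq)
  have z: "\<zeta> \<in> strip (3 * \<delta> / 4)" "\<zeta> \<in> strip \<delta>"
   using b[of "fst n"] b[of "snd n"] f(2) by (auto simp: strip_iff Im simp del: abs_mult)
  define g where "g z = f z * torus_char (- n) z" for z
  have g: "strip_hol \<delta> g" unfolding g_def[abs_def] by (intro sh_mult f sh_torus_char)
  have gper: "g (cpt (w + axis j 1)) = g (cpt w)" for w j using per by (simp add: g_def cpt_add)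
  have "mean (\<lambda>w. g (cpt w)) = mean (\<lambda>w. g (cpt w + \<zeta>))"
   by (rule mean_complex_shift[OF g f(2) gper z(2)])
  moreover have "norm (mean (\<lambda>w. g (cpt w + \<zeta>))) \<le> M * exp (- (2 * pi * (\<delta> / 2) * (\<bar>of_int (fst n)\<bar> + \<bar>of_int (snd n)\<bar>)))"
  proof (rule norm_mean_le)
   show "(\<lambda>w. g (cpt w + \<zeta>)) \<in> lmeas_fns"
    by (intro measurable_lebesgue_cont continuous_on_compose2[OF sh_cont[OF g]] continuous_intros)
     (use z strip_add_cpt[of \<zeta>] in \<open>auto simp: add.commute\<close>)
   fix w
   have "cpt w + \<zeta> \<in> strip (3 * \<delta> / 4)" using z strip_add_cpt[of \<zeta> w] by (simp add: add.commute)
   then have 1: "norm (f (cpt w + \<zeta>)) \<le> M" by (rule M)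
   have sg: "x * sgn x = \<bar>x\<bar>" for x :: real by (simp add: abs_sgn mult.commute)
   have "norm (torus_char (- n) (cpt w + \<zeta>)) = exp (- (2 * pi * (of_int (fst (- n)) * Im (fst \<zeta>) + of_int (snd (- n)) * Im (snd \<zeta>))))"
    unfolding norm_torus_char by (simp add: cpt_def)
   also have "of_int (fst (- n)) * Im (fst \<zeta>) + of_int (snd (- n)) * Im (snd \<zeta>) =
     (\<delta> / 2) * (of_int (fst n) * sgn (of_int (fst n)) + of_int (snd n) * sgn (of_int (snd n)))"
    unfolding Im by (simp add: algebra_simps)
   also have "\<dots> = (\<delta> / 2) * (\<bar>of_int (fst n)\<bar> + \<bar>of_int (snd n)\<bar>)" unfolding sg ..
   finally have 2: "norm (torus_char (- n) (cpt w + \<zeta>)) = exp (- (2 * pi * (\<delta> / 2) * (\<bar>of_int (fst n)\<bar> + \<bar>of_int (snd n)\<bar>)))"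
    by (simp add: mult.assoc)
   show "norm (g (cpt w + \<zeta>)) \<le> M * exp (- (2 * pi * (\<delta> / 2) * (\<bar>of_int (fst n)\<bar> + \<bar>of_int (snd n)\<bar>)))"
    unfolding g_def norm_mult 2 using 1 by (intro mult_right_mono) auto
  qed
  ultimately show ?thesis by (simp add: g_def)
 qed
 then show ?thesis using that M(1) by blast
qed

lemma has_sum_diff_complex:
 fixes f g :: "'a \<Rightarrow> complex"
 assumes "(f has_sum a) A" "(g has_sum b) A" shows "((\<lambda>x. f x - g x) has_sum (a - b)) A"
 using has_sum_add[OF assms(1), of "\<lambda>x. - g x" "- b"] assms(2) by (simp add: has_sum_uminus)

lemma summable_exp_abs_int:
 assumes "s > 0" shows "(\<lambda>n::int. exp (- (s * \<bar>of_int n\<bar>)) :: real) summable_on UNIV"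
proof -
 have nat: "(\<lambda>n::nat. exp (- (s * of_nat n)) :: real) summable_on UNIV"
 proof -
  have "exp (- (s * of_nat n)) = exp (- s) ^ n" for n by (simp add: exp_of_nat_mult[symmetric] mult.commute)
  then have "summable (\<lambda>n::nat. norm (exp (- (s * of_nat n)) :: real))"
   using assms by (simp add: summable_geometric)
  then show ?thesis by (rule norm_summable_imp_summable_on)
 qed
 have "(\<lambda>n::int. exp (- (s * \<bar>of_int n\<bar>)) :: real) summable_on (range int \<union> range (\<lambda>n. - int n))"
 proof (rule summable_on_union)
  show "(\<lambda>n::int. exp (- (s * \<bar>of_int n\<bar>)) :: real) summable_on range int"
   using nat by (subst summable_on_reindex) (auto simp: o_def inj_on_def)
  show "(\<lambda>n::int. exp (- (s * \<bar>of_int n\<bar>)) :: real) summable_on range (\<lambda>n. - int n)"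
   using nat by (subst summable_on_reindex) (auto simp: o_def inj_on_def)
 qed
 moreover have "(UNIV :: int set) = range int \<union> range (\<lambda>n. - int n)"
 proof -
  have "n \<in> range int \<union> range (\<lambda>n. - int n)" for n :: int
   by (cases n rule: int_cases2) auto
  then show ?thesis by blast
 qed
 ultimately show ?thesis by simp
qed

definition l1_norm :: "int \<times> int \<Rightarrow> real" where
 "l1_norm n = \<bar>of_int (fst n)\<bar> + \<bar>of_int (snd n)\<bar>"

lemma l1_norm_ge_1: "n \<noteq> 0 \<Longrightarrow> l1_norm n \<ge> 1"
proof -
 assume "n \<noteq> 0"
 then have "\<bar>fst n\<bar> + \<bar>snd n\<bar> \<ge> 1" by (auto simp: prod_eq_iff)
 then have "real_of_int (\<bar>fst n\<bar> + \<bar>snd n\<bar>) \<ge> 1" by linarith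
 then show ?thesis by (simp add: l1_norm_def)
qed

lemma summable_exp_l1_norm:
 assumes "s > 0" shows "(\<lambda>n. exp (- (s * l1_norm n))) summable_on UNIV"
proof -
 have "(\<lambda>(n::int, m::int). exp (- (s * \<bar>of_int n\<bar>)) * exp (- (s * \<bar>of_int m\<bar>)) :: real) summable_on UNIV \<times> UNIV"
  by (intro summable_on_prod_nonneg summable_exp_abs_int assms) auto
 then show ?thesis
  by (simp add: l1_norm_def case_prod_unfold exp_add[symmetric] algebra_simps)
qed

lemma powr_le_exp:
 assumes "\<nu> > 0" "t > 0" "x \<ge> (1::real)"
 shows "x powr \<nu> \<le> exp (\<nu> * ln (\<nu> / t)) * exp (t * x)"
proof -
 define k where "k = \<nu> / t"
 have k: "k > 0" using assms by (simp add: k_def)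
 have "ln x = ln (x / k) + ln k" using assms k by (simp add: ln_div)
 also have "\<dots> \<le> x / k + ln k" using ln_le_minus_one[of "x / k"] assms k by (simp add: field_simps)
 finally have "\<nu> * ln x \<le> \<nu> * (x / k + ln k)" using assms by (intro mult_left_mono) auto
 also have "\<dots> = t * x + \<nu> * ln k" using assms by (simp add: k_def field_simps)
 finally have "exp (\<nu> * ln x) \<le> exp (t * x + \<nu> * ln k)" by simp
 then show ?thesis using assms by (simp add: powr_def exp_add k_def mult.commute)
qed

lemma norm_torus_char_strip:
 assumes "z \<in> strip \<delta>"
 shows "norm (torus_char n z) \<le> exp (2 * pi * \<delta> * l1_norm n)"
proof -
 have 1: "\<bar>of_int i * y\<bar> \<le> \<bar>of_int i\<bar> * \<delta>" if "\<bar>y\<bar> < \<delta>" for i :: int and y :: real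
  unfolding abs_mult using that by (intro mult_left_mono) auto
 have "- (of_int (fst n) * Im (fst z) + of_int (snd n) * Im (snd z)) \<le> \<delta> * l1_norm n"
  using 1[of "Im (fst z)" "fst n"] 1[of "Im (snd z)" "snd n"] assms
  unfolding strip_iff l1_norm_def ring_distribs by (simp add: mult.commute)
 then have "2 * pi * (- (of_int (fst n) * Im (fst z) + of_int (snd n) * Im (snd z))) \<le> 2 * pi * (\<delta> * l1_norm n)"
  by (intro mult_left_mono) auto
 moreover have "norm (torus_char n z) = exp (2 * pi * (- (of_int (fst n) * Im (fst z) + of_int (snd n) * Im (snd z))))"
  unfolding norm_torus_char by (simp only: mult_minus_right)
 ultimately show ?thesis by (simp only: exp_le_cancel_iff mult.assoc)
qed

lemma sh_char_series:
 assumes "s > 2 * pi * \<delta>" and b: "\<And>n. norm (b n) \<le> K * exp (- (s * l1_norm n))"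
 shows "strip_hol \<delta> (\<lambda>z. \<Sum>\<^sub>\<infinity>n. b n * torus_char n z)"
  "\<And>z. z \<in> strip \<delta> \<Longrightarrow> (\<lambda>n. b n * torus_char n z) summable_on UNIV"
proof -
 define M where "M n = K * exp (- ((s - 2 * pi * \<delta>) * l1_norm n))" for n
 have M: "M summable_on UNIV" unfolding M_def[abs_def]
  by (intro summable_on_cmult_right summable_exp_l1_norm) (use assms in simp)
 have bd: "norm (b n * torus_char n z) \<le> M n" if "z \<in> strip \<delta>" for n z
 proof -
  have "norm (b n * torus_char n z) \<le> K * exp (- (s * l1_norm n)) * exp (2 * pi * \<delta> * l1_norm n)"
   unfolding norm_mult
   by (intro mult_mono b norm_torus_char_strip[OF that]) (use order_trans[OF norm_ge_zero b] in auto)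
  also have "\<dots> = M n" by (simp add: M_def mult.assoc exp_add[symmetric] algebra_simps)
  finally show ?thesis .
 qed
 show "strip_hol \<delta> (\<lambda>z. \<Sum>\<^sub>\<infinity>n. b n * torus_char n z)"
  by (rule sh_infsum) (use M bd in \<open>auto intro!: sh_mult sh_torus_char exI[of _ M]\<close>)
 show "(\<lambda>n. b n * torus_char n z) summable_on UNIV" if "z \<in> strip \<delta>" for z
  by (rule abs_summable_summable, rule summable_on_comparison_test[OF M]) (use bd[OF that] in auto)
qed

text \<open>A periodic strip-holomorphic function is the sum of its Fourier series: the difference has
 vanishing Fourier coefficients.\<close>

lemma sh_fourier_series:
 assumes f: "strip_hol \<delta> f" "\<delta> > 0" and per: "\<And>j w. f (cpt (w + axis j 1)) = f (cpt w)"
  and a: "\<And>n. a n = mean (\<lambda>w. f (cpt w) * torus_char (- n) (cpt w))"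
 shows "((\<lambda>n. a n * torus_char n (cpt w)) has_sum f (cpt w)) UNIV"
proof -
 obtain M where M: "M > 0" "\<And>n. norm (a n) \<le> M * exp (- (pi * \<delta> * l1_norm n))"
  using fourier_coeff_decay[OF f per] unfolding a l1_norm_def by (auto simp: mult_ac)
 define S where "S z = (\<Sum>\<^sub>\<infinity>n. a n * torus_char n z)" for z
 have lt: "2 * pi * (\<delta> / 4) < pi * \<delta>" using f(2) by simp
 note sh = sh_char_series[OF lt, of a M, OF M(2), folded S_def]
 have d: "\<delta> / 4 > 0" using f(2) by simp
 have fc: "continuous_on UNIV (\<lambda>w. f (cpt w))" by (rule sh_cont_cpt[OF f])
 have Sc: "continuous_on UNIV (\<lambda>w. S (cpt w))" by (rule sh_cont_cpt[OF sh(1) d])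
 have Sper: "S (cpt (w + axis j 1)) = S (cpt w)" for w j by (simp add: S_def cpt_add)
 define u where "u w = f (cpt w) - S (cpt w)" for w
 have uc: "continuous_on UNIV u" unfolding u_def[abs_def] by (intro continuous_intros fc Sc)
 have uper: "u (w + axis j 1) = u w" for w j by (simp add: u_def per Sper)
 obtain C where C: "\<And>w. norm (u w) \<le> C" using periodic_continuous_bounded[OF uc uper] by blast
 have Msum: "(\<lambda>n. M * exp (- (pi * \<delta> * l1_norm n))) summable_on UNIV"
  by (intro summable_on_cmult_right summable_exp_l1_norm) (use f(2) in simp)
 have ul: "uniform_limit UNIV (\<lambda>X w. \<Sum>n\<in>X. a n * torus_char n (cpt w)) (\<lambda>w. S (cpt w)) (finite_subsets_at_top UNIV)"
  unfolding S_def by (rule Weierstrass_m_test_general[OF _ Msum]) (use M(2) in \<open>auto simp: norm_mult\<close>)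
 have coeff: "mean (\<lambda>w. S (cpt w) * torus_char m (cpt w)) = a (- m)" for m
 proof -
  define P where "P X w = (\<Sum>n\<in>X. a n * torus_char n (cpt w))" for X w
  have Pc: "continuous_on UNIV (P X)" for X unfolding P_def[abs_def]
   by (intro continuous_intros continuous_on_compose2[OF continuous_torus_char continuous_cpt]) auto
  have cc: "continuous_on UNIV (\<lambda>w. torus_char m (cpt w))"
   by (intro continuous_on_compose2[OF continuous_torus_char continuous_cpt]) auto
  have PX: "mean (\<lambda>w. P X w * torus_char m (cpt w)) = (if - m \<in> X then a (- m) else 0)" if "finite X" for X
   using that
  proof (induction X rule: finite_induct)
   case empty then show ?case by (simp add: P_def)
  next
   case (insert x X)
   obtain D where D: "\<And>w. norm (P X w) \<le> D"
   proof -
    have "norm (P X w) \<le> (\<Sum>n\<in>X. norm (a n))" for w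
     unfolding P_def by (rule sum_norm_le) (simp add: norm_mult)
    then show ?thesis using that by blast
   qed
   have "mean (\<lambda>w. P (insert x X) w * torus_char m (cpt w)) =
    mean (\<lambda>w. a x * torus_char (x + m) (cpt w) + P X w * torus_char m (cpt w))"
    by (rule mean_cong) (simp add: P_def insert.hyps torus_char_add' algebra_simps)
   also have "\<dots> = mean (\<lambda>w. a x * torus_char (x + m) (cpt w)) + mean (\<lambda>w. P X w * torus_char m (cpt w))"
    by (rule mean_add[where C = "norm (a x)" and C' = D])
     (use D in \<open>auto simp: norm_mult intro!: measurable_lebesgue_cont continuous_intros Pc cc
      continuous_on_compose2[OF continuous_torus_char continuous_cpt]\<close>)
   also have "mean (\<lambda>w. a x * torus_char (x + m) (cpt w)) = (if x = - m then a x else 0)"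
    unfolding mean_cmult using mean_torus_char[of "x + m"] by (auto simp: add_eq_0_iff2)
   finally show ?case using insert by (auto simp: minus_equation_iff)
  qed
  have "norm (mean (\<lambda>w. S (cpt w) * torus_char m (cpt w)) - a (- m)) \<le> 0 + e" if e: "e > 0" for e
  proof -
   have "\<forall>\<^sub>F X in finite_subsets_at_top UNIV. \<forall>w\<in>UNIV. dist (P X w) (S (cpt w)) < e"
    using ul e unfolding uniform_limit_iff P_def by blast
   moreover have "\<forall>\<^sub>F X in finite_subsets_at_top UNIV. finite X \<and> - m \<in> X"
    by (auto simp: eventually_finite_subsets_at_top intro!: exI[of _ "{- m}"])
   ultimately have "\<forall>\<^sub>F X in finite_subsets_at_top UNIV. (\<forall>w\<in>UNIV. dist (P X w) (S (cpt w)) < e) \<and> finite X \<and> - m \<in> X"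
    by (rule eventually_conj)
   then obtain X where X: "\<And>w. dist (P X w) (S (cpt w)) < e" "finite X" "- m \<in> X"
    using eventually_happens'[of "finite_subsets_at_top UNIV"] by (metis (no_types, lifting) UNIV_I finite_subsets_at_top_neq_bot)
   obtain D where D: "\<And>w. norm (P X w) \<le> D"
   proof -
    have "norm (P X w) \<le> (\<Sum>n\<in>X. norm (a n))" for w
     unfolding P_def by (rule sum_norm_le) (simp add: norm_mult)
    then show ?thesis using that by blast
   qed
   have "mean (\<lambda>w. S (cpt w) * torus_char m (cpt w)) =
    mean (\<lambda>w. (S (cpt w) - P X w) * torus_char m (cpt w) + P X w * torus_char m (cpt w))"
    by (simp add: algebra_simps)
   also have "\<dots> = mean (\<lambda>w. (S (cpt w) - P X w) * torus_char m (cpt w)) + mean (\<lambda>w. P X w * torus_char m (cpt w))"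
    by (rule mean_add[where C = e and C' = D])
     (use X(1) D in \<open>auto simp: norm_mult dist_norm norm_minus_commute less_imp_le
      intro!: measurable_lebesgue_cont continuous_intros Pc cc Sc\<close>)
   finally have "mean (\<lambda>w. S (cpt w) * torus_char m (cpt w)) - a (- m) = mean (\<lambda>w. (S (cpt w) - P X w) * torus_char m (cpt w))"
    using PX[OF X(2)] X(3) by simp
   moreover have "norm (mean (\<lambda>w. (S (cpt w) - P X w) * torus_char m (cpt w))) \<le> e"
    by (rule norm_mean_le)
     (use X(1) in \<open>auto simp: norm_mult dist_norm norm_minus_commute less_imp_le
      intro!: measurable_lebesgue_cont continuous_intros Pc cc Sc\<close>)
   ultimately show ?thesis by simp
  qed
  then have "norm (mean (\<lambda>w. S (cpt w) * torus_char m (cpt w)) - a (- m)) \<le> 0" by (rule field_le_epsilon)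
  then show ?thesis by simp
 qed
 obtain C1 where C1: "\<And>w. norm (f (cpt w)) \<le> C1" using periodic_continuous_bounded[OF fc per] by blast
 obtain C2 where C2: "\<And>w. norm (S (cpt w)) \<le> C2" using periodic_continuous_bounded[OF Sc Sper] by blast
 have zero: "mean (\<lambda>w. u w * torus_char m (cpt w)) = 0" for m
 proof -
  have "mean (\<lambda>w. u w * torus_char m (cpt w)) =
   mean (\<lambda>w. f (cpt w) * torus_char m (cpt w) + (- 1) * (S (cpt w) * torus_char m (cpt w)))"
   by (simp add: u_def algebra_simps)
  also have "\<dots> = mean (\<lambda>w. f (cpt w) * torus_char m (cpt w)) + mean (\<lambda>w. (- 1) * (S (cpt w) * torus_char m (cpt w)))"
   by (rule mean_add[where C = C1 and C' = C2])
    (use C1 C2 in \<open>auto simp: norm_mult intro!: measurable_lebesgue_cont continuous_intros fc Sc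
      continuous_on_compose2[OF continuous_torus_char continuous_cpt]\<close>)
  also have "\<dots> = 0" unfolding mean_cmult coeff using a[of "- m"] by simp
  finally show ?thesis .
 qed
 have "AE w in lebesgue. u w = 0"
 proof (rule AE_periodic_from_unit_square)
  show "AE w in lebesgue. w \<in> cbox 0 1 \<longrightarrow> u w = 0"
   by (rule fourier_uniqueness[OF measurable_lebesgue_cont[OF uc] C zero])
 qed (simp add: uper)
 then have "AE w in lebesgue. w \<in> {w. u w = 0}" by simp
 then have "w \<in> {w. u w = 0}"
  by (intro mem_closed_if_AE_lebesgue closed_Collect_eq continuous_intros uc)
 then have "f (cpt w) = S (cpt w)" by (simp add: u_def)
 then show ?thesis using sh(2)[of "cpt w"] d unfolding S_def by (simp add: has_sum_infsum)
qed

text \<open>The cohomological equation over a Diophantine translation: division by the small divisors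
 costs only a polynomial factor, absorbed by shrinking the strip.\<close>

lemma sh_cohomological_equation:
 assumes f: "strip_hol \<delta> f" "\<delta> > 0" and per: "\<And>j w. f (cpt (w + axis j 1)) = f (cpt w)"
  and c: "c > 0" and \<nu>: "\<nu> > 0"
  and dio: "\<And>n. n \<noteq> 0 \<Longrightarrow> norm (torus_char n (cpt \<tau>) - 1) \<ge> c * l1_norm n powr (- \<nu>)"
 obtains \<psi> \<delta>' where "\<delta>' > 0" "\<delta>' \<le> \<delta>" "strip_hol \<delta>' \<psi>"
  "\<And>j w. \<psi> (cpt (w + axis j 1)) = \<psi> (cpt w)"
  "\<And>w. \<psi> (cpt (w + \<tau>)) - \<psi> (cpt w) = f (cpt w) - mean (\<lambda>w. f (cpt w))"
proof -
 define a where "a n = mean (\<lambda>w. f (cpt w) * torus_char (- n) (cpt w))" for n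
 obtain M where M: "M > 0" "\<And>n. norm (a n) \<le> M * exp (- (pi * \<delta> * l1_norm n))"
  using fourier_coeff_decay[OF f per] unfolding a_def l1_norm_def by (auto simp: mult_ac)
 define b where "b n = (if n = 0 then 0 else a n / (torus_char n (cpt \<tau>) - 1))" for n
 define t where "t = pi * \<delta> / 4"
 have t: "t > 0" using f(2) by (simp add: t_def)
 \<comment> \<open>the polynomial loss from the small divisors is at most \<open>exp (t |n|)\<close> up to a constant\<close>
 define K where "K = M / c * exp (\<nu> * ln (\<nu> / t))"
 have nz: "torus_char n (cpt \<tau>) - 1 \<noteq> 0" if "n \<noteq> 0" for n
 proof -
  have "0 < c * l1_norm n powr (- \<nu>)" using c l1_norm_ge_1[OF that] by (intro mult_pos_pos) auto
  then show ?thesis using dio[OF that] by auto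
 qed
 have bb: "norm (b n) \<le> K * exp (- (3 * t * l1_norm n))" for n
 proof (cases "n = 0")
  case True then show ?thesis using M(1) c by (simp add: b_def K_def)
 next
  case False
  define x where "x = l1_norm n"
  have x: "x \<ge> 1" using l1_norm_ge_1[OF False] by (simp add: x_def)
  have pos: "0 < c * x powr (- \<nu>)" using c x by (intro mult_pos_pos) auto
  have "norm (b n) = norm (a n) / norm (torus_char n (cpt \<tau>) - 1)" using False by (simp add: b_def norm_divide)
  also have "\<dots> \<le> (M * exp (- (4 * t * x))) / (c * x powr (- \<nu>))"
   by (intro frac_le) (use M(1) M(2)[of n] dio[OF False] pos in \<open>auto simp: x_def t_def\<close>)
  also have "\<dots> = M / c * exp (- (4 * t * x)) * x powr \<nu>" using x by (simp add: powr_minus field_simps)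
  also have "\<dots> \<le> M / c * exp (- (4 * t * x)) * (exp (\<nu> * ln (\<nu> / t)) * exp (t * x))"
   by (intro mult_left_mono powr_le_exp[OF \<nu> t x]) (use M(1) c in auto)
  also have "\<dots> = K * (exp (- (4 * t * x)) * exp (t * x))" by (simp add: K_def mult_ac)
  also have "\<dots> = K * exp (- (3 * t * x))" by (simp add: exp_add[symmetric] algebra_simps)
  finally show ?thesis by (simp add: x_def)
 qed
 define \<delta>' where "\<delta>' = \<delta> / 4"
 have d': "\<delta>' > 0" "\<delta>' \<le> \<delta>" using f(2) by (auto simp: \<delta>'_def)
 have lt: "2 * pi * \<delta>' < 3 * t" using f(2) by (simp add: \<delta>'_def t_def)
 define \<psi> where "\<psi> z = (\<Sum>\<^sub>\<infinity>n. b n * torus_char n z)" for z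
 note sh = sh_char_series[OF lt, of b K, OF bb, folded \<psi>_def]
 have "\<psi> (cpt (w + \<tau>)) - \<psi> (cpt w) = f (cpt w) - mean (\<lambda>w. f (cpt w))" for w
 proof -
  have h1: "((\<lambda>n. b n * torus_char n (cpt (w + \<tau>))) has_sum \<psi> (cpt (w + \<tau>))) UNIV"
   "((\<lambda>n. b n * torus_char n (cpt w)) has_sum \<psi> (cpt w)) UNIV"
   unfolding \<psi>_def by (intro has_sum_infsum sh(2); simp add: d')+
  have "((\<lambda>n. b n * torus_char n (cpt (w + \<tau>)) - b n * torus_char n (cpt w)) has_sum (\<psi> (cpt (w + \<tau>)) - \<psi> (cpt w))) UNIV"
   by (rule has_sum_diff_complex[OF h1])
  moreover have "b n * torus_char n (cpt (w + \<tau>)) - b n * torus_char n (cpt w) = (if n = 0 then 0 else a n * torus_char n (cpt w))" for n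
   using nz[of n] by (auto simp: b_def cpt_add torus_char_add divide_simps) (simp add: algebra_simps)
  moreover have "((\<lambda>n. if n = 0 then 0 else a n * torus_char n (cpt w)) has_sum (f (cpt w) - a 0)) UNIV"
  proof -
   have h: "((\<lambda>n. a n * torus_char n (cpt w)) has_sum f (cpt w)) UNIV"
    by (rule sh_fourier_series[OF f per a_def])
   have "((\<lambda>n. if n = 0 then a 0 else 0) has_sum a 0) {0}"
    using has_sum_finite[of "{0}" "\<lambda>n. if n = 0 then a 0 else 0"] by simp
   then have h0: "((\<lambda>n. if n = 0 then a 0 else 0) has_sum a 0) UNIV"
    by (subst (asm) has_sum_cong_neutral[where T = UNIV and g = "\<lambda>n. if n = 0 then a 0 else 0"]) auto
   have "(\<lambda>n. a n * torus_char n (cpt w) - (if n = 0 then a 0 else 0)) = (\<lambda>n. if n = 0 then 0 else a n * torus_char n (cpt w))"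
    by (auto simp: fun_eq_iff)
   then show ?thesis using has_sum_diff_complex[OF h h0] by simp
  qed
  ultimately have "\<psi> (cpt (w + \<tau>)) - \<psi> (cpt w) = f (cpt w) - a 0"
   by (simp add: has_sum_unique)
  then show ?thesis by (simp add: a_def)
 qed
 moreover have "\<psi> (cpt (w + axis j 1)) = \<psi> (cpt w)" for w j by (simp add: \<psi>_def cpt_add)
 ultimately show ?thesis using that[OF d' sh(1)] by blast
qed

section \<open>Sections and phases over the plane\<close>

lemma herm_inner_add: "herm_inner x (y + z) = herm_inner x y + herm_inner x z"
 by (simp add: herm_inner_def sum.distrib ring_distribs)

lemma herm_inner_smult: "herm_inner x (c *s y) = c * herm_inner x y"
 by (simp add: herm_inner_def sum_distrib_left mult_ac)

lemma herm_inner_smult_left: "herm_inner (c *s x) y = cnj c * herm_inner x y"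
 by (simp add: herm_inner_def sum_distrib_left mult_ac)

lemma herm_inner_self: "herm_inner x x = of_real ((norm x)\<^sup>2)"
proof -
 have "(norm x)\<^sup>2 = (\<Sum>i\<in>UNIV. (norm (x $ i))\<^sup>2)"
  by (simp add: norm_vec_def L2_set_def sum_nonneg)
 then show ?thesis by (simp add: herm_inner_def complex_norm_square mult.commute del: of_real_power)
qed

lemma herm_inner_self_nz: "x \<noteq> 0 \<Longrightarrow> herm_inner x x \<noteq> 0"
 by (simp add: herm_inner_self)

lemma continuous_herm_inner [continuous_intros]:
 "continuous_on S f \<Longrightarrow> continuous_on S g \<Longrightarrow> continuous_on S (\<lambda>w. herm_inner (f w) (g w))"
 unfolding herm_inner_def by (intro continuous_intros)

lemma norm_smult: "norm (c *s (x :: complex^'n)) = norm c * norm x"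
 by (simp add: norm_vec_def norm_mult L2_set_right_distrib)

lemma continuous_smult [continuous_intros]:
 fixes f :: "'a::topological_space \<Rightarrow> complex" and g :: "'a \<Rightarrow> complex^'n"
 assumes "continuous_on S f" "continuous_on S g" shows "continuous_on S (\<lambda>w. f w *s g w)"
 unfolding vector_scalar_mult_def
 by (intro continuous_on_vec_lambda continuous_intros assms)

lemma continuous_matrix_vector [continuous_intros]:
 fixes f :: "'a::topological_space \<Rightarrow> complex^'n^'m" and g :: "'a \<Rightarrow> complex^'n"
 assumes "continuous_on S f" "continuous_on S g" shows "continuous_on S (\<lambda>w. f w *v g w)"
 unfolding matrix_vector_mult_def
 by (intro continuous_on_vec_lambda continuous_intros assms)

lemma matrix_smult_vec: "(M :: complex^'n^'m) *v (c *s x) = c *s (M *v x)"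
 by (simp add: vec_eq_iff matrix_vector_mult_def sum_distrib_left mult_ac)

lemma matrix_zero_vec [simp]: "(M :: complex^'n^'m) *v 0 = 0"
 by (simp add: vec_eq_iff matrix_vector_mult_def)

lemma complex_line_eqI: "c \<noteq> 0 \<Longrightarrow> complex_line (c *s v) = complex_line v"
 unfolding complex_line_def
proof (intro equalityI subsetI)
 fix x assume "c \<noteq> 0" "x \<in> range (\<lambda>a. a *s v)"
 then obtain a where "x = (a / c) *s (c *s v)" by (auto simp: vector_smult_assoc)
 then show "x \<in> range (\<lambda>a. a *s (c *s v))" by blast
qed (auto simp: vector_smult_assoc)

lemma complex_line_self: "v \<in> complex_line v"
 unfolding complex_line_def by (rule range_eqI[of _ _ 1]) simp

lemma CP1_multiple:
 assumes "L \<in> CP1" "x \<in> L" "y \<in> L" "y \<noteq> 0"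
 obtains c where "x = c *s y"
proof -
 obtain v where "L = complex_line v" using assms(1) by (auto simp: CP1_def)
 then obtain a b where "x = a *s v" "y = b *s v" using assms by (auto simp: complex_line_def)
 moreover from this have "b \<noteq> 0" using assms(4) by auto
 ultimately have "x = (a / b) *s y" by (simp add: vector_smult_assoc)
 then show ?thesis using that by blast
qed

lemma CP1_smult: "L \<in> CP1 \<Longrightarrow> x \<in> L \<Longrightarrow> c *s x \<in> L"
 by (auto simp: CP1_def complex_line_def vector_smult_assoc)

lemma CP1_eq_line: "L \<in> CP1 \<Longrightarrow> x \<in> L \<Longrightarrow> x \<noteq> 0 \<Longrightarrow> L = complex_line x"
proof -
 assume L: "L \<in> CP1" "x \<in> L" "x \<noteq> 0"
 then obtain v where v: "L = complex_line v" by (auto simp: CP1_def)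
 then obtain a where a: "x = a *s v" using L by (auto simp: complex_line_def)
 then have "a \<noteq> 0" using L by auto
 then show ?thesis using v a complex_line_eqI by metis
qed

text \<open>Orthogonal projection; the choice of the spanning vector does not matter.\<close>

definition line_proj :: "(complex^2) set \<Rightarrow> complex^2 \<Rightarrow> complex^2" where
 "line_proj L x = (let v = (SOME v. v \<noteq> 0 \<and> L = complex_line v) in (herm_inner v x / herm_inner v v) *s v)"

lemma line_proj_eq:
 assumes "v \<noteq> 0"
 shows "line_proj (complex_line v) x = (herm_inner v x / herm_inner v v) *s v"
proof -
 define u where "u = (SOME u. u \<noteq> 0 \<and> complex_line v = complex_line u)"
 have u: "u \<noteq> 0" "complex_line v = complex_line u"
  using someI[of "\<lambda>u. u \<noteq> 0 \<and> complex_line v = complex_line u" v] assms by (auto simp: u_def)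
 have "u \<in> complex_line v" unfolding u(2) by (rule complex_line_self)
 then obtain c where c: "u = c *s v" by (auto simp: complex_line_def)
 then have c0: "c \<noteq> 0" using u by auto
 have "line_proj (complex_line v) x = (herm_inner u x / herm_inner u u) *s u"
  by (simp add: line_proj_def u_def[symmetric] Let_def)
 also have "\<dots> = (herm_inner v x / herm_inner v v) *s v"
  using c0 herm_inner_self_nz[OF assms]
  by (simp add: c herm_inner_smult herm_inner_smult_left vector_smult_assoc field_simps)
 finally show ?thesis .
qed

lemma line_proj_mem: "L \<in> CP1 \<Longrightarrow> line_proj L x \<in> L"
proof -
 assume "L \<in> CP1"
 then obtain v where v: "v \<noteq> 0" "L = complex_line v" by (auto simp: CP1_def)
 show ?thesis unfolding v(2) line_proj_eq[OF v(1)] by (auto simp: complex_line_def)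
qed

lemma line_proj_id: "L \<in> CP1 \<Longrightarrow> x \<in> L \<Longrightarrow> line_proj L x = x"
proof -
 assume "L \<in> CP1" "x \<in> L"
 then obtain v a where v: "v \<noteq> 0" "L = complex_line v" "x = a *s v"
  by (auto simp: CP1_def complex_line_def)
 then show ?thesis using herm_inner_self_nz[OF v(1)] by (simp add: line_proj_eq herm_inner_smult)
qed

lemma line_proj_expand:
 assumes "L \<in> CP1"
 shows "line_proj L x = x $ 1 *s line_proj L (axis 1 1) + x $ 2 *s line_proj L (axis 2 1)"
proof -
 obtain v where v: "v \<noteq> 0" "L = complex_line v" using assms by (auto simp: CP1_def)
 have "x = x $ 1 *s axis 1 1 + x $ 2 *s axis 2 1" by (simp add: vec_eq_iff forall_2 axis_def)
 then have "herm_inner v x = x $ 1 * herm_inner v (axis 1 1) + x $ 2 * herm_inner v (axis 2 1)"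
  by (metis herm_inner_add herm_inner_smult)
 then show ?thesis using v
  by (simp add: line_proj_eq vector_smult_assoc add_divide_distrib vec.scale_left_distrib)
qed

lemma continuous_line_proj:
 assumes l: "continuous_map euclidean CP1_topology l"
 shows "continuous_on UNIV (\<lambda>(w :: real^2, x). line_proj (l w) x)"
proof -
 have mem: "l w \<in> CP1" for w using continuous_map_image_subset_topspace[OF l] by (auto simp: topspace_CP1)
 have fix_x: "continuous_on UNIV (\<lambda>w. line_proj (l w) x)" for x
 proof -
  have "continuous_on (- {0}) (\<lambda>v. (herm_inner v x / herm_inner v v) *s v)"
   by (intro continuous_intros) (simp add: herm_inner_self_nz)
  then have "continuous_on (- {0}) ((\<lambda>L. line_proj L x) \<circ> complex_line)"
   by (rule continuous_on_eq) (simp add: line_proj_eq)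
  then have "continuous_map (top_of_set (- {0})) euclidean ((\<lambda>L. line_proj L x) \<circ> complex_line)"
   by simp
  then have "continuous_map CP1_topology euclidean (\<lambda>L. line_proj L x)"
   using continuous_compose_quotient_map_eq[OF quotient_map_CP1] by blast
  then have "continuous_map euclidean euclidean ((\<lambda>L. line_proj L x) \<circ> l)"
   by (rule continuous_map_compose[OF l])
  then show ?thesis by (simp add: o_def)
 qed
 have "continuous_on UNIV (\<lambda>p::(real^2) \<times> (complex^2). snd p $ 1 *s line_proj (l (fst p)) (axis 1 1) + snd p $ 2 *s line_proj (l (fst p)) (axis 2 1))"
  by (intro continuous_intros continuous_on_compose2[OF fix_x continuous_on_fst]) auto
 then show ?thesis
  by (simp add: case_prod_unfold line_proj_expand[OF mem, symmetric])
qed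

text \<open>Radial retraction onto the ball of radius \<open>r\<close>.\<close>

definition radial_clamp :: "real \<Rightarrow> 'a::real_normed_vector \<Rightarrow> 'a" where
 "radial_clamp r w = (r / max r (norm w)) *\<^sub>R w"

lemma radial_clamp_id: "norm w \<le> r \<Longrightarrow> radial_clamp r w = w"
 by (cases "r = 0") (auto simp: radial_clamp_def max_def)

lemma radial_clamp_le: "r \<ge> 0 \<Longrightarrow> norm (radial_clamp r w) \<le> r"
 by (auto simp: radial_clamp_def max_def divide_simps)

lemma continuous_radial_clamp: "r \<ge> 0 \<Longrightarrow> continuous_on S (radial_clamp r)"
proof (cases "r = 0")
 case False
 assume "r \<ge> 0"
 have "max r (norm (w::'a)) \<noteq> 0" for w using False \<open>r \<ge> 0\<close> by (auto simp: max_def)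
 then show ?thesis unfolding radial_clamp_def[abs_def] by (intro continuous_intros) auto
qed (simp add: radial_clamp_def)

lemma dist_radial_clamp:
 assumes "0 \<le> r" "r \<le> r'"
 shows "dist (radial_clamp r w) (radial_clamp r' w) \<le> r' - r"
proof -
 have "dist (radial_clamp r w) (radial_clamp r' w) = \<bar>r / max r (norm w) - r' / max r' (norm w)\<bar> * norm w"
  by (simp add: radial_clamp_def dist_norm flip: scaleR_left_diff_distrib)
 also have "\<dots> = \<bar>(r / max r (norm w)) * norm w - (r' / max r' (norm w)) * norm w\<bar>"
  unfolding left_diff_distrib[symmetric] abs_mult by simp
 also have "(r / max r (norm w)) * norm w = min r (norm w)" if "r \<ge> 0" for r
  using that by (cases "norm w \<le> r"; cases "r = 0") (auto simp: max_def min_def)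
 then have "\<bar>(r / max r (norm w)) * norm w - (r' / max r' (norm w)) * norm w\<bar> = \<bar>min r (norm w) - min r' (norm w)\<bar>"
  using assms by simp
 also have "\<dots> \<le> r' - r" using assms by (auto simp: min_def)
 finally show ?thesis .
qed

text \<open>A line field over the plane has a continuous nowhere-vanishing section: it is carried
 outwards along rays by short orthogonal projections, which cannot vanish.\<close>

lemma continuous_section_exists:
 fixes l :: "real^2 \<Rightarrow> (complex^2) set"
 assumes l: "continuous_map euclidean CP1_topology l"
 obtains v where "continuous_on UNIV v" "\<And>w. v w \<in> l w" "\<And>w. v w \<noteq> 0"
proof -
 have mem: "l w \<in> CP1" for w using continuous_map_image_subset_topspace[OF l] by (auto simp: topspace_CP1)
 define p where "p w x = line_proj (l w) x" for w x
 have pc: "continuous_on UNIV (\<lambda>(w, x). p w x)" unfolding p_def by (rule continuous_line_proj[OF l])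
 have pc2: "continuous_on UNIV f \<Longrightarrow> continuous_on UNIV g \<Longrightarrow> continuous_on UNIV (\<lambda>w. p (f w) (g w))" for f g :: "real^2 \<Rightarrow> _"
  using continuous_on_compose2[OF pc, of UNIV "\<lambda>w. (f w, g w)"] by (simp add: continuous_on_Pair)
 have pm: "p w x \<in> l w" for w x by (simp add: p_def line_proj_mem mem)
 have pid: "x \<in> l w \<Longrightarrow> p w x = x" for w x by (simp add: p_def line_proj_id mem)
 have psc: "p w (c *s x) = c *s p w x" for w c x
 proof -
  obtain v where v: "v \<noteq> 0" "l w = complex_line v" using mem[of w] by (auto simp: CP1_def)
  show ?thesis unfolding p_def v(2) line_proj_eq[OF v(1)] by (simp add: herm_inner_smult vector_smult_assoc)
 qed
 define Good where "Good r v \<longleftrightarrow> continuous_on UNIV v \<and> (\<forall>w. v w \<in> l (radial_clamp r w) \<and> v w \<noteq> 0)" for r v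
 \<comment> \<open>a section over a ball extends to a slightly larger one: by uniform continuity, projecting a unit vector of one line to a nearby line moves it by less than its length\<close>
 have step: "\<exists>\<epsilon>>0. \<forall>r r' v. 0 \<le> r \<longrightarrow> r \<le> r' \<longrightarrow> r' \<le> R \<longrightarrow> r' \<le> r + \<epsilon> \<longrightarrow> Good r v \<longrightarrow>
   (\<exists>v'. Good r' v' \<and> (\<forall>w. norm w \<le> r \<longrightarrow> v' w = v w))" for R
 proof -
  have "uniformly_continuous_on (cball 0 R \<times> cball 0 1) (\<lambda>(w, x). p w x)"
   by (rule compact_uniformly_continuous) (auto intro: continuous_on_subset[OF pc] compact_Times)
  then obtain d where d0: "d > 0" "\<forall>y\<in>cball 0 R \<times> cball 0 1. \<forall>y'\<in>cball 0 R \<times> cball 0 1. dist y' y < d \<longrightarrow>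
    dist (case y' of (w, x) \<Rightarrow> p w x) (case y of (w, x) \<Rightarrow> p w x) < 1"
   unfolding uniformly_continuous_on_def using zero_less_one by blast
  then have d: "d > 0" "\<And>w x w' x'. w \<in> cball 0 R \<Longrightarrow> x \<in> cball 0 1 \<Longrightarrow> w' \<in> cball 0 R \<Longrightarrow> x' \<in> cball 0 1 \<Longrightarrow>
    dist (w', x') (w, x) < d \<Longrightarrow> dist (p w' x') (p w x) < 1"
   by (auto dest!: bspec[OF d0(2), OF SigmaI])
  have nz: "p w' x \<noteq> 0" if w: "w \<in> cball 0 R" "w' \<in> cball 0 R" "dist w w' < d" and x: "x \<in> l w" "x \<noteq> 0" for w w' x
  proof -
   define y where "y = (1 / of_real (norm x)) *s x"
   have y: "norm y = 1" "y \<in> l w" using x mem[of w] by (auto simp: y_def norm_smult norm_divide CP1_smult)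
   have "dist (p w' y) (p w y) < 1"
    by (rule d(2)) (use w y in \<open>auto simp: dist_Pair_Pair dist_commute\<close>)
   then have "norm (p w' y - y) < 1" using pid[OF y(2)] by (simp add: dist_norm)
   then have "p w' y \<noteq> 0" using y(1) by auto
   then show ?thesis using psc[of w' "1 / of_real (norm x)" x] by (auto simp: y_def)
  qed
  show ?thesis
  proof (intro exI[of _ "d / 2"] conjI allI impI)
   fix r r' v assume r: "0 \<le> r" "r \<le> r'" "r' \<le> R" "r' \<le> r + d / 2" and v: "Good r v"
   define v' where "v' w = p (radial_clamp r' w) (v w)" for w
   have "Good r' v'" unfolding Good_def
   proof (intro conjI allI)
    show "continuous_on UNIV v'" unfolding v'_def[abs_def]
     by (intro pc2 continuous_radial_clamp) (use r v in \<open>auto simp: Good_def\<close>)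
    fix w
    show "v' w \<in> l (radial_clamp r' w)" by (simp add: v'_def pm)
    show "v' w \<noteq> 0" unfolding v'_def
    proof (rule nz[of "radial_clamp r w"])
     show "radial_clamp r w \<in> cball 0 R" "radial_clamp r' w \<in> cball 0 R"
      using radial_clamp_le[of r w] radial_clamp_le[of r' w] r by auto
     show "dist (radial_clamp r w) (radial_clamp r' w) < d"
      using dist_radial_clamp[of r r' w] r d(1) by linarith
    qed (use v in \<open>auto simp: Good_def\<close>)
   qed
   moreover have "v' w = v w" if "norm w \<le> r" for w
   proof -
    have "radial_clamp r w = w" "radial_clamp r' w = w" using that r by (auto intro: radial_clamp_id)
    then show ?thesis using v by (auto simp: v'_def Good_def intro: pid) (metis pid)
   qed
   ultimately show "\<exists>v'. Good r' v' \<and> (\<forall>w. norm w \<le> r \<longrightarrow> v' w = v w)" by blast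
  qed (use d in simp)
 qed
 have extend: "\<exists>v'. Good (real (Suc n)) v' \<and> (\<forall>w. norm w \<le> real n \<longrightarrow> v' w = v w)" if v: "Good (real n) v" for n v
 proof -
  obtain \<epsilon> where \<epsilon>: "\<epsilon> > 0" "\<And>r r' v. 0 \<le> r \<Longrightarrow> r \<le> r' \<Longrightarrow> r' \<le> real (Suc n) \<Longrightarrow> r' \<le> r + \<epsilon> \<Longrightarrow> Good r v \<Longrightarrow>
   \<exists>v'. Good r' v' \<and> (\<forall>w. norm w \<le> r \<longrightarrow> v' w = v w)" using step[of "real (Suc n)"] by blast
  obtain N :: nat where N: "real N > 1 / \<epsilon>" using reals_Archimedean2 by blast
  then have N0: "N > 0" using \<epsilon>(1) by (auto intro: gr0I simp: field_simps)
  have N1: "1 / real N \<le> \<epsilon>" using N N0 \<epsilon>(1) by (simp add: field_simps)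
  have "\<exists>v'. Good (real n + real k / real N) v' \<and> (\<forall>w. norm w \<le> real n \<longrightarrow> v' w = v w)" if "k \<le> N" for k
   using that
  proof (induction k)
   case 0 then show ?case using v by auto
  next
   case (Suc k)
   then obtain u where u: "Good (real n + real k / real N) u" "\<forall>w. norm w \<le> real n \<longrightarrow> u w = v w" by auto
   have a: "real (Suc k) / real N = real k / real N + 1 / real N" by (simp add: add_divide_distrib)
   have b: "real (Suc k) / real N \<le> 1" using Suc.prems N0 by (simp add: divide_le_eq)
   have "\<exists>v'. Good (real n + real (Suc k) / real N) v' \<and> (\<forall>w. norm w \<le> real n + real k / real N \<longrightarrow> v' w = u w)"
    by (rule \<epsilon>(2)[OF _ _ _ _ u(1)]) (use a b N1 N0 in \<open>auto simp: divide_right_mono\<close>)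
   then obtain v' where v': "Good (real n + real (Suc k) / real N) v'" "\<forall>w. norm w \<le> real n + real k / real N \<longrightarrow> v' w = u w"
    by blast
   have "v' w = v w" if "norm w \<le> real n" for w
   proof -
    have "norm w \<le> real n + real k / real N" using that by (simp add: add_increasing2)
    then show ?thesis using v'(2) u(2) that by simp
   qed
   then show ?case using v'(1) by blast
  qed
  from this[of N] N0 show ?thesis by (simp add: add.commute)
 qed
 obtain x0 where x0: "x0 \<noteq> 0" "l 0 = complex_line x0" using mem[of 0] by (auto simp: CP1_def)
 have x0l: "x0 \<in> l 0" unfolding x0(2) by (rule complex_line_self)
 have "Good 0 (\<lambda>_. x0)" using x0 x0l by (auto simp: Good_def radial_clamp_def)
 then have "\<exists>V. \<forall>n. Good (real n) (V n) \<and> (\<forall>w. norm w \<le> real n \<longrightarrow> V (Suc n) w = V n w)"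
  by (intro dependent_nat_choice[where P = "\<lambda>n v. Good (real n) v" and Q = "\<lambda>n v v'. \<forall>w. norm w \<le> real n \<longrightarrow> v' w = v w"])
   (use extend in auto)
 then obtain V where V: "\<And>n. Good (real n) (V n)" "\<And>n w. norm w \<le> real n \<Longrightarrow> V (Suc n) w = V n w" by blast
 have Vge: "V m w = V n w" if "norm w \<le> real n" "n \<le> m" for m n w
  using that(2)
 proof (induction m rule: dec_induct)
  case (step m)
  then have "norm w \<le> real m" using that(1) by simp
  then show ?case using V(2) step by simp
 qed simp
 define v where "v w = V (nat \<lceil>norm w\<rceil>) w" for w
 have v_eq: "v w = V n w" if "norm w \<le> real n" for w n
 proof -
  have "nat \<lceil>norm w\<rceil> \<le> n" unfolding nat_le_iff ceiling_le_iff using that by simp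
  moreover have "norm w \<le> real (nat \<lceil>norm w\<rceil>)" by linarith
  ultimately show ?thesis unfolding v_def by (intro Vge[symmetric])
 qed
 show ?thesis
 proof (rule that)
  show "continuous_on UNIV v"
  proof (rule continuous_at_imp_continuous_on, rule ballI)
   fix w :: "real^2"
   obtain n where n: "real n > norm w" using reals_Archimedean2 by blast
   have "continuous_on (ball 0 (real n)) (V n)" using V(1)[of n] by (auto simp: Good_def intro: continuous_on_subset)
   then have "continuous_on (ball 0 (real n)) v"
    by (rule continuous_on_eq) (auto intro!: v_eq[symmetric])
   then show "isCont v w" using n by (simp add: continuous_on_eq_continuous_at)
  qed
  fix w :: "real^2"
  obtain n where n: "real n > norm w" using reals_Archimedean2 by blast
  have "V n w \<in> l (radial_clamp (real n) w) \<and> V n w \<noteq> 0" using V(1)[of n] by (auto simp: Good_def)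
  then show "v w \<in> l w" "v w \<noteq> 0" using n v_eq[of w n] radial_clamp_id[of w "real n"] by auto
 qed
qed

text \<open>Additive coboundaries in one lattice direction: cut the function into a part supported to
 the right and one to the left, and sum each over the translates that do not see it.\<close>

lemma additive_coboundary:
 fixes \<phi> :: "real^2 \<Rightarrow> real"
 assumes \<phi>: "continuous_on UNIV \<phi>"
 shows "\<exists>\<theta>. continuous_on UNIV \<theta> \<and> (\<forall>w. \<theta> (w + axis j 1) - \<theta> w = \<phi> w) \<and>
  (\<forall>i. i \<noteq> j \<longrightarrow> (\<forall>w. \<phi> (w + axis i 1) = \<phi> w) \<longrightarrow> (\<forall>w. \<theta> (w + axis i 1) = \<theta> w))"
proof -
 define \<rho> where "\<rho> x = max 0 (min 1 x)" for x :: real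
 define e where "e = (axis j 1 :: real^2)"
 have ej: "e $ j = 1" by (simp add: e_def)
 define f where "f w = \<phi> w * \<rho> (w $ j)" for w
 define g where "g w = \<phi> w * (1 - \<rho> (w $ j))" for w
 have fc: "continuous_on UNIV f" and gc: "continuous_on UNIV g"
  unfolding f_def[abs_def] g_def[abs_def] \<rho>_def by (intro continuous_intros \<phi>)+
 have f0: "f w = 0" if "w $ j \<le> 0" for w using that by (simp add: f_def \<rho>_def)
 have g0: "g w = 0" if "w $ j \<ge> 1" for w using that by (simp add: g_def \<rho>_def)
 \<comment> \<open>only finitely many terms are nonzero near a given point\<close>
 define S where "S N w = (\<Sum>n<N. f (w - real (Suc n) *\<^sub>R e)) - (\<Sum>n<N. g (w + real n *\<^sub>R e))" for N w
 have S_eq: "S M w = S N w" if "N \<le> M" "\<bar>w $ j\<bar> + 1 \<le> real N" for M N w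
  using that(1)
 proof (induction M rule: dec_induct)
  case (step M)
  have "real N \<le> real M" using step by simp
  then have "f (w - real (Suc M) *\<^sub>R e) = 0" "g (w + real M *\<^sub>R e) = 0"
   using that(2) by (auto intro!: f0 g0 simp: ej)
  then show ?case using step by (simp add: S_def)
 qed simp
 define \<theta> where "\<theta> w = S (nat \<lceil>\<bar>w $ j\<bar> + 1\<rceil>) w" for w
 have \<theta>_eq: "\<theta> w = S N w" if "\<bar>w $ j\<bar> + 1 \<le> real N" for w N
 proof -
  have "nat \<lceil>\<bar>w $ j\<bar> + 1\<rceil> \<le> N" unfolding nat_le_iff ceiling_le_iff using that by simp
  moreover have "\<bar>w $ j\<bar> + 1 \<le> real (nat \<lceil>\<bar>w $ j\<bar> + 1\<rceil>)" by linarith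
  ultimately show ?thesis unfolding \<theta>_def by (intro S_eq[symmetric])
 qed
 have Sc: "continuous_on UNIV (S N)" for N unfolding S_def[abs_def]
  by (intro continuous_intros continuous_on_compose2[OF fc] continuous_on_compose2[OF gc]) auto
 show ?thesis
 proof (intro exI[of _ \<theta>] conjI allI impI)
  show "continuous_on UNIV \<theta>"
  proof (rule continuous_at_imp_continuous_on, rule ballI)
   fix w :: "real^2"
   obtain N where N: "real N > \<bar>w $ j\<bar> + 1" using reals_Archimedean2 by blast
   define T where "T = {w::real^2. \<bar>w $ j\<bar> + 1 < real N}"
   have "open T" unfolding T_def by (intro open_Collect_less continuous_intros)
   moreover have "continuous_on T \<theta>"
    by (rule continuous_on_eq[OF continuous_on_subset[OF Sc[of N]]]) (auto simp: T_def intro!: \<theta>_eq[symmetric])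
   moreover have "w \<in> T" using N by (simp add: T_def)
   ultimately show "isCont \<theta> w" by (simp add: continuous_on_eq_continuous_at)
  qed
  show "\<theta> (w + axis j 1) - \<theta> w = \<phi> w" for w
  proof -
   obtain N where N: "real N > \<bar>w $ j\<bar> + 2" using reals_Archimedean2 by blast
   have "\<bar>(w + e) $ j\<bar> + 1 \<le> real N" using N ej by simp
   then have 1: "\<theta> (w + e) = S N (w + e)" by (rule \<theta>_eq)
   have 2: "\<theta> w = S N w" using N by (intro \<theta>_eq) simp
   have "(w + e) - real (Suc n) *\<^sub>R e = w - real n *\<^sub>R e" "(w + e) + real n *\<^sub>R e = w + real (Suc n) *\<^sub>R e" for n
    by (simp_all add: algebra_simps)
   note sh = this
   have "S N (w + e) - S N w = ((\<Sum>n<N. f (w - real n *\<^sub>R e)) - (\<Sum>n<N. f (w - real (Suc n) *\<^sub>R e)))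
     - ((\<Sum>n<N. g (w + real (Suc n) *\<^sub>R e)) - (\<Sum>n<N. g (w + real n *\<^sub>R e)))"
    unfolding S_def sh by simp
   also have "(\<Sum>n<N. f (w - real n *\<^sub>R e)) - (\<Sum>n<N. f (w - real (Suc n) *\<^sub>R e)) = f w - f (w - real N *\<^sub>R e)"
    unfolding sum_subtractf[symmetric] by (subst sum_lessThan_telescope') simp
   also have "(\<Sum>n<N. g (w + real (Suc n) *\<^sub>R e)) - (\<Sum>n<N. g (w + real n *\<^sub>R e)) = g (w + real N *\<^sub>R e) - g w"
    unfolding sum_subtractf[symmetric] by (subst sum_lessThan_telescope) simp
   also have "f (w - real N *\<^sub>R e) = 0" using N ej by (intro f0) simp
   also have "g (w + real N *\<^sub>R e) = 0" using N ej by (intro g0) simp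
   also have "f w - 0 - (0 - g w) = \<phi> w" by (simp add: f_def g_def algebra_simps)
   finally show ?thesis using 1 2 by (simp add: e_def)
  qed
  show "\<theta> (w + axis i 1) = \<theta> w" if "i \<noteq> j" "\<forall>w. \<phi> (w + axis i 1) = \<phi> w" for i w
  proof -
   have c: "(w + axis i 1) $ j = w $ j" for w :: "real^2" using that(1) by (simp add: axis_def)
   have "f (w + axis i 1) = f w" "g (w + axis i 1) = g w" for w
    using that(2) unfolding f_def g_def c by auto
   then have "f (w + axis i 1 - x) = f (w - x)" "g (w + axis i 1 + x) = g (w + x)" for x
    by (metis add_diff_eq diff_add_eq add.commute, metis add.assoc add.commute)
   then show ?thesis unfolding \<theta>_def c S_def by simp
  qed
 qed
qed

lemma integer_valued_constant:
 fixes f :: "'a::real_normed_vector \<Rightarrow> complex"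
 assumes cont: "continuous_on UNIV f" and int: "\<And>w. \<exists>n::int. f w = of_int n"
 obtains n :: int where "\<And>w. f w = of_int n"
proof -
 have "f constant_on UNIV"
 proof (rule continuous_discrete_range_constant[OF connected_UNIV cont])
  fix x
  have "1 \<le> norm (f y - f x)" if "f y \<noteq> f x" for y
  proof -
   obtain a b where "f y = of_int a" "f x = of_int b" using int by metis
   moreover from this have "a \<noteq> b" using that by auto
   ultimately show ?thesis
    by (metis eq_iff_diff_eq_0 norm_of_int of_int_1_le_iff of_int_abs of_int_diff zero_less_abs_iff int_one_le_iff_zero_less)
  qed
  then show "\<exists>e>0. \<forall>y. y \<in> UNIV \<and> f y \<noteq> f x \<longrightarrow> e \<le> norm (f y - f x)"
   by (intro exI[of _ 1]) auto
 qed
 then obtain c where c: "\<And>w. f w = c" by (auto simp: constant_on_def)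
 then show ?thesis using int[of 0] that by metis
qed

lemma exp_2pi_eq_1: "exp (2 * of_real pi * \<i> * z) = 1 \<Longrightarrow> \<exists>n::int. z = of_int n"
 using exp_eq_1[of "2 * of_real pi * \<i> * z"] by (force simp: complex_eq_iff)

lemma continuous_phase:
 fixes f :: "real^2 \<Rightarrow> complex"
 assumes "continuous_on UNIV f" "\<And>w. norm (f w) = 1"
 obtains \<phi> :: "real^2 \<Rightarrow> real" where "continuous_on UNIV \<phi>" "\<And>w. f w = exp (2 * of_real pi * \<i> * of_real (\<phi> w))"
proof -
 have "f w \<noteq> 0" for w using assms(2)[of w] by auto
 then obtain h where h: "continuous_on UNIV h" "\<And>w. f w = exp (h w)"
  using continuous_logarithm_on_contractible[OF assms(1) convex_imp_contractible] by auto
 have "Re (h w) = 0" for w using assms(2)[of w] by (simp add: h(2))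
 then have eq: "2 * of_real pi * \<i> * of_real (Im (h w) / (2 * pi)) = h w" for w by (simp add: complex_eq_iff)
 show ?thesis
 proof (rule that)
  show "continuous_on UNIV (\<lambda>w. Im (h w) / (2 * pi))" by (intro continuous_intros h) auto
  show "f w = exp (2 * of_real pi * \<i> * of_real (Im (h w) / (2 * pi)))" for w unfolding eq by (rule h(2))
 qed
qed

text \<open>A logarithm on the plane changes by integer multiples of \<open>2 \<pi> \<i>\<close> under the lattice; these constants are the winding.\<close>

lemma continuous_winding:
 fixes f :: "real^2 \<Rightarrow> complex"
 assumes f: "continuous_on UNIV f" "\<And>w. f w \<noteq> 0" and per: "\<And>j w. f (w + axis j 1) = f w"
 obtains k h where "continuous_on UNIV h" "\<And>j w. h (w + axis j 1) = h w"
  "\<And>w. f w = exp (2 * of_real pi * \<i> * of_real (lattice_dot k w) + h w)"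
proof -
 obtain \<eta> where \<eta>: "continuous_on UNIV \<eta>" "\<And>w. f w = exp (\<eta> w)"
  using continuous_logarithm_on_contractible[OF f(1) convex_imp_contractible] f(2) by auto
 have "\<exists>n::int. \<forall>w. \<eta> (w + axis j 1) - \<eta> w = 2 * of_real pi * \<i> * of_int n" for j
 proof -
  have "continuous_on UNIV (\<lambda>w. (\<eta> (w + axis j 1) - \<eta> w) / (2 * of_real pi * \<i>))"
   by (intro continuous_intros \<eta> continuous_on_compose2[OF \<eta>(1)]) auto
  moreover have "\<exists>n::int. (\<eta> (w + axis j 1) - \<eta> w) / (2 * of_real pi * \<i>) = of_int n" for w
  proof (rule exp_2pi_eq_1)
   have "exp (\<eta> (w + axis j 1) - \<eta> w) = 1" using per[of w j] f(2)[of w] by (simp add: exp_diff \<eta>(2))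
   then show "exp (2 * of_real pi * \<i> * ((\<eta> (w + axis j 1) - \<eta> w) / (2 * of_real pi * \<i>))) = 1" by simp
  qed
  ultimately obtain n :: int where "\<And>w. (\<eta> (w + axis j 1) - \<eta> w) / (2 * of_real pi * \<i>) = of_int n"
   by (rule integer_valued_constant) blast
  then show ?thesis by (intro exI[of _ n]) (simp add: divide_eq_eq mult.commute)
 qed
 then obtain n where n: "\<And>j w. \<eta> (w + axis j 1) - \<eta> w = 2 * of_real pi * \<i> * of_int (n j)" by metis
 define k :: "int^2" where "k = (\<chi> j. n j)"
 define h where "h w = \<eta> w - 2 * of_real pi * \<i> * of_real (lattice_dot k w)" for w
 show ?thesis
 proof (rule that)
  show "continuous_on UNIV h" unfolding h_def lattice_dot_def by (intro continuous_intros \<eta>)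
  show "f w = exp (2 * of_real pi * \<i> * of_real (lattice_dot k w) + h w)" for w by (simp add: h_def \<eta>(2))
  show "h (w + axis j 1) = h w" for j w
  proof -
   have "lattice_dot k (w + axis j 1) = lattice_dot k w + of_int (n j)"
    using exhaust_2[of j] by (auto simp: lattice_dot_def UNIV_2 axis_def k_def algebra_simps)
   then show ?thesis using n[of w j] by (simp add: h_def algebra_simps)
  qed
 qed
qed

lemma lattice_dot_axis: "lattice_dot k (w + axis j 1) = lattice_dot k w + of_int (k $ j)"
 using exhaust_2[of j] by (auto simp: lattice_dot_def UNIV_2 axis_def algebra_simps)

lemma winding_unique:
 assumes h: "continuous_on UNIV h" "\<And>j w. h (w + axis j 1) = h w" "continuous_on UNIV h'" "\<And>j w. h' (w + axis j 1) = h' w"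
  and eq: "\<And>w. exp (2 * of_real pi * \<i> * of_real (lattice_dot k w) + h w) = exp (2 * of_real pi * \<i> * of_real (lattice_dot k' w) + h' w)"
 obtains n :: int where "k = k'" "\<And>w. h w = h' w + 2 * of_real pi * \<i> * of_int n"
proof -
 define D where "D w = of_real (lattice_dot k w - lattice_dot k' w) + (h w - h' w) / (2 * of_real pi * \<i>)" for w
 have "continuous_on UNIV D" unfolding D_def[abs_def] lattice_dot_def by (intro continuous_intros h) auto
 moreover have "\<exists>n::int. D w = of_int n" for w
 proof (rule exp_2pi_eq_1)
  have "2 * of_real pi * \<i> * D w = (2 * of_real pi * \<i> * of_real (lattice_dot k w) + h w) - (2 * of_real pi * \<i> * of_real (lattice_dot k' w) + h' w)"
   by (simp add: D_def field_simps)
  then show "exp (2 * of_real pi * \<i> * D w) = 1" by (simp only: exp_diff eq) simp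
 qed
 ultimately obtain n :: int where n: "\<And>w. D w = of_int n" by (rule integer_valued_constant) blast
 have "k $ j = k' $ j" for j
 proof -
  have "D (0 + axis j 1) - D 0 = of_int (k $ j - k' $ j)"
   unfolding D_def lattice_dot_axis h by (simp add: algebra_simps)
  then show ?thesis using n by simp
 qed
 then have k: "k = k'" by (simp add: vec_eq_iff)
 have "h w = h' w + 2 * of_real pi * \<i> * of_int n" for w
  using n[of w] unfolding D_def k by (simp add: field_simps)
 then show ?thesis using that k by blast
qed

lemma invariant_line_CP1: "invariant_line \<tau> U A l \<Longrightarrow> l w \<in> CP1"
 unfolding invariant_line_def using continuous_map_image_subset_topspace[of euclidean CP1_topology l]
 by (auto simp: topspace_CP1)

lemma unitary_norm: "unitary_matrix M \<Longrightarrow> norm (M *v x) = norm (x :: complex^2)"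
proof -
 assume M: "unitary_matrix M"
 have adj: "herm_inner (M *v x) y = herm_inner x (conj_transpose M *v y)" for y
  by (simp add: herm_inner_def matrix_vector_mult_def conj_transpose_def UNIV_2 algebra_simps)
 have "herm_inner (M *v x) (M *v x) = herm_inner x x"
  using M unfolding adj by (simp add: unitary_matrix_def matrix_vector_mul_assoc)
 then have "complex_of_real ((norm (M *v x))\<^sup>2) = of_real ((norm x)\<^sup>2)" by (simp only: herm_inner_self)
 then show ?thesis by (metis norm_ge_zero of_real_eq_iff power2_eq_iff_nonneg)
qed

lemma det_nz_mult_nz: "det (M :: complex^2^2) \<noteq> 0 \<Longrightarrow> x \<noteq> 0 \<Longrightarrow> M *v x \<noteq> 0"
 by (metis invertible_det_nz invertible_def matrix_vector_mul_assoc matrix_vector_mul_lid matrix_zero_vec)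

lemma unitary_nz: "unitary_matrix M \<Longrightarrow> x \<noteq> 0 \<Longrightarrow> M *v x \<noteq> (0 :: complex^2)"
 by (metis norm_eq_zero unitary_norm)

abbreviation twist :: "int \<Rightarrow> real^2 \<Rightarrow> complex" where
 "twist m w \<equiv> exp (2 * pi * \<i> * of_int m * w $ 1)"

text \<open>Every invariant line has a normalized unit section: logarithms of the transition phases of any
 unit section satisfy a cocycle identity up to an integer, and two coboundaries remove everything
 except the linear term carrying that integer.\<close>

lemma normalized_unit_section_exists:
 assumes U: "sewing_system U" and l: "continuous_map euclidean CP1_topology l"
  and inv: "\<And>j w. l (w + axis j 1) = (\<lambda>v. U j w *v v) ` l w"
 obtains e m where "normalized_unit_section U l e m"
proof -
 have mem: "l w \<in> CP1" for w using continuous_map_image_subset_topspace[OF l] by (auto simp: topspace_CP1)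
 obtain v where v: "continuous_on UNIV v" "\<And>w. v w \<in> l w" "\<And>w. v w \<noteq> 0"
  by (rule continuous_section_exists[OF l]) blast
 define e0 where "e0 w = (1 / of_real (norm (v w))) *s v w" for w
 have e0c: "continuous_on UNIV e0" unfolding e0_def[abs_def] using v by (intro continuous_intros) auto
 have e0n: "norm (e0 w) = 1" for w using v(3) by (simp add: e0_def norm_smult norm_divide)
 have e0l: "e0 w \<in> l w" for w using v(2) mem by (simp add: e0_def CP1_smult)
 have Un: "unitary_matrix (U j w)" and Uc: "continuous_on UNIV (U j)" for j w
  using U by (auto simp: sewing_system_def)
 define \<zeta> where "\<zeta> j w = herm_inner (U j w *v e0 w) (e0 (w + axis j 1))" for j w
 have trans: "e0 (w + axis j 1) = \<zeta> j w *s (U j w *v e0 w)" for j w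
 proof -
  have n1: "norm (U j w *v e0 w) = 1" using unitary_norm[OF Un] e0n by simp
  have "U j w *v e0 w \<in> l (w + axis j 1)" using inv e0l by blast
  then obtain c where c: "e0 (w + axis j 1) = c *s (U j w *v e0 w)"
   using CP1_multiple[OF mem e0l] n1 by (metis norm_zero zero_neq_one)
  have "\<zeta> j w = c" unfolding \<zeta>_def c herm_inner_smult herm_inner_self n1 by simp
  then show ?thesis using c by simp
 qed
 have \<zeta>n: "norm (\<zeta> j w) = 1" for j w
  using arg_cong[OF trans[of w j], of norm] by (simp add: norm_smult e0n unitary_norm[OF Un])
 have \<zeta>c: "continuous_on UNIV (\<zeta> j)" for j
  unfolding \<zeta>_def[abs_def] by (intro continuous_intros e0c Uc continuous_on_compose2[OF e0c]) auto
 have "\<exists>\<phi>. continuous_on UNIV \<phi> \<and> (\<forall>w. \<zeta> j w = exp (2 * of_real pi * \<i> * of_real (\<phi> w)))" for j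
  by (rule continuous_phase[OF \<zeta>c \<zeta>n, of j]) blast
 then obtain \<phi> where \<phi>: "\<And>j. continuous_on UNIV (\<phi> j)" "\<And>j w. \<zeta> j w = exp (2 * of_real pi * \<i> * of_real (\<phi> j w))"
  by metis
 define D where "D w = \<phi> 2 (w + axis 1 1) + \<phi> 1 w - \<phi> 1 (w + axis 2 1) - \<phi> 2 w" for w
 have \<zeta>K: "\<zeta> 1 (w + axis 2 1) * \<zeta> 2 w = \<zeta> 2 (w + axis 1 1) * \<zeta> 1 w" for w
 proof -
  define x where "x = U 2 (w + axis 1 1) *v (U 1 w *v e0 w)"
  have K: "U 1 (w + axis 2 1) *v (U 2 w *v e0 w) = x"
  proof -
   have "U 1 (w + axis 2 1) ** U 2 w = U 2 (w + axis 1 1) ** U 1 w" using U by (simp add: sewing_system_def)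
   then show ?thesis unfolding x_def by (simp add: matrix_vector_mul_assoc)
  qed
  have "e0 w \<noteq> 0" using e0n[of w] by auto
  then have x0: "x \<noteq> 0" unfolding x_def by (intro unitary_nz Un)
  have "(\<zeta> 1 (w + axis 2 1) * \<zeta> 2 w) *s x = e0 (w + axis 2 1 + axis 1 1)"
   unfolding trans matrix_smult_vec K by (simp add: vector_smult_assoc)
  also have "\<dots> = e0 (w + axis 1 1 + axis 2 1)" by (simp add: add_ac)
  also have "\<dots> = (\<zeta> 2 (w + axis 1 1) * \<zeta> 1 w) *s x"
   unfolding trans matrix_smult_vec x_def by (simp add: vector_smult_assoc)
  finally show ?thesis using x0 by simp
 qed
 have "continuous_on UNIV (\<lambda>w. complex_of_real (D w))"
  unfolding D_def by (intro continuous_intros \<phi> continuous_on_compose2[OF \<phi>(1)]) auto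
 moreover have "\<exists>n::int. complex_of_real (D w) = of_int n" for w
 proof (rule exp_2pi_eq_1)
  have "exp (2 * of_real pi * \<i> * complex_of_real (D w)) * (\<zeta> 1 (w + axis 2 1) * \<zeta> 2 w) = \<zeta> 2 (w + axis 1 1) * \<zeta> 1 w"
   by (simp add: \<phi>(2) D_def exp_add[symmetric] algebra_simps)
  then show "exp (2 * of_real pi * \<i> * complex_of_real (D w)) = 1"
   using \<zeta>K[of w] by (simp add: \<phi>(2))
 qed
 ultimately obtain m :: int where "\<And>w. complex_of_real (D w) = of_int m"
  by (rule integer_valued_constant) blast
 then have m: "D w = of_int m" for w by (metis of_real_eq_iff of_real_of_int_eq)
 obtain \<theta>1 where \<theta>1: "continuous_on UNIV \<theta>1" "\<And>w. \<theta>1 (w + axis 1 1) - \<theta>1 w = - \<phi> 1 w"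
  using additive_coboundary[OF continuous_on_minus[OF \<phi>(1)[of 1]], of 1] by blast
 define \<phi>' where "\<phi>' w = \<phi> 2 w + \<theta>1 (w + axis 2 1) - \<theta>1 w - of_int m * w $ 1" for w
 have \<phi>'c: "continuous_on UNIV (\<lambda>w. - \<phi>' w)" unfolding \<phi>'_def
  by (intro continuous_intros \<phi> \<theta>1 continuous_on_compose2[OF \<theta>1(1)]) auto
 have \<phi>'p: "- \<phi>' (w + axis 1 1) = - \<phi>' w" for w
 proof -
  have "\<theta>1 (w + axis 1 1 + axis 2 1) = \<theta>1 (w + axis 2 1) - \<phi> 1 (w + axis 2 1)"
   using \<theta>1(2)[of "w + axis 2 1"] by (simp add: add_ac)
  moreover have "\<theta>1 (w + axis 1 1) = \<theta>1 w - \<phi> 1 w" using \<theta>1(2)[of w] by simp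
  moreover have "(w + axis 1 1) $ 1 = w $ 1 + 1" by (simp add: axis_def)
  ultimately show ?thesis using m[of w] unfolding \<phi>'_def D_def by (simp add: algebra_simps)
 qed
 obtain \<theta>2 where \<theta>2: "continuous_on UNIV \<theta>2" "\<And>w. \<theta>2 (w + axis 2 1) - \<theta>2 w = - \<phi>' w"
   "\<forall>i. i \<noteq> 2 \<longrightarrow> (\<forall>w. - \<phi>' (w + axis i 1) = - \<phi>' w) \<longrightarrow> (\<forall>w. \<theta>2 (w + axis i 1) = \<theta>2 w)"
  using additive_coboundary[OF \<phi>'c, of 2] by blast
 have "(1::2) \<noteq> 2" by simp
 then have \<theta>2p: "\<theta>2 (w + axis 1 1) = \<theta>2 w" for w using \<theta>2(3) \<phi>'p by blast
 define \<theta> where "\<theta> w = \<theta>1 w + \<theta>2 w" for w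
 define e where "e w = exp (2 * of_real pi * \<i> * of_real (\<theta> w)) *s e0 w" for w
 have etr: "e (w + axis j 1) = exp (2 * of_real pi * \<i> * of_real (\<theta> (w + axis j 1) - \<theta> w + \<phi> j w)) *s (U j w *v e w)" for w j
  unfolding e_def trans matrix_smult_vec by (simp add: vector_smult_assoc \<phi>(2) exp_add[symmetric] algebra_simps)
 have "normalized_unit_section U l e m"
  unfolding normalized_unit_section_def
 proof (intro conjI allI)
  show "continuous_on UNIV e" unfolding e_def[abs_def] \<theta>_def by (intro continuous_intros \<theta>1 \<theta>2 e0c)
  fix w
  show "norm (e w) = 1" by (simp add: e_def norm_smult e0n)
  show "e w \<in> l w" by (simp add: e_def CP1_smult mem e0l)
  have "\<theta> (w + axis 1 1) - \<theta> w + \<phi> 1 w = 0" using \<theta>1(2)[of w] \<theta>2p[of w] by (simp add: \<theta>_def)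
  then show "e (w + axis 1 1) = U 1 w *v e w" using etr[of w 1] by simp
  have "\<theta> (w + axis 2 1) - \<theta> w + \<phi> 2 w = of_int m * w $ 1"
   using \<theta>2(2)[of w] by (simp add: \<theta>_def \<phi>'_def)
  then show "e (w + axis 2 1) = twist m w *s (U 2 w *v e w)"
   using etr[of w 2] by (simp add: mult.assoc)
 qed
 then show ?thesis by (rule that)
qed

lemma unit_section_props:
 assumes "normalized_unit_section U l e m"
 shows "norm (e w) = 1" "e w \<noteq> 0" "e w \<in> l w" "continuous_on UNIV e"
  "e (w + axis 1 1) = U 1 w *v e w" "e (w + axis 2 1) = twist m w *s (U 2 w *v e w)"
 using assms unfolding normalized_unit_section_def by (auto dest: spec[of _ w])

lemma multiplier_props:
 assumes A: "equivariant_cocycle \<tau> U A" and U: "sewing_system U" and l: "invariant_line \<tau> U A l" and e: "normalized_unit_section U l e m"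
 shows "A w *v e w = multiplier \<tau> A e w *s e (w + \<tau>)"
  and "multiplier \<tau> A e w \<noteq> 0"
  and "continuous_on UNIV (multiplier \<tau> A e)"
  and "multiplier \<tau> A e (w + axis 1 1) = multiplier \<tau> A e w"
  and "multiplier \<tau> A e (w + axis 2 1) = exp (- (2 * pi * \<i> * of_int m * \<tau> $ 1)) * multiplier \<tau> A e w"
  and "norm (A w *v e w) = norm (multiplier \<tau> A e w)"
proof -
 note en = unit_section_props[OF e]
 have q: "A w *v e w = multiplier \<tau> A e w *s e (w + \<tau>)" for w
 proof -
  have "A w *v e w \<in> l (w + \<tau>)" using l en(3)[of w] unfolding invariant_line_def by blast
  then obtain c where c: "A w *v e w = c *s e (w + \<tau>)"
   using CP1_multiple[OF invariant_line_CP1[OF l] _ en(3) en(2)] by blast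
  have "multiplier \<tau> A e w = c" by (simp add: multiplier_def c herm_inner_smult herm_inner_self en(1))
  then show ?thesis using c by simp
 qed
 have Ad: "det (A w) \<noteq> 0" for w using A by (simp add: equivariant_cocycle_def)
 have K2: "A (w + axis j 1) *v (U j w *v x) = U j (w + \<tau>) *v (A w *v x)" for j w x
  using A unfolding equivariant_cocycle_def by (metis matrix_vector_mul_assoc)
 have Un: "unitary_matrix (U j w)" for j w using U by (simp add: sewing_system_def)
 show "A w *v e w = multiplier \<tau> A e w *s e (w + \<tau>)" by (rule q)
 show "multiplier \<tau> A e w \<noteq> 0"
 proof
  assume "multiplier \<tau> A e w = 0"
  then have "A w *v e w = 0" using q[of w] by simp
  then show False using det_nz_mult_nz[OF Ad en(2)] by blast
 qed
 show "continuous_on UNIV (multiplier \<tau> A e)"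
  unfolding multiplier_def[abs_def] using A
  by (intro continuous_intros continuous_on_compose2[OF en(4)] en(4)) (auto simp: equivariant_cocycle_def)
 show "norm (A w *v e w) = norm (multiplier \<tau> A e w)" unfolding q norm_smult en(1) by simp
 show "multiplier \<tau> A e (w + axis 1 1) = multiplier \<tau> A e w"
 proof -
  have "multiplier \<tau> A e (w + axis 1 1) *s e (w + axis 1 1 + \<tau>) = U 1 (w + \<tau>) *v (A w *v e w)"
   unfolding q[symmetric] en(5) by (rule K2)
  also have "\<dots> = multiplier \<tau> A e w *s e (w + \<tau> + axis 1 1)" unfolding q matrix_smult_vec en(5) ..
  also have "w + \<tau> + axis 1 1 = w + axis 1 1 + \<tau>" by simp
  finally show ?thesis using en(2) by simp
 qed
 show "multiplier \<tau> A e (w + axis 2 1) = exp (- (2 * pi * \<i> * of_int m * \<tau> $ 1)) * multiplier \<tau> A e w"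
 proof -
  have "multiplier \<tau> A e (w + axis 2 1) *s e (w + axis 2 1 + \<tau>) = twist m w *s (U 2 (w + \<tau>) *v (A w *v e w))"
   unfolding q[symmetric] en(6) matrix_smult_vec K2 ..
  also have "\<dots> = (twist m w * multiplier \<tau> A e w) *s (U 2 (w + \<tau>) *v e (w + \<tau>))"
   unfolding q matrix_smult_vec by (simp add: vector_smult_assoc)
  finally have "multiplier \<tau> A e (w + axis 2 1) *s e (w + \<tau> + axis 2 1) = (twist m w * multiplier \<tau> A e w) *s (U 2 (w + \<tau>) *v e (w + \<tau>))"
   by (simp add: add_ac)
  then have "(multiplier \<tau> A e (w + axis 2 1) * exp (2 * pi * \<i> * of_int m * (w + \<tau>) $ 1)) *s (U 2 (w + \<tau>) *v e (w + \<tau>)) =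
    (twist m w * multiplier \<tau> A e w) *s (U 2 (w + \<tau>) *v e (w + \<tau>))"
   unfolding en(6) by (simp add: vector_smult_assoc)
  then have "multiplier \<tau> A e (w + axis 2 1) * exp (2 * pi * \<i> * of_int m * (w + \<tau>) $ 1) = twist m w * multiplier \<tau> A e w"
   using unitary_nz[OF Un en(2)] by simp
  moreover have "exp (2 * pi * \<i> * of_int m * (w + \<tau>) $ 1) = twist m w * exp (2 * pi * \<i> * of_int m * \<tau> $ 1)"
   by (simp add: exp_add[symmetric] algebra_simps)
  ultimately have "multiplier \<tau> A e (w + axis 2 1) * exp (2 * pi * \<i> * of_int m * \<tau> $ 1) = multiplier \<tau> A e w"
   by simp
  then show ?thesis by (simp add: exp_minus field_simps)
 qed
qed

lemma norm_multiplier_periodic: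
 assumes "equivariant_cocycle \<tau> U A" "sewing_system U" "invariant_line \<tau> U A l" "normalized_unit_section U l e m"
 shows "norm (multiplier \<tau> A e (w + axis j 1)) = norm (multiplier \<tau> A e w)"
 using exhaust_2[of j] multiplier_props(4,5)[OF assms, of w] by (auto simp: norm_mult)

lemma periodic_phase_props:
 assumes "equivariant_cocycle \<tau> U A" "sewing_system U" "invariant_line \<tau> U A l" "normalized_unit_section U l e m"
 shows "continuous_on UNIV (periodic_phase \<tau> A e m)" "periodic_phase \<tau> A e m w \<noteq> 0"
  "norm (periodic_phase \<tau> A e m w) = 1"
  "periodic_phase \<tau> A e m (w + axis j 1) = periodic_phase \<tau> A e m w"
proof -
 note mp = multiplier_props[OF assms]
 show n: "norm (periodic_phase \<tau> A e m w) = 1" for w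
  using mp(2)[of w] by (simp add: periodic_phase_def norm_mult norm_divide)
 show "periodic_phase \<tau> A e m w \<noteq> 0" using n[of w] by auto
 show "continuous_on UNIV (periodic_phase \<tau> A e m)"
  unfolding periodic_phase_def[abs_def] using mp(2) by (intro continuous_intros mp(3)) auto
 show "periodic_phase \<tau> A e m (w + axis j 1) = periodic_phase \<tau> A e m w"
 proof (cases "j = 1")
  case True
  then show ?thesis by (simp add: periodic_phase_def mp(4)) (simp add: axis_def)
 next
  case False
  then have j: "j = 2" using exhaust_2[of j] by auto
  have "exp (- (2 * pi * \<i> * of_int m * \<tau> $ 1)) * exp (2 * pi * \<i> * of_int m * \<tau> $ 1 * (w + axis 2 1) $ 2) = exp (2 * pi * \<i> * of_int m * \<tau> $ 1 * w $ 2)"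
   by (simp add: exp_add[symmetric] axis_def algebra_simps)
  moreover have "norm (multiplier \<tau> A e (w + axis 2 1)) = norm (multiplier \<tau> A e w)"
   by (rule norm_multiplier_periodic[OF assms])
  ultimately show ?thesis unfolding j periodic_phase_def
   by (simp only: mp(5)) (simp add: mult.assoc mult.left_commute[of "exp (- _)"])
 qed
qed

lemma phase_representation_exists:
 assumes "equivariant_cocycle \<tau> U A" "sewing_system U" "invariant_line \<tau> U A l" "normalized_unit_section U l e m"
 obtains k g where "phase_representation (periodic_phase \<tau> A e m) k g"
proof -
 note pp = periodic_phase_props[OF assms]
 obtain k h where h: "continuous_on UNIV h" "\<And>j w. h (w + axis j 1) = h w"
  "\<And>w. periodic_phase \<tau> A e m w = exp (2 * of_real pi * \<i> * of_real (lattice_dot k w) + h w)"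
  by (rule continuous_winding[OF pp(1,2,4)]) blast
 define g where "g w = Im (h w) / (2 * pi)" for w
 have "Re (h w) = 0" for w using pp(3)[of w] by (simp add: h(3))
 then have hg: "h w = 2 * pi * \<i> * g w" for w by (simp add: g_def complex_eq_iff)
 have "phase_representation (periodic_phase \<tau> A e m) k g"
  unfolding phase_representation_def lattice_periodic_def
 proof (intro conjI allI)
  show "continuous_on UNIV g" unfolding g_def by (intro continuous_intros h) auto
  show "g (w + axis j 1) = g w" for j w by (simp add: g_def h(2))
  show "periodic_phase \<tau> A e m w = exp (2 * pi * \<i> * (lattice_dot k w + g w))" for w
   unfolding h(3) hg by (simp add: algebra_simps)
 qed
 then show ?thesis by (rule that)
qed

text \<open>Two normalized unit sections differ by a unimodular periodic factor. It changes the periodic phase by a coboundary, which has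
 no winding.\<close>

lemma winding_vector_eq:
 assumes A: "equivariant_cocycle \<tau> U A" "sewing_system U" "invariant_line \<tau> U A l"
  and e: "normalized_unit_section U l e m" and g: "phase_representation (periodic_phase \<tau> A e m) k g"
 shows "winding_vector \<tau> U A l = k"
 unfolding winding_vector_def
proof (rule the_equality)
 show "\<exists>e m g. normalized_unit_section U l e m \<and> phase_representation (periodic_phase \<tau> A e m) k g"
  using e g by blast
 fix k' assume "\<exists>e m g. normalized_unit_section U l e m \<and> phase_representation (periodic_phase \<tau> A e m) k' g"
 then obtain e' m' g' where e': "normalized_unit_section U l e' m'" and g': "phase_representation (periodic_phase \<tau> A e' m') k' g'"
  by blast
 have line: "l w \<in> CP1" for w by (rule invariant_line_CP1[OF A(3)])
 have mm: "m' = m"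
  using normalized_unit_section_imp_first_chern_number[OF line e] normalized_unit_section_imp_first_chern_number[OF line e'] by simp
 note en = unit_section_props[OF e] and en' = unit_section_props[OF e']
 define u where "u w = herm_inner (e w) (e' w)" for w
 have ue: "e' w = u w *s e w" for w
 proof -
  obtain c where c: "e' w = c *s e w" using CP1_multiple[OF line en'(3) en(3) en(2)] by blast
  then show ?thesis by (simp add: u_def c herm_inner_smult herm_inner_self en(1))
 qed
 have un: "norm (u w) = 1" for w using arg_cong[OF ue[of w], of norm] by (simp add: norm_smult en(1) en'(1))
 have u0: "u w \<noteq> 0" for w using un[of w] by auto
 have uc: "continuous_on UNIV u" unfolding u_def[abs_def] by (intro continuous_intros en(4) en'(4))
 have up: "u (w + axis j 1) = u w" for w j
 proof -
  have Un: "unitary_matrix (U j w)" for j w using A(2) by (simp add: sewing_system_def)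
  have "j = 1 \<or> j = 2" using exhaust_2 by blast
  then show ?thesis
  proof
   assume j: "j = 1"
   have "u (w + axis 1 1) *s (U 1 w *v e w) = u w *s (U 1 w *v e w)"
    using ue[of "w + axis 1 1"] unfolding en(5) en'(5) ue[of w] matrix_smult_vec by (rule sym)
   then show ?thesis unfolding j using unitary_nz[OF Un[of 1 w] en(2)[of w]] by (metis vector_mul_rcancel)
  next
   assume j: "j = 2"
   define E where "E = twist m w"
   have "E \<noteq> 0" by (simp add: E_def)
   have "(u (w + axis 2 1) * E) *s (U 2 w *v e w) = (u w * E) *s (U 2 w *v e w)"
    using ue[of "w + axis 2 1"] unfolding en(6) en'(6) mm E_def[symmetric] ue[of w] matrix_smult_vec vector_smult_assoc by (metis mult.commute)
   then show ?thesis unfolding j using unitary_nz[OF Un[of 2 w] en(2)[of w]] \<open>E \<noteq> 0\<close> by (metis vector_mul_rcancel mult_right_cancel)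
  qed
 qed
 obtain ku h where h: "continuous_on UNIV h" "\<And>j w. h (w + axis j 1) = h w"
  "\<And>w. u w = exp (2 * of_real pi * \<i> * of_real (lattice_dot ku w) + h w)"
  by (rule continuous_winding[OF uc u0 up]) blast
 have q: "multiplier \<tau> A e' w = cnj (u (w + \<tau>)) * u w * multiplier \<tau> A e w" for w
  by (simp add: multiplier_def ue matrix_smult_vec herm_inner_smult herm_inner_smult_left)
 have cu: "cnj (u w) = inverse (u w)" for w
  using un[of w] by (metis complex_norm_square inverse_unique mult.commute of_real_1 one_power2)
 have pq: "periodic_phase \<tau> A e' m' w = u w / u (w + \<tau>) * periodic_phase \<tau> A e m w" for w
  unfolding periodic_phase_def q mm by (simp add: norm_mult un cu divide_inverse norm_inverse mult_ac)
 note gd = g[unfolded phase_representation_def lattice_periodic_def] and gd' = g'[unfolded phase_representation_def lattice_periodic_def]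
 define H where "H w = 2 * of_real pi * \<i> * of_real (g w) + h w - h (w + \<tau>) - 2 * of_real pi * \<i> * of_real (lattice_dot ku \<tau>)" for w
 have "lattice_dot ku (w + \<tau>) = lattice_dot ku w + lattice_dot ku \<tau>" for w
  by (simp add: lattice_dot_def ring_distribs sum.distrib)
 then have eqH: "exp (2 * of_real pi * \<i> * of_real (lattice_dot k' w) + 2 * of_real pi * \<i> * of_real (g' w)) =
   exp (2 * of_real pi * \<i> * of_real (lattice_dot k w) + H w)" for w
 proof -
  have 1: "periodic_phase \<tau> A e' m' w = exp (2 * of_real pi * \<i> * of_real (lattice_dot k' w) + 2 * of_real pi * \<i> * of_real (g' w))"
   using gd' by (simp add: algebra_simps)
  have 2: "periodic_phase \<tau> A e m w = exp (2 * of_real pi * \<i> * of_real (lattice_dot k w) + 2 * of_real pi * \<i> * of_real (g w))"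
   using gd by (simp add: algebra_simps)
  show ?thesis
   unfolding 1[symmetric] pq 2 h(3) H_def \<open>\<And>w. lattice_dot ku (w + \<tau>) = _ w\<close>
   by (simp add: exp_diff[symmetric] exp_add[symmetric] algebra_simps)
 qed
 have hs: "h (w + axis j 1 + \<tau>) = h (w + \<tau>)" for w j using h(2)[of "w + \<tau>" j] by (simp add: add_ac)
 show "k' = k"
  by (rule winding_unique[of "\<lambda>w. 2 * of_real pi * \<i> * of_real (g' w)" H k' k, OF _ _ _ _ eqH])
   (use gd gd' h hs in \<open>auto simp: H_def[abs_def] intro!: continuous_intros continuous_on_compose2[OF h(1)]\<close>)
qed

section \<open>Analytic approximation of sections by averaging over the lattice\<close>

lemma le_exp_square: "\<bar>x\<bar> \<le> exp (x\<^sup>2)" for x :: real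
proof -
 have "\<bar>x\<bar> \<le> 1 + x\<^sup>2"
  using zero_le_power2[of "\<bar>x\<bar> - 1"] by (simp add: power2_eq_square algebra_simps)
 also have "\<dots> \<le> exp (x\<^sup>2)" by (rule exp_ge_add_one_self)
 finally show ?thesis .
qed

definition gauss :: "C2 \<Rightarrow> complex" where
 "gauss z = exp (- ((fst z)\<^sup>2 + (snd z)\<^sup>2))"

definition gauss_bound :: "C2 \<Rightarrow> real" where
 "gauss_bound z = exp (- (Re (fst z))\<^sup>2) * exp (- (Re (snd z))\<^sup>2)"

lemma sh_gauss: "strip_hol \<delta> gauss"
 unfolding gauss_def[abs_def] by (intro sh_exp sh_minus sh_add sh_power sh_fst sh_snd)

lemma norm_gauss:
 assumes "z \<in> strip 1" shows "norm (gauss z) \<le> exp 2 * gauss_bound z"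
proof -
 have "(Im (fst z))\<^sup>2 \<le> 1" "(Im (snd z))\<^sup>2 \<le> 1"
  using assms by (auto simp: strip_iff abs_square_le_1)
 then have "Re (- ((fst z)\<^sup>2 + (snd z)\<^sup>2)) \<le> 2 + (- (Re (fst z))\<^sup>2 + - (Re (snd z))\<^sup>2)"
  by (simp add: Re_power2)
 then have "exp (Re (- ((fst z)\<^sup>2 + (snd z)\<^sup>2))) \<le> exp (2 + (- (Re (fst z))\<^sup>2 + - (Re (snd z))\<^sup>2))"
  by (simp only: exp_le_cancel_iff)
 then show ?thesis by (simp only: gauss_def gauss_bound_def norm_exp_eq_Re exp_add)
qed

lemma gauss_bound_le: "gauss_bound z \<le> 1" "gauss_bound z \<ge> 0"
 by (simp_all add: gauss_bound_def mult_le_one)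

lemma abs_Re_gauss_bound:
 "\<bar>Re (fst z)\<bar> * gauss_bound z \<le> 1" "\<bar>Re (snd z)\<bar> * gauss_bound z \<le> 1"
proof -
 have 1: "\<bar>x\<bar> * exp (- x\<^sup>2) \<le> 1" for x :: real
  using le_exp_square[of x] by (simp add: exp_minus field_simps)
 have 2: "exp (- x\<^sup>2) \<le> 1" for x :: real by simp
 have "(\<bar>Re (fst z)\<bar> * exp (- (Re (fst z))\<^sup>2)) * exp (- (Re (snd z))\<^sup>2) \<le> 1 * 1"
  by (intro mult_mono 1 2) auto
 then show "\<bar>Re (fst z)\<bar> * gauss_bound z \<le> 1" by (simp add: gauss_bound_def mult.assoc)
 have "(\<bar>Re (snd z)\<bar> * exp (- (Re (snd z))\<^sup>2)) * exp (- (Re (fst z))\<^sup>2) \<le> 1 * 1"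
  by (intro mult_mono 1 2) auto
 then show "\<bar>Re (snd z)\<bar> * gauss_bound z \<le> 1" by (simp add: gauss_bound_def mult_ac)
qed

lemma norm_coord_gauss:
 assumes z: "z \<in> strip 1"
 shows "norm (fst z * gauss z) \<le> 2 * exp 2" "norm (snd z * gauss z) \<le> 2 * exp 2"
proof -
 have *: "norm (c * gauss z) \<le> 2 * exp 2" if "\<bar>Im c\<bar> < 1" "\<bar>Re c\<bar> * gauss_bound z \<le> 1" for c
 proof -
  have "norm (c * gauss z) \<le> (\<bar>Re c\<bar> + 1) * (exp 2 * gauss_bound z)"
   unfolding norm_mult
   by (intro mult_mono norm_gauss z) (use cmod_le[of c] that in auto)
  also have "\<dots> = exp 2 * (\<bar>Re c\<bar> * gauss_bound z + gauss_bound z)" by (simp add: algebra_simps)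
  also have "\<dots> \<le> exp 2 * (1 + 1)"
   by (intro mult_left_mono add_mono that gauss_bound_le) auto
  finally show ?thesis by simp
 qed
 show "norm (fst z * gauss z) \<le> 2 * exp 2" "norm (snd z * gauss z) \<le> 2 * exp 2"
  by (rule *; use z abs_Re_gauss_bound in \<open>auto simp: strip_iff\<close>)+
qed

text \<open>Bounded functions that separate points; polynomials in them extend to entire functions that are bounded on strips.\<close>

definition gauss_embed :: "real^2 \<Rightarrow> real \<times> real \<times> real" where
 "gauss_embed w = (let g = exp (- ((w $ 1)\<^sup>2 + (w $ 2)\<^sup>2)) in (g, w $ 1 * g, w $ 2 * g))"

lemma gauss_cpt: "gauss (cpt w) = of_real (exp (- ((w $ 1)\<^sup>2 + (w $ 2)\<^sup>2)))"
 by (simp add: gauss_def cpt_def flip: exp_of_real)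

lemma real_polynomial_gauss_extension:
 assumes "real_polynomial_function p"
 shows "\<exists>P C. (\<forall>\<delta>. strip_hol \<delta> P) \<and> (\<forall>z\<in>strip 1. norm (P z) \<le> C) \<and> (\<forall>w. P (cpt w) = of_real (p (gauss_embed w)))"
 using assms
proof (induction rule: real_polynomial_function.induct)
 case (linear f)
 note lin = bounded_linear.linear[OF linear]
 define a b c where "a = f (1, 0, 0)" and "b = f (0, 1, 0)" and "c = f (0, 0, 1)"
 have f: "f (x, y, t) = x * a + y * b + t * c" for x y t
 proof -
  have eq: "(x, y, t) = x *\<^sub>R (1, 0, 0) + y *\<^sub>R (0, 1, 0) + t *\<^sub>R (0, 0, 1)" by simp
  show ?thesis by (subst eq) (simp only: linear_add[OF lin] linear_scale[OF lin] real_scaleR_def a_def b_def c_def)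
 qed
 define P where "P z = gauss z * of_real a + fst z * gauss z * of_real b + snd z * gauss z * of_real c" for z
 have "norm (P z) \<le> exp 2 * \<bar>a\<bar> + 2 * exp 2 * \<bar>b\<bar> + 2 * exp 2 * \<bar>c\<bar>" if z: "z \<in> strip 1" for z
 proof -
  have g: "norm (gauss z) \<le> exp 2"
  proof -
   have "exp 2 * gauss_bound z \<le> exp 2 * 1" by (intro mult_left_mono gauss_bound_le) auto
   from order_trans[OF norm_gauss[OF z] this] show ?thesis by simp
  qed
  have "norm (gauss z * of_real a) \<le> exp 2 * \<bar>a\<bar>"
   unfolding norm_mult norm_of_real by (intro mult_right_mono g) auto
  moreover have "norm (fst z * gauss z * of_real b) \<le> 2 * exp 2 * \<bar>b\<bar>"
   unfolding norm_mult[of "_ * _"] norm_of_real by (intro mult_right_mono norm_coord_gauss z) auto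
  moreover have "norm (snd z * gauss z * of_real c) \<le> 2 * exp 2 * \<bar>c\<bar>"
   unfolding norm_mult[of "_ * _"] norm_of_real by (intro mult_right_mono norm_coord_gauss z) auto
  ultimately show ?thesis unfolding P_def by (intro norm_triangle_mono)
 qed
 moreover have "strip_hol \<delta> P" for \<delta> unfolding P_def[abs_def]
  by (intro sh_add sh_mult sh_gauss sh_const sh_fst sh_snd)
 moreover have "P (cpt w) = of_real (f (gauss_embed w))" for w
  by (simp add: P_def gauss_embed_def Let_def f gauss_cpt) (simp add: cpt_def)
 ultimately show ?case by blast
next
 case (const c)
 then show ?case by (intro exI[of _ "\<lambda>z. of_real c"] exI[of _ "\<bar>c\<bar>"]) auto
next
 case (add f g)
 then obtain P C Q D where "\<forall>\<delta>. strip_hol \<delta> P" "\<forall>z\<in>strip 1. norm (P z) \<le> C" "\<forall>w. P (cpt w) = of_real (f (gauss_embed w))"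
  "\<forall>\<delta>. strip_hol \<delta> Q" "\<forall>z\<in>strip 1. norm (Q z) \<le> D" "\<forall>w. Q (cpt w) = of_real (g (gauss_embed w))" by blast
 then show ?case
  by (intro exI[of _ "\<lambda>z. P z + Q z"] exI[of _ "C + D"]) (auto intro!: sh_add norm_triangle_mono)
next
 case (mult f g)
 then obtain P C Q D where PQ: "\<forall>\<delta>. strip_hol \<delta> P" "\<forall>z\<in>strip 1. norm (P z) \<le> C" "\<forall>w. P (cpt w) = of_real (f (gauss_embed w))"
  "\<forall>\<delta>. strip_hol \<delta> Q" "\<forall>z\<in>strip 1. norm (Q z) \<le> D" "\<forall>w. Q (cpt w) = of_real (g (gauss_embed w))" by blast
 have "norm (P z * Q z) \<le> C * D" if "z \<in> strip 1" for z
 proof -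
  have "0 \<le> C" using PQ(2) that order_trans[OF norm_ge_zero] by blast
  then show ?thesis unfolding norm_mult by (intro mult_mono) (use PQ that in auto)
 qed
 then show ?case using PQ
  by (intro exI[of _ "\<lambda>z. P z * Q z"] exI[of _ "C * D"]) (auto intro!: sh_mult)
qed

lemma norm_gauss_embed: "norm (gauss_embed w) \<le> 3"
proof -
 define z where "z = cpt w"
 have z: "Re (fst z) = w $ 1" "Re (snd z) = w $ 2" by (auto simp: z_def cpt_def)
 have g: "gauss_bound z = exp (- ((w $ 1)\<^sup>2 + (w $ 2)\<^sup>2))" by (simp add: gauss_bound_def z exp_add[symmetric])
 have "norm (gauss_embed w) \<le> norm (gauss_bound z) + norm (w $ 1 * gauss_bound z, w $ 2 * gauss_bound z)"
  unfolding gauss_embed_def Let_def g by (rule norm_Pair_le)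
 also have "\<dots> \<le> norm (gauss_bound z) + (norm (w $ 1 * gauss_bound z) + norm (w $ 2 * gauss_bound z))"
  by (intro add_left_mono norm_Pair_le)
 also have "\<dots> \<le> 1 + (1 + 1)"
  using gauss_bound_le[of z] abs_Re_gauss_bound[of z] by (intro add_mono) (auto simp: abs_mult z)
 finally show ?thesis by simp
qed

text \<open>Compactly supported functions are approximated, with Gaussian weight in the error, by entire functions of
 Gaussian decay: the curve of the three functions above is bounded, and polynomials in them suffice.\<close>

lemma gaussian_approx_real:
 fixes E0 :: "real^2 \<Rightarrow> real"
 assumes c: "continuous_on UNIV E0" and supp: "\<And>w. (w $ 1)\<^sup>2 + (w $ 2)\<^sup>2 \<ge> R \<Longrightarrow> E0 w = 0" and \<epsilon>: "\<epsilon> > 0"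
 shows "\<exists>G C. (\<forall>\<delta>. strip_hol \<delta> G) \<and> (\<forall>z\<in>strip 1. norm (G z) \<le> C * gauss_bound z) \<and>
  (\<forall>w. norm (G (cpt w) - of_real (E0 w)) \<le> \<epsilon> * exp (- ((w $ 1)\<^sup>2 + (w $ 2)\<^sup>2)))"
proof -
 define E1 where "E1 w = E0 w * exp ((w $ 1)\<^sup>2 + (w $ 2)\<^sup>2)" for w
 have E1c: "continuous_on UNIV E1" unfolding E1_def[abs_def] by (intro continuous_intros c)
 define c0 where "c0 = exp (- R) / 2"
 have c0: "c0 > 0" by (simp add: c0_def)
 define cut where "cut t = min 1 (max 0 (t / c0 - 1))" for t :: real
 define vec where "vec x = (\<chi> i::2. if i = 1 then fst (snd x) / fst x else snd (snd x) / fst x)" for x :: "real \<times> real \<times> real"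
 define \<Phi> where "\<Phi> x = E1 (vec x) * cut (fst x)" for x
 have "continuous_on ({x. fst x > 0} \<union> {x. fst x < c0}) \<Phi>"
 proof (rule continuous_on_open_Un)
  show "open {x::real \<times> real \<times> real. fst x > 0}" "open {x::real \<times> real \<times> real. fst x < c0}"
   by (auto intro!: open_Collect_less continuous_intros)
  have vc: "continuous_on {x. fst x > 0} vec"
   unfolding vec_def[abs_def]
  proof (rule continuous_on_vec_lambda)
   fix i :: 2
   show "continuous_on {x. fst x > 0} (\<lambda>x::real \<times> real \<times> real. if i = 1 then fst (snd x) / fst x else snd (snd x) / fst x)"
    by (cases "i = 1") (auto intro!: continuous_intros)
  qed
  show "continuous_on {x. fst x > 0} \<Phi>"
   unfolding \<Phi>_def[abs_def] cut_def
   by (intro continuous_intros continuous_on_compose2[OF E1c vc]) (use c0 in auto)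
  have "cut t = 0" if "t < c0" for t
  proof -
   have "t / c0 - 1 \<le> 0" using that c0 by (simp add: field_simps)
   then show ?thesis by (simp add: cut_def max_def)
  qed
  then have z: "\<Phi> x = 0" if "x \<in> {x. fst x < c0}" for x using that by (simp add: \<Phi>_def)
  show "continuous_on {x. fst x < c0} \<Phi>"
   by (rule continuous_on_eq[OF continuous_on_const[of _ 0]]) (use z in auto)
 qed
 moreover have "{x. fst x > 0} \<union> {x::real \<times> real \<times> real. fst x < c0} = UNIV" using c0 by auto
 ultimately have \<Phi>c: "continuous_on UNIV \<Phi>" by simp
 have \<Phi>: "\<Phi> (gauss_embed w) = E1 w" for w
 proof -
  define g where "g = exp (- ((w $ 1)\<^sup>2 + (w $ 2)\<^sup>2))"
  have g: "g > 0" by (simp add: g_def)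
  have v: "vec (gauss_embed w) = w" by (rule real2_eqI) (use g in \<open>auto simp: vec_def gauss_embed_def Let_def g_def[symmetric]\<close>)
  have f: "fst (gauss_embed w) = g" by (simp add: gauss_embed_def Let_def g_def)
  show ?thesis
  proof (cases "(w $ 1)\<^sup>2 + (w $ 2)\<^sup>2 \<ge> R")
   case True then show ?thesis using supp[of w] unfolding \<Phi>_def v by (simp add: E1_def)
  next
   case False
   then have "exp (- R) \<le> g" unfolding g_def by simp
   then have "g / c0 - 1 \<ge> 1" using c0 by (simp add: c0_def field_simps)
   then have "cut g = 1" by (simp add: cut_def)
   then show ?thesis unfolding \<Phi>_def v f by simp
  qed
 qed
 obtain p where p: "real_polynomial_function p" "\<And>x. x \<in> cball 0 3 \<Longrightarrow> \<bar>\<Phi> x - p x\<bar> < \<epsilon>"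
  using Stone_Weierstrass_real_polynomial_function[OF compact_cball[of 0 3] _ \<epsilon>, of \<Phi>] \<Phi>c continuous_on_subset by blast
 obtain P C where P: "\<And>\<delta>. strip_hol \<delta> P" "\<And>z. z \<in> strip 1 \<Longrightarrow> norm (P z) \<le> C" "\<And>w. P (cpt w) = of_real (p (gauss_embed w))"
  using real_polynomial_gauss_extension[OF p(1)] by blast
 define G where "G z = gauss z * P z" for z
 have "norm (G z) \<le> (exp 2 * C) * gauss_bound z" if z: "z \<in> strip 1" for z
 proof -
  have "norm (G z) \<le> (exp 2 * gauss_bound z) * C" unfolding G_def norm_mult
   by (intro mult_mono norm_gauss P z) (auto simp: gauss_bound_le)
  then show ?thesis by (simp add: mult_ac)
 qed
 moreover have "norm (G (cpt w) - of_real (E0 w)) \<le> \<epsilon> * exp (- ((w $ 1)\<^sup>2 + (w $ 2)\<^sup>2))" for w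
 proof -
  define g where "g = exp (- ((w $ 1)\<^sup>2 + (w $ 2)\<^sup>2))"
  have "g * exp ((w $ 1)\<^sup>2 + (w $ 2)\<^sup>2) = 1" unfolding g_def by (simp only: exp_add[symmetric]) simp
  then have "E0 w = g * E1 w" by (simp add: E1_def mult.left_commute[of g])
  moreover have "gauss (cpt w) = of_real g" by (simp only: gauss_cpt g_def)
  ultimately have "G (cpt w) - of_real (E0 w) = of_real (g * (p (gauss_embed w) - E1 w))"
   by (simp add: G_def P(3) right_diff_distrib)
  then have "norm (G (cpt w) - of_real (E0 w)) = g * \<bar>p (gauss_embed w) - E1 w\<bar>"
   by (simp only: norm_of_real abs_mult) (simp add: g_def)
  also have "\<dots> \<le> g * \<epsilon>"
   using p(2)[of "gauss_embed w"] norm_gauss_embed[of w] unfolding \<Phi> by (intro mult_left_mono) (auto simp: g_def)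
  finally show ?thesis by (simp add: g_def mult.commute)
 qed
 moreover have "strip_hol \<delta> G" for \<delta> unfolding G_def[abs_def] by (intro sh_mult sh_gauss P)
 ultimately show ?thesis by blast
qed

lemma gaussian_approx:
 fixes E0 :: "real^2 \<Rightarrow> complex"
 assumes c: "continuous_on UNIV E0" and supp: "\<And>w. (w $ 1)\<^sup>2 + (w $ 2)\<^sup>2 \<ge> R \<Longrightarrow> E0 w = 0" and \<epsilon>: "\<epsilon> > 0"
 shows "\<exists>G C. (\<forall>\<delta>. strip_hol \<delta> G) \<and> (\<forall>z\<in>strip 1. norm (G z) \<le> C * gauss_bound z) \<and>
  (\<forall>w. norm (G (cpt w) - E0 w) \<le> \<epsilon> * exp (- ((w $ 1)\<^sup>2 + (w $ 2)\<^sup>2)))"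
proof -
 have e2: "\<epsilon> / 2 > 0" using \<epsilon> by simp
 have suppR: "Re (E0 w) = 0" and suppI: "Im (E0 w) = 0" if "(w $ 1)\<^sup>2 + (w $ 2)\<^sup>2 \<ge> R" for w
  using supp[OF that] by auto
 obtain G C where G: "\<And>\<delta>. strip_hol \<delta> G" "\<And>z. z\<in>strip 1 \<Longrightarrow> norm (G z) \<le> C * gauss_bound z"
  "\<And>w. norm (G (cpt w) - of_real (Re (E0 w))) \<le> \<epsilon> / 2 * exp (- ((w $ 1)\<^sup>2 + (w $ 2)\<^sup>2))"
  using gaussian_approx_real[of "\<lambda>w. Re (E0 w)" R, OF continuous_on_Re[OF c] suppR e2] by blast
 obtain H D where H: "\<And>\<delta>. strip_hol \<delta> H" "\<And>z. z\<in>strip 1 \<Longrightarrow> norm (H z) \<le> D * gauss_bound z"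
  "\<And>w. norm (H (cpt w) - of_real (Im (E0 w))) \<le> \<epsilon> / 2 * exp (- ((w $ 1)\<^sup>2 + (w $ 2)\<^sup>2))"
  using gaussian_approx_real[of "\<lambda>w. Im (E0 w)" R, OF continuous_on_Im[OF c] suppI e2] by blast
 show ?thesis
 proof (intro exI[of _ "\<lambda>z. G z + \<i> * H z"] exI[of _ "C + D"] conjI allI ballI)
  show "strip_hol \<delta> (\<lambda>z. G z + \<i> * H z)" for \<delta> by (intro sh_add sh_mult sh_const G H)
  show "norm (G z + \<i> * H z) \<le> (C + D) * gauss_bound z" if "z \<in> strip 1" for z
   unfolding ring_distribs by (intro norm_triangle_mono) (use G(2)[OF that] H(2)[OF that] in \<open>auto simp: norm_mult\<close>)
  show "norm (G (cpt w) + \<i> * H (cpt w) - E0 w) \<le> \<epsilon> * exp (- ((w $ 1)\<^sup>2 + (w $ 2)\<^sup>2))" for w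
  proof -
   have "G (cpt w) + \<i> * H (cpt w) - E0 w = (G (cpt w) - of_real (Re (E0 w))) + \<i> * (H (cpt w) - of_real (Im (E0 w)))"
    by (simp add: complex_eq_iff)
   also have "norm \<dots> \<le> \<epsilon> / 2 * exp (- ((w $ 1)\<^sup>2 + (w $ 2)\<^sup>2)) + \<epsilon> / 2 * exp (- ((w $ 1)\<^sup>2 + (w $ 2)\<^sup>2))"
    by (intro norm_triangle_mono) (use G(3)[of w] H(3)[of w] in \<open>auto simp: norm_mult\<close>)
   finally show ?thesis by simp
  qed
 qed
qed

lemma summable_int_of_nat:
 fixes f :: "int \<Rightarrow> real"
 assumes "\<And>n. 0 \<le> f n" "\<And>n. f n \<le> K * exp (- \<bar>of_int n\<bar>)"
 shows "f summable_on UNIV"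
proof (rule summable_on_comparison_test)
 show "(\<lambda>n::int. K * exp (- (1 * \<bar>of_int n\<bar>))) summable_on UNIV"
  by (intro summable_on_cmult_right summable_exp_abs_int) simp
qed (use assms in auto)

text \<open>Majorant for the terms of a lattice average: \<open>n\<close> matrices of norm at most \<open>C\<close> against Gaussian decay that sets in at distance \<open>R\<close>.\<close>

definition gauss_weight :: "real \<Rightarrow> real \<Rightarrow> int \<Rightarrow> real" where
 "gauss_weight C R n = C ^ nat \<bar>n\<bar> * exp (- (max 0 (\<bar>of_int n\<bar> - R))\<^sup>2)"

lemma gauss_weight_nonneg: "C \<ge> 1 \<Longrightarrow> gauss_weight C R n \<ge> 0"
 by (simp add: gauss_weight_def)

lemma gauss_weight_summable:
 assumes C: "C \<ge> 1"
 shows "gauss_weight C R summable_on UNIV"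
proof (rule summable_int_of_nat)
 define L where "L = (ln C + 1) / 2"
 have L: "L \<ge> 0" "2 * L = ln C + 1" using C by (auto simp: L_def)
 fix n :: int
 show "0 \<le> gauss_weight C R n" using C by (rule gauss_weight_nonneg)
 define k m where "k = \<bar>real_of_int n\<bar>" and "m = max 0 (k - R)"
 have Cn: "C ^ nat \<bar>n\<bar> = exp (k * ln C)"
  using C by (simp add: k_def exp_of_nat_mult[symmetric] exp_of_nat2_mult flip: powr_realpow) (simp add: powr_def)
 have "0 \<le> (m - L)\<^sup>2" by simp
 then have "- m\<^sup>2 \<le> L\<^sup>2 - 2 * L * m" by (simp add: power2_eq_square algebra_simps)
 also have "\<dots> \<le> L\<^sup>2 - 2 * L * (k - R)"
  using L(1) by (intro diff_left_mono mult_left_mono) (auto simp: m_def)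
 finally have "k * ln C - m\<^sup>2 \<le> - k + ((ln C + 1) * R + L\<^sup>2)" unfolding L(2) by (simp add: algebra_simps)
 then have "exp (k * ln C - m\<^sup>2) \<le> exp (- k + ((ln C + 1) * R + L\<^sup>2))" by simp
 then show "gauss_weight C R n \<le> exp ((ln C + 1) * R + L\<^sup>2) * exp (- \<bar>real_of_int n\<bar>)"
  unfolding gauss_weight_def Cn k_def[symmetric] m_def[symmetric] by (simp add: exp_add[symmetric] algebra_simps)
qed

lemma exp_square_shift_le:
 fixes x R :: real
 assumes "\<bar>x\<bar> \<le> R" shows "exp (- (x + of_int n)\<^sup>2) \<le> exp (- (max 0 (\<bar>of_int n\<bar> - R))\<^sup>2)"
proof -
 have "max 0 (\<bar>of_int n\<bar> - R) \<le> \<bar>x + of_int n\<bar>" using assms by auto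
 then have "(max 0 (\<bar>of_int n\<bar> - R))\<^sup>2 \<le> \<bar>x + of_int n\<bar>\<^sup>2" by (intro power_mono) auto
 then show ?thesis by simp
qed

definition gauss_theta :: real where "gauss_theta = infsum (gauss_weight 1 1) UNIV"

lemma gauss_sum_bound:
 "(\<lambda>n::int. exp (- (x + of_int n)\<^sup>2)) summable_on UNIV" "(\<Sum>\<^sub>\<infinity>n::int. exp (- (x + of_int n)\<^sup>2)) \<le> gauss_theta"
proof -
 define y where "y = frac x"
 have y: "\<bar>y\<bar> \<le> 1" using frac_lt_1[of x] frac_ge_0[of x] by (simp add: y_def)
 have le: "exp (- (y + of_int n)\<^sup>2) \<le> gauss_weight 1 1 n" for n
  using exp_square_shift_le[OF y, of n] by (simp add: gauss_weight_def)
 have sy: "(\<lambda>n::int. exp (- (y + of_int n)\<^sup>2)) summable_on UNIV"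
  by (rule summable_on_comparison_test[OF gauss_weight_summable[of 1 1]]) (use le in auto)
 have b: "bij (\<lambda>n. n + \<lfloor>x\<rfloor>)"
  by (rule bij_betw_byWitness[where f' = "\<lambda>n. n - \<lfloor>x\<rfloor>"]) auto
 have eq: "exp (- (x + of_int n)\<^sup>2) = exp (- (y + of_int (n + \<lfloor>x\<rfloor>))\<^sup>2)" for n
  by (simp add: y_def frac_def)
 show "(\<lambda>n::int. exp (- (x + of_int n)\<^sup>2)) summable_on UNIV"
  unfolding eq using summable_on_reindex_bij_betw[OF b, of "\<lambda>n. exp (- (y + of_int n)\<^sup>2)"] sy by simp
 have "(\<Sum>\<^sub>\<infinity>n::int. exp (- (x + of_int n)\<^sup>2)) = (\<Sum>\<^sub>\<infinity>n::int. exp (- (y + of_int n)\<^sup>2))"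
  unfolding eq by (rule infsum_reindex_bij_betw[OF b])
 also have "\<dots> \<le> gauss_theta" unfolding gauss_theta_def
  by (intro infsum_mono sy gauss_weight_summable le) auto
 finally show "(\<Sum>\<^sub>\<infinity>n::int. exp (- (x + of_int n)\<^sup>2)) \<le> gauss_theta" .
qed

lemma gauss_theta_nonneg: "gauss_theta \<ge> 0"
 unfolding gauss_theta_def by (intro infsum_nonneg gauss_weight_nonneg) auto

definition tent :: "real \<Rightarrow> real" where "tent x = max 0 (1 - \<bar>x\<bar>)"

lemma tent_partition: "((\<lambda>n::int. tent (x + of_int n)) has_sum 1) UNIV"
proof -
 define N where "N = - \<lfloor>x\<rfloor>"
 have z: "tent (x + of_int n) = 0" if "n \<notin> {N, N - 1}" for n
 proof -
  have "n \<ge> N + 1 \<or> n \<le> N - 2" using that by auto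
  then have "of_int n \<ge> (of_int N + 1 :: real) \<or> of_int n \<le> (of_int N - 2 :: real)" by linarith
  moreover have "0 \<le> x + of_int N" "x + of_int N < 1" unfolding N_def by linarith+
  ultimately have "\<bar>x + of_int n\<bar> \<ge> 1" by linarith
  then show ?thesis by (simp add: tent_def)
 qed
 have "((\<lambda>n::int. tent (x + of_int n)) has_sum (\<Sum>n\<in>{N, N - 1}. tent (x + of_int n))) {N, N - 1}"
  by (rule has_sum_finite) simp
 moreover have "(\<Sum>n\<in>{N, N - 1}. tent (x + of_int n)) = 1"
 proof -
  have "0 \<le> x + of_int N" "x + of_int N < 1" unfolding N_def by linarith+
  then show ?thesis by (simp add: tent_def max_def abs_if)
 qed
 ultimately have "((\<lambda>n::int. tent (x + of_int n)) has_sum 1) {N, N - 1}" by simp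
 then show ?thesis
  by (subst (asm) has_sum_cong_neutral[where T = UNIV and g = "\<lambda>n. tent (x + of_int n)"]) (use z in auto)
qed

text \<open>One lattice direction of the averaging. The functions pulled back from the translates of a point
 are transported along the lattice by the sewing matrices, so their sum is equivariant.\<close>

definition pull_forward where
 "pull_forward W s G = (\<lambda>z. W z *v G (z + s))"

definition pull_backward where
 "pull_backward V s G = (\<lambda>z. V (z - s) *v G (z - s))"

definition lattice_pull ::
 "(C2 \<Rightarrow> complex^2^2) \<Rightarrow> (C2 \<Rightarrow> complex^2^2) \<Rightarrow> C2 \<Rightarrow> int
  \<Rightarrow> (C2 \<Rightarrow> complex^2) \<Rightarrow> C2 \<Rightarrow> complex^2" where
 "lattice_pull V W s n G = (if n \<ge> 0 then (pull_forward W s ^^ nat n) G else (pull_backward V s ^^ nat (- n)) G)"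

definition lattice_average where
 "lattice_average V W s G z = (\<chi> i. \<Sum>\<^sub>\<infinity>n. lattice_pull V W s n G z $ i)"

lemma lattice_pull_cases:
 assumes zero: "P 0 G"
  and fw: "\<And>n H. n \<ge> 0 \<Longrightarrow> P n H \<Longrightarrow> P (n + 1) (pull_forward W s H)"
  and bw: "\<And>n H. n \<le> 0 \<Longrightarrow> P n H \<Longrightarrow> P (n - 1) (pull_backward V s H)"
 shows "P n (lattice_pull V W s n G)"
proof -
 have 1: "P (int k) ((pull_forward W s ^^ k) G)" for k
 proof (induction k)
  case (Suc k) then show ?case using fw[of "int k"] by (simp add: add.commute)
 qed (use zero in simp)
 have 2: "P (- int k) ((pull_backward V s ^^ k) G)" for k
 proof (induction k)
  case (Suc k)
  have eq: "- int (Suc k) = - int k - 1" and "- int k \<le> 0" by simp_all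
  from bw[OF this(2) Suc] show ?case by (simp only: eq funpow.simps o_apply)
 qed (use zero in simp)
 show ?thesis using 1[of "nat n"] 2[of "nat (- n)"] by (auto simp: lattice_pull_def)
qed

lemma lattice_pull_shift:
 assumes VW: "V z ** W z = mat 1"
 shows "lattice_pull V W s n G (z + s) = V z *v lattice_pull V W s (n + 1) G z"
proof (cases "n \<ge> 0")
 case True
 then have "nat (n + 1) = Suc (nat n)" by simp
 then have "lattice_pull V W s (n + 1) G z = W z *v lattice_pull V W s n G (z + s)"
  using True by (simp add: lattice_pull_def pull_forward_def)
 then show ?thesis using VW by (simp add: matrix_vector_mul_assoc)
next
 case False
 then obtain k where n: "n = - int (Suc k)"
  using that[of "nat (- n) - 1"] by simp
 have "lattice_pull V W s (n + 1) G = (pull_backward V s ^^ k) G"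
 proof -
  have n1: "n + 1 = - int k" by (simp add: n)
  show ?thesis unfolding lattice_pull_def n1 by auto
 qed
 then show ?thesis by (simp add: lattice_pull_def n pull_backward_def nat_add_distrib)
qed

lemma sh_matrix_vector:
 fixes V :: "C2 \<Rightarrow> complex^2^2" and G :: "C2 \<Rightarrow> complex^2"
 assumes "\<And>i k. strip_hol \<delta> (\<lambda>z. V z $ i $ k)" "\<And>i. strip_hol \<delta> (\<lambda>z. G z $ i)"
 shows "strip_hol \<delta> (\<lambda>z. (V z *v G z) $ i)"
 unfolding matrix_vector_mult_def by (simp add: sh_sum sh_mult assms)

lemma sh_lattice_pull:
 assumes V: "\<And>i k. strip_hol \<delta> (\<lambda>z. V z $ i $ k)" and W: "\<And>i k. strip_hol \<delta> (\<lambda>z. W z $ i $ k)"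
  and G: "\<And>i. strip_hol \<delta> (\<lambda>z. G z $ i)"
 shows "strip_hol \<delta> (\<lambda>z. lattice_pull V W (cpt s) n G z $ i)"
proof -
 have "\<forall>i. strip_hol \<delta> (\<lambda>z. lattice_pull V W (cpt s) n G z $ i)"
 proof (rule lattice_pull_cases[where P = "\<lambda>n H. \<forall>i. strip_hol \<delta> (\<lambda>z. H z $ i)"])
  fix H :: "C2 \<Rightarrow> complex^2" assume H: "\<forall>i. strip_hol \<delta> (\<lambda>z. H z $ i)"
  show "\<forall>i. strip_hol \<delta> (\<lambda>z. pull_forward W (cpt s) H z $ i)"
   unfolding pull_forward_def by (intro allI sh_matrix_vector W sh_translate[where f = "\<lambda>z. H z $ _"]) (use H in auto)
  show "\<forall>i. strip_hol \<delta> (\<lambda>z. pull_backward V (cpt s) H z $ i)"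
   unfolding pull_backward_def
   by (intro allI sh_matrix_vector sh_translate_minus[where f = "\<lambda>z. V z $ _ $ _"] sh_translate_minus[where f = "\<lambda>z. H z $ _"] V) (use H in auto)
 qed (use G in auto)
 then show ?thesis by blast
qed

lemma lattice_pull_bound:
 assumes C: "C \<ge> 1" and V: "\<And>z x. z \<in> strip \<delta> \<Longrightarrow> norm (V z *v x) \<le> C * norm x" and W: "\<And>z x. z \<in> strip \<delta> \<Longrightarrow> norm (W z *v x) \<le> C * norm x"
  and z: "z \<in> strip \<delta>"
 shows "norm (lattice_pull V W (cpt s) n G z) \<le> C ^ nat \<bar>n\<bar> * norm (G (z + cpt (of_int n *\<^sub>R s)))"
proof -
 have "\<forall>z\<in>strip \<delta>. norm (lattice_pull V W (cpt s) n G z) \<le> C ^ nat \<bar>n\<bar> * norm (G (z + cpt (of_int n *\<^sub>R s)))"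
 proof (rule lattice_pull_cases[where P = "\<lambda>n H. \<forall>z\<in>strip \<delta>. norm (H z) \<le> C ^ nat \<bar>n\<bar> * norm (G (z + cpt (of_int n *\<^sub>R s)))"])
  fix n :: int and H :: "C2 \<Rightarrow> complex^2" assume n: "n \<ge> 0" and H: "\<forall>z\<in>strip \<delta>. norm (H z) \<le> C ^ nat \<bar>n\<bar> * norm (G (z + cpt (of_int n *\<^sub>R s)))"
  show "\<forall>z\<in>strip \<delta>. norm (pull_forward W (cpt s) H z) \<le> C ^ nat \<bar>n + 1\<bar> * norm (G (z + cpt (of_int (n + 1) *\<^sub>R s)))"
  proof
   fix z assume z: "z \<in> strip \<delta>"
   have "norm (pull_forward W (cpt s) H z) \<le> C * norm (H (z + cpt s))" unfolding pull_forward_def by (rule W[OF z])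
   also have "\<dots> \<le> C * (C ^ nat \<bar>n\<bar> * norm (G (z + cpt s + cpt (of_int n *\<^sub>R s))))"
    using H z C by (intro mult_left_mono) auto
   also have "z + cpt s + cpt (of_int n *\<^sub>R s) = z + cpt (of_int (n + 1) *\<^sub>R s)" by (simp add: cpt_add[symmetric] algebra_simps)
   also have "nat \<bar>n + 1\<bar> = Suc (nat \<bar>n\<bar>)" using n by simp
   then have "C * (C ^ nat \<bar>n\<bar> * norm (G (z + cpt (of_int (n + 1) *\<^sub>R s)))) = C ^ nat \<bar>n + 1\<bar> * norm (G (z + cpt (of_int (n + 1) *\<^sub>R s)))"
     by (simp only: power_Suc mult.assoc)
   finally show "norm (pull_forward W (cpt s) H z) \<le> C ^ nat \<bar>n + 1\<bar> * norm (G (z + cpt (of_int (n + 1) *\<^sub>R s)))" .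
  qed
 next
  fix n :: int and H :: "C2 \<Rightarrow> complex^2" assume n: "n \<le> 0" and H: "\<forall>z\<in>strip \<delta>. norm (H z) \<le> C ^ nat \<bar>n\<bar> * norm (G (z + cpt (of_int n *\<^sub>R s)))"
  show "\<forall>z\<in>strip \<delta>. norm (pull_backward V (cpt s) H z) \<le> C ^ nat \<bar>n - 1\<bar> * norm (G (z + cpt (of_int (n - 1) *\<^sub>R s)))"
  proof
   fix z assume z: "z \<in> strip \<delta>"
   have "norm (pull_backward V (cpt s) H z) \<le> C * norm (H (z - cpt s))" unfolding pull_backward_def by (rule V) (use z in simp)
   also have "\<dots> \<le> C * (C ^ nat \<bar>n\<bar> * norm (G (z - cpt s + cpt (of_int n *\<^sub>R s))))"
    using H z C by (intro mult_left_mono) auto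
   also have "z - cpt s + cpt (of_int n *\<^sub>R s) = z + cpt (of_int (n - 1) *\<^sub>R s)" by (simp add: cpt_diff algebra_simps)
   also have "nat \<bar>n - 1\<bar> = Suc (nat \<bar>n\<bar>)" using n by simp
   then have "C * (C ^ nat \<bar>n\<bar> * norm (G (z + cpt (of_int (n - 1) *\<^sub>R s)))) = C ^ nat \<bar>n - 1\<bar> * norm (G (z + cpt (of_int (n - 1) *\<^sub>R s)))"
     by (simp only: power_Suc mult.assoc)
   finally show "norm (pull_backward V (cpt s) H z) \<le> C ^ nat \<bar>n - 1\<bar> * norm (G (z + cpt (of_int (n - 1) *\<^sub>R s)))" .
  qed
 qed simp
 then show ?thesis using z by blast
qed

text \<open>The transport is isometric on real points, so the error of an approximation of an equivariant
 section at a point is the sum of the errors at its translates.\<close>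

lemma lattice_pull_error:
 assumes V: "\<And>w x. norm (V (cpt w) *v x) = norm x" and W: "\<And>w x. norm (W (cpt w) *v x) = norm x"
  and VW: "\<And>w. W (cpt w) ** V (cpt w) = mat 1"
  and e: "\<And>w. e (w + s) = V (cpt w) *v e w"
 shows "norm (lattice_pull V W (cpt s) n G (cpt w) - a (w + of_int n *\<^sub>R s) *s e w)
  = norm (G (cpt (w + of_int n *\<^sub>R s)) - a (w + of_int n *\<^sub>R s) *s e (w + of_int n *\<^sub>R s))"
proof -
 have e': "W (cpt w) *v e (w + s) = e w" for w unfolding e by (simp add: matrix_vector_mul_assoc VW)
 have diff: "M *v x - c *s (M *v y) = M *v (x - c *s y)" for M :: "complex^2^2" and x y c
  by (simp add: vec_eq_iff matrix_vector_mult_def sum_subtractf right_diff_distrib sum_distrib_left mult_ac)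
 define Q where "Q n H \<longleftrightarrow> (\<forall>w. norm (H (cpt w) - a (w + of_int n *\<^sub>R s) *s e w)
  = norm (G (cpt (w + of_int n *\<^sub>R s)) - a (w + of_int n *\<^sub>R s) *s e (w + of_int n *\<^sub>R s)))" for n :: int and H
 have "Q n (lattice_pull V W (cpt s) n G)"
 proof (rule lattice_pull_cases[where P = Q])
  fix n :: int and H :: "C2 \<Rightarrow> complex^2" assume H: "Q n H"
  have 1: "w + s + of_int n *\<^sub>R s = w + of_int (n + 1) *\<^sub>R s" for w by (simp add: algebra_simps)
  have "norm (pull_forward W (cpt s) H (cpt w) - c *s e w) = norm (H (cpt (w + s)) - c *s e (w + s))" for c w
  proof -
   have "pull_forward W (cpt s) H (cpt w) - c *s e w = W (cpt w) *v H (cpt (w + s)) - c *s (W (cpt w) *v e (w + s))"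
    by (simp add: pull_forward_def e' cpt_add)
   then show ?thesis unfolding diff by (simp add: W)
  qed
  then show "Q (n + 1) (pull_forward W (cpt s) H)" using H unfolding Q_def 1[symmetric] by simp
 next
  fix n :: int and H :: "C2 \<Rightarrow> complex^2" assume H: "Q n H"
  have 1: "w - s + of_int n *\<^sub>R s = w + of_int (n - 1) *\<^sub>R s" for w by (simp add: algebra_simps)
  have "norm (pull_backward V (cpt s) H (cpt w) - c *s e w) = norm (H (cpt (w - s)) - c *s e (w - s))" for c w
  proof -
   have "pull_backward V (cpt s) H (cpt w) - c *s e w = V (cpt (w - s)) *v H (cpt (w - s)) - c *s (V (cpt (w - s)) *v e (w - s))"
    using e[of "w - s"] by (simp add: pull_backward_def cpt_diff)
   then show ?thesis unfolding diff by (simp add: V)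
  qed
  then show "Q (n - 1) (pull_backward V (cpt s) H)" using H unfolding Q_def 1[symmetric] by simp
 qed (simp add: Q_def)
 then show ?thesis by (simp add: Q_def)
qed

lemma lattice_pull_commute:
 assumes K: "\<And>w. V' (cpt (w + s)) ** V (cpt w) = V (cpt (w + s')) ** V' (cpt w)"
  and VW: "\<And>w. V (cpt w) ** W (cpt w) = mat 1" "\<And>w. W (cpt w) ** V (cpt w) = mat 1"
  and G: "\<And>w. G (cpt (w + s')) = V' (cpt w) *v G (cpt w)"
 shows "lattice_pull V W (cpt s) n G (cpt (w + s')) = V' (cpt w) *v lattice_pull V W (cpt s) n G (cpt w)"
proof -
 have KW: "W (cpt (w + s')) ** V' (cpt (w + s)) = V' (cpt w) ** W (cpt w)" for w
 proof -
  have "W (cpt (w + s')) ** V' (cpt (w + s)) = W (cpt (w + s')) ** ((V' (cpt (w + s)) ** V (cpt w)) ** W (cpt w))"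
   by (simp add: matrix_mul_assoc[symmetric] VW)
  also have "\<dots> = (W (cpt (w + s')) ** V (cpt (w + s'))) ** (V' (cpt w) ** W (cpt w))"
   unfolding K by (simp add: matrix_mul_assoc)
  also have "\<dots> = V' (cpt w) ** W (cpt w)" by (simp add: VW)
  finally show ?thesis .
 qed
 define Q where "Q H \<longleftrightarrow> (\<forall>w. H (cpt (w + s')) = V' (cpt w) *v H (cpt w))" for H
 have "Q (lattice_pull V W (cpt s) n G)"
 proof (rule lattice_pull_cases[where P = "\<lambda>_. Q"])
  fix H :: "C2 \<Rightarrow> complex^2" assume H: "Q H"
  have "pull_forward W (cpt s) H (cpt (w + s')) = V' (cpt w) *v pull_forward W (cpt s) H (cpt w)" for w
  proof -
   have "pull_forward W (cpt s) H (cpt (w + s')) = W (cpt (w + s')) *v H (cpt ((w + s) + s'))"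
    by (simp add: pull_forward_def cpt_add add_ac)
   also have "\<dots> = (W (cpt (w + s')) ** V' (cpt (w + s))) *v H (cpt (w + s))"
    using H by (simp only: Q_def matrix_vector_mul_assoc)
   also have "\<dots> = V' (cpt w) *v pull_forward W (cpt s) H (cpt w)"
    unfolding KW by (simp add: pull_forward_def cpt_add matrix_vector_mul_assoc)
   finally show ?thesis .
  qed
  then show "Q (pull_forward W (cpt s) H)" by (simp add: Q_def)
  have "pull_backward V (cpt s) H (cpt (w + s')) = V' (cpt w) *v pull_backward V (cpt s) H (cpt w)" for w
  proof -
   have "pull_backward V (cpt s) H (cpt (w + s')) = V (cpt ((w - s) + s')) *v H (cpt ((w - s) + s'))"
    by (simp add: pull_backward_def cpt_add cpt_diff algebra_simps)
   also have "\<dots> = (V (cpt ((w - s) + s')) ** V' (cpt (w - s))) *v H (cpt (w - s))"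
    using H by (simp only: Q_def matrix_vector_mul_assoc)
   also have "\<dots> = V' (cpt w) *v pull_backward V (cpt s) H (cpt w)"
    unfolding K[symmetric] by (simp add: pull_backward_def cpt_diff matrix_vector_mul_assoc)
   finally show ?thesis .
  qed
  then show "Q (pull_backward V (cpt s) H)" by (simp add: Q_def)
 qed (use G in \<open>simp add: Q_def\<close>)
 then show ?thesis by (simp add: Q_def)
qed

lemma norm_le_components: "norm (x :: complex^2) \<le> norm (x $ 1) + norm (x $ 2)"
proof -
 have "norm x = L2_set (\<lambda>i. norm (x $ i)) UNIV" by (simp add: norm_vec_def)
 also have "\<dots> \<le> (\<Sum>i\<in>UNIV. norm (x $ i))" by (rule L2_set_le_sum) auto
 finally show ?thesis by (simp add: UNIV_2)
qed

lemma norm_component_le: "norm ((x :: complex^'n) $ i) \<le> norm x"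
 by (rule Finite_Cartesian_Product.norm_nth_le)

lemma lattice_average_pointwise:
 assumes C: "C \<ge> 1" and V: "\<And>z x. z \<in> strip \<delta> \<Longrightarrow> norm (V z *v x) \<le> C * norm x" and W: "\<And>z x. z \<in> strip \<delta> \<Longrightarrow> norm (W z *v x) \<le> C * norm x"
  and z: "z \<in> strip \<delta>" and x: "\<bar>x\<bar> \<le> R" and B: "B \<ge> 0"
  and G: "\<And>n::int. norm (G (z + cpt (of_int n *\<^sub>R s))) \<le> B * exp (- (x + of_int n)\<^sup>2)"
 shows "norm (lattice_pull V W (cpt s) n G z $ i) \<le> B * gauss_weight C R n"
  and "(\<lambda>n. lattice_pull V W (cpt s) n G z $ i) summable_on UNIV"
  and "norm (lattice_average V W (cpt s) G z) \<le> 2 * (B * infsum (gauss_weight C R) UNIV)"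
proof -
 have bd: "norm (lattice_pull V W (cpt s) n G z $ i) \<le> B * gauss_weight C R n" for n i
 proof -
  have "norm (lattice_pull V W (cpt s) n G z $ i) \<le> norm (lattice_pull V W (cpt s) n G z)" by (rule norm_component_le)
  also have "\<dots> \<le> C ^ nat \<bar>n\<bar> * norm (G (z + cpt (of_int n *\<^sub>R s)))" by (rule lattice_pull_bound[OF C V W z])
  also have "\<dots> \<le> C ^ nat \<bar>n\<bar> * (B * exp (- (max 0 (\<bar>of_int n\<bar> - R))\<^sup>2))"
   using C B exp_square_shift_le[OF x, of n] by (intro mult_left_mono order_trans[OF G] mult_left_mono) auto
  finally show ?thesis by (simp add: gauss_weight_def mult_ac)
 qed
 have sw: "(\<lambda>n. B * gauss_weight C R n) summable_on UNIV" by (intro summable_on_cmult_right gauss_weight_summable C)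
 have sn: "(\<lambda>n. norm (lattice_pull V W (cpt s) n G z $ i)) summable_on UNIV" for i
  by (rule summable_on_comparison_test[OF sw]) (use bd in auto)
 show "norm (lattice_pull V W (cpt s) n G z $ i) \<le> B * gauss_weight C R n" by (rule bd)
 show "(\<lambda>n. lattice_pull V W (cpt s) n G z $ i) summable_on UNIV" by (rule abs_summable_summable[OF sn])
 have "norm (lattice_average V W (cpt s) G z $ i) \<le> B * infsum (gauss_weight C R) UNIV" for i
 proof -
  have "norm (lattice_average V W (cpt s) G z $ i) \<le> (\<Sum>\<^sub>\<infinity>n. norm (lattice_pull V W (cpt s) n G z $ i))"
   unfolding lattice_average_def vec_lambda_beta by (rule norm_infsum_bound[OF sn])
  also have "\<dots> \<le> (\<Sum>\<^sub>\<infinity>n. B * gauss_weight C R n)" by (intro infsum_mono sn sw bd)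
  also have "\<dots> = B * infsum (gauss_weight C R) UNIV" by (rule infsum_cmult_right')
  finally show ?thesis .
 qed
 from add_mono[OF this[of 1] this[of 2]] show "norm (lattice_average V W (cpt s) G z) \<le> 2 * (B * infsum (gauss_weight C R) UNIV)"
  using norm_le_components[of "lattice_average V W (cpt s) G z"] by simp
qed

lemma matrix_vector_infsum:
 fixes M :: "complex^2^2"
 assumes "\<And>i. (\<lambda>n. f n $ i) summable_on UNIV"
 shows "(\<chi> i. \<Sum>\<^sub>\<infinity>n. (M *v f n) $ i) = M *v (\<chi> i. \<Sum>\<^sub>\<infinity>n. f n $ i)"
proof -
 have "(\<Sum>\<^sub>\<infinity>n. (M *v f n) $ i) = (\<Sum>k\<in>UNIV. M $ i $ k * (\<Sum>\<^sub>\<infinity>n. f n $ k))" for i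
 proof -
  have "((\<lambda>n. M $ i $ 1 * f n $ 1 + M $ i $ 2 * f n $ 2) has_sum (M $ i $ 1 * (\<Sum>\<^sub>\<infinity>n. f n $ 1) + M $ i $ 2 * (\<Sum>\<^sub>\<infinity>n. f n $ 2))) UNIV"
   by (intro has_sum_add has_sum_cmult_right has_sum_infsum assms)
  then show ?thesis by (simp add: matrix_vector_mult_def infsumI UNIV_2)
 qed
 then show ?thesis by (simp add: vec_eq_iff matrix_vector_mult_def)
qed

lemma lattice_average_shift:
 assumes VW: "V z ** W z = mat 1" and s: "\<And>i. (\<lambda>n. lattice_pull V W s n G z $ i) summable_on UNIV"
 shows "lattice_average V W s G (z + s) = V z *v lattice_average V W s G z"
proof -
 have b: "bij (\<lambda>n::int. n + 1)" by (rule bij_betw_byWitness[where f' = "\<lambda>n. n - 1"]) auto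
 have sb: "(\<lambda>n. lattice_pull V W s (n + 1) G z $ i) summable_on UNIV" for i
  using summable_on_reindex_bij_betw[OF b, of "\<lambda>n. lattice_pull V W s n G z $ i"] s by simp
 have "lattice_average V W s G (z + s) = (\<chi> i. \<Sum>\<^sub>\<infinity>n. (V z *v lattice_pull V W s (n + 1) G z) $ i)"
  unfolding lattice_average_def lattice_pull_shift[where V = V and W = W and z = z, OF VW] ..
 also have "\<dots> = V z *v (\<chi> i. \<Sum>\<^sub>\<infinity>n. lattice_pull V W s (n + 1) G z $ i)"
  by (rule matrix_vector_infsum[OF sb])
 also have "(\<lambda>i. \<Sum>\<^sub>\<infinity>n. lattice_pull V W s (n + 1) G z $ i) = (\<lambda>i. \<Sum>\<^sub>\<infinity>n. lattice_pull V W s n G z $ i)"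
  by (intro ext infsum_reindex_bij_betw[OF b])
 finally show ?thesis by (simp add: lattice_average_def)
qed

lemma lattice_average_error:
 assumes V: "\<And>w x. norm (V (cpt w) *v x) = norm x" and W: "\<And>w x. norm (W (cpt w) *v x) = norm x"
  and VW: "\<And>w. W (cpt w) ** V (cpt w) = mat 1"
  and e: "\<And>w. e (w + s) = V (cpt w) *v e w"
  and sm: "\<And>i. (\<lambda>n. lattice_pull V W (cpt s) n G (cpt w) $ i) summable_on UNIV"
  and a: "((\<lambda>n::int. a (w + of_int n *\<^sub>R s)) has_sum b) UNIV" and \<kappa>: "\<kappa> \<ge> 0"
  and err: "\<And>n::int. norm (G (cpt (w + of_int n *\<^sub>R s)) - a (w + of_int n *\<^sub>R s) *s e (w + of_int n *\<^sub>R s)) \<le> \<kappa> * exp (- (x + of_int n)\<^sup>2)"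
 shows "norm (lattice_average V W (cpt s) G (cpt w) - b *s e w) \<le> 2 * (\<kappa> * gauss_theta)"
proof -
 define D where "D n = lattice_pull V W (cpt s) n G (cpt w) - a (w + of_int n *\<^sub>R s) *s e w" for n :: int
 have Db: "norm (D n $ i) \<le> \<kappa> * exp (- (x + of_int n)\<^sup>2)" for n i
 proof -
  have "norm (D n $ i) \<le> norm (D n)" by (rule norm_component_le)
  also have "\<dots> \<le> \<kappa> * exp (- (x + of_int n)\<^sup>2)"
   unfolding D_def lattice_pull_error[OF V W VW e] by (rule err)
  finally show ?thesis .
 qed
 have sg: "(\<lambda>n::int. \<kappa> * exp (- (x + of_int n)\<^sup>2)) summable_on UNIV" by (intro summable_on_cmult_right gauss_sum_bound)
 have sn: "(\<lambda>n. norm (D n $ i)) summable_on UNIV" for i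
  by (rule summable_on_comparison_test[OF sg]) (use Db in auto)
 have "norm ((lattice_average V W (cpt s) G (cpt w) - b *s e w) $ i) \<le> \<kappa> * gauss_theta" for i
 proof -
  have "((\<lambda>n. lattice_pull V W (cpt s) n G (cpt w) $ i - a (w + of_int n *\<^sub>R s) * e w $ i) has_sum
    (lattice_average V W (cpt s) G (cpt w) $ i - b * e w $ i)) UNIV"
   unfolding lattice_average_def vec_lambda_beta
   by (intro has_sum_diff_complex has_sum_infsum sm has_sum_cmult_left a)
  then have "(lattice_average V W (cpt s) G (cpt w) - b *s e w) $ i = (\<Sum>\<^sub>\<infinity>n. D n $ i)"
   by (simp add: D_def infsumI)
  also have "norm \<dots> \<le> (\<Sum>\<^sub>\<infinity>n. norm (D n $ i))" by (rule norm_infsum_bound[OF sn])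
  also have "\<dots> \<le> (\<Sum>\<^sub>\<infinity>n::int. \<kappa> * exp (- (x + of_int n)\<^sup>2))" by (intro infsum_mono sn sg Db)
  also have "\<dots> = \<kappa> * (\<Sum>\<^sub>\<infinity>n::int. exp (- (x + of_int n)\<^sup>2))" by (rule infsum_cmult_right')
  also have "\<dots> \<le> \<kappa> * gauss_theta" by (intro mult_left_mono gauss_sum_bound \<kappa>)
  finally show ?thesis .
 qed
 from add_mono[OF this[of 1] this[of 2]] show ?thesis
  using norm_le_components[of "lattice_average V W (cpt s) G (cpt w) - b *s e w"] by (simp add: mult.commute[of \<kappa>])
qed

lemma matrix_norm_bound:
 fixes M :: "complex^2^2"
 assumes "\<And>i k. norm (M $ i $ k) \<le> B"
 shows "norm (M *v x) \<le> max 1 (4 * B) * norm x"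
proof -
 have B: "B \<ge> 0" using order_trans[OF norm_ge_zero assms] .
 have "norm ((M *v x) $ i) \<le> 2 * B * norm x" for i
 proof -
  have "norm ((M *v x) $ i) \<le> norm (M $ i $ 1) * norm (x $ 1) + norm (M $ i $ 2) * norm (x $ 2)"
   by (simp add: matrix_vector_mult_def UNIV_2 norm_triangle_mono norm_mult flip: norm_mult)
  also have "\<dots> \<le> B * norm x + B * norm x"
   by (intro add_mono mult_mono assms norm_component_le B) auto
  finally show ?thesis by simp
 qed
 from add_mono[OF this[of 1] this[of 2]] have "norm (M *v x) \<le> (4 * B) * norm x"
  using norm_le_components[of "M *v x"] by simp
 also have "\<dots> \<le> max 1 (4 * B) * norm x" by (intro mult_right_mono) auto
 finally show ?thesis .
qed

text \<open>At real points the adjoint, hence the inverse where the matrix is unitary.\<close>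

definition adjoint_extension :: "(C2 \<Rightarrow> complex^2^2) \<Rightarrow> C2 \<Rightarrow> complex^2^2" where
 "adjoint_extension V z = (\<chi> i k. schwarz_reflect (\<lambda>z. V z $ k $ i) z)"

lemma adjoint_extension_cpt: "adjoint_extension V (cpt w) = conj_transpose (V (cpt w))"
 by (simp add: adjoint_extension_def conj_transpose_def vec_eq_iff)

lemma unitary_conj_transpose: "unitary_matrix M \<Longrightarrow> unitary_matrix (conj_transpose M)"
 unfolding unitary_matrix_def by (simp add: conj_transpose_def vec_eq_iff)

text \<open>Continuous equivariant sections are uniform limits of holomorphic ones.  Averaging the
 Gaussian approximation of a section cut off by a tent function over the lattice, first in one and then in
 the other direction, restores equivariance, and the tents add up to one.\<close>

lemma analytic_section_approx:
 fixes V :: "2 \<Rightarrow> C2 \<Rightarrow> complex^2^2"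
 assumes \<delta>: "0 < \<delta>" "\<delta> \<le> 1" and sh: "\<And>j i k. strip_hol \<delta> (\<lambda>z. V j z $ i $ k)"
  and Vb: "\<And>j z i k. z \<in> strip \<delta> \<Longrightarrow> norm (V j z $ i $ k) \<le> B"
  and Vu: "\<And>j w. unitary_matrix (V j (cpt w))"
  and K: "\<And>w. V 1 (cpt (w + axis 2 1)) ** V 2 (cpt w) = V 2 (cpt (w + axis 1 1)) ** V 1 (cpt w)"
  and ec: "continuous_on UNIV e" and e: "\<And>j w. e (w + axis j 1) = V j (cpt w) *v e w"
  and \<epsilon>: "\<epsilon> > 0"
 shows "\<exists>v. (\<forall>i. strip_hol \<delta> (\<lambda>z. v z $ i)) \<and>
  (\<forall>j w. v (cpt (w + axis j 1)) = V j (cpt w) *v v (cpt w)) \<and> (\<forall>w. norm (v (cpt w) - e w) \<le> \<epsilon>)"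
proof -
 define W where "W j = adjoint_extension (V j)" for j
 have Wsh: "strip_hol \<delta> (\<lambda>z. W j z $ i $ k)" for j i k
  using sh_reflect[OF sh[of j k i]] by (simp add: W_def adjoint_extension_def)
 have Wb: "norm (W j z $ i $ k) \<le> B" if "z \<in> strip \<delta>" for j z i k
  using Vb[of "conj_pair z" j k i] that by (simp add: W_def adjoint_extension_def schwarz_reflect_def)
 define C where "C = max 1 (4 * B)"
 have C: "C \<ge> 1" by (simp add: C_def)
 have VC: "norm (V j z *v x) \<le> C * norm x" and WC: "norm (W j z *v x) \<le> C * norm x" if "z \<in> strip \<delta>" for j z x
  unfolding C_def by (intro matrix_norm_bound Vb Wb that)+
 have Vn: "norm (V j (cpt w) *v x) = norm x" for j w x by (rule unitary_norm[OF Vu])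
 have Wn: "norm (W j (cpt w) *v x) = norm x" for j w x
  unfolding W_def adjoint_extension_cpt by (intro unitary_norm unitary_conj_transpose Vu)
 have VW: "V j (cpt w) ** W j (cpt w) = mat 1" "W j (cpt w) ** V j (cpt w) = mat 1" for j w
  unfolding W_def adjoint_extension_cpt using Vu[of j w] by (auto simp: unitary_matrix_def)
 define \<theta> where "\<theta> = gauss_theta"
 have \<theta>: "\<theta> \<ge> 0" unfolding \<theta>_def by (rule gauss_theta_nonneg)
 \<comment> \<open>each of the two averages multiplies the error by at most \<open>2 \<theta>\<close>, and the initial error is \<open>2 \<epsilon>'\<close>\<close>
 define \<epsilon>' where "\<epsilon>' = \<epsilon> / (8 * \<theta>\<^sup>2 + 1)"
 have \<epsilon>': "\<epsilon>' > 0" using \<epsilon> by (simp add: \<epsilon>'_def add_nonneg_pos)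
 define a where "a w = complex_of_real (tent (w $ 1) * tent (w $ 2))" for w :: "real^2"
 have ac: "continuous_on UNIV a" unfolding a_def[abs_def] tent_def by (intro continuous_intros)
 have asupp: "a w = 0" if "(w $ 1)\<^sup>2 + (w $ 2)\<^sup>2 \<ge> 2" for w
 proof -
  have "(w $ 1)\<^sup>2 \<ge> 1 \<or> (w $ 2)\<^sup>2 \<ge> 1" using that by linarith
  then have "\<bar>w $ 1\<bar> \<ge> 1 \<or> \<bar>w $ 2\<bar> \<ge> 1" by (metis abs_square_less_1 not_le)
  then show ?thesis by (auto simp: a_def tent_def)
 qed
 have "\<exists>G C. (\<forall>\<delta>. strip_hol \<delta> G) \<and> (\<forall>z\<in>strip 1. norm (G z) \<le> C * gauss_bound z) \<and>
  (\<forall>w. norm (G (cpt w) - a w * e w $ i) \<le> \<epsilon>' * exp (- ((w $ 1)\<^sup>2 + (w $ 2)\<^sup>2)))" for i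
  by (rule gaussian_approx[where R = 2, OF _ _ \<epsilon>']) (use asupp in \<open>auto intro!: continuous_intros ac ec\<close>)
 then obtain g D where g: "\<And>i \<delta>. strip_hol \<delta> (g i)" "\<And>i z. z \<in> strip 1 \<Longrightarrow> norm (g i z) \<le> D i * gauss_bound z"
  "\<And>i w. norm (g i (cpt w) - a w * e w $ i) \<le> \<epsilon>' * exp (- ((w $ 1)\<^sup>2 + (w $ 2)\<^sup>2))"
  by metis
 define G where "G z = (\<chi> i. g i z)" for z
 define B0 where "B0 = \<bar>D 1\<bar> + \<bar>D 2\<bar>"
 have B0: "B0 \<ge> 0" by (simp add: B0_def)
 have Gb: "norm (G z) \<le> B0 * gauss_bound z" if "z \<in> strip \<delta>" for z
 proof -
  have "z \<in> strip 1" using that \<delta> strip_mono by blast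
  then have "norm (g i z) \<le> \<bar>D i\<bar> * gauss_bound z" for i
   using g(2)[of z i] gauss_bound_le(2)[of z] by (meson abs_ge_self mult_right_mono order_trans)
  from add_mono[OF this[of 1] this[of 2]] show ?thesis
   using norm_le_components[of "G z"] by (simp add: G_def B0_def ring_distribs)
 qed
 have Gerr: "norm (G (cpt w) - a w *s e w) \<le> 2 * \<epsilon>' * (exp (- (w $ 1)\<^sup>2) * exp (- (w $ 2)\<^sup>2))" for w
  using add_mono[OF g(3)[of 1 w] g(3)[of 2 w]] norm_le_components[of "G (cpt w) - a w *s e w"]
  by (simp add: G_def exp_add[symmetric])
 have Gsh: "strip_hol \<delta> (\<lambda>z. G z $ i)" for i using g(1) by (simp add: G_def)
 define s1 s2 :: "real^2" where "s1 = axis 1 1" and "s2 = axis 2 1"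
 define Q where "Q R = infsum (gauss_weight C R) UNIV" for R
 have Q: "Q R \<ge> 0" for R unfolding Q_def by (intro infsum_nonneg gauss_weight_nonneg C)
 have st: "z + cpt (r *\<^sub>R s) \<in> strip \<delta> \<longleftrightarrow> z \<in> strip \<delta>" for z r s by simp
 have G_trans: "norm (G (z + cpt (of_int n *\<^sub>R s1))) \<le> (B0 * exp (- (Re (snd z))\<^sup>2)) * exp (- (Re (fst z) + of_int n)\<^sup>2)"
  if "z \<in> strip \<delta>" for z and n :: int
 proof -
  have "norm (G (z + cpt (of_int n *\<^sub>R s1))) \<le> B0 * gauss_bound (z + cpt (of_int n *\<^sub>R s1))"
   by (rule Gb) (use that in simp)
  then show ?thesis by (simp add: gauss_bound_def s1_def cpt_def axis_def mult_ac)
 qed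
 define G1 where "G1 = lattice_average (V 1) (W 1) (cpt s1) G"
 have pw1: "norm (lattice_pull (V 1) (W 1) (cpt s1) n G z $ i) \<le> (B0 * exp (- (Re (snd z))\<^sup>2)) * gauss_weight C R n"
   "(\<lambda>n. lattice_pull (V 1) (W 1) (cpt s1) n G z $ i) summable_on UNIV"
   "norm (G1 z) \<le> 2 * ((B0 * exp (- (Re (snd z))\<^sup>2)) * Q R)"
  if "z \<in> strip \<delta>" "\<bar>Re (fst z)\<bar> \<le> R" for z n i R
 proof -
  have "B0 * exp (- (Re (snd z))\<^sup>2) \<ge> 0" using B0 by simp
  note lp = lattice_average_pointwise[where V = "V 1" and W = "W 1" and G = G, OF C VC WC that this G_trans[OF that(1)]]
  show "norm (lattice_pull (V 1) (W 1) (cpt s1) n G z $ i) \<le> (B0 * exp (- (Re (snd z))\<^sup>2)) * gauss_weight C R n"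
   by (rule lp(1))
  show "(\<lambda>n. lattice_pull (V 1) (W 1) (cpt s1) n G z $ i) summable_on UNIV" by (rule lp(2))
  show "norm (G1 z) \<le> 2 * ((B0 * exp (- (Re (snd z))\<^sup>2)) * Q R)" unfolding G1_def Q_def by (rule lp(3))
 qed
 have G1sh: "strip_hol \<delta> (\<lambda>z. G1 z $ i)" for i
  unfolding G1_def lattice_average_def vec_lambda_beta
 proof (rule sh_infsum)
  show "strip_hol \<delta> (\<lambda>z. lattice_pull (V 1) (W 1) (cpt s1) n G z $ i)" for n
   by (intro sh_lattice_pull sh Wsh Gsh)
  fix R
  show "\<exists>M. M summable_on UNIV \<and> (\<forall>n\<in>UNIV. \<forall>z\<in>strip \<delta>. \<bar>Re (fst z)\<bar> \<le> R \<longrightarrow> \<bar>Re (snd z)\<bar> \<le> R \<longrightarrow>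
    norm (lattice_pull (V 1) (W 1) (cpt s1) n G z $ i) \<le> M n)"
  proof (intro exI[of _ "\<lambda>n. B0 * gauss_weight C R n"] conjI ballI impI)
   show "(\<lambda>n. B0 * gauss_weight C R n) summable_on UNIV" by (intro summable_on_cmult_right gauss_weight_summable C)
   fix n :: int and z assume z: "z \<in> strip \<delta>" "\<bar>Re (fst z)\<bar> \<le> R"
   have "B0 * exp (- (Re (snd z))\<^sup>2) \<le> B0 * 1" using B0 by (intro mult_left_mono) auto
   then have "(B0 * exp (- (Re (snd z))\<^sup>2)) * gauss_weight C R n \<le> B0 * gauss_weight C R n"
    using gauss_weight_nonneg[OF C] by (intro mult_right_mono) auto
   then show "norm (lattice_pull (V 1) (W 1) (cpt s1) n G z $ i) \<le> B0 * gauss_weight C R n"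
    using pw1(1)[OF z] by (rule order_trans[rotated])
  qed
 qed
 have G1eq: "G1 (cpt (w + s1)) = V 1 (cpt w) *v G1 (cpt w)" for w
  unfolding G1_def cpt_add
  by (rule lattice_average_shift[where V = "V 1" and W = "W 1" and z = "cpt w", OF VW(1)]) (rule pw1(2)[OF _ order_refl], use \<delta> in simp)
 have e1: "e (w + s1) = V 1 (cpt w) *v e w" and e2: "e (w + s2) = V 2 (cpt w) *v e w" for w using e by (auto simp: s1_def s2_def)
 have G1err: "norm (G1 (cpt w) - of_real (tent (w $ 2)) *s e w) \<le> 2 * ((2 * \<epsilon>' * exp (- (w $ 2)\<^sup>2)) * \<theta>)" for w
  unfolding G1_def \<theta>_def
 proof (rule lattice_average_error[where V = "V 1" and W = "W 1" and a = a and x = "w $ 1", OF Vn Wn VW(2) e1])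
  show "(\<lambda>n. lattice_pull (V 1) (W 1) (cpt s1) n G (cpt w) $ i) summable_on UNIV" for i
   by (rule pw1(2)[OF _ order_refl]) (use \<delta> in simp)
  have "((\<lambda>n::int. complex_of_real (tent (w $ 1 + of_int n) * tent (w $ 2))) has_sum of_real (1 * tent (w $ 2))) UNIV"
   by (intro has_sum_of_real has_sum_cmult_left tent_partition)
  then show "((\<lambda>n::int. a (w + of_int n *\<^sub>R s1)) has_sum of_real (tent (w $ 2))) UNIV"
   by (simp add: a_def s1_def axis_def)
  show "norm (G (cpt (w + of_int n *\<^sub>R s1)) - a (w + of_int n *\<^sub>R s1) *s e (w + of_int n *\<^sub>R s1)) \<le>
    2 * \<epsilon>' * exp (- (w $ 2)\<^sup>2) * exp (- (w $ 1 + of_int n)\<^sup>2)" for n :: int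
   using Gerr[of "w + of_int n *\<^sub>R s1"] by (simp add: s1_def axis_def mult_ac)
 qed (use \<epsilon>' in simp)
 have G1_trans: "norm (G1 (z + cpt (of_int n *\<^sub>R s2))) \<le> (2 * B0 * Q R) * exp (- (Re (snd z) + of_int n)\<^sup>2)"
  if "z \<in> strip \<delta>" "\<bar>Re (fst z)\<bar> \<le> R" for z and n :: int and R
  using pw1(3)[of "z + cpt (of_int n *\<^sub>R s2)" R] that by (simp add: s2_def cpt_def axis_def mult_ac strip_iff)
 define G2 where "G2 = lattice_average (V 2) (W 2) (cpt s2) G1"
 have pw2: "norm (lattice_pull (V 2) (W 2) (cpt s2) n G1 z $ i) \<le> (2 * B0 * Q R) * gauss_weight C R n"
   "(\<lambda>n. lattice_pull (V 2) (W 2) (cpt s2) n G1 z $ i) summable_on UNIV"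
  if "z \<in> strip \<delta>" "\<bar>Re (fst z)\<bar> \<le> R" "\<bar>Re (snd z)\<bar> \<le> R" for z n i R
 proof -
  have "2 * B0 * Q R \<ge> 0" using B0 Q by simp
  note lp = lattice_average_pointwise[where V = "V 2" and W = "W 2" and G = G1, OF C VC WC that(1,3) this G1_trans[OF that(1,2)]]
  show "norm (lattice_pull (V 2) (W 2) (cpt s2) n G1 z $ i) \<le> (2 * B0 * Q R) * gauss_weight C R n"
   by (rule lp(1))
  show "(\<lambda>n. lattice_pull (V 2) (W 2) (cpt s2) n G1 z $ i) summable_on UNIV" by (rule lp(2))
 qed
 have pw2': "(\<lambda>n. lattice_pull (V 2) (W 2) (cpt s2) n G1 (cpt w) $ i) summable_on UNIV" for w i
  by (rule pw2(2)[of _ "max \<bar>Re (fst (cpt w))\<bar> \<bar>Re (snd (cpt w))\<bar>"]) (use \<delta> in auto)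
 have G2sh: "strip_hol \<delta> (\<lambda>z. G2 z $ i)" for i
  unfolding G2_def lattice_average_def vec_lambda_beta
 proof (rule sh_infsum)
  show "strip_hol \<delta> (\<lambda>z. lattice_pull (V 2) (W 2) (cpt s2) n G1 z $ i)" for n
   by (intro sh_lattice_pull sh Wsh G1sh)
  fix R
  show "\<exists>M. M summable_on UNIV \<and> (\<forall>n\<in>UNIV. \<forall>z\<in>strip \<delta>. \<bar>Re (fst z)\<bar> \<le> R \<longrightarrow> \<bar>Re (snd z)\<bar> \<le> R \<longrightarrow>
    norm (lattice_pull (V 2) (W 2) (cpt s2) n G1 z $ i) \<le> M n)"
   by (intro exI[of _ "\<lambda>n. (2 * B0 * Q R) * gauss_weight C R n"] conjI ballI impI summable_on_cmult_right gauss_weight_summable C pw2(1))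
 qed
 have G2eq2: "G2 (cpt (w + s2)) = V 2 (cpt w) *v G2 (cpt w)" for w
  unfolding G2_def cpt_add by (rule lattice_average_shift[where V = "V 2" and W = "W 2" and z = "cpt w", OF VW(1) pw2'])
 have G2eq1: "G2 (cpt (w + s1)) = V 1 (cpt w) *v G2 (cpt w)" for w
 proof -
  have K': "V 1 (cpt (w + s2)) ** V 2 (cpt w) = V 2 (cpt (w + s1)) ** V 1 (cpt w)" for w using K by (simp add: s1_def s2_def)
  have "lattice_pull (V 2) (W 2) (cpt s2) n G1 (cpt (w + s1)) = V 1 (cpt w) *v lattice_pull (V 2) (W 2) (cpt s2) n G1 (cpt w)" for n
   by (rule lattice_pull_commute[OF K' VW G1eq])
  then have "G2 (cpt (w + s1)) = (\<chi> i. \<Sum>\<^sub>\<infinity>n. (V 1 (cpt w) *v lattice_pull (V 2) (W 2) (cpt s2) n G1 (cpt w)) $ i)"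
   by (simp add: G2_def lattice_average_def)
  also have "\<dots> = V 1 (cpt w) *v G2 (cpt w)"
   unfolding G2_def lattice_average_def by (rule matrix_vector_infsum[OF pw2'])
  finally show ?thesis .
 qed
 have G2err: "norm (G2 (cpt w) - 1 *s e w) \<le> 2 * ((4 * \<epsilon>' * \<theta>) * \<theta>)" for w
  unfolding G2_def \<theta>_def[symmetric]
 proof (rule lattice_average_error[where V = "V 2" and W = "W 2" and a = "\<lambda>w. of_real (tent (w $ 2))" and x = "w $ 2", OF Vn Wn VW(2) e2 pw2', folded \<theta>_def])
  have "((\<lambda>n::int. complex_of_real (tent (w $ 2 + of_int n))) has_sum of_real 1) UNIV"
   by (intro has_sum_of_real tent_partition)
  then show "((\<lambda>n::int. complex_of_real (tent ((w + of_int n *\<^sub>R s2) $ 2))) has_sum 1) UNIV"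
   by (simp add: s2_def axis_def)
  show "norm (G1 (cpt (w + of_int n *\<^sub>R s2)) - of_real (tent ((w + of_int n *\<^sub>R s2) $ 2)) *s e (w + of_int n *\<^sub>R s2)) \<le>
    4 * \<epsilon>' * \<theta> * exp (- (w $ 2 + of_int n)\<^sup>2)" for n :: int
   using G1err[of "w + of_int n *\<^sub>R s2"] by (simp add: s2_def axis_def mult_ac)
 qed (use \<epsilon>' \<theta> in simp)
 have "2 * ((4 * \<epsilon>' * \<theta>) * \<theta>) \<le> \<epsilon>"
 proof -
  have "2 * ((4 * \<epsilon>' * \<theta>) * \<theta>) = \<epsilon> * ((8 * \<theta>\<^sup>2) / (8 * \<theta>\<^sup>2 + 1))" by (simp add: \<epsilon>'_def power2_eq_square)
  also have "\<dots> \<le> \<epsilon> * 1" using \<epsilon> by (intro mult_left_mono) (auto simp: divide_le_eq add_nonneg_pos)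
  finally show ?thesis by simp
 qed
 then have err: "norm (G2 (cpt w) - e w) \<le> \<epsilon>" for w using G2err[of w] by simp
 have "G2 (cpt (w + axis j 1)) = V j (cpt w) *v G2 (cpt w)" for j w
  using exhaust_2[of j] G2eq1 G2eq2 by (auto simp: s1_def s2_def)
 then show ?thesis using G2sh err by blast
qed

section \<open>Holomorphic extension of a dominated splitting\<close>

text \<open>The denominators are within the factor \<open>1 - \<epsilon>\<close> of \<open>\<eta>\<close>, and the difference of two values is the determinant times the difference of
 the arguments over the product of the two denominators.\<close>

lemma moebius_estimate:
 fixes \<alpha> \<beta> \<gamma> \<eta> x y :: complex and r r' \<kappa> \<epsilon> :: real
 assumes r: "r > 0" "r' > 0" and \<kappa>: "0 \<le> \<kappa>" "0 \<le> \<epsilon>" "\<epsilon> < 1" "\<kappa> + \<epsilon> < (1 - \<epsilon>)\<^sup>2" and \<eta>: "\<eta> \<noteq> 0"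
  and a: "norm \<alpha> * r' \<le> \<kappa> * norm \<eta> * r" and b: "norm \<beta> \<le> \<epsilon> * norm \<eta> * r" and c: "norm \<gamma> * r' \<le> \<epsilon> * norm \<eta>"
  and x: "norm x \<le> r'" and y: "norm y \<le> r'"
 shows "\<gamma> * x + \<eta> \<noteq> 0" and "norm ((\<alpha> * x + \<beta>) / (\<gamma> * x + \<eta>)) \<le> r"
  and "norm ((\<alpha> * x + \<beta>) / (\<gamma> * x + \<eta>) - (\<alpha> * y + \<beta>) / (\<gamma> * y + \<eta>)) \<le> (\<kappa> + \<epsilon>) / (1 - \<epsilon>)\<^sup>2 * (r / r' * norm (x - y))"
proof -
 have n: "norm \<eta> > 0" using \<eta> by simp
 have den: "(1 - \<epsilon>) * norm \<eta> \<le> norm (\<gamma> * x + \<eta>)" if "norm x \<le> r'" for x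
 proof -
  have "norm (\<gamma> * x) \<le> norm \<gamma> * r'" unfolding norm_mult by (intro mult_left_mono that) auto
  also have "\<dots> \<le> \<epsilon> * norm \<eta>" by (rule c)
  finally show ?thesis using norm_diff_ineq[of \<eta> "\<gamma> * x"] by (simp add: algebra_simps)
 qed
 have pos: "(1 - \<epsilon>) * norm \<eta> > 0" using n \<kappa> by simp
 have nz: "\<gamma> * x + \<eta> \<noteq> 0" if "norm x \<le> r'" for x using den[OF that] pos by auto
 show "\<gamma> * x + \<eta> \<noteq> 0" by (rule nz[OF x])
 have "norm (\<alpha> * x + \<beta>) \<le> norm \<alpha> * r' + \<epsilon> * norm \<eta> * r"
  by (intro norm_triangle_mono b) (use x in \<open>auto simp: norm_mult intro!: mult_left_mono\<close>)
 also have "\<dots> \<le> \<kappa> * norm \<eta> * r + \<epsilon> * norm \<eta> * r" using a by simp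
 also have "\<dots> = (\<kappa> + \<epsilon>) * (norm \<eta> * r)" by (simp add: algebra_simps)
 also have "\<dots> \<le> (1 - \<epsilon>) * (norm \<eta> * r)"
 proof (rule mult_right_mono)
  have "(1 - \<epsilon>)\<^sup>2 \<le> 1 - \<epsilon>" using \<kappa> by (simp add: power2_eq_square mult_left_le)
  then show "\<kappa> + \<epsilon> \<le> 1 - \<epsilon>" using \<kappa> by linarith
 qed (use n r in auto)
 also have "\<dots> = ((1 - \<epsilon>) * norm \<eta>) * r" by simp
 also have "\<dots> \<le> norm (\<gamma> * x + \<eta>) * r" by (intro mult_right_mono den x) (use r in simp)
 finally show "norm ((\<alpha> * x + \<beta>) / (\<gamma> * x + \<eta>)) \<le> r"
  using nz[OF x] by (simp add: norm_divide divide_le_eq mult.commute)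
 have eq: "(\<alpha> * x + \<beta>) / (\<gamma> * x + \<eta>) - (\<alpha> * y + \<beta>) / (\<gamma> * y + \<eta>) = (\<alpha> * \<eta> - \<beta> * \<gamma>) * (x - y) / ((\<gamma> * x + \<eta>) * (\<gamma> * y + \<eta>))"
  using nz[OF x] nz[OF y] by (simp add: divide_simps) (simp add: algebra_simps)
 have "norm (\<alpha> * \<eta> - \<beta> * \<gamma>) * r' \<le> (norm \<alpha> * norm \<eta> + norm \<beta> * norm \<gamma>) * r'"
  by (intro mult_right_mono order_trans[OF norm_triangle_ineq4]) (use r in \<open>auto simp: norm_mult\<close>)
 also have "\<dots> = (norm \<alpha> * r') * norm \<eta> + norm \<beta> * (norm \<gamma> * r')" by (simp add: algebra_simps)
 also have "\<dots> \<le> (\<kappa> * norm \<eta> * r) * norm \<eta> + (\<epsilon> * norm \<eta> * r) * (\<epsilon> * norm \<eta>)"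
  by (intro add_mono mult_mono mult_right_mono a b c) (use n r \<kappa> in auto)
 also have "\<dots> = (\<kappa> + \<epsilon> * \<epsilon>) * ((norm \<eta>)\<^sup>2 * r)" by (simp add: power2_eq_square algebra_simps)
 also have "\<dots> \<le> (\<kappa> + \<epsilon>) * ((norm \<eta>)\<^sup>2 * r)"
  using \<kappa> r by (intro mult_right_mono add_left_mono mult_left_le) auto
 finally have num: "norm (\<alpha> * \<eta> - \<beta> * \<gamma>) \<le> (\<kappa> + \<epsilon>) * ((norm \<eta>)\<^sup>2 * r) / r'"
  using r by (simp add: pos_le_divide_eq)
 have dd: "((1 - \<epsilon>) * norm \<eta>) * ((1 - \<epsilon>) * norm \<eta>) \<le> norm ((\<gamma> * x + \<eta>) * (\<gamma> * y + \<eta>))"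
  unfolding norm_mult by (intro mult_mono den x y) (use pos in auto)
 have "norm ((\<alpha> * \<eta> - \<beta> * \<gamma>) * (x - y) / ((\<gamma> * x + \<eta>) * (\<gamma> * y + \<eta>)))
   \<le> ((\<kappa> + \<epsilon>) * ((norm \<eta>)\<^sup>2 * r) / r' * norm (x - y)) / (((1 - \<epsilon>) * norm \<eta>) * ((1 - \<epsilon>) * norm \<eta>))"
  unfolding norm_divide norm_mult[of _ "x - y"]
  by (intro frac_le mult_right_mono num dd) (use pos \<kappa> r in \<open>auto intro!: mult_nonneg_nonneg divide_nonneg_nonneg mult_pos_pos\<close>)
 also have "\<dots> = (\<kappa> + \<epsilon>) / (1 - \<epsilon>)\<^sup>2 * (r / r' * norm (x - y))"
 proof -
  define p where "p = 1 - \<epsilon>"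
  have "p > 0" using \<kappa> by (simp add: p_def)
  then show ?thesis unfolding p_def[symmetric] using n r by (simp add: power2_eq_square field_simps)
 qed
 finally show "norm ((\<alpha> * x + \<beta>) / (\<gamma> * x + \<eta>) - (\<alpha> * y + \<beta>) / (\<gamma> * y + \<eta>)) \<le> (\<kappa> + \<epsilon>) / (1 - \<epsilon>)\<^sup>2 * (r / r' * norm (x - y))"
  unfolding eq .
qed

text \<open>The graph transform acts on slopes by fractional linear maps that contract discs; the radius of the disc may depend on
 the point. Its iterates are holomorphic and converge uniformly, and on real points the fixed point is the only one.\<close>

lemma graph_transform:
 fixes \<alpha> \<beta> \<gamma> \<eta> :: "C2 \<Rightarrow> complex" and \<rho> :: "C2 \<Rightarrow> real" and \<sigma> :: "real^2"
 assumes sh: "strip_hol \<delta> \<alpha>" "strip_hol \<delta> \<beta>" "strip_hol \<delta> \<gamma>" "strip_hol \<delta> \<eta>"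
  and \<delta>: "\<delta> > 0" and \<rho>: "\<And>z. \<rho> z > 0" "\<And>w. \<rho> (cpt w) = 1"
  and \<rho>b: "\<And>R. \<exists>M. \<forall>z\<in>strip \<delta>. \<bar>Re (fst z)\<bar> \<le> R \<longrightarrow> \<bar>Re (snd z)\<bar> \<le> R \<longrightarrow> \<rho> z \<le> M"
  and \<kappa>: "0 \<le> \<kappa>" "0 \<le> \<epsilon>" "\<epsilon> < 1" "\<kappa> + \<epsilon> < (1 - \<epsilon>)\<^sup>2"
  and \<eta>: "\<And>z. z \<in> strip \<delta> \<Longrightarrow> \<eta> z \<noteq> 0"
  and a: "\<And>z. z \<in> strip \<delta> \<Longrightarrow> norm (\<alpha> z) * \<rho> (z + cpt \<sigma>) \<le> \<kappa> * norm (\<eta> z) * \<rho> z"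
  and b: "\<And>z. z \<in> strip \<delta> \<Longrightarrow> norm (\<beta> z) \<le> \<epsilon> * norm (\<eta> z) * \<rho> z"
  and c: "\<And>z. z \<in> strip \<delta> \<Longrightarrow> norm (\<gamma> z) * \<rho> (z + cpt \<sigma>) \<le> \<epsilon> * norm (\<eta> z)"
  and s: "\<And>w. norm (s w) \<le> 1" "\<And>w. s w * (\<gamma> (cpt w) * s (w + \<sigma>) + \<eta> (cpt w)) = \<alpha> (cpt w) * s (w + \<sigma>) + \<beta> (cpt w)"
 obtains t where "strip_hol \<delta> t" "\<And>w. t (cpt w) = s w"
proof -
 define \<phi> where "\<phi> z x = (\<alpha> z * x + \<beta> z) / (\<gamma> z * x + \<eta> z)" for z x
 define k where "k = (\<kappa> + \<epsilon>) / (1 - \<epsilon>)\<^sup>2"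
 have k: "0 \<le> k" "k < 1" using \<kappa> by (auto simp: k_def divide_less_eq)
 have \<phi>: "\<gamma> z * x + \<eta> z \<noteq> 0" "norm (\<phi> z x) \<le> \<rho> z" "norm (\<phi> z x - \<phi> z y) \<le> k * (\<rho> z / \<rho> (z + cpt \<sigma>) * norm (x - y))"
  if z: "z \<in> strip \<delta>" and "norm x \<le> \<rho> (z + cpt \<sigma>)" "norm y \<le> \<rho> (z + cpt \<sigma>)" for z x y
  unfolding \<phi>_def k_def
  by (rule moebius_estimate[OF \<rho>(1) \<rho>(1) \<kappa> \<eta>[OF z] a[OF z] b[OF z] c[OF z] that(2,3)])+
 \<comment> \<open>iterates of the transform, starting from the slope zero\<close>
 define T where "T n = ((\<lambda>f z. \<phi> z (f (z + cpt \<sigma>))) ^^ n) (\<lambda>z. 0)" for n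
 have T0: "T 0 z = 0" and TS: "T (Suc n) z = \<phi> z (T n (z + cpt \<sigma>))" for n z by (simp_all add: T_def)
 have Tb: "z \<in> strip \<delta> \<Longrightarrow> norm (T n z) \<le> \<rho> z" for n z
 proof (induction n arbitrary: z)
  case 0 then show ?case using \<rho>(1)[of z] by (simp add: T0)
 next
  case (Suc n)
  then have "norm (T n (z + cpt \<sigma>)) \<le> \<rho> (z + cpt \<sigma>)" by simp
  then show ?case unfolding TS using \<phi>(2)[OF Suc.prems] by blast
 qed
 have Td: "z \<in> strip \<delta> \<Longrightarrow> norm (T (Suc n) z - T n z) \<le> k ^ n * \<rho> z" for n z
 proof (induction n arbitrary: z)
  case 0 then show ?case using Tb[of z 1] by (simp add: T0)
 next
  case (Suc n)
  have z': "z + cpt \<sigma> \<in> strip \<delta>" using Suc.prems by simp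
  have "norm (T (Suc (Suc n)) z - T (Suc n) z) \<le> k * (\<rho> z / \<rho> (z + cpt \<sigma>) * norm (T (Suc n) (z + cpt \<sigma>) - T n (z + cpt \<sigma>)))"
   unfolding TS[of "Suc n"] TS[of n z] by (rule \<phi>(3)[OF Suc.prems Tb[OF z'] Tb[OF z']])
  also have "\<dots> \<le> k * (\<rho> z / \<rho> (z + cpt \<sigma>) * (k ^ n * \<rho> (z + cpt \<sigma>)))"
   using k \<rho>(1)[of z] \<rho>(1)[of "z + cpt \<sigma>"] by (intro mult_left_mono Suc.IH z') auto
  also have "\<dots> = k ^ Suc n * \<rho> z" using \<rho>(1)[of "z + cpt \<sigma>"] by simp
  finally show ?case .
 qed
 have Tsh: "strip_hol \<delta> (T n)" for n
 proof (induction n)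
  case 0
  have "T 0 = (\<lambda>z. 0)" by (simp add: T_def)
  then show ?case by simp
 next
  case (Suc n)
  have "strip_hol \<delta> (\<lambda>z. (\<alpha> z * T n (z + cpt \<sigma>) + \<beta> z) / (\<gamma> z * T n (z + cpt \<sigma>) + \<eta> z))"
  proof (intro sh_divide sh_add sh_mult sh sh_translate Suc)
   fix z assume z: "z \<in> strip \<delta>"
   then show "\<gamma> z * T n (z + cpt \<sigma>) + \<eta> z \<noteq> 0" by (intro \<phi>(1)[OF z Tb Tb]) auto
  qed
  then show ?case by (simp add: TS[abs_def] \<phi>_def)
 qed
 define t where "t z = (\<Sum>\<^sub>\<infinity>n. T (Suc n) z - T n z)" for z
 have ks: "(\<lambda>n. k ^ n) summable_on UNIV"
  by (rule norm_summable_imp_summable_on) (use k in \<open>auto intro!: summable_geometric simp: power_abs\<close>)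
 have tsh: "strip_hol \<delta> t" unfolding t_def
 proof (rule sh_infsum)
  show "strip_hol \<delta> (\<lambda>z. T (Suc n) z - T n z)" for n by (intro sh_diff Tsh)
  fix R
  obtain M where M: "\<And>z. z \<in> strip \<delta> \<Longrightarrow> \<bar>Re (fst z)\<bar> \<le> R \<Longrightarrow> \<bar>Re (snd z)\<bar> \<le> R \<Longrightarrow> \<rho> z \<le> M" using \<rho>b by blast
  show "\<exists>M. M summable_on UNIV \<and> (\<forall>n\<in>UNIV. \<forall>z\<in>strip \<delta>. \<bar>Re (fst z)\<bar> \<le> R \<longrightarrow> \<bar>Re (snd z)\<bar> \<le> R \<longrightarrow>
    norm (T (Suc n) z - T n z) \<le> M n)"
  proof (intro exI[of _ "\<lambda>n. k ^ n * M"] conjI ballI impI)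
   show "(\<lambda>n. k ^ n * M) summable_on UNIV" by (intro summable_on_cmult_left ks)
   fix n :: nat and z assume z: "z \<in> strip \<delta>" "\<bar>Re (fst z)\<bar> \<le> R" "\<bar>Re (snd z)\<bar> \<le> R"
   show "norm (T (Suc n) z - T n z) \<le> k ^ n * M"
    by (rule order_trans[OF Td[OF z(1)]]) (use M[OF z] k in \<open>auto intro: mult_left_mono\<close>)
  qed
 qed
 have lim: "(\<lambda>n. T n z) \<longlonglongrightarrow> t z" if z: "z \<in> strip \<delta>" for z
 proof -
  have "(\<lambda>n. T (Suc n) z - T n z) summable_on UNIV"
  proof (rule abs_summable_summable, rule summable_on_comparison_test)
   show "(\<lambda>n. k ^ n * \<rho> z) summable_on UNIV" by (intro summable_on_cmult_left ks)
  qed (use Td[OF z] in auto)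
  then have "(\<lambda>n. T (Suc n) z - T n z) sums t z"
   unfolding t_def by (intro has_sum_imp_sums has_sum_infsum)
  then show ?thesis unfolding sums_def sum_lessThan_telescope[of "\<lambda>n. T n z"] T0 by simp
 qed
 have teq: "t z = \<phi> z (t (z + cpt \<sigma>))" and tb: "norm (t z) \<le> \<rho> z" if z: "z \<in> strip \<delta>" for z
 proof -
  have z': "z + cpt \<sigma> \<in> strip \<delta>" using z by simp
  have bd: "norm (t z) \<le> \<rho> z" if "z \<in> strip \<delta>" for z
   by (rule tendsto_upperbound[OF tendsto_norm[OF lim[OF that]]]) (use Tb[OF that] in auto)
  then show "norm (t z) \<le> \<rho> z" using z by blast
  have "(\<lambda>n. T (Suc n) z) \<longlonglongrightarrow> \<phi> z (t (z + cpt \<sigma>))"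
   unfolding TS \<phi>_def by (intro tendsto_intros lim z' \<phi>(1)[OF z bd[OF z'] bd[OF z']])
  moreover have "(\<lambda>n. T (Suc n) z) \<longlonglongrightarrow> t z" using lim[OF z] by (rule LIMSEQ_Suc)
  ultimately show "t z = \<phi> z (t (z + cpt \<sigma>))" by (rule LIMSEQ_unique[rotated])
 qed
 \<comment> \<open>on the real orbit both \<open>t\<close> and \<open>s\<close> are fixed by the transform, and their distance is at most 2\<close>
 have d: "norm (t (cpt w) - s w) \<le> k * norm (t (cpt (w + \<sigma>)) - s (w + \<sigma>))" for w
 proof -
  have z: "cpt w \<in> strip \<delta>" "cpt (w + \<sigma>) \<in> strip \<delta>" using \<delta> by auto
  have r: "\<rho> (cpt w + cpt \<sigma>) = 1" using \<rho>(2)[of "w + \<sigma>"] by (simp add: cpt_add)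
  have t1: "norm (t (cpt w + cpt \<sigma>)) \<le> 1" using tb[OF z(2)] r by (simp add: cpt_add)
  have "norm (\<phi> (cpt w) (t (cpt w + cpt \<sigma>)) - \<phi> (cpt w) (s (w + \<sigma>))) \<le> k * (\<rho> (cpt w) / \<rho> (cpt w + cpt \<sigma>) * norm (t (cpt w + cpt \<sigma>) - s (w + \<sigma>)))"
   by (rule \<phi>(3)[OF z(1)]) (use t1 s(1) r in auto)
  moreover have "\<phi> (cpt w) (s (w + \<sigma>)) = s w"
  proof -
   have "\<gamma> (cpt w) * s (w + \<sigma>) + \<eta> (cpt w) \<noteq> 0" by (rule \<phi>(1)[OF z(1)]) (use s(1) r in auto)
   then show ?thesis unfolding \<phi>_def s(2)[of w, symmetric] by simp
  qed
  ultimately show ?thesis using teq[OF z(1)] r \<rho>(2) by (simp add: cpt_add)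
 qed
 have it: "norm (t (cpt w) - s w) \<le> k ^ n * 2" for n w
 proof (induction n arbitrary: w)
  case 0
  have "norm (t (cpt w) - s w) \<le> norm (t (cpt w)) + norm (s w)" by (rule norm_triangle_ineq4)
  also have "\<dots> \<le> 1 + 1" using tb[of "cpt w"] \<delta> \<rho>(2) s(1) by (intro add_mono) auto
  finally show ?case by simp
 next
  case (Suc n)
  have "norm (t (cpt w) - s w) \<le> k * norm (t (cpt (w + \<sigma>)) - s (w + \<sigma>))" by (rule d)
  also have "\<dots> \<le> k * (k ^ n * 2)" by (intro mult_left_mono Suc k)
  finally show ?case by simp
 qed
 have "t (cpt w) = s w" for w
 proof -
  have "(\<lambda>n. k ^ n * 2) \<longlonglongrightarrow> 0 * 2" by (intro tendsto_intros LIMSEQ_power_zero) (use k in auto)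
  then have "norm (t (cpt w) - s w) \<le> 0 * 2"
   by (rule tendsto_lowerbound) (use it in auto)
  then show ?thesis by simp
 qed
 then show ?thesis using that tsh by blast
qed

definition det2 :: "complex^2 \<Rightarrow> complex^2 \<Rightarrow> complex" where
 "det2 x y = x $ 1 * y $ 2 - x $ 2 * y $ 1"

lemma det2_simps [simp]:
 "det2 (x + y) z = det2 x z + det2 y z" "det2 x (y + z) = det2 x y + det2 x z"
 "det2 (x - y) z = det2 x z - det2 y z" "det2 x (y - z) = det2 x y - det2 x z"
 "det2 (c *s x) y = c * det2 x y" "det2 x (c *s y) = c * det2 x y" "det2 x x = 0"
 by (simp_all add: det2_def algebra_simps)

lemma det2_swap: "det2 y x = - det2 x y"
 by (simp add: det2_def)

lemma det2_matrix: "det2 (M *v x) (M *v y) = det M * det2 x y"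
 by (simp add: det2_def matrix_vector_mult_def UNIV_2 det_2 algebra_simps)

lemma norm_det2: "norm (det2 x y) \<le> 2 * norm x * norm y"
proof -
 have "norm (det2 x y) \<le> norm (x $ 1) * norm (y $ 2) + norm (x $ 2) * norm (y $ 1)"
  unfolding det2_def norm_mult[symmetric] by (rule norm_triangle_ineq4)
 also have "\<dots> \<le> norm x * norm y + norm x * norm y"
  by (intro add_mono mult_mono norm_component_le) auto
 finally show ?thesis by simp
qed

lemma det2_zero_parallel: "det2 x y = 0 \<Longrightarrow> y \<noteq> 0 \<Longrightarrow> \<exists>c. x = c *s y"
proof -
 assume d: "det2 x y = 0" and y: "y \<noteq> 0"
 show ?thesis
 proof (cases "y $ 1 = 0")
  case True
  then have "y $ 2 \<noteq> 0" using y by (metis real2_eqI zero_index)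
  then have "x = (x $ 2 / y $ 2) *s y" using d True by (intro real2_eqI) (auto simp: det2_def)
  then show ?thesis ..
 next
  case False
  then have "x = (x $ 1 / y $ 1) *s y" using d by (intro real2_eqI) (auto simp: det2_def field_simps)
  then show ?thesis ..
 qed
qed

lemma det2_nz: "L \<in> CP1 \<Longrightarrow> L' \<in> CP1 \<Longrightarrow> L \<noteq> L' \<Longrightarrow> x \<in> L \<Longrightarrow> y \<in> L' \<Longrightarrow> x \<noteq> 0 \<Longrightarrow> y \<noteq> 0 \<Longrightarrow> det2 x y \<noteq> 0"
proof
 assume a: "L \<in> CP1" "L' \<in> CP1" "L \<noteq> L'" "x \<in> L" "y \<in> L'" "x \<noteq> 0" "y \<noteq> 0" "det2 x y = 0"
 then obtain c where c: "x = c *s y" using det2_zero_parallel by blast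
 then have "complex_line x = complex_line y" using complex_line_eqI a(6) by (metis vector_smult_lzero)
 then show False using CP1_eq_line[of L x] CP1_eq_line[of L' y] a by simp
qed

lemma continuous_det2 [continuous_intros]:
 "continuous_on S f \<Longrightarrow> continuous_on S g \<Longrightarrow> continuous_on S (\<lambda>w. det2 (f w) (g w))"
 unfolding det2_def by (intro continuous_intros)

lemma sh_det2:
 assumes "\<And>i. strip_hol \<delta> (\<lambda>z. f z $ i)" "\<And>i. strip_hol \<delta> (\<lambda>z. g z $ i)"
 shows "strip_hol \<delta> (\<lambda>z. det2 (f z) (g z))"
 unfolding det2_def by (intro sh_diff sh_mult assms)

text \<open>Averaging the logarithmic growth ratio over one domination period gives a metric in which every single step dominates.\<close>

lemma adapted_weight:
 fixes \<phi> :: "real^2 \<Rightarrow> real"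
 assumes \<phi>: "continuous_on UNIV \<phi>" "\<And>j w. \<phi> (w + axis j 1) = \<phi> w" and N: "N > 0"
  and le: "\<And>w. (\<Sum>i<N. \<phi> (w + real i *\<^sub>R \<tau>)) \<le> c"
 obtains \<theta> where "continuous_on UNIV \<theta>" "\<And>j w. \<theta> (w + axis j 1) = \<theta> w" "\<And>w. \<phi> w + \<theta> (w + \<tau>) - \<theta> w \<le> c / real N"
proof -
 define S where "S n w = (\<Sum>i<n. \<phi> (w + real i *\<^sub>R \<tau>))" for n w
 define \<theta> where "\<theta> w = (\<Sum>n<N. S n w) / real N" for w
 have "\<phi> (w + axis j 1 + x) = \<phi> (w + x)" for w j x using \<phi>(2)[of "w + x" j] by (simp add: add_ac)
 then have Sp: "S n (w + axis j 1) = S n w" for n w j by (simp add: S_def)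
 have Sc: "continuous_on UNIV (S n)" for n unfolding S_def[abs_def]
  by (intro continuous_intros continuous_on_compose2[OF \<phi>(1)]) auto
 have st: "S n (w + \<tau>) - S n w = \<phi> (w + real n *\<^sub>R \<tau>) - \<phi> w" for n w
 proof (induction n)
  case (Suc n)
  have e2: "w + \<tau> + real n *\<^sub>R \<tau> = w + real (Suc n) *\<^sub>R \<tau>" by (simp add: algebra_simps)
  have "S (Suc n) (w + \<tau>) - S (Suc n) w = (S n (w + \<tau>) - S n w) + \<phi> (w + \<tau> + real n *\<^sub>R \<tau>) - \<phi> (w + real n *\<^sub>R \<tau>)"
   by (simp add: S_def)
  then show ?case using Suc unfolding e2 by simp
 qed (simp add: S_def)
 have "\<theta> (w + \<tau>) - \<theta> w = S N w / real N - \<phi> w" for w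
 proof -
  have "\<theta> (w + \<tau>) - \<theta> w = (\<Sum>n<N. S n (w + \<tau>) - S n w) / real N"
   by (simp add: \<theta>_def sum_subtractf diff_divide_distrib)
  also have "\<dots> = S N w / real N - \<phi> w"
   unfolding st using N by (simp add: sum_subtractf diff_divide_distrib S_def)
  finally show ?thesis .
 qed
 note \<theta>d = this
 have "\<phi> w + \<theta> (w + \<tau>) - \<theta> w \<le> c / real N" for w
 proof -
  have "S N w / real N \<le> c / real N" using le[of w] by (simp add: S_def divide_right_mono)
  then show ?thesis using \<theta>d[of w] by linarith
 qed
 moreover have "continuous_on UNIV \<theta>" unfolding \<theta>_def[abs_def] by (intro continuous_intros Sc) (use N in auto)
 ultimately show ?thesis using that[of \<theta>] by (simp add: \<theta>_def Sp)
qed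

lemma cocycle_iterate_section:
 assumes "\<And>w. A w *v e w = q w *s e (w + \<tau>)"
 shows "cocycle_iterate \<tau> A n w *v e w = (\<Prod>i<n. q (w + real i *\<^sub>R \<tau>)) *s e (w + real n *\<^sub>R \<tau>)"
proof (induction n)
 case (Suc n)
 have eq: "w + real n *\<^sub>R \<tau> + \<tau> = w + real (Suc n) *\<^sub>R \<tau>" by (simp add: algebra_simps)
 have "cocycle_iterate \<tau> A (Suc n) w *v e w = A (w + real n *\<^sub>R \<tau>) *v ((\<Prod>i<n. q (w + real i *\<^sub>R \<tau>)) *s e (w + real n *\<^sub>R \<tau>))"
  using Suc by (simp add: matrix_vector_mul_assoc[symmetric])
 also have "\<dots> = (\<Prod>i<Suc n. q (w + real i *\<^sub>R \<tau>)) *s e (w + real n *\<^sub>R \<tau> + \<tau>)"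
  unfolding matrix_smult_vec assms by (simp add: vector_smult_assoc)
 finally show ?case unfolding eq .
qed simp

lemma restricted_norm_eq:
 assumes "L \<in> CP1" "e \<in> L" "norm e = 1"
 shows "restricted_norm M L = norm (M *v e)" "restricted_conorm M L = norm (M *v e)"
proof -
 have e0: "e \<noteq> 0" using assms(3) by auto
 have eq: "norm (M *v v) = norm (M *v e)" if "v \<in> unit_vectors L" for v
 proof -
  from that obtain c where c: "v = c *s e" using CP1_multiple[OF assms(1) _ assms(2) e0] unfolding unit_vectors_def by blast
  then have "norm c = 1" using that assms(3) by (simp add: unit_vectors_def norm_smult)
  then show ?thesis by (simp add: c matrix_smult_vec norm_smult)
 qed
 have ne: "unit_vectors L \<noteq> {}" using assms by (auto simp: unit_vectors_def)
 show "restricted_norm M L = norm (M *v e)" unfolding restricted_norm_def using ne eq by simp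
 show "restricted_conorm M L = norm (M *v e)" unfolding restricted_conorm_def using ne eq by simp
qed

lemma strip_extension:
 assumes "extends_to_strip \<delta> M"
 obtains F B where "\<And>i j. strip_hol \<delta> (\<lambda>z. F z $ i $ j)" "\<And>z i j. z \<in> strip \<delta> \<Longrightarrow> norm (F z $ i $ j) \<le> B" "\<And>w. F (cpt w) = M w"
proof -
 obtain f G where f: "open G" "closed_strip \<delta> \<subseteq> G" "matrix_holomorphic_on f G" "bounded (f ` closed_strip \<delta>)" "\<And>w. f (complexify w) = M w"
  using assms unfolding extends_to_strip_def by blast
 define vec where "vec z = (\<chi> j::2. if j = 1 then fst z else snd z)" for z :: "C2"
 have vc: "vec z \<in> closed_strip \<delta>" if "z \<in> strip \<delta>" for z
  using that by (auto simp: vec_def closed_strip_def strip_iff)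
 have vcont: "continuous_on S vec" for S unfolding vec_def[abs_def]
 proof (rule continuous_on_vec_lambda)
  fix j :: 2
  show "continuous_on S (\<lambda>z::C2. if j = 1 then fst z else snd z)" by (cases "j = 1") (auto intro: continuous_intros)
 qed
 define F where "F z = f (vec z)" for z
 obtain B where B: "\<And>x. x \<in> closed_strip \<delta> \<Longrightarrow> norm (f x) \<le> B" using f(4) by (auto simp: bounded_iff)
 have "norm (F z $ i $ j) \<le> B" if "z \<in> strip \<delta>" for z i j
  using B[OF vc[OF that]] norm_component_le[of "f (vec z) $ i" j] Finite_Cartesian_Product.norm_nth_le[of "f (vec z)" i]
  unfolding F_def by linarith
 moreover have "F (cpt w) = M w" for w
 proof -
  have "vec (cpt w) = complexify w" by (intro real2_eqI) (auto simp: vec_def cpt_def complexify_def)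
  then show ?thesis using f(5) by (simp add: F_def)
 qed
 moreover have "strip_hol \<delta> (\<lambda>z. F z $ i $ j)" for i j
 proof -
  have D: "\<exists>D. ((\<lambda>x. f x $ i $ j) has_derivative D) (at (vec z)) \<and> (\<forall>a v. D (a *s v) = a * D v)" if "z \<in> strip \<delta>" for z
   using f(3) vc[OF that] f(2) unfolding matrix_holomorphic_on_def by blast
  have gen: "((\<lambda>a. f (g a) $ i $ j) has_field_derivative d) (at a)"
   if g: "\<And>h. g (a + h) = g a + h *s u" and der: "((\<lambda>x. f x $ i $ j) has_derivative D) (at (g a))" and lin: "\<And>a v. D (a *s v) = a * D v" and d: "d = D u" for g a u D d
  proof -
   have gd: "(g has_derivative (\<lambda>h. h *s u)) (at a)"
   proof (rule has_derivativeI_sandwich[where e = 1 and H = "\<lambda>_. 0"])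
    show "bounded_linear (\<lambda>h. h *s u)"
    proof (rule bounded_linear_intro[where K = "norm u"])
     show "(x + y) *s u = x *s u + y *s u" for x y by (simp add: vec_eq_iff algebra_simps)
     show "(r *\<^sub>R x) *s u = r *\<^sub>R (x *s u)" for r x by (simp add: vec_eq_iff)
    qed (simp add: norm_smult)
    fix y
    have "g y - g a - (y - a) *s u = 0" using g[of "y - a"] by simp
    then show "norm (g y - g a - (y - a) *s u) / norm (y - a) \<le> 0" by simp
   qed auto
   have "((\<lambda>a. f (g a) $ i $ j) has_derivative (\<lambda>h. D (h *s u))) (at a)"
    using has_derivative_compose[OF gd der] .
   then show ?thesis unfolding has_field_derivative_def lin d by (simp add: mult.commute[of _ "D u"])
  qed
  show ?thesis unfolding strip_hol_def
  proof (intro conjI ballI)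
   show "continuous_on (strip \<delta>) (\<lambda>z. F z $ i $ j)"
   proof (rule continuous_at_imp_continuous_on, rule ballI)
    fix z assume z: "z \<in> strip \<delta>"
    have "isCont (\<lambda>x. f x $ i $ j) (vec z)" using D[OF z] has_derivative_continuous by blast
    moreover have "isCont vec z" using vcont[of UNIV] continuous_on_eq_continuous_at[OF open_UNIV] by blast
    ultimately show "isCont (\<lambda>z. F z $ i $ j) z" unfolding F_def by (rule isCont_o2[rotated])
   qed
   {
    fix b assume b: "b \<in> band \<delta>"
    show "(\<lambda>a. F (a, b) $ i $ j) holomorphic_on band \<delta>"
     unfolding holomorphic_on_open[OF open_band]
    proof
     fix a assume a: "a \<in> band \<delta>"
     then obtain D where D: "((\<lambda>x. f x $ i $ j) has_derivative D) (at (vec (a, b)))" "\<And>a v. D (a *s v) = a * D v"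
      using D[of "(a, b)"] b by (auto simp: strip_def)
     have "((\<lambda>a. f ((\<lambda>a. vec (a, b)) a) $ i $ j) has_field_derivative D (axis 1 1)) (at a)"
      by (rule gen[where u = "axis 1 1" and D = D and g = "\<lambda>a. vec (a, b)", OF _ D(1) D(2) refl]) (auto simp: vec_def axis_def vec_eq_iff)
     then show "\<exists>f'. ((\<lambda>a. F (a, b) $ i $ j) has_field_derivative f') (at a)" unfolding F_def by blast
    qed
   }
   {
    fix a assume a: "a \<in> band \<delta>"
    show "(\<lambda>b. F (a, b) $ i $ j) holomorphic_on band \<delta>"
     unfolding holomorphic_on_open[OF open_band]
    proof
     fix b assume b: "b \<in> band \<delta>"
     then obtain D where D: "((\<lambda>x. f x $ i $ j) has_derivative D) (at (vec (a, b)))" "\<And>a v. D (a *s v) = a * D v"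
      using D[of "(a, b)"] a by (auto simp: strip_def)
     have "((\<lambda>b. f ((\<lambda>b. vec (a, b)) b) $ i $ j) has_field_derivative D (axis 2 1)) (at b)"
      by (rule gen[where u = "axis 2 1" and D = D and g = "\<lambda>b. vec (a, b)", OF _ D(1) D(2) refl])
       (use exhaust_2 in \<open>auto simp: vec_def axis_def vec_eq_iff\<close>)
     then show "\<exists>f'. ((\<lambda>b. F (a, b) $ i $ j) has_field_derivative f') (at b)" unfolding F_def by blast
    qed
   }
  qed
 qed
 ultimately show ?thesis using that by blast
qed

lemma open_Collect_less_on:
 fixes f g :: "'a::topological_space \<Rightarrow> real"
 assumes "open S" "continuous_on S f" "continuous_on S g"
 shows "open {z\<in>S. f z < g z}"
proof -
 have "continuous_on S (\<lambda>z. g z - f z)" by (intro continuous_intros assms)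
 then have "open ((\<lambda>z. g z - f z) -` {0<..} \<inter> S)"
  using continuous_on_open_vimage[OF assms(1)] open_greaterThan by blast
 moreover have "(\<lambda>z. g z - f z) -` {0<..} \<inter> S = {z\<in>S. f z < g z}" by auto
 ultimately show ?thesis by simp
qed

lemma norm_det_unitary: "unitary_matrix (M :: complex^2^2) \<Longrightarrow> norm (det M) = 1"
proof -
 assume "unitary_matrix M"
 then have "det (conj_transpose M ** M) = 1" by (simp add: unitary_matrix_def)
 then have "det (conj_transpose M) * det M = 1" by (simp add: det_mul)
 moreover have "det (conj_transpose M) = cnj (det M)" by (simp add: det_2 conj_transpose_def mult.commute)
 ultimately have "cnj (det M) * det M = 1" by simp
 then have "norm (cnj (det M) * det M) = 1" by simp
 then show ?thesis by (simp add: norm_mult) (metis abs_norm_cancel abs_square_eq_1 power2_eq_square)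
qed

lemma sh_det:
 fixes F :: "C2 \<Rightarrow> complex^2^2"
 assumes "\<And>i k. strip_hol \<delta> (\<lambda>z. F z $ i $ k)"
 shows "strip_hol \<delta> (\<lambda>z. det (F z))"
 unfolding det_2 by (intro sh_diff sh_mult assms)

text \<open>The product of \<open>det F\<close> and its Schwarz reflection is 1 at real points, hence on the strip.\<close>

lemma det_unitary_extension_nz:
 fixes F :: "C2 \<Rightarrow> complex^2^2"
 assumes F: "\<And>i k. strip_hol \<delta> (\<lambda>z. F z $ i $ k)" and \<delta>: "\<delta> > 0" and u: "\<And>w. unitary_matrix (F (cpt w))"
  and z: "z \<in> strip \<delta>"
 shows "det (F z) \<noteq> 0"
proof -
 have "det (F z) * schwarz_reflect (\<lambda>z. det (F z)) z = 1"
 proof (rule sh_eqI[OF _ _ \<delta> _ z])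
  show "strip_hol \<delta> (\<lambda>z. det (F z) * schwarz_reflect (\<lambda>z. det (F z)) z)"
   by (intro sh_mult sh_reflect sh_det F)
  show "det (F (cpt w)) * schwarz_reflect (\<lambda>z. det (F z)) (cpt w) = 1" for w
   using norm_det_unitary[OF u[of w]] by (simp add: complex_norm_square[symmetric])
 qed simp
 then show ?thesis by auto
qed

text \<open>The matrix entries of the cocycle between the frames at \<open>z\<close> and \<open>z + \<tau>\<close>, by Cramer's rule and up to the determinant of the second frame.\<close>

definition pairing ::
 "real^2 \<Rightarrow> (C2 \<Rightarrow> complex^2^2) \<Rightarrow> (C2 \<Rightarrow> complex^2) \<Rightarrow> (C2 \<Rightarrow> complex^2)
  \<Rightarrow> C2 \<Rightarrow> complex" where
 "pairing \<tau> F x y z = det2 (F z *v x z) (y (z + cpt \<tau>))"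

text \<open>Off the real points the twist \<open>exp (2 \<pi> \<i> n z\<^sub>1)\<close> is not unimodular. The unit translation in \<open>z\<^sub>2\<close> divides this weight by its modulus.\<close>

definition twist_weight :: "int \<Rightarrow> C2 \<Rightarrow> real" where
 "twist_weight n z = exp (2 * pi * of_int n * Im (fst z) * Re (snd z))"

lemma sh_pairing:
 assumes "\<And>i k. strip_hol \<delta> (\<lambda>z. F z $ i $ k)" "\<And>i. strip_hol \<delta> (\<lambda>z. x z $ i)" "\<And>i. strip_hol \<delta> (\<lambda>z. y z $ i)"
 shows "strip_hol \<delta> (pairing \<tau> F x y)"
 unfolding pairing_def[abs_def]
 by (intro sh_det2 sh_matrix_vector assms sh_translate[where f = "\<lambda>z. y z $ _"])

lemma pairing_periodic:
 assumes \<delta>: "\<delta> > 0" and F: "\<And>i k. strip_hol \<delta> (\<lambda>z. F z $ i $ k)"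
  and x: "\<And>i. strip_hol \<delta> (\<lambda>z. x z $ i)" and y: "\<And>i. strip_hol \<delta> (\<lambda>z. y z $ i)"
  and U: "\<And>j i k. strip_hol \<delta> (\<lambda>z. U j z $ i $ k)"
  and K: "\<And>j w. F (cpt (w + axis j 1)) ** U j (cpt w) = U j (cpt (w + \<tau>)) ** F (cpt w)"
  and x1: "\<And>w. x (cpt (w + axis 1 1)) = U 1 (cpt w) *v x (cpt w)"
  and x2: "\<And>w. x (cpt (w + axis 2 1)) = twist m w *s (U 2 (cpt w) *v x (cpt w))"
  and y1: "\<And>w. y (cpt (w + axis 1 1)) = U 1 (cpt w) *v y (cpt w)"
  and y2: "\<And>w. y (cpt (w + axis 2 1)) = twist n w *s (U 2 (cpt w) *v y (cpt w))"
  and z: "z \<in> strip \<delta>"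
 shows "norm (pairing \<tau> F x y (z + cpt (axis 1 1))) = norm (det (U 1 (z + cpt \<tau>))) * norm (pairing \<tau> F x y z)"
  and "norm (pairing \<tau> F x y (z + cpt (axis 2 1))) =
   norm (det (U 2 (z + cpt \<tau>))) * exp (- 2 * pi * of_int (m + n) * Im (fst z)) * norm (pairing \<tau> F x y z)"
proof -
 have K': "F (cpt (w + axis j 1)) *v (U j (cpt w) *v v) = U j (cpt (w + \<tau>)) *v (F (cpt w) *v v)" for j w v
  using K by (simp add: matrix_vector_mul_assoc)
 have sw: "cpt (w + axis j 1) + cpt \<tau> = cpt (w + \<tau> + axis j 1)" "cpt w + cpt \<tau> = cpt (w + \<tau>)" for w j
  by (simp_all add: cpt_add add_ac)
 note sp = sh_pairing[OF F x y]
 have dsh: "strip_hol \<delta> (\<lambda>z. det (U j (z + cpt \<tau>)))" for j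
  by (rule sh_translate[OF sh_det[OF U]])
 have "pairing \<tau> F x y (z + cpt (axis 1 1)) = det (U 1 (z + cpt \<tau>)) * pairing \<tau> F x y z"
 proof (rule sh_eqI[OF sh_translate[OF sp] sh_mult[OF dsh sp] \<delta> _ z])
  fix w
  show "pairing \<tau> F x y (cpt w + cpt (axis 1 1)) = det (U 1 (cpt w + cpt \<tau>)) * pairing \<tau> F x y (cpt w)"
   unfolding cpt_add[symmetric, of w "axis 1 1"] pairing_def sw(1) x1 y1 K' det2_matrix
   unfolding sw(2) ..
 qed
 then show "norm (pairing \<tau> F x y (z + cpt (axis 1 1))) = norm (det (U 1 (z + cpt \<tau>))) * norm (pairing \<tau> F x y z)"
  by (simp add: norm_mult)
 define E where "E z = exp (2 * pi * \<i> * of_int m * fst z) * exp (2 * pi * \<i> * of_int n * (fst z + of_real (\<tau> $ 1)))" for z :: "C2"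
 have Esh: "strip_hol \<delta> E" unfolding E_def[abs_def] by (intro sh_mult sh_exp sh_add sh_const sh_fst)
 have "pairing \<tau> F x y (z + cpt (axis 2 1)) = (det (U 2 (z + cpt \<tau>)) * E z) * pairing \<tau> F x y z"
 proof (rule sh_eqI[OF sh_translate[OF sp] sh_mult[OF sh_mult[OF dsh Esh] sp] \<delta> _ z])
  fix w
  have "E (cpt w) = twist m w * exp (2 * pi * \<i> * of_int n * (w + \<tau>) $ 1)"
   by (simp add: E_def cpt_def)
  then show "pairing \<tau> F x y (cpt w + cpt (axis 2 1)) = (det (U 2 (cpt w + cpt \<tau>)) * E (cpt w)) * pairing \<tau> F x y (cpt w)"
   unfolding cpt_add[symmetric, of w "axis 2 1"] pairing_def sw(1) x2 y2 matrix_smult_vec K' det2_simps det2_matrix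
   unfolding sw(2)
   by (simp only: mult_ac)
 qed
 moreover have "norm (E z) = exp (- 2 * pi * of_int (m + n) * Im (fst z))"
  unfolding E_def norm_mult norm_exp_eq_Re exp_add[symmetric] by (simp add: algebra_simps)
 ultimately show "norm (pairing \<tau> F x y (z + cpt (axis 2 1))) =
   norm (det (U 2 (z + cpt \<tau>))) * exp (- 2 * pi * of_int (m + n) * Im (fst z)) * norm (pairing \<tau> F x y z)"
  by (simp only: norm_mult)
qed

lemma twist_weight_shift:
 "twist_weight n (z + cpt (axis 1 1)) = twist_weight n z"
 "twist_weight n (z + cpt (axis 2 1)) = twist_weight n z * exp (2 * pi * of_int n * Im (fst z))"
 "twist_weight n (z + cpt (axis 1 1) + cpt \<tau>) = twist_weight n (z + cpt \<tau>)"
 "twist_weight n (z + cpt (axis 2 1) + cpt \<tau>) = twist_weight n (z + cpt \<tau>) * exp (2 * pi * of_int n * Im (fst z))"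
 "twist_weight n (cpt w) = 1" "twist_weight n (cpt w + cpt \<tau>) = 1" "twist_weight n z > 0"
 by (simp_all add: twist_weight_def cpt_def axis_def exp_add[symmetric] algebra_simps)

lemma continuous_twist_weight: "continuous_on S (\<lambda>z. twist_weight n z)" "continuous_on S (\<lambda>z. twist_weight n (z + cpt \<tau>))"
 unfolding twist_weight_def by (intro continuous_intros)+

lemma scaled_less_iff: "(c::real) > 0 \<Longrightarrow> a' = c * a \<Longrightarrow> b' = c * b \<Longrightarrow> a' < b' \<longleftrightarrow> a < b"
 by simp

text \<open>Domination of the coefficients of the cocycle in a holomorphic frame persists off the real points. Because the
 frame vectors are twisted by different powers, the comparison must be weighted to be periodic.\<close>

lemma strip_domination:
 assumes \<delta>: "\<delta> > 0" and F: "\<And>i k. strip_hol \<delta> (\<lambda>z. F z $ i $ k)"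
  and x: "\<And>i. strip_hol \<delta> (\<lambda>z. x z $ i)" and y: "\<And>i. strip_hol \<delta> (\<lambda>z. y z $ i)"
  and U: "\<And>j i k. strip_hol \<delta> (\<lambda>z. U j z $ i $ k)" and Uu: "\<And>j w. unitary_matrix (U j (cpt w))"
  and K: "\<And>j w. F (cpt (w + axis j 1)) ** U j (cpt w) = U j (cpt (w + \<tau>)) ** F (cpt w)"
  and x1: "\<And>w. x (cpt (w + axis 1 1)) = U 1 (cpt w) *v x (cpt w)"
  and x2: "\<And>w. x (cpt (w + axis 2 1)) = twist m w *s (U 2 (cpt w) *v x (cpt w))"
  and y1: "\<And>w. y (cpt (w + axis 1 1)) = U 1 (cpt w) *v y (cpt w)"
  and y2: "\<And>w. y (cpt (w + axis 2 1)) = twist n w *s (U 2 (cpt w) *v y (cpt w))"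
  and dom: "\<And>w. norm (pairing \<tau> F x y (cpt w)) < \<kappa> * norm (pairing \<tau> F y x (cpt w))"
   "\<And>w. norm (pairing \<tau> F y y (cpt w)) < \<epsilon> * norm (pairing \<tau> F y x (cpt w))"
   "\<And>w. norm (pairing \<tau> F x x (cpt w)) < \<epsilon> * norm (pairing \<tau> F y x (cpt w))"
  and \<kappa>: "\<kappa> \<ge> 0" and d: "d = n - m"
 obtains \<delta>' where "0 < \<delta>'" "\<delta>' \<le> \<delta>"
  "\<And>z. z \<in> strip \<delta>' \<Longrightarrow> pairing \<tau> F y x z \<noteq> 0"
  "\<And>z. z \<in> strip \<delta>' \<Longrightarrow> norm (pairing \<tau> F x y z) * twist_weight d (z + cpt \<tau>) \<le> \<kappa> * norm (pairing \<tau> F y x z) * twist_weight d z"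
  "\<And>z. z \<in> strip \<delta>' \<Longrightarrow> norm (pairing \<tau> F y y z) * twist_weight d (z + cpt \<tau>) \<le> \<epsilon> * norm (pairing \<tau> F y x z)"
  "\<And>z. z \<in> strip \<delta>' \<Longrightarrow> norm (pairing \<tau> F x x z) \<le> \<epsilon> * norm (pairing \<tau> F y x z) * twist_weight d z"
proof -
 define xy yx xx yy where "xy z = norm (pairing \<tau> F x y z)" and "yx z = norm (pairing \<tau> F y x z)"
  and "xx z = norm (pairing \<tau> F x x z)" and "yy z = norm (pairing \<tau> F y y z)" for z
 define W W' where "W z = twist_weight d z" and "W' z = twist_weight d (z + cpt \<tau>)" for z
 have cont: "continuous_on (strip \<delta>) xy" "continuous_on (strip \<delta>) yx" "continuous_on (strip \<delta>) xx" "continuous_on (strip \<delta>) yy"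
  unfolding xy_def[abs_def] yx_def[abs_def] xx_def[abs_def] yy_def[abs_def]
  by (intro continuous_on_norm sh_cont sh_pairing F x y)+
 have Wc: "continuous_on (strip \<delta>) W" "continuous_on (strip \<delta>) W'"
  unfolding W_def[abs_def] W'_def[abs_def] by (rule continuous_twist_weight)+
 define S1 where "S1 = {z\<in>strip \<delta>. xy z * W' z < \<kappa> * yx z * W z}"
 define S2 where "S2 = {z\<in>strip \<delta>. yy z * W' z < \<epsilon> * yx z}"
 define S3 where "S3 = {z\<in>strip \<delta>. xx z < \<epsilon> * yx z * W z}"
 have "open S1" "open S2" "open S3" unfolding S1_def S2_def S3_def
  by (intro open_Collect_less_on open_strip continuous_intros cont Wc)+
 then have op: "open (S1 \<inter> S2 \<inter> S3)" by auto
 have real: "cpt w \<in> S1 \<inter> S2 \<inter> S3" for w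
  using dom[of w] \<delta> by (simp add: S1_def S2_def S3_def xy_def yx_def xx_def yy_def W_def W'_def twist_weight_shift)
 have per: "z + cpt (axis j 1) \<in> S1 \<inter> S2 \<inter> S3 \<longleftrightarrow> z \<in> S1 \<inter> S2 \<inter> S3" if z: "z \<in> strip \<delta>" for j z
 proof -
  have dn: "norm (det (U j (z + cpt \<tau>))) > 0" for j
   using det_unitary_extension_nz[OF U \<delta> Uu, of "z + cpt \<tau>" j] z by simp
  have zj: "z + cpt (axis j 1) \<in> strip \<delta>" for j using z by simp
  have "j = 1 \<or> j = 2" using exhaust_2 by blast
  then show ?thesis
  proof
   assume j: "j = 1"
   define D where "D = norm (det (U 1 (z + cpt \<tau>)))"
   note p = pairing_periodic(1)[OF \<delta> F _ _ U K, folded D_def]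
   have sh: "xy (z + cpt (axis 1 1)) = D * xy z" "yx (z + cpt (axis 1 1)) = D * yx z" "xx (z + cpt (axis 1 1)) = D * xx z" "yy (z + cpt (axis 1 1)) = D * yy z"
    unfolding xy_def yx_def xx_def yy_def D_def
    by (rule pairing_periodic(1)[OF \<delta> F x y U K x1 x2 y1 y2 z] pairing_periodic(1)[OF \<delta> F y x U K y1 y2 x1 x2 z]
     pairing_periodic(1)[OF \<delta> F x x U K x1 x2 x1 x2 z] pairing_periodic(1)[OF \<delta> F y y U K y1 y2 y1 y2 z])+
   have w: "W (z + cpt (axis 1 1)) = W z" "W' (z + cpt (axis 1 1)) = W' z" by (simp_all add: W_def W'_def twist_weight_shift)
   have D: "D > 0" using dn by (simp add: D_def)
   have "z + cpt (axis 1 1) \<in> S1 \<longleftrightarrow> z \<in> S1"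
    unfolding S1_def mem_Collect_eq sh w using z zj by (auto intro!: scaled_less_iff[OF D])
   moreover have "z + cpt (axis 1 1) \<in> S2 \<longleftrightarrow> z \<in> S2"
    unfolding S2_def mem_Collect_eq sh w using z zj by (auto intro!: scaled_less_iff[OF D])
   moreover have "z + cpt (axis 1 1) \<in> S3 \<longleftrightarrow> z \<in> S3"
    unfolding S3_def mem_Collect_eq sh w using z zj by (auto intro!: scaled_less_iff[OF D])
   ultimately show ?thesis unfolding j by blast
  next
   assume j: "j = 2"
   define D where "D = norm (det (U 2 (z + cpt \<tau>)))"
   define T where "T i = exp (- 2 * pi * of_int i * Im (fst z))" for i
   have T: "T i > 0" for i by (simp add: T_def)
   have Tm: "T a * T b = T (a + b)" for a b by (simp add: T_def exp_add[symmetric] algebra_simps)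
   have sh: "xy (z + cpt (axis 2 1)) = D * T (m + n) * xy z" "yx (z + cpt (axis 2 1)) = D * T (n + m) * yx z"
     "xx (z + cpt (axis 2 1)) = D * T (m + m) * xx z" "yy (z + cpt (axis 2 1)) = D * T (n + n) * yy z"
    unfolding xy_def yx_def xx_def yy_def D_def T_def
    by (rule pairing_periodic(2)[OF \<delta> F x y U K x1 x2 y1 y2 z] pairing_periodic(2)[OF \<delta> F y x U K y1 y2 x1 x2 z]
     pairing_periodic(2)[OF \<delta> F x x U K x1 x2 x1 x2 z] pairing_periodic(2)[OF \<delta> F y y U K y1 y2 y1 y2 z])+
   have w: "W (z + cpt (axis 2 1)) = W z * T (- d)" "W' (z + cpt (axis 2 1)) = W' z * T (- d)"
    by (simp_all add: W_def W'_def twist_weight_shift T_def)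
   have D: "D > 0" using dn by (simp add: D_def)
   have e2: "D * T (n + n) * yy z * (W' z * T (- d)) = D * T (n + m) * (yy z * W' z)"
   proof -
    have "T (n + n) * T (- d) = T (n + m)" unfolding Tm by (simp add: d)
    then show ?thesis by (metis (no_types, lifting) mult.assoc mult.commute)
   qed
   have e3: "\<epsilon> * (D * T (n + m) * yx z) * (W z * T (- d)) = D * T (m + m) * (\<epsilon> * yx z * W z)"
   proof -
    have "T (n + m) * T (- d) = T (m + m)" unfolding Tm by (simp add: d)
    then show ?thesis by (metis (no_types, lifting) mult.assoc mult.commute)
   qed
   have "z + cpt (axis 2 1) \<in> S1 \<longleftrightarrow> z \<in> S1"
    unfolding S1_def mem_Collect_eq sh w using z zj D T[of "m + n"] T[of "- d"]
    by (auto simp: add.commute[of n m] intro!: scaled_less_iff[of "D * T (m + n) * T (- d)"])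
   moreover have "z + cpt (axis 2 1) \<in> S2 \<longleftrightarrow> z \<in> S2"
    unfolding S2_def mem_Collect_eq sh w e2 using z zj D T[of "n + m"]
    by (auto intro!: scaled_less_iff[of "D * T (n + m)"])
   moreover have "z + cpt (axis 2 1) \<in> S3 \<longleftrightarrow> z \<in> S3"
    unfolding S3_def mem_Collect_eq sh w e3 using z zj D T[of "m + m"]
    by (auto intro!: scaled_less_iff[of "D * T (m + m)"])
   ultimately show ?thesis unfolding j by blast
  qed
 qed
 obtain \<delta>' where \<delta>': "\<delta>' > 0" "\<delta>' \<le> \<delta>" "strip \<delta>' \<subseteq> S1 \<inter> S2 \<inter> S3"
  by (rule strip_tube[OF op real \<delta> per]) blast+
 have yx0: "pairing \<tau> F y x z \<noteq> 0" if "z \<in> strip \<delta>'" for z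
 proof
  assume "pairing \<tau> F y x z = 0"
  then have "yx z = 0" by (simp add: yx_def)
  moreover have "xy z * W' z < \<kappa> * yx z * W z" using \<delta>'(3) that by (auto simp: S1_def)
  moreover have "xy z * W' z \<ge> 0" unfolding xy_def W'_def using twist_weight_shift(7)[of d "z + cpt \<tau>"] by (intro mult_nonneg_nonneg) auto
  ultimately show False by simp
 qed
 show ?thesis
 proof (rule that[OF \<delta>'(1,2) yx0])
  fix z assume "z \<in> strip \<delta>'"
  then have "z \<in> S1" "z \<in> S2" "z \<in> S3" using \<delta>'(3) by auto
  then show "norm (pairing \<tau> F x y z) * twist_weight d (z + cpt \<tau>) \<le> \<kappa> * norm (pairing \<tau> F y x z) * twist_weight d z"
   "norm (pairing \<tau> F y y z) * twist_weight d (z + cpt \<tau>) \<le> \<epsilon> * norm (pairing \<tau> F y x z)"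
   "norm (pairing \<tau> F x x z) \<le> \<epsilon> * norm (pairing \<tau> F y x z) * twist_weight d z"
   by (simp_all add: S1_def S2_def S3_def xy_def yx_def xx_def yy_def W_def W'_def)
 qed
qed

text \<open>The line of \<open>e\<close> has slope \<open>s\<close> in the frame \<open>(x, y)\<close>. Since the line is invariant, its slope is fixed by the fractional linear action of the
 cocycle, whose coefficients are written as determinants.\<close>

lemma slope_relation:
 fixes A :: "complex^2^2"
 assumes c: "c \<noteq> 0" and e: "A *v e = c *s e'"
  and n: "det2 y e \<noteq> 0" "det2 y' e' \<noteq> 0" and b: "det2 x y \<noteq> 0" and e0: "e \<noteq> 0"
  and s: "s = det2 e x / det2 y e" and s': "s' = det2 e' x' / det2 y' e'"
 shows "s' * (- det2 (A *v x) y' - s * det2 (A *v y) y') = det2 (A *v x) x' + s * det2 (A *v y) x'"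
  and "\<exists>k. k \<noteq> 0 \<and> x + s *s y = k *s e"
proof -
 define v where "v = x + s *s y"
 have "det2 v e = 0"
  using n(1) det2_swap[of x e] by (simp add: v_def s)
 then obtain k where k: "v = k *s e" using det2_zero_parallel e0 by blast
 have "v \<noteq> 0"
 proof
  assume "v = 0"
  then have "det2 v y = 0" by (simp add: det2_def)
  then show False using b by (simp add: v_def)
 qed
 then have k0: "k \<noteq> 0" using k by auto
 then show "\<exists>k. k \<noteq> 0 \<and> x + s *s y = k *s e" using k by (auto simp: v_def)
 have Av: "A *v v = (k * c) *s e'" unfolding k matrix_smult_vec e by (simp add: vector_smult_assoc)
 have Av2: "A *v v = A *v x + s *s (A *v y)" by (simp add: v_def matrix_vector_right_distrib matrix_smult_vec)
 have "s' * det2 y' (A *v v) = det2 (A *v v) x'"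
  unfolding Av using n(2) by (simp add: s')
 then show "s' * (- det2 (A *v x) y' - s * det2 (A *v y) y') = det2 (A *v x) x' + s * det2 (A *v y) x'"
  unfolding Av2 det2_simps using det2_swap[of y' "A *v x"] det2_swap[of y' "A *v y"] by simp
qed

lemma periodic_pos_lower:
 fixes f :: "real^2 \<Rightarrow> real"
 assumes f: "continuous_on UNIV f" "\<And>w. f w > 0" and per: "\<And>j w. f (w + axis j 1) = f w"
 obtains c where "c > 0" "\<And>w. c \<le> f w"
proof -
 have "continuous_on UNIV (\<lambda>w. inverse (f w))" by (intro continuous_intros f) (use f(2) in \<open>auto simp: less_imp_neq[symmetric]\<close>)
 then obtain C where C: "C > 0" "\<And>w. norm (inverse (f w)) \<le> C"
  using periodic_continuous_bounded[of "\<lambda>w. inverse (f w)"] per by auto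
 have "inverse C \<le> f w" for w
 proof -
  have "inverse (f w) \<le> C" using C(2)[of w] f(2)[of w] by simp
  then have "inverse C \<le> inverse (inverse (f w))" using f(2)[of w] by (intro le_imp_inverse_le) auto
  then show ?thesis by simp
 qed
 then show ?thesis using that[of "inverse C"] C(1) by auto
qed

definition scale_matrix :: "complex \<Rightarrow> complex^2^2 \<Rightarrow> complex^2^2" where
 "scale_matrix c M = (\<chi> i k. c * M $ i $ k)"

lemma scale_matrix_simps:
 "scale_matrix c M ** N = scale_matrix c (M ** N)" "M ** scale_matrix c N = scale_matrix c (M ** N)"
 "scale_matrix c M *v x = c *s (M *v x)" "scale_matrix 1 M = M"
 by (simp_all add: scale_matrix_def vec_eq_iff matrix_matrix_mult_def matrix_vector_mult_def sum_distrib_left mult_ac)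

lemma unitary_scale:
 assumes c: "norm c = 1" and M: "unitary_matrix M" shows "unitary_matrix (scale_matrix c M)"
proof -
 have "conj_transpose (scale_matrix c M) = scale_matrix (cnj c) (conj_transpose M)"
  by (simp add: scale_matrix_def conj_transpose_def vec_eq_iff)
 moreover have "scale_matrix a (scale_matrix b M) = scale_matrix (a * b) M" for a b M
  by (simp add: scale_matrix_def vec_eq_iff)
 moreover have "c * cnj c = 1" using c by (simp add: complex_norm_square[symmetric])
 ultimately show ?thesis using M by (simp add: unitary_matrix_def scale_matrix_simps mult.commute)
qed

text \<open>Multiplying the second sewing matrix by the twist keeps its extension bounded on the strip and reduces this to equivariant sections.\<close>

lemma twisted_section_approx:
 assumes U: "sewing_system U" and \<delta>: "0 < \<delta>" "\<delta> \<le> 1"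
  and F: "\<And>j i k. strip_hol \<delta> (\<lambda>z. F j z $ i $ k)" and B: "\<And>j z i k. z \<in> strip \<delta> \<Longrightarrow> norm (F j z $ i $ k) \<le> B"
  and FU: "\<And>j w. F j (cpt w) = U j w"
  and e: "continuous_on UNIV e" "\<And>w. e (w + axis 1 1) = U 1 w *v e w"
   "\<And>w. e (w + axis 2 1) = twist m w *s (U 2 w *v e w)"
  and \<epsilon>: "\<epsilon> > 0"
 shows "\<exists>v. (\<forall>i. strip_hol \<delta> (\<lambda>z. v z $ i)) \<and>
  (\<forall>w. v (cpt (w + axis 1 1)) = F 1 (cpt w) *v v (cpt w)) \<and>
  (\<forall>w. v (cpt (w + axis 2 1)) = twist m w *s (F 2 (cpt w) *v v (cpt w))) \<and>
  (\<forall>w. norm (v (cpt w) - e w) \<le> \<epsilon>)"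
proof -
 define E where "E z = exp (2 * pi * \<i> * of_int m * fst z)" for z :: "C2"
 define V where "V j z = (if j = 1 then F 1 z else scale_matrix (E z) (F 2 z))" for j :: 2 and z
 have V1: "V 1 z = F 1 z" and V2: "V 2 z = scale_matrix (E z) (F 2 z)" for z by (simp_all add: V_def)
 have j12: "j = 1 \<or> j = 2" for j :: 2 using exhaust_2 by blast
 have Er: "E (cpt w) = twist m w" for w by (simp add: E_def cpt_def)
 have En: "norm (E (cpt w)) = 1" for w by (simp add: E_def cpt_def)
 have Esh: "strip_hol \<delta> E" unfolding E_def[abs_def] by (intro sh_exp sh_mult sh_const sh_fst)
 define K where "K = exp (2 * pi * \<bar>of_int m\<bar>)"
 have Eb: "norm (E z) \<le> K" if "z \<in> strip \<delta>" for z
 proof -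
  have "\<bar>Im (fst z)\<bar> \<le> 1" using that \<delta> by (auto simp: strip_iff)
  then have "\<bar>of_int m * Im (fst z)\<bar> \<le> \<bar>of_int m\<bar> * 1" unfolding abs_mult by (intro mult_left_mono) auto
  then have "2 * pi * (- (of_int m * Im (fst z))) \<le> 2 * pi * \<bar>of_int m\<bar>" by (intro mult_left_mono) auto
  then show ?thesis by (simp add: E_def K_def)
 qed
 have c0: "cpt 0 \<in> strip \<delta>" using cpt_strip[OF \<delta>(1)] .
 have B0: "0 \<le> B" using order_trans[OF norm_ge_zero B[OF c0]] .
 have K1: "K \<ge> 1" by (simp add: K_def)
 have "\<exists>v. (\<forall>i. strip_hol \<delta> (\<lambda>z. v z $ i)) \<and>
  (\<forall>j w. v (cpt (w + axis j 1)) = V j (cpt w) *v v (cpt w)) \<and> (\<forall>w. norm (v (cpt w) - e w) \<le> \<epsilon>)"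
 proof (rule analytic_section_approx[OF \<delta> _ _ _ _ e(1) _ \<epsilon>])
  fix j i k
  show "strip_hol \<delta> (\<lambda>z. V j z $ i $ k)"
   using j12[of j] by (auto simp: V1 V2 scale_matrix_def intro!: sh_mult Esh F)
  show "norm (V j z $ i $ k) \<le> K * B" if z: "z \<in> strip \<delta>" for z
   using j12[of j]
  proof
   assume j: "j = 1"
   have "norm (V j z $ i $ k) \<le> 1 * B" using B[OF z] by (simp add: j V1)
   also have "\<dots> \<le> K * B" using K1 B0 by (intro mult_right_mono)
   finally show ?thesis .
  next
   assume j: "j = 2"
   show ?thesis unfolding j V2 scale_matrix_def using Eb[OF z] B[OF z] K1 by (auto simp: norm_mult intro!: mult_mono)
  qed
 next
  show "unitary_matrix (V j (cpt w))" for j w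
   using j12[of j] U by (auto simp: V1 V2 FU sewing_system_def intro!: unitary_scale En)
  show "V 1 (cpt (w + axis 2 1)) ** V 2 (cpt w) = V 2 (cpt (w + axis 1 1)) ** V 1 (cpt w)" for w
  proof -
   have "E (cpt (w + axis 1 1)) = E (cpt w)"
    unfolding Er by (simp add: axis_def ring_distribs exp_add)
   moreover have "U 1 (w + axis 2 1) ** U 2 w = U 2 (w + axis 1 1) ** U 1 w" using U by (simp add: sewing_system_def)
   ultimately show ?thesis by (simp add: V1 V2 scale_matrix_simps FU)
  qed
  show "e (w + axis j 1) = V j (cpt w) *v e w" for j w
   using j12[of j] e by (auto simp: V1 V2 scale_matrix_simps FU Er)
 qed
 then obtain v where v: "\<And>i. strip_hol \<delta> (\<lambda>z. v z $ i)" "\<And>j w. v (cpt (w + axis j 1)) = V j (cpt w) *v v (cpt w)"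
  "\<And>w. norm (v (cpt w) - e w) \<le> \<epsilon>" by blast
 have "v (cpt (w + axis 1 1)) = F 1 (cpt w) *v v (cpt w)"
  "v (cpt (w + axis 2 1)) = twist m w *s (F 2 (cpt w) *v v (cpt w))" for w
  unfolding v(2) by (simp_all add: V1 V2 scale_matrix_simps Er)
 then show ?thesis using v by blast
qed

lemma pairing_perturbation:
 fixes M :: "complex^2^2"
 assumes M: "\<And>x. norm (M *v x) \<le> C * norm x" and C: "C \<ge> 0"
  and x: "norm (x' - x) \<le> \<eta>" "norm x \<le> E" and y: "norm (y' - y) \<le> \<eta>" "norm y \<le> E" and \<eta>: "\<eta> \<le> 1"
 shows "norm (det2 (M *v x') y' - det2 (M *v x) y) \<le> 2 * C * (2 * E + 1) * \<eta>"
proof -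
 have eta0: "0 \<le> \<eta>" using order_trans[OF norm_ge_zero x(1)] .
 have E0: "0 \<le> E" using order_trans[OF norm_ge_zero x(2)] .
 have y': "norm y' \<le> E + 1" using norm_triangle_sub[of y' y] y \<eta> by linarith
 have "det2 (M *v x') y' - det2 (M *v x) y = det2 (M *v (x' - x)) y' + det2 (M *v x) (y' - y)"
  by (simp add: matrix_vector_mult_diff_distrib)
 also have "norm \<dots> \<le> 2 * (C * \<eta>) * (E + 1) + 2 * (C * E) * \<eta>"
 proof (rule norm_triangle_mono)
  have "norm (M *v (x' - x)) \<le> C * \<eta>" by (rule order_trans[OF M]) (intro mult_left_mono x C)
  then show "norm (det2 (M *v (x' - x)) y') \<le> 2 * (C * \<eta>) * (E + 1)"
   by (intro order_trans[OF norm_det2] mult_mono y') (use C eta0 in auto)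
  have "norm (M *v x) \<le> C * E" by (rule order_trans[OF M]) (intro mult_left_mono x C)
  then show "norm (det2 (M *v x) (y' - y)) \<le> 2 * (C * E) * \<eta>"
   by (intro order_trans[OF norm_det2] mult_mono y) (use C E0 in auto)
 qed
 also have "\<dots> = 2 * C * (2 * E + 1) * \<eta>" by (simp add: algebra_simps)
 finally show ?thesis .
qed

definition holomorphic_section :: "(2 \<Rightarrow> real^2 \<Rightarrow> complex^2^2) \<Rightarrow> (real^2 \<Rightarrow> (complex^2) set) \<Rightarrow> int \<Rightarrow> real \<Rightarrow> (C2 \<Rightarrow> complex^2) \<Rightarrow> bool" where
 "holomorphic_section U l m \<delta> v \<longleftrightarrow> \<delta> > 0 \<and> (\<forall>i. strip_hol \<delta> (\<lambda>z. v z $ i)) \<and>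
  (\<forall>w. v (cpt w) \<noteq> 0 \<and> v (cpt w) \<in> l w) \<and>
  (\<forall>w. v (cpt (w + axis 1 1)) = U 1 w *v v (cpt w)) \<and>
  (\<forall>w. v (cpt (w + axis 2 1)) = twist m w *s (U 2 w *v v (cpt w)))"

lemma holomorphic_section_of_graph:
 fixes x y :: "C2 \<Rightarrow> complex^2"
 assumes U: "\<And>j w. unitary_matrix (U j w)" and CP: "\<And>w. l w \<in> CP1" and el: "\<And>w. e w \<in> l w"
  and \<delta>: "\<delta> > 0" and x: "\<And>i. strip_hol \<delta> (\<lambda>z. x z $ i)" and y: "\<And>i. strip_hol \<delta> (\<lambda>z. y z $ i)"
  and t: "strip_hol \<delta> t" "\<And>w. t (cpt w) = det2 (e w) (x (cpt w)) / det2 (y (cpt w)) (e w)"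
  and k: "\<And>w. \<exists>k. k \<noteq> 0 \<and> x (cpt w) + (det2 (e w) (x (cpt w)) / det2 (y (cpt w)) (e w)) *s y (cpt w) = k *s e w" and e0: "\<And>w. e w \<noteq> 0"
  and e: "\<And>w. e (w + axis 1 1) = U 1 w *v e w" "\<And>w. e (w + axis 2 1) = twist m w *s (U 2 w *v e w)"
  and x12: "\<And>w. x (cpt (w + axis 1 1)) = U 1 w *v x (cpt w)" "\<And>w. x (cpt (w + axis 2 1)) = twist m w *s (U 2 w *v x (cpt w))"
  and y12: "\<And>w. y (cpt (w + axis 1 1)) = U 1 w *v y (cpt w)" "\<And>w. y (cpt (w + axis 2 1)) = twist n w *s (U 2 w *v y (cpt w))"
 shows "holomorphic_section U l m \<delta> (\<lambda>z. x z + t z *s y z)"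
 unfolding holomorphic_section_def
proof (intro conjI allI \<delta>)
 show "strip_hol \<delta> (\<lambda>z. (x z + t z *s y z) $ i)" for i
  by (simp add: sh_add sh_mult x y t)
 fix w
 obtain k where k: "k \<noteq> 0" "x (cpt w) + t (cpt w) *s y (cpt w) = k *s e w" using k[of w] t(2) by auto
 then show "x (cpt w) + t (cpt w) *s y (cpt w) \<noteq> 0" using e0[of w] by simp
 show "x (cpt w) + t (cpt w) *s y (cpt w) \<in> l w" unfolding k(2) by (intro CP1_smult CP el)
 have dU: "det (U j w) \<noteq> 0" for j using norm_det_unitary[OF U[of j w]] by auto
 have "t (cpt (w + axis 1 1)) = t (cpt w)"
  unfolding t(2) e x12 y12 det2_matrix using dU by simp
 then show "x (cpt (w + axis 1 1)) + t (cpt (w + axis 1 1)) *s y (cpt (w + axis 1 1)) = U 1 w *v (x (cpt w) + t (cpt w) *s y (cpt w))"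
  unfolding x12 y12 by (simp add: matrix_vector_right_distrib matrix_smult_vec)
 define a b where "a = twist m w" and "b = twist n w"
 have ab: "a \<noteq> 0" "b \<noteq> 0" by (auto simp: a_def b_def)
 have "t (cpt (w + axis 2 1)) * b = a * t (cpt w)"
  unfolding t(2) e x12 y12 a_def[symmetric] b_def[symmetric] det2_simps det2_matrix using dU[of 2] ab by (simp add: field_simps)
 then have "(t (cpt (w + axis 2 1)) * b) *s (U 2 w *v y (cpt w)) = (a * t (cpt w)) *s (U 2 w *v y (cpt w))" by simp
 then show "x (cpt (w + axis 2 1)) + t (cpt (w + axis 2 1)) *s y (cpt (w + axis 2 1)) =
   twist m w *s (U 2 w *v (x (cpt w) + t (cpt w) *s y (cpt w)))"
  unfolding x12 y12 a_def[symmetric] b_def[symmetric]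
  by (simp add: matrix_vector_right_distrib matrix_smult_vec vector_smult_assoc vector_add_ldistrib)
qed

lemma twist_weight_locally_bounded:
 assumes "\<delta> \<le> 1"
 shows "\<exists>M. \<forall>z\<in>strip \<delta>. \<bar>Re (fst z)\<bar> \<le> R \<longrightarrow> \<bar>Re (snd z)\<bar> \<le> R \<longrightarrow> twist_weight d z \<le> M"
proof (intro exI ballI impI)
 fix z assume z: "z \<in> strip \<delta>" "\<bar>Re (snd z)\<bar> \<le> R"
 have "\<bar>Im (fst z) * Re (snd z)\<bar> \<le> 1 * R" unfolding abs_mult
  by (intro mult_mono) (use z assms in \<open>auto simp: strip_iff\<close>)
 then have "\<bar>of_int d * (Im (fst z) * Re (snd z))\<bar> \<le> \<bar>of_int d\<bar> * R" unfolding abs_mult[of "of_int d"] by (intro mult_left_mono) auto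
 then have "2 * pi * (of_int d * (Im (fst z) * Re (snd z))) \<le> 2 * pi * (\<bar>of_int d\<bar> * R)" by (intro mult_left_mono) auto
 then show "twist_weight d z \<le> exp (2 * pi * (\<bar>of_int d\<bar> * R))" by (simp add: twist_weight_def mult.assoc)
qed

text \<open>Both lines of a dominated splitting have holomorphic sections.  Sections close to continuous ones form a
 holomorphic frame in which the cocycle is nearly diagonal and dominated; the graph transform of this frame, run
 forwards for the unstable and backwards for the stable line, yields holomorphic slopes, and its only real fixed point is the slope of the line.\<close>

lemma dominated_frame_sections:
 fixes \<tau> :: "real^2"
 assumes U: "sewing_system U" and A: "equivariant_cocycle \<tau> U A" and \<delta>0: "0 < \<delta>0"
  and extU: "\<And>j. extends_to_strip \<delta>0 (U j)" and extA: "extends_to_strip \<delta>0 A"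
  and ls: "invariant_line \<tau> U A ls" and lu: "invariant_line \<tau> U A lu"
  and e1c: "continuous_on UNIV e1" and e2c: "continuous_on UNIV e2"
  and e1l: "\<And>w. e1 w \<in> ls w" and e2l: "\<And>w. e2 w \<in> lu w"
  and e10: "\<And>w. e1 w \<noteq> 0" and e20: "\<And>w. e2 w \<noteq> 0" and ne: "\<And>w. ls w \<noteq> lu w"
  and e1: "\<And>w. e1 (w + axis 1 1) = U 1 w *v e1 w" "\<And>w. e1 (w + axis 2 1) = twist m w *s (U 2 w *v e1 w)"
  and e2: "\<And>w. e2 (w + axis 1 1) = U 1 w *v e2 w" "\<And>w. e2 (w + axis 2 1) = twist n w *s (U 2 w *v e2 w)"
  and q1: "\<And>w. A w *v e1 w = q1 w *s e1 (w + \<tau>)" "\<And>w. q1 w \<noteq> 0"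
  and q2: "\<And>w. A w *v e2 w = q2 w *s e2 (w + \<tau>)" "\<And>w. q2 w \<noteq> 0" and q2c: "continuous_on UNIV q2" "\<And>j w. norm (q2 (w + axis j 1)) = norm (q2 w)"
  and dom: "\<And>w. norm (q1 w) \<le> \<kappa> * norm (q2 w)" and \<kappa>: "0 < \<kappa>" "\<kappa> < 1"
 shows "(\<exists>\<delta> v. holomorphic_section U ls m \<delta> v) \<and> (\<exists>\<delta> v. holomorphic_section U lu n \<delta> v)"
proof -
 define \<delta>1 where "\<delta>1 = min \<delta>0 1"
 have \<delta>1: "0 < \<delta>1" "\<delta>1 \<le> 1" "\<delta>1 \<le> \<delta>0" using \<delta>0 by (auto simp: \<delta>1_def)
 have j12: "j = 1 \<or> j = 2" for j :: 2 using exhaust_2 by blast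
 have Un: "unitary_matrix (U j w)" for j w using U by (simp add: sewing_system_def)
 have "\<exists>F B. (\<forall>i k. strip_hol \<delta>1 (\<lambda>z. F z $ i $ k)) \<and> (\<forall>z\<in>strip \<delta>1. \<forall>i k. norm (F z $ i $ k) \<le> B) \<and> (\<forall>w. F (cpt w) = M w)"
  if ex: "extends_to_strip \<delta>0 M" for M
 proof -
  obtain F B where "\<And>i j. strip_hol \<delta>0 (\<lambda>z. F z $ i $ j)" "\<And>z i j. z \<in> strip \<delta>0 \<Longrightarrow> norm (F z $ i $ j) \<le> B" "\<And>w. F (cpt w) = M w"
   using strip_extension[OF ex] by blast
  then show ?thesis using sh_mono \<delta>1(3) strip_mono[OF \<delta>1(3)] by (intro exI[of _ F] exI[of _ B]) blast
 qed
 note ext = this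
 obtain FA BA where FA: "\<And>i k. strip_hol \<delta>1 (\<lambda>z. FA z $ i $ k)" "\<And>z i k. z\<in>strip \<delta>1 \<Longrightarrow> norm (FA z $ i $ k) \<le> BA" "\<And>w. FA (cpt w) = A w"
  using ext[OF extA] by blast
 let ?p = "pairing \<tau> FA"
 have "\<forall>j. \<exists>F B. (\<forall>i k. strip_hol \<delta>1 (\<lambda>z. F z $ i $ k)) \<and> (\<forall>z\<in>strip \<delta>1. \<forall>i k. norm (F z $ i $ k) \<le> B) \<and> (\<forall>w. F (cpt w) = U j w)"
  using ext[OF extU] by blast
 then obtain F BU where F: "\<And>j i k. strip_hol \<delta>1 (\<lambda>z. F j z $ i $ k)" "\<And>j z i k. z\<in>strip \<delta>1 \<Longrightarrow> norm (F j z $ i $ k) \<le> BU j" "\<And>j w. F j (cpt w) = U j w"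
  by metis
 define B where "B = max (BU 1) (BU 2)"
 have Fb: "norm (F j z $ i $ k) \<le> B" if "z \<in> strip \<delta>1" for j z i k
  using j12[of j] F(2)[OF that, of j i k] by (auto simp: B_def)
 define C where "C = max 1 (4 * BA)"
 have C: "C \<ge> 1" by (simp add: C_def)
 have AC: "norm (A w *v x) \<le> C * norm x" for w x
  unfolding C_def FA(3)[symmetric] by (rule matrix_norm_bound) (use FA(2) \<delta>1 in auto)
 have CP: "ls w \<in> CP1" "lu w \<in> CP1" for w using invariant_line_CP1 ls lu by blast+
 have dU: "norm (det (U j w)) = 1" for j w by (rule norm_det_unitary[OF Un])
 have norm_per: "norm (e (w + axis j 1)) = norm (e w)"
  if "\<And>w. e (w + axis 1 1) = U 1 w *v e w" "\<And>w. e (w + axis 2 1) = twist m w *s (U 2 w *v e w)" for e :: "real^2 \<Rightarrow> complex^2" and m j w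
  using j12[of j] that by (auto simp: norm_smult unitary_norm[OF Un])
 obtain E1 where E1: "E1 > 0" "\<And>w. norm (norm (e1 w)) \<le> E1"
  using periodic_continuous_bounded[of "\<lambda>w. norm (e1 w)"] norm_per[OF e1] continuous_on_norm[OF e1c] by blast
 obtain E2 where E2: "E2 > 0" "\<And>w. norm (norm (e2 w)) \<le> E2"
  using periodic_continuous_bounded[of "\<lambda>w. norm (e2 w)"] norm_per[OF e2] continuous_on_norm[OF e2c] by blast
 define E where "E = E1 + E2"
 have E: "norm (e1 w) \<le> E" "norm (e2 w) \<le> E" "E > 0" for w using E1 E2 by (auto simp: E_def intro: add_increasing add_increasing2)
 define D where "D w = norm (det2 (e1 w) (e2 w))" for w
 have D0: "D w > 0" for w unfolding D_def using det2_nz[OF CP(1) CP(2) ne e1l e2l e10 e20] by simp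
 have Dp: "D (w + axis j 1) = D w" for w j
  using j12[of j] by (auto simp: D_def e1 e2 det2_matrix norm_mult dU)
 obtain d0 where d0: "d0 > 0" "\<And>w. d0 \<le> D w"
  by (rule periodic_pos_lower[of D]) (use D0 Dp in \<open>auto simp: D_def[abs_def] intro!: continuous_intros e1c e2c\<close>)
 obtain q0 where q0: "q0 > 0" "\<And>w. q0 \<le> norm (q2 w)"
  by (rule periodic_pos_lower[of "\<lambda>w. norm (q2 w)"]) (use q2 q2c in \<open>auto intro!: continuous_intros\<close>)
 \<comment> \<open>The constants satisfy \<open>\<kappa>1 + \<epsilon> < (1 - \<epsilon>)\<^sup>2\<close>, the contraction condition of the graph transform, and \<open>\<eta>\<close> is so small that the frame error \<open>K \<eta>\<close> is at most \<open>x\<close> times the dominant entry.\<close>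
 define \<epsilon> where "\<epsilon> = (1 - \<kappa>) / 8"
 define \<kappa>1 where "\<kappa>1 = \<kappa> + (1 - \<kappa>) / 4"
 define x where "x = (1 - \<kappa>) / 32"
 have params: "0 \<le> \<kappa>1" "0 \<le> \<epsilon>" "\<epsilon> < 1" "\<kappa>1 + \<epsilon> < (1 - \<epsilon>)\<^sup>2"
 proof -
  show "0 \<le> \<kappa>1" "0 \<le> \<epsilon>" "\<epsilon> < 1" using \<kappa> by (auto simp: \<kappa>1_def \<epsilon>_def)
  have "1 - 2 * \<epsilon> \<le> (1 - \<epsilon>)\<^sup>2" by (simp add: power2_eq_square algebra_simps)
  moreover have "\<kappa>1 + \<epsilon> < 1 - 2 * \<epsilon>" using \<kappa> by (simp add: \<kappa>1_def \<epsilon>_def field_simps)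
  ultimately show "\<kappa>1 + \<epsilon> < (1 - \<epsilon>)\<^sup>2" by linarith
 qed
 define \<Delta> where "\<Delta> = q0 * d0"
 have \<Delta>: "\<Delta> > 0" using q0 d0 by (simp add: \<Delta>_def)
 define K where "K = 2 * C * (2 * E + 1)"
 have K: "K > 0" using C E by (auto simp: K_def intro!: mult_pos_pos add_pos_pos)
 define \<eta> where "\<eta> = min 1 (min (x * \<Delta> / K) (d0 / (4 * (2 * E + 1))))"
 have x0: "x > 0" using \<kappa> by (simp add: x_def)
 have \<eta>: "\<eta> > 0" "\<eta> \<le> 1" "K * \<eta> \<le> x * \<Delta>" "4 * (2 * E + 1) * \<eta> \<le> d0"
 proof -
  have E4: "4 * (2 * E + 1) > 0" using E by simp
  show "\<eta> > 0" unfolding \<eta>_def min_less_iff_conj using x0 \<Delta> K d0 E4 by simp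
  show "\<eta> \<le> 1" by (simp add: \<eta>_def)
  have "\<eta> \<le> x * \<Delta> / K" "\<eta> \<le> d0 / (4 * (2 * E + 1))" by (auto simp: \<eta>_def)
  then show "K * \<eta> \<le> x * \<Delta>" "4 * (2 * E + 1) * \<eta> \<le> d0" using K E4 by (simp_all add: pos_le_divide_eq mult.commute)
 qed
 obtain v1 where v1: "\<And>i. strip_hol \<delta>1 (\<lambda>z. v1 z $ i)" "\<And>w. v1 (cpt (w + axis 1 1)) = F 1 (cpt w) *v v1 (cpt w)"
  "\<And>w. v1 (cpt (w + axis 2 1)) = twist m w *s (F 2 (cpt w) *v v1 (cpt w))"
  "\<And>w. norm (v1 (cpt w) - e1 w) \<le> \<eta>"
  using twisted_section_approx[OF U \<delta>1(1,2) F(1) Fb F(3) e1c e1 \<eta>(1)] by blast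
 obtain v2 where v2: "\<And>i. strip_hol \<delta>1 (\<lambda>z. v2 z $ i)" "\<And>w. v2 (cpt (w + axis 1 1)) = F 1 (cpt w) *v v2 (cpt w)"
  "\<And>w. v2 (cpt (w + axis 2 1)) = twist n w *s (F 2 (cpt w) *v v2 (cpt w))"
  "\<And>w. norm (v2 (cpt w) - e2 w) \<le> \<eta>"
  using twisted_section_approx[OF U \<delta>1(1,2) F(1) Fb F(3) e2c e2 \<eta>(1)] by blast
 have sp: "?p a b (cpt w) = det2 (A w *v a (cpt w)) (b (cpt (w + \<tau>)))" for a b w
  by (simp add: pairing_def FA(3) cpt_add)
 define P where "P w = norm (q2 w) * D (w + \<tau>)" for w
 have P: "\<Delta> \<le> P w" for w unfolding \<Delta>_def P_def by (intro mult_mono q0 d0) (use q0 d0 in auto)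
 have C0: "C \<ge> 0" using C by simp
 have pert: "norm (det2 (A w *v v1 (cpt w)) (v2 (cpt (w + \<tau>))) - q1 w * det2 (e1 (w + \<tau>)) (e2 (w + \<tau>))) \<le> x * P w"
  "norm (det2 (A w *v v2 (cpt w)) (v1 (cpt (w + \<tau>))) + q2 w * det2 (e1 (w + \<tau>)) (e2 (w + \<tau>))) \<le> x * P w"
  "norm (det2 (A w *v v1 (cpt w)) (v1 (cpt (w + \<tau>)))) \<le> x * P w"
  "norm (det2 (A w *v v2 (cpt w)) (v2 (cpt (w + \<tau>)))) \<le> x * P w" for w
 proof -
  have le: "K * \<eta> \<le> x * P w" using \<eta>(3) mult_left_mono[OF P[of w], of x] x0 by linarith
  note pp = pairing_perturbation[OF AC C0 _ _ _ _ \<eta>(2)]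
  have s: "det2 (e2 (w + \<tau>)) (e1 (w + \<tau>)) = - det2 (e1 (w + \<tau>)) (e2 (w + \<tau>))" by (rule det2_swap)
  show "norm (det2 (A w *v v1 (cpt w)) (v2 (cpt (w + \<tau>))) - q1 w * det2 (e1 (w + \<tau>)) (e2 (w + \<tau>))) \<le> x * P w"
   using pp[OF v1(4) E(1) v2(4) E(2), of w w "w + \<tau>"] le by (simp add: K_def q1)
  show "norm (det2 (A w *v v2 (cpt w)) (v1 (cpt (w + \<tau>))) + q2 w * det2 (e1 (w + \<tau>)) (e2 (w + \<tau>))) \<le> x * P w"
   using pp[OF v2(4) E(2) v1(4) E(1), of w w "w + \<tau>"] le by (simp add: K_def q2 s)
  show "norm (det2 (A w *v v1 (cpt w)) (v1 (cpt (w + \<tau>)))) \<le> x * P w"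
   using pp[OF v1(4) E(1) v1(4) E(1), of w w "w + \<tau>"] le by (simp add: K_def q1)
  show "norm (det2 (A w *v v2 (cpt w)) (v2 (cpt (w + \<tau>)))) \<le> x * P w"
   using pp[OF v2(4) E(2) v2(4) E(2), of w w "w + \<tau>"] le by (simp add: K_def q2)
 qed
 have P0: "P w > 0" for w using P[of w] \<Delta> by linarith
 have low: "(1 - x) * P w \<le> norm (?p v2 v1 (cpt w))" for w
 proof -
  have "norm (q2 w * det2 (e1 (w + \<tau>)) (e2 (w + \<tau>))) = P w" by (simp add: P_def D_def norm_mult)
  then have "P w \<le> norm (det2 (A w *v v2 (cpt w)) (v1 (cpt (w + \<tau>)))) + x * P w"
   using pert(2)[of w] norm_triangle_ineq2[of "- (q2 w * det2 (e1 (w + \<tau>)) (e2 (w + \<tau>)))" "det2 (A w *v v2 (cpt w)) (v1 (cpt (w + \<tau>)))"]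
   by (simp add: norm_minus_commute add.commute[of "det2 _ _"])
  then show ?thesis unfolding sp by (simp add: algebra_simps)
 qed
 have dom1: "norm (?p v1 v2 (cpt w)) < \<kappa>1 * norm (?p v2 v1 (cpt w))" for w
 proof -
  have "norm (q1 w * det2 (e1 (w + \<tau>)) (e2 (w + \<tau>))) \<le> \<kappa> * P w"
   unfolding norm_mult P_def D_def mult.assoc[symmetric] by (intro mult_right_mono dom) auto
  then have "norm (?p v1 v2 (cpt w)) \<le> \<kappa> * P w + x * P w"
   unfolding sp using pert(1)[of w] norm_triangle_sub[of "det2 (A w *v v1 (cpt w)) (v2 (cpt (w + \<tau>)))" "q1 w * det2 (e1 (w + \<tau>)) (e2 (w + \<tau>))"] by linarith
  also have "\<dots> = (\<kappa> + x) * P w" by (simp add: algebra_simps)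
  also have "\<dots> < (\<kappa>1 * (1 - x)) * P w"
  proof (rule mult_strict_right_mono[OF _ P0])
   have "\<kappa>1 \<le> 1" using \<kappa> by (simp add: \<kappa>1_def field_simps)
   then have "\<kappa>1 * x \<le> 1 * x" using x0 by (intro mult_right_mono) auto
   moreover have "\<kappa> + 2 * x < \<kappa>1" using \<kappa> by (simp add: x_def \<kappa>1_def)
   ultimately show "\<kappa> + x < \<kappa>1 * (1 - x)" by (simp add: algebra_simps)
  qed
  also have "\<dots> = \<kappa>1 * ((1 - x) * P w)" by simp
  also have "\<dots> \<le> \<kappa>1 * norm (?p v2 v1 (cpt w))" by (intro mult_left_mono low params)
  finally show ?thesis .
 qed
 have xe: "x * P w < \<epsilon> * norm (?p v2 v1 (cpt w))" for w
 proof -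
  have "x < \<epsilon> * (1 - x)"
  proof -
   have "x = \<epsilon> / 4" by (simp add: x_def \<epsilon>_def)
   moreover have "\<epsilon> * x \<le> 1 * x" using params(3) x0 by (intro mult_right_mono) auto
   ultimately have "x + \<epsilon> * x < \<epsilon>" using x0 by linarith
   then show ?thesis by (simp add: algebra_simps)
  qed
  then have "x * P w < (\<epsilon> * (1 - x)) * P w" by (rule mult_strict_right_mono[OF _ P0])
  also have "\<dots> = \<epsilon> * ((1 - x) * P w)" by simp
  also have "\<dots> \<le> \<epsilon> * norm (?p v2 v1 (cpt w))" by (intro mult_left_mono low params)
  finally show ?thesis .
 qed
 have dom2: "norm (?p v2 v2 (cpt w)) < \<epsilon> * norm (?p v2 v1 (cpt w))"
  and dom3: "norm (?p v1 v1 (cpt w)) < \<epsilon> * norm (?p v2 v1 (cpt w))" for w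
  using pert(3,4)[of w] xe[of w] unfolding sp by linarith+
 have Fu: "unitary_matrix (F j (cpt w))" for j w unfolding F(3) by (rule Un)
 have K2: "FA (cpt (w + axis j 1)) ** F j (cpt w) = F j (cpt (w + \<tau>)) ** FA (cpt w)" for j w
  using A unfolding F(3) FA(3) equivariant_cocycle_def by blast
 obtain \<delta> where \<delta>: "0 < \<delta>" "\<delta> \<le> \<delta>1"
  "\<And>z. z \<in> strip \<delta> \<Longrightarrow> ?p v2 v1 z \<noteq> 0"
  "\<And>z. z \<in> strip \<delta> \<Longrightarrow> norm (?p v1 v2 z) * twist_weight (n - m) (z + cpt \<tau>) \<le> \<kappa>1 * norm (?p v2 v1 z) * twist_weight (n - m) z"
  "\<And>z. z \<in> strip \<delta> \<Longrightarrow> norm (?p v2 v2 z) * twist_weight (n - m) (z + cpt \<tau>) \<le> \<epsilon> * norm (?p v2 v1 z)"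
  "\<And>z. z \<in> strip \<delta> \<Longrightarrow> norm (?p v1 v1 z) \<le> \<epsilon> * norm (?p v2 v1 z) * twist_weight (n - m) z"
  by (rule strip_domination[OF \<delta>1(1) FA(1) v1(1) v2(1) F(1) Fu K2 v1(2,3) v2(2,3) dom1 dom2 dom3 params(1) refl]) blast
 define \<omega> where "\<omega> = twist_weight (n - m)"
 note dm = \<delta>(3-6)[folded \<omega>_def]
 have \<omega>0: "\<omega> z > 0" for z by (simp add: \<omega>_def twist_weight_shift)
 have \<omega>1: "\<omega> (cpt w) = 1" for w by (simp add: \<omega>_def twist_weight_shift)
 have \<delta>le1: "\<delta> \<le> 1" using \<delta> \<delta>1 by simp
 have shp: "strip_hol \<delta> (?p a b)" if "\<And>i. strip_hol \<delta>1 (\<lambda>z. a z $ i)" "\<And>i. strip_hol \<delta>1 (\<lambda>z. b z $ i)" for a b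
  by (rule sh_mono[OF sh_pairing[OF FA(1) that] \<delta>(2)])
 have eE: "norm (v - e) \<le> \<eta> \<Longrightarrow> norm e \<le> E \<Longrightarrow> norm f \<le> E \<Longrightarrow> norm (det2 v f - det2 e f) \<le> d0 / 4" for v e f :: "complex^2"
 proof -
  assume a: "norm (v - e) \<le> \<eta>" "norm e \<le> E" "norm f \<le> E"
  have "norm (det2 (v - e) f) \<le> 2 * \<eta> * E"
   by (intro order_trans[OF norm_det2] mult_mono a) (use \<eta> E in auto)
  also have "\<dots> \<le> (2 * E + 1) * \<eta>" using \<eta> by (simp add: algebra_simps)
  also have "\<dots> \<le> d0 / 4" using \<eta>(4) unfolding mult.assoc by linarith
  finally show "norm (det2 v f - det2 e f) \<le> d0 / 4" by simp
 qed
 have D1: "norm (det2 (v2 (cpt w)) (e1 w)) \<ge> 3 * d0 / 4" and D2: "norm (det2 (v1 (cpt w)) (e2 w)) \<ge> 3 * d0 / 4"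
   and N1: "norm (det2 (e1 w) (v1 (cpt w))) \<le> d0 / 4" and N2: "norm (det2 (e2 w) (v2 (cpt w))) \<le> d0 / 4"
   and b12: "det2 (v1 (cpt w)) (v2 (cpt w)) \<noteq> 0" for w
 proof -
  have s: "norm (det2 (e2 w) (e1 w)) = D w" "norm (det2 (e1 w) (e2 w)) = D w" by (simp_all add: D_def det2_swap[of "e2 w" "e1 w"])
  show "norm (det2 (v2 (cpt w)) (e1 w)) \<ge> 3 * d0 / 4"
   using eE[OF v2(4) E(2) E(1), of w w] d0(2)[of w] s norm_triangle_ineq2[of "det2 (e2 w) (e1 w)" "det2 (v2 (cpt w)) (e1 w)"]
   by (simp add: norm_minus_commute)
  show D2: "norm (det2 (v1 (cpt w)) (e2 w)) \<ge> 3 * d0 / 4"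
   using eE[OF v1(4) E(1) E(2), of w w] d0(2)[of w] s norm_triangle_ineq2[of "det2 (e1 w) (e2 w)" "det2 (v1 (cpt w)) (e2 w)"]
   by (simp add: norm_minus_commute)
  show "norm (det2 (e1 w) (v1 (cpt w))) \<le> d0 / 4" using eE[OF v1(4) E(1) E(1), of w w] by (simp add: det2_swap[of "e1 w" "v1 (cpt w)"])
  show "norm (det2 (e2 w) (v2 (cpt w))) \<le> d0 / 4" using eE[OF v2(4) E(2) E(2), of w w] by (simp add: det2_swap[of "e2 w" "v2 (cpt w)"])
  have "norm (det2 (v1 (cpt w)) (v2 (cpt w) - e2 w)) \<le> 2 * (E + 1) * \<eta>"
  proof (rule order_trans[OF norm_det2 mult_mono])
   show "norm (v2 (cpt w) - e2 w) \<le> \<eta>" by (rule v2(4))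
   show "2 * norm (v1 (cpt w)) \<le> 2 * (E + 1)" using norm_triangle_sub[of "v1 (cpt w)" "e1 w"] v1(4)[of w] E(1)[of w] \<eta>(2) by simp
  qed (use E in auto)
  also have "\<dots> \<le> 2 * ((2 * E + 1) * \<eta>)" using E \<eta> by simp
  also have "\<dots> \<le> d0 / 2" using \<eta>(4) unfolding mult.assoc by linarith
  finally have "norm (det2 (v1 (cpt w)) (e2 w) - det2 (v1 (cpt w)) (v2 (cpt w))) \<le> d0 / 2" by (simp add: norm_minus_commute)
  then have "norm (det2 (v1 (cpt w)) (v2 (cpt w))) > 0"
   using D2 d0(1) norm_triangle_ineq2[of "det2 (v1 (cpt w)) (e2 w)" "det2 (v1 (cpt w)) (v2 (cpt w))"] by linarith
  then show "det2 (v1 (cpt w)) (v2 (cpt w)) \<noteq> 0" by simp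
 qed
 have D1n: "det2 (v2 (cpt w)) (e1 w) \<noteq> 0" and D2n: "det2 (v1 (cpt w)) (e2 w) \<noteq> 0" for w using D1[of w] D2[of w] d0(1) by auto
 have b21: "det2 (v2 (cpt w)) (v1 (cpt w)) \<noteq> 0" for w using b12[of w] det2_swap[of "v2 (cpt w)" "v1 (cpt w)"] by simp
 have v1U: "v1 (cpt (w + axis 1 1)) = U 1 w *v v1 (cpt w)" "v1 (cpt (w + axis 2 1)) = twist m w *s (U 2 w *v v1 (cpt w))"
  and v2U: "v2 (cpt (w + axis 1 1)) = U 1 w *v v2 (cpt w)" "v2 (cpt (w + axis 2 1)) = twist n w *s (U 2 w *v v2 (cpt w))" for w
  using v1(2,3) v2(2,3) by (auto simp: F(3))
 have vd: "strip_hol \<delta> (\<lambda>z. v1 z $ i)" "strip_hol \<delta> (\<lambda>z. v2 z $ i)" for i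
  by (rule sh_mono[OF v1(1) \<delta>(2)], rule sh_mono[OF v2(1) \<delta>(2)])
 define s1 s2 where "s1 w = det2 (e1 w) (v1 (cpt w)) / det2 (v2 (cpt w)) (e1 w)" and "s2 w = det2 (e2 w) (v2 (cpt w)) / det2 (v1 (cpt w)) (e2 w)" for w
 have s1n: "norm (s1 w) \<le> 1" and s2n: "norm (s2 w) \<le> 1" for w
 proof -
  have d: "d0 / 4 \<le> 3 * d0 / 4" using d0(1) by simp
  show "norm (s1 w) \<le> 1" unfolding s1_def norm_divide using D1[of w] N1[of w] d D1n[of w]
   by (subst divide_le_eq_1_pos) auto
  show "norm (s2 w) \<le> 1" unfolding s2_def norm_divide using D2[of w] N2[of w] d D2n[of w]
   by (subst divide_le_eq_1_pos) auto
 qed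
 note rel1 = slope_relation[OF q1(2) q1(1) D1n D1n b12 e10 s1_def s1_def]
 note rel2 = slope_relation[OF q2(2) q2(1) D2n D2n b21 e20 s2_def s2_def]
 have "\<exists>\<delta> v. holomorphic_section U ls m \<delta> v"
 proof -
  obtain t where t: "strip_hol \<delta> t" "\<And>w. t (cpt w) = s1 w"
  proof (rule graph_transform[where \<alpha> = "\<lambda>z. - ?p v1 v2 z" and \<beta> = "\<lambda>z. - ?p v1 v1 z"
     and \<gamma> = "?p v2 v2" and \<eta> = "?p v2 v1" and \<sigma> = \<tau> and \<rho> = \<omega> and s = s1 and \<delta> = \<delta> and \<kappa> = \<kappa>1 and \<epsilon> = \<epsilon>])
   show "\<exists>M. \<forall>z\<in>strip \<delta>. \<bar>Re (fst z)\<bar> \<le> R \<longrightarrow> \<bar>Re (snd z)\<bar> \<le> R \<longrightarrow> \<omega> z \<le> M" for R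
    unfolding \<omega>_def by (rule twist_weight_locally_bounded[OF \<delta>le1])
   show "s1 w * (?p v2 v2 (cpt w) * s1 (w + \<tau>) + ?p v2 v1 (cpt w)) =
     - ?p v1 v2 (cpt w) * s1 (w + \<tau>) + - ?p v1 v1 (cpt w)" for w
    using rel1(1)[of w] unfolding sp by (simp add: algebra_simps)
  qed (use dm \<delta>(1) \<omega>0 \<omega>1 params s1n in \<open>auto intro!: sh_minus shp v1 v2\<close>)
  have "holomorphic_section U ls m \<delta> (\<lambda>z. v1 z + t z *s v2 z)"
   by (rule holomorphic_section_of_graph[OF Un CP(1) e1l \<delta>(1) vd t(1) _ _ e10 e1 v1U v2U])
    (use t(2) rel1(2) in \<open>auto simp: s1_def\<close>)
  then show ?thesis by blast
 qed
 moreover have "\<exists>\<delta> v. holomorphic_section U lu n \<delta> v"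
 proof -
  have pm: "w - \<tau> + \<tau> = w" "cpt w - cpt \<tau> = cpt (w - \<tau>)" for w by (simp_all add: cpt_diff)
  have zm: "z - cpt \<tau> + cpt \<tau> = z" "z + cpt (- \<tau>) = z - cpt \<tau>" for z by (simp_all add: cpt_def)
  have zs: "z - cpt \<tau> \<in> strip \<delta>" if "z \<in> strip \<delta>" for z using that by simp
  obtain t where t: "strip_hol \<delta> t" "\<And>w. t (cpt w) = s2 w"
  proof (rule graph_transform[where \<alpha> = "\<lambda>z. ?p v1 v2 (z - cpt \<tau>)" and \<beta> = "\<lambda>z. ?p v2 v2 (z - cpt \<tau>)"
     and \<gamma> = "\<lambda>z. - ?p v1 v1 (z - cpt \<tau>)" and \<eta> = "\<lambda>z. - ?p v2 v1 (z - cpt \<tau>)" and \<sigma> = "- \<tau>"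
     and \<rho> = "\<lambda>z. inverse (\<omega> z)" and s = s2 and \<delta> = \<delta> and \<kappa> = \<kappa>1 and \<epsilon> = \<epsilon>])
   show "strip_hol \<delta> (\<lambda>z. ?p v1 v2 (z - cpt \<tau>))" "strip_hol \<delta> (\<lambda>z. ?p v2 v2 (z - cpt \<tau>))"
    "strip_hol \<delta> (\<lambda>z. - ?p v1 v1 (z - cpt \<tau>))" "strip_hol \<delta> (\<lambda>z. - ?p v2 v1 (z - cpt \<tau>))"
    by (intro sh_minus sh_translate_minus shp v1 v2)+
   show "\<exists>M. \<forall>z\<in>strip \<delta>. \<bar>Re (fst z)\<bar> \<le> R \<longrightarrow> \<bar>Re (snd z)\<bar> \<le> R \<longrightarrow> inverse (\<omega> z) \<le> M" for R
   proof -
    have "inverse (\<omega> z) = twist_weight (- (n - m)) z" for z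
     by (simp add: \<omega>_def twist_weight_def exp_minus[symmetric] algebra_simps)
    then show ?thesis using twist_weight_locally_bounded[OF \<delta>le1] by simp
   qed
   show "s2 w * (- ?p v1 v1 (cpt w - cpt \<tau>) * s2 (w + - \<tau>) + - ?p v2 v1 (cpt w - cpt \<tau>)) =
     ?p v1 v2 (cpt w - cpt \<tau>) * s2 (w + - \<tau>) + ?p v2 v2 (cpt w - cpt \<tau>)" for w
    using rel2(1)[of "w - \<tau>"] unfolding pm sp by (simp add: algebra_simps)
   fix z assume z: "z \<in> strip \<delta>"
   note dz = dm[OF zs[OF z], unfolded zm]
   show "norm (?p v1 v2 (z - cpt \<tau>)) * inverse (\<omega> (z + cpt (- \<tau>))) \<le> \<kappa>1 * norm (- ?p v2 v1 (z - cpt \<tau>)) * inverse (\<omega> z)"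
    using dz(2) \<omega>0[of z] \<omega>0[of "z - cpt \<tau>"] unfolding zm by (simp add: field_simps)
   show "norm (?p v2 v2 (z - cpt \<tau>)) \<le> \<epsilon> * norm (- ?p v2 v1 (z - cpt \<tau>)) * inverse (\<omega> z)"
    using dz(3) \<omega>0[of z] by (simp add: field_simps)
   show "norm (- ?p v1 v1 (z - cpt \<tau>)) * inverse (\<omega> (z + cpt (- \<tau>))) \<le> \<epsilon> * norm (- ?p v2 v1 (z - cpt \<tau>))"
    using dz(4) \<omega>0[of "z - cpt \<tau>"] unfolding zm by (simp add: field_simps)
   show "- ?p v2 v1 (z - cpt \<tau>) \<noteq> 0" using dz(1) by simp
  qed (use \<delta>(1) \<omega>0 \<omega>1 params s2n in auto)
  have "holomorphic_section U lu n \<delta> (\<lambda>z. v2 z + t z *s v1 z)"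
   by (rule holomorphic_section_of_graph[OF Un CP(2) e2l \<delta>(1) vd(2) vd(1) t(1) _ _ e20 e2 v2U v1U])
    (use t(2) rel2(2) in \<open>auto simp: s2_def\<close>)
  then show ?thesis by blast
 qed
 ultimately show ?thesis ..
qed

text \<open>A dominated splitting, after the change of metric on the stable line, has a continuous frame in which every
 single step dominates.\<close>

lemma dominated_frame:
 assumes adm: "strip_admissible \<tau> U A" and ds: "dominated_splitting \<tau> U A ls lu"
  and es: "normalized_unit_section U ls es ms" and eu: "normalized_unit_section U lu eu mu"
 obtains \<theta> \<kappa> where "continuous_on UNIV \<theta>" "\<And>j w. \<theta> (w + axis j 1) = \<theta> w" "0 < \<kappa>" "\<kappa> < 1"
  "\<And>w. norm (multiplier \<tau> A es w) * exp (\<theta> (w + \<tau>) - \<theta> w) \<le> \<kappa> * norm (multiplier \<tau> A eu w)"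
proof -
 have UA: "equivariant_cocycle \<tau> U A" "sewing_system U" using adm by (auto simp: strip_admissible_def)
 have ls: "invariant_line \<tau> U A ls" and lu: "invariant_line \<tau> U A lu" using ds by (auto simp: dominated_splitting_def)
 obtain N \<kappa> where N: "N \<ge> 1" "0 < \<kappa>" "\<kappa> < 1" and dom: "\<And>z. restricted_norm (cocycle_iterate \<tau> A N z) (ls z) /
      restricted_conorm (cocycle_iterate \<tau> A N z) (lu z) \<le> \<kappa>\<^sup>2"
  using ds unfolding dominated_splitting_def by blast
 define qs where "qs = multiplier \<tau> A es"
 define qu where "qu = multiplier \<tau> A eu"
 note ps = multiplier_props[OF UA ls es, folded qs_def] and pu = multiplier_props[OF UA lu eu, folded qu_def]
 note ns = unit_section_props[OF es] and nu = unit_section_props[OF eu]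
 define \<phi> where "\<phi> w = ln (norm (qs w)) - ln (norm (qu w))" for w
 have \<phi>c: "continuous_on UNIV \<phi>" unfolding \<phi>_def[abs_def] using ps(2) pu(2) by (intro continuous_intros ps(3) pu(3)) auto
 have \<phi>p: "\<phi> (w + axis j 1) = \<phi> w" for j w
  using norm_multiplier_periodic[OF UA ls es] norm_multiplier_periodic[OF UA lu eu] by (simp add: \<phi>_def qs_def qu_def)
 have sum: "(\<Sum>i<N. \<phi> (w + real i *\<^sub>R \<tau>)) \<le> ln (\<kappa>\<^sup>2)" for w
 proof -
  define Ps where "Ps = (\<Prod>i<N. norm (qs (w + real i *\<^sub>R \<tau>)))"
  define Pu where "Pu = (\<Prod>i<N. norm (qu (w + real i *\<^sub>R \<tau>)))"
  have pos: "Ps > 0" "Pu > 0" using ps(2) pu(2) by (auto simp: Ps_def Pu_def intro!: prod_pos)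
  have "restricted_norm (cocycle_iterate \<tau> A N w) (ls w) = Ps"
   unfolding restricted_norm_eq(1)[OF invariant_line_CP1[OF ls] ns(3) ns(1)] cocycle_iterate_section[of A es qs \<tau>, OF ps(1)]
   by (simp add: norm_smult ns(1) Ps_def prod_norm)
  moreover have "restricted_conorm (cocycle_iterate \<tau> A N w) (lu w) = Pu"
   unfolding restricted_norm_eq(2)[OF invariant_line_CP1[OF lu] nu(3) nu(1)] cocycle_iterate_section[of A eu qu \<tau>, OF pu(1)]
   by (simp add: norm_smult nu(1) Pu_def prod_norm)
  ultimately have "ln (Ps / Pu) \<le> ln (\<kappa>\<^sup>2)" using dom[of w] pos N(2) by (simp add: ln_le_cancel_iff del: ln_realpow ln_div)
  moreover have "ln (Ps / Pu) = (\<Sum>i<N. \<phi> (w + real i *\<^sub>R \<tau>))"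
   using pos ps(2) pu(2) by (simp add: ln_div \<phi>_def sum_subtractf Ps_def Pu_def ln_prod)
  ultimately show ?thesis by simp
 qed
 obtain \<theta> where \<theta>: "continuous_on UNIV \<theta>" "\<And>j w. \<theta> (w + axis j 1) = \<theta> w" "\<And>w. \<phi> w + \<theta> (w + \<tau>) - \<theta> w \<le> ln (\<kappa>\<^sup>2) / real N"
  using adapted_weight[OF \<phi>c \<phi>p _ sum] N(1) by auto
 define \<kappa>' where "\<kappa>' = exp (ln (\<kappa>\<^sup>2) / real N)"
 have k2: "\<kappa>\<^sup>2 < 1" using N by (simp add: power_less_one_iff)
 have "ln (\<kappa>\<^sup>2) < 0" using ln_less_zero[of "\<kappa>\<^sup>2"] N(2) k2 by simp
 then have k': "0 < \<kappa>'" "\<kappa>' < 1" using N(1) unfolding \<kappa>'_def by (auto simp del: ln_realpow simp: divide_less_0_iff)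
 have "norm (qs w) * exp (\<theta> (w + \<tau>) - \<theta> w) \<le> \<kappa>' * norm (qu w)" for w
 proof -
  have "exp (\<phi> w + \<theta> (w + \<tau>) - \<theta> w) \<le> \<kappa>'" unfolding \<kappa>'_def using \<theta>(3) by (simp only: exp_le_cancel_iff)
  moreover have "exp (\<phi> w + \<theta> (w + \<tau>) - \<theta> w) = norm (qs w) / norm (qu w) * exp (\<theta> (w + \<tau>) - \<theta> w)"
   using ps(2)[of w] pu(2)[of w] by (simp add: \<phi>_def exp_add exp_diff)
  ultimately have "norm (qs w) / norm (qu w) * exp (\<theta> (w + \<tau>) - \<theta> w) * norm (qu w) \<le> \<kappa>' * norm (qu w)"
   by (intro mult_right_mono) auto
  then show ?thesis using pu(2)[of w] by simp
 qed
 then show ?thesis using that[OF \<theta>(1,2) k'] by (simp add: qs_def qu_def)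
qed

lemma dominated_splitting_holomorphic_sections:
 assumes adm: "strip_admissible \<tau> U A" and ds: "dominated_splitting \<tau> U A ls lu"
  and es: "normalized_unit_section U ls es ms" and eu: "normalized_unit_section U lu eu mu"
 shows "\<exists>\<delta> v. holomorphic_section U ls ms \<delta> v" "\<exists>\<delta> v. holomorphic_section U lu mu \<delta> v"
proof -
 have UA: "equivariant_cocycle \<tau> U A" "sewing_system U" using adm by (auto simp: strip_admissible_def)
 obtain \<delta>0 where \<delta>0: "\<delta>0 > 0" "\<And>j. extends_to_strip \<delta>0 (U j)" "extends_to_strip \<delta>0 A"
  using adm unfolding strip_admissible_def by blast
 have ls: "invariant_line \<tau> U A ls" and lu: "invariant_line \<tau> U A lu" and ne: "\<And>w. ls w \<noteq> lu w"
  using ds by (auto simp: dominated_splitting_def)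
 obtain \<theta> \<kappa> where \<theta>: "continuous_on UNIV \<theta>" "\<And>j w. \<theta> (w + axis j 1) = \<theta> w" and \<kappa>: "0 < \<kappa>" "\<kappa> < 1"
  and dom: "\<And>w. norm (multiplier \<tau> A es w) * exp (\<theta> (w + \<tau>) - \<theta> w) \<le> \<kappa> * norm (multiplier \<tau> A eu w)"
  by (rule dominated_frame[OF adm ds es eu]) blast
 define qs where "qs = multiplier \<tau> A es"
 define qu where "qu = multiplier \<tau> A eu"
 note ps = multiplier_props[OF UA ls es, folded qs_def] and pu = multiplier_props[OF UA lu eu, folded qu_def]
 note ns = unit_section_props[OF es] and nu = unit_section_props[OF eu]
 define e1 where "e1 w = of_real (exp (- \<theta> w)) *s es w" for w
 define q1 where "q1 w = qs w * of_real (exp (\<theta> (w + \<tau>) - \<theta> w))" for w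
 have "(\<exists>\<delta> v. holomorphic_section U ls ms \<delta> v) \<and> (\<exists>\<delta> v. holomorphic_section U lu mu \<delta> v)"
 proof (rule dominated_frame_sections[of U \<tau> A \<delta>0 ls lu e1 eu ms mu q1 qu \<kappa>])
  show "continuous_on UNIV e1" unfolding e1_def[abs_def] by (intro continuous_intros \<theta>(1) ns(4))
  show "e1 w \<in> ls w" for w unfolding e1_def by (intro CP1_smult invariant_line_CP1[OF ls] ns(3))
  show "e1 w \<noteq> 0" for w using ns(2)[of w] by (simp add: e1_def)
  show "e1 (w + axis 1 1) = U 1 w *v e1 w" for w by (simp add: e1_def \<theta>(2) ns(5) matrix_smult_vec)
  show "e1 (w + axis 2 1) = twist ms w *s (U 2 w *v e1 w)" for w
   by (simp add: e1_def \<theta>(2) ns(6) matrix_smult_vec vector_smult_assoc mult.commute)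
  show "A w *v e1 w = q1 w *s e1 (w + \<tau>)" for w
  proof -
   have "of_real (exp (\<theta> (w + \<tau>) - \<theta> w)) * of_real (exp (- \<theta> (w + \<tau>))) = complex_of_real (exp (- \<theta> w))"
    unfolding of_real_mult[symmetric] exp_add[symmetric] by simp
   then show ?thesis by (simp add: e1_def q1_def ps(1) matrix_smult_vec vector_smult_assoc mult.assoc mult.commute[of "qs w"])
  qed
  show "q1 w \<noteq> 0" for w using ps(2) by (simp add: q1_def)
  show "norm (q1 w) \<le> \<kappa> * norm (qu w)" for w using dom[of w] by (simp add: q1_def norm_mult qs_def qu_def)
  show "norm (qu (w + axis j 1)) = norm (qu w)" for w j unfolding qu_def by (rule norm_multiplier_periodic[OF UA lu eu])
 qed (use UA \<delta>0 ls lu ne nu pu \<kappa> in auto)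
 then show "\<exists>\<delta> v. holomorphic_section U ls ms \<delta> v" "\<exists>\<delta> v. holomorphic_section U lu mu \<delta> v" by blast+
qed

text \<open>The translation preserves the mean, so \<open>G w - G (w + \<tau>)\<close> is continuous, nonnegative and of mean zero.\<close>

lemma monotone_along_orbits_invariant:
 fixes G :: "real^2 \<Rightarrow> real"
 assumes G: "continuous_on UNIV G" and per: "\<And>j w. G (w + axis j 1) = G w" and le: "\<And>w. G (w + \<tau>) \<le> G w"
 shows "G (w + \<tau>) = G w"
proof -
 define D where "D w = G w - G (w + \<tau>)" for w
 have Gc: "continuous_on UNIV (\<lambda>w. complex_of_real (G w))" by (intro continuous_intros G)
 have Gt: "continuous_on S (\<lambda>w. G (w + \<tau>))" for S by (intro continuous_on_compose2[OF G] continuous_intros) auto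
 have Gs: "continuous_on S (\<lambda>w. G w)" for S using continuous_on_subset[OF G] by simp
 have Dc: "continuous_on S D" for S unfolding D_def[abs_def] by (intro continuous_on_diff Gt Gs)
 have Dp: "D (w + axis j 1) = D w" for w j using per[of w j] per[of "w + \<tau>" j] by (simp add: D_def add_ac)
 obtain C where C: "\<And>w. norm (G w) \<le> C" using periodic_continuous_bounded[OF G per] by blast
 have "mean (\<lambda>w. complex_of_real (G (w + \<tau>))) = mean (\<lambda>w. complex_of_real (G w))"
  by (rule mean_shift[where f = "\<lambda>w. complex_of_real (G w)" and C = C]) (use measurable_lebesgue_cont[OF Gc] C per in auto)
 then have "integral (cbox 0 1) (\<lambda>w. complex_of_real (G (w + \<tau>))) = integral (cbox 0 1) (\<lambda>w. complex_of_real (G w))"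
  using Gt Gs by (simp add: mean_eq_integral continuous_intros)
 moreover have "integral (cbox 0 1) (\<lambda>w. complex_of_real (G (w + \<tau>))) = of_real (integral (cbox 0 1) (\<lambda>w. G (w + \<tau>)))"
  "integral (cbox 0 1) (\<lambda>w. complex_of_real (G w)) = of_real (integral (cbox 0 1) G)"
  using integral_linear[OF integrable_continuous[OF Gt] bounded_linear_of_real[where ?'a = complex], of 0 1]
   integral_linear[OF integrable_continuous[OF Gs] bounded_linear_of_real[where ?'a = complex], of 0 1] by (simp_all add: o_def)
 ultimately have "integral (cbox 0 1) D = 0"
  unfolding D_def by (simp add: Henstock_Kurzweil_Integration.integral_diff integrable_continuous Gt Gs)
 moreover have box01: "box 0 (1::real^2) \<noteq> {}" unfolding interval_ne_empty_cart by simp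
 moreover have D0: "D v \<ge> 0" for v using le by (simp add: D_def)
 ultimately have z: "\<forall>v\<in>cbox 0 1. D v = 0"
  using integral_cbox_eq_0_iff[OF Dc box01 D0] by blast
 obtain v where "v \<in> cbox 0 1" "D w = D v" using lattice_reduce[of D w, OF Dp] by blast
 then show ?thesis using z by (simp add: D_def)
qed

text \<open>The function \<open>G\<close> below measures the angle of \<open>l\<close> to the two lines of the splitting. By domination it does not increase along orbits, and it decreases strictly
 where \<open>l\<close> agrees with neither line; the preceding lemma excludes strict decrease.\<close>

lemma invariant_line_of_splitting:
 assumes adm: "strip_admissible \<tau> U A" and ds: "dominated_splitting \<tau> U A ls lu" and l: "invariant_line \<tau> U A l"
 shows "l = ls \<or> l = lu"
proof -
 have UA: "equivariant_cocycle \<tau> U A" "sewing_system U" using adm by (auto simp: strip_admissible_def)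
 have ls: "invariant_line \<tau> U A ls" and lu: "invariant_line \<tau> U A lu" and ne: "\<And>w. ls w \<noteq> lu w"
  using ds by (auto simp: dominated_splitting_def)
 have ex: "\<exists>e m. normalized_unit_section U l e m" if "invariant_line \<tau> U A l" for l
  using normalized_unit_section_exists[OF UA(2), of l] that unfolding invariant_line_def by metis
 obtain es ms eu mu e m where es: "normalized_unit_section U ls es ms" and eu: "normalized_unit_section U lu eu mu"
  and e: "normalized_unit_section U l e m" using ex ls lu l by metis
 obtain \<theta> \<kappa> where \<theta>: "continuous_on UNIV \<theta>" "\<And>j w. \<theta> (w + axis j 1) = \<theta> w" and \<kappa>: "0 < \<kappa>" "\<kappa> < 1"
  and dom: "\<And>w. norm (multiplier \<tau> A es w) * exp (\<theta> (w + \<tau>) - \<theta> w) \<le> \<kappa> * norm (multiplier \<tau> A eu w)"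
  by (rule dominated_frame[OF adm ds es eu]) blast
 note ps = multiplier_props[OF UA ls es] and pu = multiplier_props[OF UA lu eu] and pe = multiplier_props[OF UA l e]
 note ns = unit_section_props[OF es] and nu = unit_section_props[OF eu] and nl = unit_section_props[OF e]
 note CP = invariant_line_CP1[OF ls] invariant_line_CP1[OF lu] invariant_line_CP1[OF l]
 define a where "a w = norm (det2 (e w) (eu w))" for w
 define b where "b w = exp (- \<theta> w) * norm (det2 (es w) (e w))" for w
 define G where "G w = a w / (a w + b w)" for w
 have a0: "a w \<ge> 0" and b0: "b w \<ge> 0" for w by (auto simp: a_def b_def)
 have alu: "l w = lu w" if "a w = 0" for w
  using det2_nz[OF CP(3) CP(2) _ nl(3) nu(3) nl(2) nu(2), of w] that by (auto simp: a_def)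
 have bls: "l w = ls w" if "b w = 0" for w
  using det2_nz[OF CP(1) CP(3) _ ns(3) nl(3) ns(2) nl(2), of w] that by (auto simp: b_def)
 have ab: "a w + b w > 0" for w using alu[of w] bls[of w] ne[of w] a0[of w] b0[of w] by (cases "a w = 0"; cases "b w = 0") auto
 have ac: "continuous_on UNIV a" "continuous_on UNIV b" unfolding a_def[abs_def] b_def[abs_def] by (intro continuous_intros ns(4) nu(4) nl(4) \<theta>(1))+
 have Gc: "continuous_on UNIV G" unfolding G_def[abs_def] using ab by (intro continuous_intros ac) (auto simp: less_le)
 have dU: "norm (det (U j w)) = 1" for j w using UA(2) norm_det_unitary by (auto simp: sewing_system_def)
 have per: "a (w + axis j 1) = a w" "b (w + axis j 1) = b w" for j w
  using exhaust_2[of j] by (auto simp: a_def b_def \<theta>(2) ns(5,6) nu(5,6) nl(5,6) det2_matrix norm_mult dU)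
 define D where "D w = norm (det (A w)) / norm (multiplier \<tau> A e w)" for w
 define x where "x w = norm (multiplier \<tau> A es w) * exp (\<theta> (w + \<tau>) - \<theta> w)" for w
 define y where "y w = norm (multiplier \<tau> A eu w)" for w
 have D0: "D w > 0" and x0: "x w > 0" and y0: "y w > 0" for w
  using UA(1) ps(2) pu(2) pe(2) by (auto simp: D_def x_def y_def equivariant_cocycle_def)
 have xy: "x w < y w" for w using dom[of w] mult_strict_right_mono[OF \<kappa>(2) y0[of w]] unfolding x_def y_def by linarith
 have shift: "a (w + \<tau>) = D w * a w / y w" "b (w + \<tau>) = D w * b w / x w" for w
 proof -
  have "det (A w) * det2 (e w) (eu w) = multiplier \<tau> A e w * (multiplier \<tau> A eu w * det2 (e (w + \<tau>)) (eu (w + \<tau>)))"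
   unfolding det2_matrix[symmetric] pe(1) pu(1) by simp
  from arg_cong[OF this, of norm] have "norm (det (A w)) * a w = norm (multiplier \<tau> A e w) * (y w * a (w + \<tau>))"
   by (simp add: norm_mult a_def y_def)
  then show "a (w + \<tau>) = D w * a w / y w" using pe(2)[of w] y0[of w] by (simp add: D_def field_simps)
  have "det (A w) * det2 (es w) (e w) = multiplier \<tau> A es w * (multiplier \<tau> A e w * det2 (es (w + \<tau>)) (e (w + \<tau>)))"
   unfolding det2_matrix[symmetric] pe(1) ps(1) by simp
  from arg_cong[OF this, of norm] have "norm (det (A w)) * norm (det2 (es w) (e w)) = norm (multiplier \<tau> A e w) * (norm (multiplier \<tau> A es w) * norm (det2 (es (w + \<tau>)) (e (w + \<tau>))))"
   by (simp add: norm_mult)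
  then show "b (w + \<tau>) = D w * b w / x w" using pe(2)[of w] ps(2)[of w] by (simp add: D_def b_def x_def exp_diff exp_minus field_simps)
 qed
 have Gs: "G (w + \<tau>) = x w * a w / (x w * a w + y w * b w)" for w
 proof -
  have pos: "x w * a w + y w * b w > 0" using ab[of w] a0[of w] b0[of w] x0[of w] y0[of w]
   by (cases "a w = 0") (auto intro: add_pos_nonneg)
  have sum: "a (w + \<tau>) + b (w + \<tau>) = D w / (x w * y w) * (x w * a w + y w * b w)"
   unfolding shift using x0[of w] y0[of w] by (simp add: field_simps)
  have num: "a (w + \<tau>) = D w / (x w * y w) * (x w * a w)" unfolding shift using x0[of w] by simp
  have "D w / (x w * y w) \<noteq> 0" using D0[of w] x0[of w] y0[of w] by simp
  then show ?thesis unfolding G_def sum unfolding num by (rule mult_divide_mult_cancel_left)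
 qed
 have diff: "x w * a w * (a w + b w) \<le> a w * (x w * a w + y w * b w)"
  and strict: "a w \<noteq> 0 \<Longrightarrow> b w \<noteq> 0 \<Longrightarrow> x w * a w * (a w + b w) < a w * (x w * a w + y w * b w)" for w
 proof -
  have eq: "a w * (x w * a w + y w * b w) - x w * a w * (a w + b w) = (y w - x w) * (a w * b w)" by (simp add: algebra_simps)
  show "x w * a w * (a w + b w) \<le> a w * (x w * a w + y w * b w)"
  proof -
   have "0 \<le> (y w - x w) * (a w * b w)" using xy[of w] a0[of w] b0[of w] by simp
   then show ?thesis using eq by linarith
  qed
  show "x w * a w * (a w + b w) < a w * (x w * a w + y w * b w)" if "a w \<noteq> 0" "b w \<noteq> 0"
  proof -
   have "0 < (y w - x w) * (a w * b w)" using xy[of w] a0[of w] b0[of w] that by (simp add: less_le)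
   then show ?thesis using eq by linarith
  qed
 qed
 have pos: "x w * a w + y w * b w > 0" for w using ab[of w] a0[of w] b0[of w] x0[of w] y0[of w]
  by (cases "a w = 0") (auto intro: add_pos_nonneg)
 have Gle: "G (w + \<tau>) \<le> G w" for w unfolding Gs unfolding G_def using diff[of w] pos[of w] ab[of w] by (simp add: divide_le_eq pos_le_divide_eq mult.commute)
 have Gp: "G (w + axis j 1) = G w" for j w by (simp add: G_def per)
 have zero: "a w = 0 \<or> b w = 0" for w
 proof (rule ccontr)
  assume "\<not> (a w = 0 \<or> b w = 0)"
  then have "x w * a w * (a w + b w) < a w * (x w * a w + y w * b w)" using strict by blast
  moreover have "x w * a w / (x w * a w + y w * b w) = a w / (a w + b w)"
   using monotone_along_orbits_invariant[OF Gc Gp Gle, of w] unfolding Gs unfolding G_def .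
  ultimately show False using pos[of w] ab[of w] by (simp add: frac_eq_eq less_le)
 qed
 have G01: "G w = 0 \<or> G w = 1" for w using zero[of w] ab[of w] by (auto simp: G_def)
 have "connected (range G)" by (rule connected_continuous_image[OF Gc connected_UNIV])
 moreover have "range G \<subseteq> {0, 1}" using G01 by auto
 ultimately have "(\<forall>w. G w = 0) \<or> (\<forall>w. G w = 1)"
  using connected_finite_iff_sing[of "range G"] finite_subset[of "range G" "{0,1}"] by (metis G01 UNIV_I finite.emptyI finite.insertI imageI singletonD empty_iff)
 then show ?thesis
 proof
  assume "\<forall>w. G w = 0"
  then have "a w = 0" for w using ab[of w] by (auto simp: G_def dest: spec[of _ w])
  then show ?thesis using alu by blast
 next
  assume "\<forall>w. G w = 1"
  then have "b w = 0" for w using ab[of w] by (auto simp: G_def dest: spec[of _ w])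
  then show ?thesis using bls by blast
 qed
qed

section \<open>Normal forms of analytic sections\<close>

lemma torus_char_lattice_dot: "torus_char (n $ 1, n $ 2) (cpt w) = exp (2 * pi * \<i> * lattice_dot n w)"
 by (simp add: torus_char_def lattice_dot_def cpt_def sum_2)

lemma int_vec_of_pair: obtains k :: "int^2" where "n = (k $ 1, k $ 2)"
 using that[of "\<chi> j. if j = 1 then fst n else snd n"] by simp

lemma chord_ge_angle: "\<bar>d\<bar> \<le> 1 / 2 \<Longrightarrow> norm (exp (2 * pi * \<i> * of_real d) - 1) \<ge> 4 * \<bar>d\<bar>"
proof -
 assume d: "\<bar>d\<bar> \<le> 1 / 2"
 have "concave_on {0..pi/2} sin"
  by (rule f''_le0_imp_concave[where f' = cos and f'' = "\<lambda>x. - sin x"]) (auto intro!: derivative_eq_intros sin_ge_zero)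
 from concave_onD_Icc[OF this, of "2 * \<bar>d\<bar>"] d have "sin (2 * \<bar>d\<bar> * (pi / 2)) \<ge> 2 * \<bar>d\<bar>" by simp
 then have s: "sin (pi * \<bar>d\<bar>) \<ge> 2 * \<bar>d\<bar>" by (simp add: mult.commute)
 have "2 * pi * \<i> * of_real d = \<i> * of_real (2 * pi * d)" by simp
 then have "norm (exp (2 * pi * \<i> * of_real d) - 1) = 2 * \<bar>sin (pi * d)\<bar>"
  by (simp only: dist_exp_i_1) simp
 also have "\<bar>sin (pi * d)\<bar> = \<bar>sin (pi * \<bar>d\<bar>)\<bar>" by (cases "d \<ge> 0") auto
 finally show ?thesis using s by linarith
qed

lemma diophantine_small_divisors:
 assumes "diophantine \<tau> c \<nu>" "n \<noteq> 0"
 shows "norm (torus_char n (cpt \<tau>) - 1) \<ge> 4 * c * l1_norm n powr (- \<nu>)"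
proof -
 obtain k :: "int^2" where k: "n = (k $ 1, k $ 2)" by (rule int_vec_of_pair)
 define r where "r = round (lattice_dot k \<tau>)"
 define d where "d = lattice_dot k \<tau> - of_int r"
 have "k \<noteq> 0" using assms(2) k by (auto simp: zero_prod_def)
 then have "c * (\<Sum>j\<in>UNIV. \<bar>of_int (k $ j)\<bar>) powr (- \<nu>) \<le> \<bar>d\<bar>" using assms(1) unfolding diophantine_def d_def r_def by blast
 then have d: "c * l1_norm n powr (- \<nu>) \<le> \<bar>d\<bar>" by (simp add: l1_norm_def k sum_2)
 have "\<bar>d\<bar> \<le> 1 / 2" using of_int_round_abs_le[of "lattice_dot k \<tau>"] unfolding d_def r_def by (simp add: abs_minus_commute)
 from chord_ge_angle[OF this] d have "norm (exp (2 * pi * \<i> * of_real d) - 1) \<ge> 4 * (c * l1_norm n powr (- \<nu>))" by linarith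
 moreover have "torus_char n (cpt \<tau>) = exp (2 * pi * \<i> * of_real d) * exp (2 * pi * \<i> * of_int r)"
  unfolding k torus_char_lattice_dot exp_add[symmetric] by (simp add: d_def algebra_simps)
 ultimately show ?thesis by simp
qed

lemma diophantine_aperiodic:
 assumes "diophantine \<tau> c \<nu>" "n \<noteq> 0"
 shows "torus_char n (cpt \<tau>) \<noteq> 1"
proof -
 have "c > 0" using assms(1) by (simp add: diophantine_def)
 then have "0 < 4 * c * l1_norm n powr (- \<nu>)" using l1_norm_ge_1[OF assms(2)] by simp
 then show ?thesis using diophantine_small_divisors[OF assms] by auto
qed

lemma mean_add_continuous:
 assumes "continuous_on UNIV f" "continuous_on UNIV g"
 shows "mean (\<lambda>w. f w + g w) = mean f + mean g"
proof -
 have c: "continuous_on (cbox 0 1) f" "continuous_on (cbox 0 1) g" using assms continuous_on_subset by blast+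
 show ?thesis using c by (simp add: mean_eq_integral continuous_on_add Henstock_Kurzweil_Integration.integral_add integrable_continuous)
qed

lemma mean_of_real:
 assumes "continuous_on UNIV f"
 shows "mean (\<lambda>w. of_real (f w)) = of_real (torus_mean f)"
proof -
 have c: "continuous_on (cbox 0 1) f" using assms continuous_on_subset by blast
 have "set_integrable lborel (cbox 0 1) f" unfolding set_integrable_def by (rule borel_integrable_compact[OF compact_cbox c])
 then have "torus_mean f = integral (cbox 0 1) f" unfolding torus_mean_def by (rule set_borel_integral_eq_integral(2))
 moreover have "integral (cbox 0 1) (\<lambda>w. complex_of_real (f w)) = of_real (integral (cbox 0 1) f)"
  using integral_linear[OF integrable_continuous[OF c] bounded_linear_of_real[where ?'a = complex]] by (simp add: o_def)
 ultimately show ?thesis using c by (simp add: mean_eq_integral continuous_intros)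
qed

lemma sh_zero_free_strip:
 assumes f: "strip_hol \<delta> f" and \<delta>: "\<delta> > 0" and per: "\<And>j w. f (cpt (w + axis j 1)) = f (cpt w)" and nz: "\<And>w. f (cpt w) \<noteq> 0"
 obtains \<delta>' where "\<delta>' > 0" "\<delta>' \<le> \<delta>" "\<And>z. z \<in> strip \<delta>' \<Longrightarrow> f z \<noteq> 0"
proof -
 define S where "S = {z\<in>strip \<delta>. 0 < norm (f z)}"
 have op: "open (strip \<delta>)" by (simp add: open_strip)
 have "open S" unfolding S_def
  using f op by (intro open_Collect_less_on continuous_on_const continuous_on_norm) (auto simp: strip_hol_def)
 moreover have "cpt w \<in> S" for w using nz \<delta> by (simp add: S_def)
 moreover have "z + cpt (axis j 1) \<in> S \<longleftrightarrow> z \<in> S" if "z \<in> strip \<delta>" for j z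
  using sh_periodic_strip[OF f \<delta> per that] by (simp add: S_def)
 ultimately obtain \<delta>' where \<delta>': "\<delta>' > 0" "\<delta>' \<le> \<delta>" "strip \<delta>' \<subseteq> S" using strip_tube[of S \<delta>] \<delta> by blast
 show ?thesis by (rule that[OF \<delta>'(1,2)]) (use \<delta>'(3) in \<open>auto simp: S_def\<close>)
qed

text \<open>Dividing two sections of one line: the quotient extends holomorphically although the line itself is
 only given at real points, because a Hermitian square norm has the extension \<open>\<Sum> v\<^sub>i v\<^sub>i\<^sup>*\<close> with
 \<open>v\<^sub>i\<^sup>*\<close> the Schwarz reflection.\<close>

lemma sh_quotient_of_sections:
 fixes v x :: "C2 \<Rightarrow> complex^2"
 assumes \<delta>: "\<delta> > 0" and v: "\<And>i. strip_hol \<delta> (\<lambda>z. v z $ i)" and x: "\<And>i. strip_hol \<delta> (\<lambda>z. x z $ i)"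
  and v0: "\<And>w. v (cpt w) \<noteq> 0" and per: "\<And>j w. norm (v (cpt (w + axis j 1))) = norm (v (cpt w))"
  and eq: "\<And>w. x (cpt w) = Q w *s v (cpt w)"
 obtains \<delta>' f where "\<delta>' > 0" "\<delta>' \<le> \<delta>" "strip_hol \<delta>' f" "\<And>w. f (cpt w) = Q w"
proof -
 define pair where "pair x z = (\<Sum>i\<in>UNIV. schwarz_reflect (\<lambda>z. v z $ i) z * x z $ i)" for x :: "C2 \<Rightarrow> complex^2" and z
 have sh: "strip_hol \<delta> (pair v)" "strip_hol \<delta> (pair x)"
  unfolding pair_def[abs_def] sum_2 by (intro sh_add sh_mult sh_reflect v x)+
 have pr: "pair y (cpt w) = herm_inner (v (cpt w)) (y (cpt w))" for y w by (simp add: pair_def herm_inner_def)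
 have nz: "pair v (cpt w) \<noteq> 0" for w unfolding pr by (rule herm_inner_self_nz[OF v0])
 have "pair v (cpt (w + axis j 1)) = pair v (cpt w)" for j w unfolding pr herm_inner_self per ..
 then obtain \<delta>' where \<delta>': "\<delta>' > 0" "\<delta>' \<le> \<delta>" "\<And>z. z \<in> strip \<delta>' \<Longrightarrow> pair v z \<noteq> 0"
  using sh_zero_free_strip[OF sh(1) \<delta> _ nz] by metis
 have "strip_hol \<delta>' (\<lambda>z. pair x z / pair v z)"
  by (intro sh_divide sh_mono[OF sh(1) \<delta>'(2)] sh_mono[OF sh(2) \<delta>'(2)] \<delta>'(3))
 moreover have "pair x (cpt w) / pair v (cpt w) = Q w" for w
  using nz[of w] unfolding pr eq herm_inner_smult by simp
 ultimately show ?thesis using that \<delta>' by blast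
qed

text \<open>The section \<open>s\<close> has the simplest multiplier of charge \<open>m\<close> and winding \<open>k\<close>.\<close>

definition normal_form where
 "normal_form \<tau> U A l m k \<Lambda> \<delta> s \<longleftrightarrow> holomorphic_section U l m \<delta> s \<and> \<Lambda> \<noteq> 0 \<and>
  (\<forall>w. A w *v s (cpt w) = (\<Lambda> * exp (2 * pi * \<i> * (lattice_dot k w - of_int m * \<tau> $ 1 * w $ 2))) *s s (cpt (w + \<tau>)))"

text \<open>Once its winding is split off, the multiplier of a holomorphic section has a holomorphic
 periodic logarithm.  Solving the cohomological equation for it normalizes the section so that only the mean of the logarithm
 survives, and this mean differs from that of the continuous data by a coboundary and by an integer combination of the frequencies.\<close>

lemma normal_form_exists:
 assumes A: "equivariant_cocycle \<tau> U A" and U: "sewing_system U" and l: "invariant_line \<tau> U A l" and e: "normalized_unit_section U l e m"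
  and g: "phase_representation (periodic_phase \<tau> A e m) k g" and dio: "diophantine \<tau> c \<nu>"
  and \<delta>0: "\<delta>0 > 0" and ext: "extends_to_strip \<delta>0 A" and hol: "holomorphic_section U l m \<delta>1 v"
 shows "\<exists>\<delta> s k'. normal_form \<tau> U A l m k (base_eigenvalue \<tau> A e g * exp (2 * pi * \<i> * lattice_dot k' \<tau>)) \<delta> s"
proof -
 note hv = hol[unfolded holomorphic_section_def]
 note en = unit_section_props[OF e] and mp = multiplier_props[OF A U l e]
 define q where "q = multiplier \<tau> A e"
 define \<delta> where "\<delta> = min \<delta>0 \<delta>1"
 have \<delta>: "\<delta> > 0" "\<delta> \<le> \<delta>0" "\<delta> \<le> \<delta>1" using \<delta>0 hv by (auto simp: \<delta>_def)
 obtain FA B where FA: "\<And>i j. strip_hol \<delta>0 (\<lambda>z. FA z $ i $ j)" "\<And>w. FA (cpt w) = A w"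
  by (rule strip_extension[OF ext]) (rule that)
 have v: "strip_hol \<delta> (\<lambda>z. v z $ i)" for i using hv sh_mono \<delta>(3) by blast
 have v0: "v (cpt w) \<noteq> 0" and vl: "v (cpt w) \<in> l w" for w using hv by auto
 have vU: "v (cpt (w + axis 1 1)) = U 1 w *v v (cpt w)" "v (cpt (w + axis 2 1)) = twist m w *s (U 2 w *v v (cpt w))" for w
  using hv by auto
 have CP: "l w \<in> CP1" for w by (rule invariant_line_CP1[OF l])
 have Un: "unitary_matrix (U j w)" for j w using U by (simp add: sewing_system_def)
 \<comment> \<open>the section in terms of the unit section\<close>
 define fv where "fv w = herm_inner (e w) (v (cpt w))" for w
 have ve: "v (cpt w) = fv w *s e w" for w
 proof -
  obtain c where c: "v (cpt w) = c *s e w" using CP1_multiple[OF CP vl en(3) en(2)] by blast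
  then show ?thesis by (simp add: fv_def c herm_inner_smult herm_inner_self en(1))
 qed
 have fv0: "fv w \<noteq> 0" for w using ve[of w] v0[of w] by auto
 have vc: "continuous_on UNIV (\<lambda>w. v (cpt w))"
 proof -
  have "continuous_on UNIV (\<lambda>w. \<chi> i. v (cpt w) $ i)" by (intro continuous_on_vec_lambda sh_cont_cpt[OF v \<delta>(1)])
  then show ?thesis by simp
 qed
 have fvc: "continuous_on UNIV fv" unfolding fv_def[abs_def] by (intro continuous_intros en(4) vc)
 have fvp: "fv (w + axis j 1) = fv w" for j w
 proof -
  define E where "E = twist m w"
  have E0: "E \<noteq> 0" by (simp add: E_def)
  have "fv (w + axis 1 1) *s (U 1 w *v e w) = fv w *s (U 1 w *v e w)"
   using ve[of "w + axis 1 1"] unfolding vU en(5) ve[of w] matrix_smult_vec by (rule sym)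
  moreover have "(fv (w + axis 2 1) * E) *s (U 2 w *v e w) = (E * fv w) *s (U 2 w *v e w)"
   using ve[of "w + axis 2 1"] unfolding vU en(6) E_def[symmetric] ve[of w] matrix_smult_vec vector_smult_assoc by (rule sym)
  ultimately show ?thesis
   using exhaust_2[of j] unitary_nz[OF Un en(2), of 1 w] unitary_nz[OF Un en(2), of 2 w] E0 by auto
 qed
 obtain kf hf where hf: "continuous_on UNIV hf" "\<And>j w. hf (w + axis j 1) = hf w"
  "\<And>w. fv w = exp (2 * of_real pi * \<i> * of_real (lattice_dot kf w) + hf w)"
  by (rule continuous_winding[OF fvc fv0 fvp]) blast
 define Q where "Q w = fv w * q w / fv (w + \<tau>)" for w
 have AQ: "A w *v v (cpt w) = Q w *s v (cpt (w + \<tau>))" for w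
  unfolding ve[of w] ve[of "w + \<tau>"] matrix_smult_vec mp(1) by (simp add: Q_def q_def vector_smult_assoc fv0)
 \<comment> \<open>the periodic multiplier extends holomorphically\<close>
 define Eh where "Eh z = exp (2 * pi * \<i> * (of_int m * of_real (\<tau> $ 1) * snd z)) * torus_char (- (k $ 1), - (k $ 2)) z" for z :: "C2"
 have Ehs: "strip_hol \<delta> Eh" for \<delta> unfolding Eh_def[abs_def]
  by (intro sh_mult sh_exp sh_const sh_snd sh_torus_char)
 have Ehr: "Eh (cpt w) = exp (2 * pi * \<i> * of_int m * \<tau> $ 1 * w $ 2) * exp (- (2 * pi * \<i> * lattice_dot k w))" for w
  using torus_char_lattice_dot[of "- k" w] by (simp add: Eh_def cpt_def lattice_dot_def sum_negf mult.assoc)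
 have "\<exists>\<delta>' f. \<delta>' > 0 \<and> \<delta>' \<le> \<delta> \<and> strip_hol \<delta>' f \<and> (\<forall>w. f (cpt w) = Q w)"
 proof (rule sh_quotient_of_sections[where v = "\<lambda>z. v (z + cpt \<tau>)" and x = "\<lambda>z. FA z *v v z" and Q = Q and \<delta> = \<delta>])
  show "strip_hol \<delta> (\<lambda>z. v (z + cpt \<tau>) $ i)" for i by (rule sh_translate[OF v])
  show "strip_hol \<delta> (\<lambda>z. (FA z *v v z) $ i)" for i
   by (rule sh_matrix_vector[OF sh_mono[OF FA(1) \<delta>(2)] v])
  show "norm (v (cpt (w + axis j 1) + cpt \<tau>)) = norm (v (cpt w + cpt \<tau>))" for j w
   using exhaust_2[of j] vU[of "w + \<tau>"] by (auto simp: cpt_add[symmetric] add_ac norm_smult unitary_norm[OF Un])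
  show "FA (cpt w) *v v (cpt w) = Q w *s v (cpt w + cpt \<tau>)" for w by (simp add: FA(2) AQ cpt_add)
 qed (use \<delta>(1) v0 in \<open>auto simp: cpt_add[symmetric]\<close>)
 then obtain \<delta>2 f where f: "\<delta>2 > 0" "\<delta>2 \<le> \<delta>" "strip_hol \<delta>2 f" "\<And>w. f (cpt w) = Q w" by blast
 define P where "P z = f z * Eh z" for z
 have Psh: "strip_hol \<delta>2 P" unfolding P_def[abs_def] by (intro sh_mult f(3) Ehs)
 note gr = g[unfolded phase_representation_def lattice_periodic_def]
 define hs where "hs w = - hf (w + \<tau>)" for w
 define K where "K = - (2 * pi * \<i> * lattice_dot kf \<tau>)"
 define R where "R w = of_real (ln (norm (q w))) + (2 * pi * \<i> * g w + (hf w + (hs w + K)))" for w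
 have PR: "P (cpt w) = exp (R w)" for w
 proof -
  have "lattice_dot kf (w + \<tau>) = lattice_dot kf w + lattice_dot kf \<tau>" by (simp add: lattice_dot_def ring_distribs sum.distrib)
  then have 1: "fv w / fv (w + \<tau>) = exp (hf w + (hs w + K))"
   unfolding hs_def K_def hf(3) exp_diff[symmetric] by (simp add: algebra_simps)
  have "q w / norm (q w) * exp (2 * pi * \<i> * of_int m * \<tau> $ 1 * w $ 2) = exp (2 * pi * \<i> * (lattice_dot k w + g w))"
   using gr unfolding periodic_phase_def q_def by blast
  then have "q w / norm (q w) * Eh (cpt w) = exp (2 * pi * \<i> * (lattice_dot k w + g w)) * exp (- (2 * pi * \<i> * lattice_dot k w))"
   unfolding Ehr by (simp only: mult.assoc[symmetric])
  also have "\<dots> = exp (2 * pi * \<i> * g w)" unfolding exp_add[symmetric] by (simp add: algebra_simps)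
  finally have 2: "q w / norm (q w) * Eh (cpt w) = exp (2 * pi * \<i> * g w)" .
  have q0: "norm (q w) > 0" using mp(2) by (simp add: q_def)
  then have 3: "complex_of_real (norm (q w)) = exp (of_real (ln (norm (q w))))" by (simp add: exp_of_real)
  have "P (cpt w) = of_real (norm (q w)) * (q w / norm (q w) * Eh (cpt w)) * (fv w / fv (w + \<tau>))"
   using q0 by (simp add: P_def f(4) Q_def)
  then show ?thesis unfolding 1 2 unfolding 3 R_def exp_add[symmetric] by (simp add: add.assoc)
 qed
 have qc: "continuous_on UNIV (\<lambda>w. ln (norm (q w)))" using mp(2,3) unfolding q_def by (intro continuous_intros) auto
 have hsc: "continuous_on UNIV hs" unfolding hs_def[abs_def] by (intro continuous_on_minus continuous_on_compose2[OF hf(1)] continuous_intros) auto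
 have gc: "continuous_on UNIV g" using gr by blast
 have Rc: "continuous_on UNIV R" unfolding R_def[abs_def] by (intro continuous_intros qc gc hf(1) hsc)
 have hft: "hf (w + axis j 1 + \<tau>) = hf (w + \<tau>)" for j w using hf(2)[of "w + \<tau>" j] by (simp add: add_ac)
 have Rp: "R (w + axis j 1) = R w" for j w
  using norm_multiplier_periodic[OF A U l e] gr by (simp add: R_def q_def hf(2) hft hs_def)
 obtain C where C: "\<And>w. norm (hf w) \<le> C" using periodic_continuous_bounded[OF hf(1,2)] by blast
 have "mean (\<lambda>w. hf (w + \<tau>)) = mean hf"
  by (rule mean_shift[where C = C]) (use measurable_lebesgue_cont[OF hf(1)] C hf(2) in auto)
 moreover have "mean hs = - mean (\<lambda>w. hf (w + \<tau>))"
  using mean_cmult[of "-1" "\<lambda>w. hf (w + \<tau>)"] by (simp add: hs_def[abs_def])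
 ultimately have hs: "mean hs = - mean hf" by simp
 have Rint: "mean R = of_real (lyapunov_exponent \<tau> A e) + 2 * pi * \<i> * torus_mean g - 2 * pi * \<i> * lattice_dot kf \<tau>"
  unfolding R_def
  by (simp add: mean_add_continuous mean_of_real mean_cmult continuous_intros qc gc hf(1) hsc lyapunov_exponent_def q_def[symmetric] hs K_def[symmetric])
    (simp add: K_def)
 \<comment> \<open>a holomorphic logarithm, which agrees with the continuous one up to a constant\<close>
 have "\<exists>\<delta>'. \<delta>' > 0 \<and> \<delta>' \<le> \<delta>2 \<and> (\<forall>z\<in>strip \<delta>'. P z \<noteq> 0)"
  by (rule sh_zero_free_strip[OF Psh f(1)]) (auto simp: PR Rp)
 then obtain \<delta>3 where \<delta>3: "\<delta>3 > 0" "\<delta>3 \<le> \<delta>2" "\<And>z. z \<in> strip \<delta>3 \<Longrightarrow> P z \<noteq> 0" by blast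
 have "\<exists>H. strip_hol \<delta>3 H \<and> (\<forall>z\<in>strip \<delta>3. P z = exp (H z))"
 proof (rule sh_log[OF sh_mono[OF Psh \<delta>3(2)] \<delta>3(3)])
  fix h assume "strip_hol \<delta>3 h" "\<And>z. z \<in> strip \<delta>3 \<Longrightarrow> P z = exp (h z)"
  then show ?thesis by (intro exI[of _ h]) simp
 qed
 then obtain H where H: "strip_hol \<delta>3 H" "\<And>z. z \<in> strip \<delta>3 \<Longrightarrow> P z = exp (H z)" by blast
 have Hc: "continuous_on UNIV (\<lambda>w. H (cpt w))" by (rule sh_cont_cpt[OF H(1) \<delta>3(1)])
 have i1: "\<exists>n::int. (H (cpt w) - R w) / (2 * of_real pi * \<i>) = of_int n" for w
 proof (rule exp_2pi_eq_1)
  have "exp (H (cpt w)) = exp (R w)" using H(2)[of "cpt w"] PR[of w] \<delta>3(1) by simp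
  then show "exp (2 * of_real pi * \<i> * ((H (cpt w) - R w) / (2 * of_real pi * \<i>))) = 1" by (simp add: exp_diff)
 qed
 have c1: "continuous_on UNIV (\<lambda>w. (H (cpt w) - R w) / (2 * of_real pi * \<i>))" by (intro continuous_intros Hc Rc) auto
 obtain n :: int where "\<And>w. (H (cpt w) - R w) / (2 * of_real pi * \<i>) = of_int n"
  by (rule integer_valued_constant[OF c1 i1]) (rule that)
 then have HR: "H (cpt w) = R w + 2 * of_real pi * \<i> * of_int n" for w by (simp add: field_simps)
 have "mean (\<lambda>w. H (cpt w)) = mean R + 2 * of_real pi * \<i> * of_int n"
  unfolding HR by (simp add: mean_add_continuous Rc)
 then have "exp (mean (\<lambda>w. H (cpt w))) = exp (mean R)" by (simp add: exp_add)
 also have "\<dots> = base_eigenvalue \<tau> A e g * exp (2 * pi * \<i> * lattice_dot (- kf) \<tau>)"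
  unfolding Rint base_eigenvalue_def exp_add[symmetric] by (simp add: lattice_dot_def sum_negf)
 finally have Hint: "exp (mean (\<lambda>w. H (cpt w))) = base_eigenvalue \<tau> A e g * exp (2 * pi * \<i> * lattice_dot (- kf) \<tau>)" .
 have c0: "4 * c > 0" "\<nu> > 0" using dio by (auto simp: diophantine_def)
 obtain \<psi> \<delta>4 where \<psi>: "\<delta>4 > 0" "\<delta>4 \<le> \<delta>3" "strip_hol \<delta>4 \<psi>" "\<And>j w. \<psi> (cpt (w + axis j 1)) = \<psi> (cpt w)"
  "\<And>w. \<psi> (cpt (w + \<tau>)) - \<psi> (cpt w) = H (cpt w) - mean (\<lambda>w. H (cpt w))"
  by (rule sh_cohomological_equation[OF H(1) \<delta>3(1) _ c0 diophantine_small_divisors[OF dio]]) (auto simp: HR Rp)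
 define s where "s z = exp (\<psi> z) *s v z" for z
 have \<delta>4: "\<delta>4 \<le> \<delta>" using \<psi>(2) \<delta>3(2) f(2) by linarith
 have "normal_form \<tau> U A l m k (base_eigenvalue \<tau> A e g * exp (2 * pi * \<i> * lattice_dot (- kf) \<tau>)) \<delta>4 s"
  unfolding normal_form_def holomorphic_section_def
 proof (intro conjI allI)
  show "strip_hol \<delta>4 (\<lambda>z. s z $ i)" for i
   unfolding s_def by (simp, intro sh_mult sh_exp \<psi>(3) sh_mono[OF v \<delta>4])
  show "A w *v s (cpt w) = (base_eigenvalue \<tau> A e g * exp (2 * pi * \<i> * lattice_dot (- kf) \<tau>) *
    exp (2 * pi * \<i> * (lattice_dot k w - of_int m * \<tau> $ 1 * w $ 2))) *s s (cpt (w + \<tau>))" for w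
  proof -
   have "Q w * Eh (cpt w) = exp (H (cpt w))" using H(2)[of "cpt w"] \<delta>3(1) f(4)[of w] by (simp add: P_def)
   moreover have "Eh (cpt w) * exp (2 * pi * \<i> * (lattice_dot k w - of_int m * \<tau> $ 1 * w $ 2)) = 1"
    unfolding Ehr exp_add[symmetric] by (simp add: algebra_simps)
   ultimately have Qw: "Q w = exp (H (cpt w)) * exp (2 * pi * \<i> * (lattice_dot k w - of_int m * \<tau> $ 1 * w $ 2))"
    by (metis mult.assoc mult.right_neutral)
   have "exp (\<psi> (cpt w)) * exp (H (cpt w)) = exp (mean (\<lambda>w. H (cpt w))) * exp (\<psi> (cpt (w + \<tau>)))"
    using \<psi>(5)[of w] unfolding exp_add[symmetric] by (simp add: algebra_simps)
   then show ?thesis unfolding s_def matrix_smult_vec AQ Qw Hint[symmetric] vector_smult_assoc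
    by (simp add: mult_ac)
  qed
 qed (use \<psi>(1,4) v0 vl CP vU in \<open>auto simp: s_def CP1_smult matrix_smult_vec vector_smult_assoc mult.commute base_eigenvalue_def\<close>)
 then show ?thesis by blast
qed

section \<open>Measurable eigensections\<close>

lemma AE_lebesgue_const: "(AE w in (lebesgue :: (real^2) measure). P) \<Longrightarrow> P"
proof (rule ccontr)
 assume "AE w in (lebesgue :: (real^2) measure). P" "\<not> P"
 then have "emeasure (lebesgue :: (real^2) measure) UNIV = 0"
  using AE_iff_measurable[of UNIV "lebesgue :: (real^2) measure" "\<lambda>w. P"] by simp
 then show False by simp
qed

text \<open>There are only countably many eigenvalues of the translation, so a continuous
 one-parameter group of them is trivial.\<close>

lemma eigenvalue_family_trivial:
 fixes \<kappa> :: real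
 assumes "\<And>x::real. \<exists>n. exp (\<i> * of_real (\<kappa> * x)) = torus_char n (cpt \<tau>)"
 shows "\<kappa> = 0"
proof (rule ccontr)
 assume \<kappa>: "\<kappa> \<noteq> 0"
 define f where "f x = exp (\<i> * of_real (\<kappa> * x))" for x :: real
 have "range f \<subseteq> range (\<lambda>n. torus_char n (cpt \<tau>))" using assms by (auto simp: f_def)
 then have "countable (range f)" by (rule countable_subset) simp
 moreover have "connected (range f)"
  by (rule connected_continuous_image) (auto simp: f_def[abs_def] intro!: continuous_intros)
 ultimately have "f 0 = f (pi / \<kappa>)" using connected_uncountable[of "range f" "f 0" "f (pi / \<kappa>)"] by auto
 then show False using \<kappa> by (simp add: f_def)
qed

lemma eigenvalue_of_nonzero:
 assumes u: "u \<in> lmeas_fns" and C: "\<And>w. norm (u w) \<le> 1"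
  and per: "\<And>j. AE w in lebesgue. u (w + axis j 1) = u w"
  and irr: "\<And>n. n \<noteq> 0 \<Longrightarrow> torus_char n (cpt \<tau>) \<noteq> 1"
  and eig: "AE w in lebesgue. u (w + \<tau>) = \<omega> * u w" and nz: "AE w in lebesgue. u w \<noteq> 0"
 obtains n c where "\<omega> = torus_char n (cpt \<tau>)" "AE w in lebesgue. u w = c * torus_char n (cpt w)"
proof -
 have "\<not> (AE w in lebesgue. u w = 0)"
 proof
  assume "AE w in lebesgue. u w = 0"
  with nz have "AE w in (lebesgue :: (real^2) measure). False" by eventually_elim simp
  then show False by (rule AE_lebesgue_const)
 qed
 then show ?thesis using translation_eigenfunction[OF u C per irr eig] that by blast
qed

lemma measurable_compose_continuous:
 assumes "h \<in> lmeas_fns" "continuous_on UNIV (f :: complex \<Rightarrow> 'b::topological_space)"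
 shows "(\<lambda>w. f (h w)) \<in> lmeas_fns"
 using measurable_comp[OF assms(1) borel_measurable_continuous_onI[OF assms(2)]] by (simp add: o_def)

text \<open>The coefficient of a measurable eigensection in a normal form is rigid. Its modulus and phase are studied separately:
 quotients of translates of the phase are periodic eigenfunctions for a continuum of eigenvalues unless charge and winding vanish,
 and likewise the imaginary powers of the modulus.\<close>

lemma twisted_eigenfunction:
 fixes h :: "real^2 \<Rightarrow> complex" and k :: "int^2" and m :: int
 assumes h[measurable]: "h \<in> lmeas_fns" and nz: "\<not> (AE w in lebesgue. h w = 0)" and \<Lambda>: "\<Lambda> \<noteq> 0" and \<mu>: "\<mu> \<noteq> 0"
  and irr: "\<And>n. n \<noteq> 0 \<Longrightarrow> torus_char n (cpt \<tau>) \<noteq> 1"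
  and h1: "AE w in lebesgue. h (w + axis 1 1) = h w" and h2: "AE w in lebesgue. h (w + axis 2 1) = exp (- (2 * pi * \<i> * of_int m * w $ 1)) * h w"
  and eig: "AE w in lebesgue. \<mu> * h (w + \<tau>) = \<Lambda> * exp (2 * pi * \<i> * (lattice_dot k w - of_int m * \<tau> $ 1 * w $ 2)) * h w"
 obtains n C where "m = 0" "k = 0" "C \<noteq> 0" "AE w in lebesgue. h w = C * torus_char n (cpt w)" "\<mu> * torus_char n (cpt \<tau>) = \<Lambda>"
proof -
 have j12: "P 1 \<Longrightarrow> P 2 \<Longrightarrow> P j" for P and j :: 2 using exhaust_2[of j] by auto
 define u where "u w = sgn (h w)" for w
 have um[measurable]: "u \<in> lmeas_fns" unfolding u_def[abs_def] sgn_div_norm by measurable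
 have ub: "norm (u w) \<le> 1" for w by (simp add: u_def norm_sgn)
 define E where "E w = exp (- (2 * pi * \<i> * of_int m * w $ 1))" for w :: "real^2"
 define c where "c w = exp (2 * pi * \<i> * (lattice_dot k w - of_int m * \<tau> $ 1 * w $ 2))" for w :: "real^2"
 have nE: "norm (E w) = 1" and nc: "norm (c w) = 1" for w by (simp_all add: E_def c_def)
 have sE: "sgn (E w) = E w" and sc: "sgn (c w) = c w" for w by (simp_all add: sgn_div_norm nE nc)
 define \<omega> where "\<omega> = sgn \<Lambda> / sgn \<mu>"
 have n\<omega>: "norm \<omega> = 1" using \<Lambda> \<mu> by (simp add: \<omega>_def norm_divide norm_sgn)
 have u1: "AE w in lebesgue. u (w + axis 1 1) = u w" using h1 by eventually_elim (simp add: u_def)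
 have hE: "AE w in lebesgue. h (w + axis 2 1) = E w * h w" unfolding E_def by (rule h2)
 then have u2: "AE w in lebesgue. u (w + axis 2 1) = E w * u w" by eventually_elim (simp add: u_def sgn_mult sE)
 have ut: "AE w in lebesgue. u (w + \<tau>) = \<omega> * c w * u w"
  using eig
 proof eventually_elim
  case (elim w)
  have "sgn \<mu> * sgn (h (w + \<tau>)) = sgn \<Lambda> * sgn (c w) * sgn (h w)"
   using arg_cong[OF elim, of sgn] unfolding c_def[symmetric] by (simp add: sgn_mult)
  then show ?case using \<mu> unfolding u_def \<omega>_def sc by (simp add: field_simps sgn_eq_0_iff)
 qed
 \<comment> \<open>the support of an eigensection is invariant, hence everything\<close>
 have unz: "AE w in lebesgue. u w \<noteq> 0"
 proof -
  define a where "a w = complex_of_real (norm (u w))" for w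
  have am: "a \<in> lmeas_fns" unfolding a_def[abs_def] by measurable
  have 1: "AE w in lebesgue. a (w + axis 1 1) = a w" using u1 by eventually_elim (simp add: a_def)
  have 2: "AE w in lebesgue. a (w + axis 2 1) = a w" using u2 by eventually_elim (simp add: a_def norm_mult nE)
  have 3: "AE w in lebesgue. a (w + \<tau>) = 1 * a w" using ut by eventually_elim (simp add: a_def norm_mult nc n\<omega>)
  have ab: "norm (a w) \<le> 1" for w using ub by (simp add: a_def)
  have ap: "AE w in lebesgue. a (w + axis j 1) = a w" for j by (rule j12[OF 1 2])
  have anz: "\<not> (AE w in lebesgue. a w = 0)"
  proof
   assume "AE w in lebesgue. a w = 0"
   then have "AE w in lebesgue. h w = 0" by eventually_elim (simp add: a_def u_def sgn_eq_0_iff)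
   then show False using nz by blast
  qed
  then obtain n b where n: "1 = torus_char n (cpt \<tau>)" "AE w in lebesgue. a w = b * torus_char n (cpt w)"
   using translation_eigenfunction[OF am ab ap irr 3] by blast
  have "n = 0" using irr[of n] n(1) by auto
  then have ab: "AE w in lebesgue. a w = b" using n(2) by (simp add: torus_char_def)
  have "b \<noteq> 0" using anz ab by auto
  with ab show ?thesis by (auto simp: a_def)
 qed
 have un1: "AE w in lebesgue. norm (u w) = 1" using unz by eventually_elim (auto simp: u_def norm_sgn sgn_eq_0_iff)
 have kaxis: "lattice_dot k (axis i x) = of_int (k $ i) * x" for i x
  using exhaust_2[of i] by (auto simp: lattice_dot_def sum_2 axis_def)
 have kadd: "lattice_dot k (w + v) = lattice_dot k w + lattice_dot k v" for w v by (simp add: lattice_dot_def ring_distribs sum.distrib)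
 \<comment> \<open>Translating by \<open>\<sigma>\<close> changes \<open>c\<close> by a constant. The quotient \<open>D\<close> is periodic if \<open>\<sigma>\<close> does not change the twist \<open>E\<close>, that is, if \<open>\<sigma>\<^sub>1 = 0\<close> or \<open>m = 0\<close>.\<close>
 have family: "\<exists>n. exp (2 * pi * \<i> * (of_int (k $ i) * x - of_int m * \<tau> $ 1 * (axis i x :: real^2) $ 2)) = torus_char n (cpt \<tau>)"
  if i: "i = 2 \<or> m = 0" for i and x :: real
 proof -
  define \<sigma> :: "real^2" where "\<sigma> = axis i x"
  define D where "D w = u (w + \<sigma>) * cnj (u w)" for w
  have um': "(\<lambda>w. u (w + \<sigma>)) \<in> lmeas_fns" by (rule measurable_translate[OF um])
  have "(\<lambda>w. cnj (u w)) \<in> lmeas_fns" by (intro measurable_compose_continuous[OF um] continuous_intros)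
  then have Dm: "D \<in> lmeas_fns" unfolding D_def[abs_def] by (rule borel_measurable_times[OF um'])
  have Db: "norm (D w) \<le> 1" for w using mult_mono[OF ub[of "w + \<sigma>"] ub[of w]] by (simp add: D_def norm_mult)
  have E1: "m = 0 \<or> \<sigma> $ 1 = 0" using i by (auto simp: \<sigma>_def axis_def)
  have EE: "E (w + \<sigma>) = E w" for w using E1 by (auto simp: E_def)
  have cnj1: "z * cnj z = 1" if "norm z = 1" for z using that by (simp add: complex_norm_square[symmetric])
  have 1: "AE w in lebesgue. D (w + axis 1 1) = D w"
   using u1 AE_translate[OF u1, of \<sigma>] by eventually_elim (simp add: D_def add_ac)
  have 2: "AE w in lebesgue. D (w + axis 2 1) = D w"
   using u2 AE_translate[OF u2, of \<sigma>]
  proof eventually_elim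
   case (elim w)
   have comm: "w + axis 2 1 + \<sigma> = w + \<sigma> + axis 2 1" by simp
   have "D (w + axis 2 1) = (E w * cnj (E w)) * D w" unfolding D_def comm elim EE by simp
   then show ?case using cnj1[OF nE] by simp
  qed
  define \<eta> where "\<eta> = exp (2 * pi * \<i> * (lattice_dot k \<sigma> - of_int m * \<tau> $ 1 * \<sigma> $ 2))"
  have cc: "c (w + \<sigma>) = \<eta> * c w" for w
   unfolding c_def \<eta>_def exp_add[symmetric] by (simp add: kadd algebra_simps)
  have 3: "AE w in lebesgue. D (w + \<tau>) = \<eta> * D w"
   using ut AE_translate[OF ut, of \<sigma>]
  proof eventually_elim
   case (elim w)
   have comm: "w + \<tau> + \<sigma> = w + \<sigma> + \<tau>" by simp
   have "D (w + \<tau>) = \<eta> * (\<omega> * cnj \<omega>) * (c w * cnj (c w)) * D w" unfolding D_def comm elim cc by simp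
   then show ?case using cnj1[OF nc] cnj1[OF n\<omega>] by simp
  qed
  have 4: "AE w in lebesgue. D w \<noteq> 0" using unz AE_translate[OF unz, of \<sigma>] by eventually_elim (simp add: D_def)
  obtain n b where "\<eta> = torus_char n (cpt \<tau>)" by (rule eigenvalue_of_nonzero[OF Dm Db j12[OF 1 2] irr 3 4])
  then show ?thesis unfolding \<eta>_def \<sigma>_def kaxis by (intro exI[of _ n]) simp
 qed
 have k2: "of_int (k $ 2) - of_int m * \<tau> $ 1 = 0"
 proof -
  have "2 * pi * (of_int (k $ 2) - of_int m * \<tau> $ 1) = 0"
  proof (rule eigenvalue_family_trivial[of _ \<tau>])
   show "\<exists>n. exp (\<i> * of_real (2 * pi * (of_int (k $ 2) - of_int m * \<tau> $ 1) * x)) = torus_char n (cpt \<tau>)" for x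
    using family[of 2 x] by (simp add: algebra_simps)
  qed
  then show ?thesis by simp
 qed
 have m0: "m = 0"
 proof (rule ccontr)
  assume "m \<noteq> 0"
  moreover have "torus_char (m, 0) (cpt \<tau>) = exp (2 * of_real pi * \<i> * of_int (k $ 2))"
  proof -
   have "of_int m * \<tau> $ 1 = of_int (k $ 2)" using k2 by simp
   then have "complex_of_real (of_int m * \<tau> $ 1) = of_int (k $ 2)" by simp
   then show ?thesis by (simp add: torus_char_def cpt_def mult.assoc)
  qed
  ultimately show False using irr[of "(m, 0)"] by (simp add: zero_prod_def)
 qed
 have k1: "k $ 1 = 0"
 proof -
  have "2 * pi * of_int (k $ 1) = 0"
  proof (rule eigenvalue_family_trivial[of _ \<tau>])
   show "\<exists>n. exp (\<i> * of_real (2 * pi * of_int (k $ 1) * x)) = torus_char n (cpt \<tau>)" for x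
    using family[of 1 x] m0 by (simp add: algebra_simps)
  qed
  then show ?thesis by simp
 qed
 have k0: "k = 0" using k1 k2 m0 by (simp add: vec_eq_iff forall_2)
 have c1: "c w = 1" and E1: "E w = 1" for w by (simp_all add: c_def E_def m0 k0 lattice_dot_def)
 have up: "AE w in lebesgue. u (w + axis j 1) = u w" for j using j12[OF u1 u2[unfolded E1 mult_1]] .
 have ut': "AE w in lebesgue. u (w + \<tau>) = \<omega> * u w" using ut by (simp add: c1)
 obtain n b where n: "\<omega> = torus_char n (cpt \<tau>)" and un: "AE w in lebesgue. u w = b * torus_char n (cpt w)"
  by (rule eigenvalue_of_nonzero[OF um ub up irr ut' unz])
 \<comment> \<open>the imaginary powers of the modulus are eigenfunctions with eigenvalue \<open>\<beta>\<close> to that power\<close>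
 define r where "r w = norm (h w)" for w
 have rm[measurable]: "r \<in> lmeas_fns" unfolding r_def[abs_def] by measurable
 have r0: "AE w in lebesgue. r w > 0" using unz by eventually_elim (simp add: r_def u_def sgn_eq_0_iff)
 have rp: "AE w in lebesgue. r (w + axis j 1) = r w" for j
 proof (rule j12)
  show "AE w in lebesgue. r (w + axis 1 1) = r w" using h1 by eventually_elim (simp add: r_def)
  show "AE w in lebesgue. r (w + axis 2 1) = r w" using h2 by eventually_elim (simp add: r_def norm_mult)
 qed
 define \<beta> where "\<beta> = norm \<Lambda> / norm \<mu>"
 have \<beta>: "\<beta> > 0" using \<Lambda> \<mu> by (simp add: \<beta>_def)
 have rt: "AE w in lebesgue. r (w + \<tau>) = \<beta> * r w"
  using eig
 proof eventually_elim
  case (elim w)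
  then have "norm (\<mu> * h (w + \<tau>)) = norm (\<Lambda> * c w * h w)" unfolding c_def by simp
  then show ?case using \<mu> by (simp add: r_def norm_mult c1 \<beta>_def field_simps)
 qed
 have "ln \<beta> = 0"
 proof (rule eigenvalue_family_trivial[of _ \<tau>])
  fix x :: real
  define v where "v w = exp (\<i> * of_real (x * ln (r w)))" for w
  have vm: "v \<in> lmeas_fns" unfolding v_def[abs_def]
   by (rule measurable_compose_continuous[where f = exp]) (measurable, intro continuous_intros)
  have v1: "norm (v w) \<le> 1" for w by (simp add: v_def)
  have vp: "AE w in lebesgue. v (w + axis j 1) = v w" for j using rp[of j] by eventually_elim (simp add: v_def)
  have vt: "AE w in lebesgue. v (w + \<tau>) = exp (\<i> * of_real (ln \<beta> * x)) * v w"
   using rt r0 by eventually_elim (use \<beta> in \<open>simp add: v_def ln_mult exp_add[symmetric] algebra_simps\<close>)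
  have v0: "AE w in lebesgue. v w \<noteq> 0" by (simp add: v_def)
  obtain n b where "exp (\<i> * of_real (ln \<beta> * x)) = torus_char n (cpt \<tau>)" by (rule eigenvalue_of_nonzero[OF vm v1 vp irr vt v0])
  then show "\<exists>n. exp (\<i> * of_real (ln \<beta> * x)) = torus_char n (cpt \<tau>)" by blast
 qed
 then have \<beta>1: "\<beta> = 1" using \<beta> by (simp add: ln_eq_zero_iff)
 define \<rho> where "\<rho> w = complex_of_real (r w / (1 + r w))" for w
 have \<rho>m: "\<rho> \<in> lmeas_fns" unfolding \<rho>_def[abs_def] by measurable
 have r0': "r w \<ge> 0" for w by (simp add: r_def)
 have \<rho>b: "norm (\<rho> w) \<le> 1" for w using r0'[of w] unfolding \<rho>_def norm_of_real by (simp add: divide_le_eq)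
 have \<rho>p: "AE w in lebesgue. \<rho> (w + axis j 1) = \<rho> w" for j using rp[of j] by eventually_elim (simp add: \<rho>_def)
 have \<rho>t: "AE w in lebesgue. \<rho> (w + \<tau>) = 1 * \<rho> w" using rt by eventually_elim (simp add: \<rho>_def \<beta>1)
 have \<rho>0: "AE w in lebesgue. \<rho> w \<noteq> 0"
  using r0
 proof eventually_elim
  case (elim w)
  then have "r w / (1 + r w) > 0" by simp
  then show ?case unfolding \<rho>_def of_real_eq_0_iff by linarith
 qed
 obtain n' b' where n': "1 = torus_char n' (cpt \<tau>)" and \<rho>c: "AE w in lebesgue. \<rho> w = b' * torus_char n' (cpt w)"
  by (rule eigenvalue_of_nonzero[OF \<rho>m \<rho>b \<rho>p irr \<rho>t \<rho>0])
 have "n' = 0" using irr[of n'] n' by auto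
 then have \<rho>c: "AE w in lebesgue. \<rho> w = b'" using \<rho>c by (simp add: torus_char_def)
 define C where "C = b' / (1 - b') * b"
 have hC: "AE w in lebesgue. h w = C * torus_char n (cpt w)"
  using \<rho>c un
 proof eventually_elim
  case (elim w)
  have "1 + r w \<noteq> 0" using r0'[of w] by linarith
  then have "complex_of_real (1 + r w) \<noteq> 0" unfolding of_real_eq_0_iff .
  then have "complex_of_real (r w) = b' / (1 - b')"
   unfolding elim(1)[symmetric] \<rho>_def by (simp add: field_simps)
  moreover have "h w = of_real (r w) * u w" by (cases "h w = 0") (simp_all add: r_def u_def sgn_div_norm scaleR_conv_of_real)
  ultimately show ?case by (simp add: C_def elim(2))
 qed
 have C0: "C \<noteq> 0"
 proof
  assume "C = 0"
  then have "AE w in lebesgue. h w = 0" using hC by simp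
  then show False using nz by blast
 qed
 have "AE w in (lebesgue :: (real^2) measure). \<mu> * torus_char n (cpt \<tau>) = \<Lambda>"
  using hC AE_translate[OF hC, of \<tau>] eig
 proof eventually_elim
  case (elim w)
  have "\<mu> * h (w + \<tau>) = \<Lambda> * c w * h w" using elim(3) by (simp add: c_def)
  then have "(\<mu> * torus_char n (cpt \<tau>)) * (C * torus_char n (cpt w)) = \<Lambda> * (C * torus_char n (cpt w))"
   by (simp add: elim(1,2) c1 cpt_add torus_char_add mult_ac)
  moreover have "torus_char n (cpt w) \<noteq> 0" by (simp add: torus_char_def)
  ultimately show ?case using C0 by simp
 qed
 then have "\<mu> * torus_char n (cpt \<tau>) = \<Lambda>" by (rule AE_lebesgue_const)
 then show ?thesis using that m0 k0 C0 hC by blast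
qed

lemma carried_section_coefficient:
 assumes U: "sewing_system U" and CP: "\<And>w. l w \<in> CP1" and s: "holomorphic_section U l m \<delta> s"
  and F: "measurable_section U F" and carried: "carried_by l F"
 obtains h where "h \<in> lmeas_fns" "AE w in lebesgue. F w = h w *s s (cpt w)"
  "AE w in lebesgue. h (w + axis 1 1) = h w" "AE w in lebesgue. h (w + axis 2 1) = exp (- (2 * pi * \<i> * of_int m * w $ 1)) * h w"
proof -
 note sv = s[unfolded holomorphic_section_def]
 have s0: "s (cpt w) \<noteq> 0" and sl: "s (cpt w) \<in> l w" for w using sv by auto
 have s1: "s (cpt (w + axis 1 1)) = U 1 w *v s (cpt w)" and s2: "s (cpt (w + axis 2 1)) = twist m w *s (U 2 w *v s (cpt w))" for w
  using sv by auto
 have Un: "unitary_matrix (U j w)" for j w using U by (simp add: sewing_system_def)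
 have Fm: "F \<in> lmeas_fns" and F12: "\<And>j. AE w in lebesgue. F (w + axis j 1) = U j w *v F w"
  using F by (auto simp: measurable_section_def)
 define h where "h w = herm_inner (s (cpt w)) (F w) / herm_inner (s (cpt w)) (s (cpt w))" for w
 have sc: "(\<lambda>w. s (cpt w) $ i) \<in> lmeas_fns" for i
  using sv by (intro measurable_lebesgue_cont sh_cont_cpt) auto
 have cs: "(\<lambda>w. cnj (s (cpt w) $ i)) \<in> lmeas_fns" for i
  by (intro measurable_compose_continuous[OF sc] continuous_intros)
 have "(\<lambda>x :: complex^2. x $ i) \<in> borel_measurable borel" for i by (intro borel_measurable_continuous_onI continuous_intros)
 then have Fi: "(\<lambda>w. F w $ i) \<in> lmeas_fns" for i
  using measurable_comp[OF Fm, of "\<lambda>x. x $ i"] by (simp add: o_def)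
 have hm: "h \<in> lmeas_fns" unfolding h_def[abs_def] herm_inner_def
  by (intro borel_measurable_divide borel_measurable_sum borel_measurable_times cs Fi sc)
 have Fh: "AE w in lebesgue. F w = h w *s s (cpt w)"
  using carried unfolding carried_by_def
 proof eventually_elim
  case (elim w)
  obtain c where c: "F w = c *s s (cpt w)" using CP1_multiple[OF CP elim sl s0] by blast
  then show ?case by (simp add: h_def herm_inner_smult herm_inner_self_nz[OF s0])
 qed
 have h1: "AE w in lebesgue. h (w + axis 1 1) = h w"
  using F12[of 1] Fh AE_translate[OF Fh, of "axis 1 1"]
 proof eventually_elim
  case (elim w)
  have "h (w + axis 1 1) *s (U 1 w *v s (cpt w)) = h w *s (U 1 w *v s (cpt w))"
   using elim(1) unfolding elim(2,3) s1 matrix_smult_vec .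
  then show ?case using unitary_nz[OF Un s0, of 1 w w] by simp
 qed
 have h2: "AE w in lebesgue. h (w + axis 2 1) = exp (- (2 * pi * \<i> * of_int m * w $ 1)) * h w"
  using F12[of 2] Fh AE_translate[OF Fh, of "axis 2 1"]
 proof eventually_elim
  case (elim w)
  define E where "E = twist m w"
  have "(h (w + axis 2 1) * E) *s (U 2 w *v s (cpt w)) = h w *s (U 2 w *v s (cpt w))"
   using elim(1) unfolding elim(2,3) s2 matrix_smult_vec E_def vector_smult_assoc .
  then have "h (w + axis 2 1) * E = h w" using unitary_nz[OF Un s0, of 2 w w] by simp
  moreover have "exp (- (2 * pi * \<i> * of_int m * w $ 1)) * E = 1" unfolding E_def exp_add[symmetric] by simp
  moreover have "h (w + axis 2 1) = (exp (- (2 * pi * \<i> * of_int m * w $ 1)) * E) * h (w + axis 2 1)" using calculation(2) by simp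
  ultimately show ?case by (metis mult.assoc mult.commute)
 qed
 show ?thesis by (rule that[OF hm Fh h1 h2])
qed

lemma eigensection_rigidity:
 assumes U: "sewing_system U" and CP: "\<And>w. l w \<in> CP1" and nf: "normal_form \<tau> U A l m k \<Lambda> \<delta> s"
  and irr: "\<And>n. n \<noteq> 0 \<Longrightarrow> torus_char n (cpt \<tau>) \<noteq> 1"
  and F: "measurable_section U F" "carried_by l F" "eigen_equation \<tau> A \<mu> F" "\<not> ae_zero F"
 obtains n C where "m = 0" "k = 0" "C \<noteq> 0" "AE w in lebesgue. F w = (C * torus_char n (cpt w)) *s s (cpt w)" "\<mu> * torus_char n (cpt \<tau>) = \<Lambda>"
proof -
 have s: "holomorphic_section U l m \<delta> s" and \<Lambda>: "\<Lambda> \<noteq> 0"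
  and As: "\<And>w. A w *v s (cpt w) = (\<Lambda> * exp (2 * pi * \<i> * (lattice_dot k w - of_int m * \<tau> $ 1 * w $ 2))) *s s (cpt (w + \<tau>))"
  using nf unfolding normal_form_def by auto
 have s0: "s (cpt w) \<noteq> 0" for w using s by (auto simp: holomorphic_section_def)
 obtain h where hm: "h \<in> lmeas_fns" and Fh: "AE w in lebesgue. F w = h w *s s (cpt w)"
  and h1: "AE w in lebesgue. h (w + axis 1 1) = h w" and h2: "AE w in lebesgue. h (w + axis 2 1) = exp (- (2 * pi * \<i> * of_int m * w $ 1)) * h w"
  by (rule carried_section_coefficient[OF U CP s F(1,2)])
 have eig: "AE w in lebesgue. \<mu> * h (w + \<tau>) = \<Lambda> * exp (2 * pi * \<i> * (lattice_dot k w - of_int m * \<tau> $ 1 * w $ 2)) * h w"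
  using F(3)[unfolded eigen_equation_def] Fh AE_translate[OF Fh, of \<tau>]
 proof eventually_elim
  case (elim w)
  have "(h w * (\<Lambda> * exp (2 * pi * \<i> * (lattice_dot k w - of_int m * \<tau> $ 1 * w $ 2)))) *s s (cpt (w + \<tau>)) = (\<mu> * h (w + \<tau>)) *s s (cpt (w + \<tau>))"
   using elim(1) unfolding elim(2,3) matrix_smult_vec As vector_smult_assoc .
  then show ?case using s0[of "w + \<tau>"] by (simp add: mult_ac)
 qed
 have nz: "\<not> (AE w in lebesgue. h w = 0)"
 proof
  assume "AE w in lebesgue. h w = 0"
  with Fh have "AE w in lebesgue. F w = 0" by eventually_elim simp
  then show False using F(4) by (simp add: ae_zero_def)
 qed
 have \<mu>: "\<mu> \<noteq> 0"
 proof
  assume "\<mu> = 0"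
  then have "AE w in lebesgue. h w = 0" using eig \<Lambda> by simp
  then show False using nz by blast
 qed
 obtain n C where n: "m = 0" "k = 0" "C \<noteq> 0" "\<mu> * torus_char n (cpt \<tau>) = \<Lambda>" and hC: "AE w in lebesgue. h w = C * torus_char n (cpt w)"
  by (rule twisted_eigenfunction[OF hm nz \<Lambda> \<mu> irr h1 h2 eig])
 have "AE w in lebesgue. F w = (C * torus_char n (cpt w)) *s s (cpt w)" using Fh hC by eventually_elim simp
 then show ?thesis using that n by blast
qed

lemma character_eigensection:
 assumes CP: "\<And>w. l w \<in> CP1" and nf: "normal_form \<tau> U A l 0 0 \<Lambda> \<delta> s" and C: "C \<noteq> 0" and \<mu>: "\<mu> * torus_char n (cpt \<tau>) = \<Lambda>"
 defines "G \<equiv> \<lambda>w. (C * torus_char n (cpt w)) *s s (cpt w)"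
 shows "measurable_eigensection \<tau> U A \<mu> G" "carried_by l G" "real_analytic G" "\<And>w. G w \<noteq> 0"
proof -
 note sv = nf[unfolded normal_form_def holomorphic_section_def]
 have \<chi>: "torus_char n z \<noteq> 0" for z by (simp add: torus_char_def)
 show G0: "G w \<noteq> 0" for w using C \<chi> sv by (simp add: G_def)
 show "carried_by l G" unfolding carried_by_def G_def using sv CP CP1_smult by (intro always_eventually) blast
 have sh: "strip_hol \<delta> (\<lambda>z. ((C * torus_char n z) *s s z) $ i)" for i
  using sv by (simp, intro sh_mult sh_const sh_torus_char) auto
 have \<delta>: "\<delta> > 0" using sv by simp
 show "real_analytic G" unfolding G_def by (rule sh_imp_real_analytic[OF sh \<delta>])
 have "continuous_on UNIV (\<lambda>w. \<chi> i. ((C * torus_char n (cpt w)) *s s (cpt w)) $ i)"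
  by (intro continuous_on_vec_lambda sh_cont_cpt[OF sh \<delta>])
 then have "continuous_on UNIV G" by (simp only: vec_lambda_eta G_def)
 then have "G \<in> lmeas_fns" by (rule measurable_lebesgue_cont)
 moreover have "G (w + axis j 1) = U j w *v G w" for j w
 proof -
  have "s (cpt (w + axis j 1)) = U j w *v s (cpt w)" using sv exhaust_2[of j] by auto
  then show ?thesis by (simp add: G_def cpt_add[of w "axis j 1"] matrix_smult_vec)
 qed
 moreover have "A w *v G w = \<mu> *s G (w + \<tau>)" for w
 proof -
  have "A w *v s (cpt w) = \<Lambda> *s s (cpt (w + \<tau>))" using sv by (simp add: lattice_dot_def)
  then show ?thesis by (simp add: G_def matrix_smult_vec vector_smult_assoc cpt_add[of w \<tau>] torus_char_add \<mu>[symmetric] mult_ac)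
 qed
 moreover have "\<not> ae_zero G"
 proof
  assume "ae_zero G"
  then have "AE w in (lebesgue :: (real^2) measure). False" using G0 by (simp add: ae_zero_def)
  then show False by (rule AE_lebesgue_const)
 qed
 ultimately show "measurable_eigensection \<tau> U A \<mu> G"
  by (simp add: measurable_eigensection_def measurable_section_def eigen_equation_def)
qed

text \<open>Aperiodicity makes \<open>\<tau>\<^sub>1\<close> irrational, so its multiples are dense modulo one.\<close>

lemma eigenvalues_dense:
 fixes b :: complex
 assumes irr: "\<And>n. n \<noteq> 0 \<Longrightarrow> torus_char n (cpt \<tau>) \<noteq> 1" and b: "b \<noteq> 0"
 shows "sphere 0 (norm b) \<subseteq> closure {b * exp (- (2 * pi * \<i> * lattice_dot n \<tau>)) | n. True}"
proof
 fix z :: complex assume z: "z \<in> sphere 0 (norm b)"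
 have irrat: "\<tau> $ 1 \<notin> \<rat>"
 proof
  assume "\<tau> $ 1 \<in> \<rat>"
  then obtain p q :: int where q: "q > 0" "\<tau> $ 1 = of_int p / of_int q" using Rats_cases' by metis
  then have "of_int q * \<tau> $ 1 = of_int p" by simp
  then have "complex_of_int q * complex_of_real (\<tau> $ 1) = of_int p" by (metis of_real_mult of_real_of_int_eq)
  then have "torus_char (q, 0) (cpt \<tau>) = exp (2 * of_real pi * \<i> * of_int p)" by (simp add: torus_char_def cpt_def)
  then show False using irr[of "(q, 0)"] q(1) by (simp add: zero_prod_def)
 qed
 define X where "X = {of_int k * \<tau> $ 1 - of_int h | k h :: int. True}"
 have "x \<in> closure X" for x
  unfolding closure_approachable
 proof (intro allI impI)
  fix \<epsilon> :: real assume "\<epsilon> > 0"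
  then obtain h k where "\<bar>of_int k * \<tau> $ 1 - of_int h - x\<bar> < \<epsilon>"
   using sequence_of_fractional_parts_is_dense[OF irrat] by metis
  then show "\<exists>y\<in>X. dist y x < \<epsilon>" by (auto simp: X_def dist_real_def)
 qed
 then have X: "closure X = UNIV" by auto
 define f where "f x = b * exp (- (2 * pi * \<i> * of_real x))" for x :: real
 let ?T = "{b * exp (- (2 * pi * \<i> * lattice_dot n \<tau>)) | n. True}"
 have "f ` closure X \<subseteq> closure ?T"
 proof (rule image_closure_subset)
  show "continuous_on (closure X) f" unfolding f_def by (intro continuous_intros)
  show "f ` X \<subseteq> closure ?T"
  proof
   fix y assume "y \<in> f ` X"
   then obtain k h :: int where y: "y = f (of_int k * \<tau> $ 1 - of_int h)" by (auto simp: X_def)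
   have "y = b * (exp (- (2 * pi * \<i> * lattice_dot (axis 1 k) \<tau>)) * exp (2 * of_real pi * \<i> * of_int h))"
    unfolding y f_def exp_add[symmetric] by (simp add: lattice_dot_def sum_2 axis_def algebra_simps)
   then have "y \<in> ?T" by auto
   then show "y \<in> closure ?T" by (rule subsetD[OF closure_subset])
  qed
 qed simp
 moreover have "z \<in> range f"
 proof -
  have "norm (z / b) = 1" using z b by (simp add: norm_divide)
  then obtain t where t: "z / b = exp (\<i> * of_real t)" using complex_unimodular_polar[of "z / b"] by (metis cis_conv_exp cis.code complex_eq_iff cis.simps)
  have "f (- t / (2 * pi)) = z" using t b by (simp add: f_def field_simps)
  then show ?thesis by blast
 qed
 ultimately show "z \<in> closure ?T" unfolding X by blast
qed

theorem theoremD: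
  fixes \<tau> :: "real^2" and U :: "2 \<Rightarrow> real^2 \<Rightarrow> complex^2^2" and A :: "real^2 \<Rightarrow> complex^2^2"
    and ls lu l :: "real^2 \<Rightarrow> (complex^2) set" and c \<nu> :: real
  assumes "strip_admissible \<tau> U A"
    and "dominated_splitting \<tau> U A ls lu"
    and "diophantine \<tau> c \<nu>"
    and "invariant_line \<tau> U A l"
  shows "(l = ls \<or> l = lu) \<and>
    ((\<exists>\<mu> F. measurable_eigensection \<tau> U A \<mu> F \<and> carried_by l F) \<longleftrightarrow>
      first_chern_number U l = 0 \<and> winding_vector \<tau> U A l = 0) \<and>
    (first_chern_number U l = 0 \<and> winding_vector \<tau> U A l = 0 \<longrightarrow>
      (\<forall>e m g. normalized_unit_section U l e m \<and>
          phase_representation (periodic_phase \<tau> A e m) (winding_vector \<tau> U A l) g \<longrightarrow>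
        realised_eigenvalues \<tau> U A l =
          {base_eigenvalue \<tau> A e g * exp (- (2 * pi * \<i> * lattice_dot n \<tau>)) | n. True} \<and>
        realised_eigenvalues \<tau> U A l \<subseteq> sphere 0 (exp (lyapunov_exponent \<tau> A e)) \<and>
        sphere 0 (exp (lyapunov_exponent \<tau> A e)) \<subseteq> closure (realised_eigenvalues \<tau> U A l)) \<and>
      (\<forall>\<mu>\<in>realised_eigenvalues \<tau> U A l. ae_one_dimensional (eigenspace_within \<tau> U A l \<mu>)) \<and>
      (\<forall>\<mu> F. measurable_eigensection \<tau> U A \<mu> F \<and> carried_by l F \<longrightarrow>
        (\<exists>G. measurable_eigensection \<tau> U A \<mu> G \<and> carried_by l G \<and> real_analytic G \<and>
          (\<forall>w. G w \<noteq> 0) \<and> (AE w in lebesgue. F w = G w))))"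
proof -
 note adm = assms(1) and ds = assms(2) and dio = assms(3) and l = assms(4)
 have A: "equivariant_cocycle \<tau> U A" and U: "sewing_system U" using adm by (auto simp: strip_admissible_def)
 obtain \<delta>0 where \<delta>0: "\<delta>0 > 0" "extends_to_strip \<delta>0 A" using adm by (auto simp: strip_admissible_def)
 have ls: "invariant_line \<tau> U A ls" and lu: "invariant_line \<tau> U A lu" using ds by (auto simp: dominated_splitting_def)
 have lines: "l = ls \<or> l = lu" by (rule invariant_line_of_splitting[OF adm ds l])
 have CP: "l w \<in> CP1" for w by (rule invariant_line_CP1[OF l])
 note irr = diophantine_aperiodic[OF dio]
 have ex: "\<exists>e m. normalized_unit_section U l e m" if "invariant_line \<tau> U A l" for l
  using normalized_unit_section_exists[OF U, of l] that unfolding invariant_line_def by metis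
 have nf: "\<exists>\<delta> s k'. normal_form \<tau> U A l m k (base_eigenvalue \<tau> A e g * exp (2 * pi * \<i> * lattice_dot k' \<tau>)) \<delta> s"
  if e: "normalized_unit_section U l e m" and g: "phase_representation (periodic_phase \<tau> A e m) k g" for e m k g
 proof -
  obtain es ms eu mu where es: "normalized_unit_section U ls es ms" and eu: "normalized_unit_section U lu eu mu" using ex ls lu by metis
  have "\<exists>\<delta> v. holomorphic_section U l m \<delta> v"
   using lines dominated_splitting_holomorphic_sections(1)[OF adm ds _ eu, of e m] dominated_splitting_holomorphic_sections(2)[OF adm ds es, of e m] e by auto
  then obtain \<delta>1 v where "holomorphic_section U l m \<delta>1 v" by blast
  then show ?thesis by (rule normal_form_exists[OF A U l e g dio \<delta>0])
 qed
 obtain e m where e: "normalized_unit_section U l e m" using ex l by blast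
 obtain k g where g: "phase_representation (periodic_phase \<tau> A e m) k g" by (rule phase_representation_exists[OF A U l e])
 have chern: "first_chern_number U l = m" by (rule normalized_unit_section_imp_first_chern_number[OF CP e])
 have wind: "winding_vector \<tau> U A l = k" by (rule winding_vector_eq[OF A U l e g])
 obtain \<Lambda> \<delta> s where s: "normal_form \<tau> U A l m k \<Lambda> \<delta> s" using nf[OF e g] by blast
 have rigid: "\<exists>n C. m = 0 \<and> k = 0 \<and> C \<noteq> 0 \<and> (AE w in lebesgue. F w = (C * torus_char n (cpt w)) *s s (cpt w)) \<and> \<mu> * torus_char n (cpt \<tau>) = \<Lambda>"
  if "measurable_eigensection \<tau> U A \<mu> F" "carried_by l F" for \<mu> F
  by (rule eigensection_rigidity[OF U CP s irr, of F \<mu>]) (use that in \<open>auto simp: measurable_eigensection_def\<close>)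
 have iff: "(\<exists>\<mu> F. measurable_eigensection \<tau> U A \<mu> F \<and> carried_by l F) \<longleftrightarrow> first_chern_number U l = 0 \<and> winding_vector \<tau> U A l = 0"
 proof
  assume "first_chern_number U l = 0 \<and> winding_vector \<tau> U A l = 0"
  then have s0: "normal_form \<tau> U A l 0 0 \<Lambda> \<delta> s" using s chern wind by simp
  have "\<Lambda> * torus_char 0 (cpt \<tau>) = \<Lambda>" by (simp add: torus_char_def)
  from character_eigensection(1,2)[OF CP s0 one_neq_zero this]
  show "\<exists>\<mu> F. measurable_eigensection \<tau> U A \<mu> F \<and> carried_by l F" by blast
 qed (use rigid chern wind in blast)
 have spectrum: "realised_eigenvalues \<tau> U A l = {base_eigenvalue \<tau> A e' g' * exp (- (2 * pi * \<i> * lattice_dot n \<tau>)) | n. True}"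
  if zero: "first_chern_number U l = 0" "winding_vector \<tau> U A l = 0"
   and e': "normalized_unit_section U l e' m'" and g': "phase_representation (periodic_phase \<tau> A e' m') (winding_vector \<tau> U A l) g'" for e' m' g'
 proof -
  have m': "m' = 0" using normalized_unit_section_imp_first_chern_number[OF CP e'] zero(1) by simp
  obtain \<delta>' s' k' where s': "normal_form \<tau> U A l 0 0 (base_eigenvalue \<tau> A e' g' * exp (2 * pi * \<i> * lattice_dot k' \<tau>)) \<delta>' s'"
   using nf[OF e' g'] unfolding m' zero(2) by blast
  define b where "b = base_eigenvalue \<tau> A e' g'"
  have shift: "\<mu> * torus_char (p $ 1, p $ 2) (cpt \<tau>) = b * exp (2 * pi * \<i> * lattice_dot k' \<tau>) \<longleftrightarrow>
    \<mu> = b * exp (- (2 * pi * \<i> * lattice_dot (p - k') \<tau>))" for \<mu> p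
  proof -
   have "exp (2 * pi * \<i> * lattice_dot k' \<tau>) = exp (- (2 * pi * \<i> * lattice_dot (p - k') \<tau>)) * exp (2 * pi * \<i> * lattice_dot p \<tau>)"
    unfolding exp_add[symmetric] by (simp add: lattice_dot_def sum_2 algebra_simps)
   then show ?thesis unfolding torus_char_lattice_dot by (simp add: mult.assoc[symmetric])
  qed
  show ?thesis unfolding b_def[symmetric]
  proof (intro set_eqI iffI)
   fix \<mu> assume "\<mu> \<in> realised_eigenvalues \<tau> U A l"
   then obtain F where F: "measurable_eigensection \<tau> U A \<mu> F" "carried_by l F" by (auto simp: realised_eigenvalues_def)
   obtain n where n: "\<mu> * torus_char n (cpt \<tau>) = b * exp (2 * pi * \<i> * lattice_dot k' \<tau>)"
    by (rule eigensection_rigidity[OF U CP s' irr, of F \<mu>]) (use F in \<open>auto simp: measurable_eigensection_def b_def\<close>)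
   obtain p :: "int^2" where p: "n = (p $ 1, p $ 2)" by (rule int_vec_of_pair)
   show "\<mu> \<in> {b * exp (- (2 * pi * \<i> * lattice_dot n \<tau>)) | n. True}" using n unfolding p shift by blast
  next
   fix \<mu> assume "\<mu> \<in> {b * exp (- (2 * pi * \<i> * lattice_dot n \<tau>)) | n. True}"
   then obtain n where n: "\<mu> = b * exp (- (2 * pi * \<i> * lattice_dot n \<tau>))" by blast
   then have "\<mu> * torus_char ((n + k') $ 1, (n + k') $ 2) (cpt \<tau>) = b * exp (2 * pi * \<i> * lattice_dot k' \<tau>)" unfolding shift by simp
   then show "\<mu> \<in> realised_eigenvalues \<tau> U A l"
    using character_eigensection(1,2)[OF CP s' one_neq_zero] unfolding realised_eigenvalues_def b_def by blast
  qed
 qed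
 have simple: "ae_one_dimensional (eigenspace_within \<tau> U A l \<mu>)"
  if zero: "first_chern_number U l = 0" "winding_vector \<tau> U A l = 0" and \<mu>: "\<mu> \<in> realised_eigenvalues \<tau> U A l" for \<mu>
 proof -
  have s0: "normal_form \<tau> U A l 0 0 \<Lambda> \<delta> s" using s chern wind zero by simp
  obtain F1 where F1: "measurable_eigensection \<tau> U A \<mu> F1" "carried_by l F1" using \<mu> by (auto simp: realised_eigenvalues_def)
  obtain n where n: "\<mu> * torus_char n (cpt \<tau>) = \<Lambda>" using rigid[OF F1] by blast
  define F0 where "F0 w = torus_char n (cpt w) *s s (cpt w)" for w
  have F0: "measurable_eigensection \<tau> U A \<mu> F0" "carried_by l F0"
   using character_eigensection(1,2)[OF CP s0 one_neq_zero n] by (simp_all add: F0_def[abs_def])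
  have \<mu>0: "\<mu> \<noteq> 0" using n s by (auto simp: normal_form_def)
  have "\<exists>c. AE w in lebesgue. F w = c *s F0 w" if F: "F \<in> eigenspace_within \<tau> U A l \<mu>" for F
  proof (cases "ae_zero F")
   case True
   then have "AE w in lebesgue. F w = 0 *s F0 w" by (simp add: ae_zero_def)
   then show ?thesis by blast
  next
   case False
   then have "measurable_eigensection \<tau> U A \<mu> F" "carried_by l F" using F by (auto simp: eigenspace_within_def measurable_eigensection_def)
   then obtain n' C where C: "AE w in lebesgue. F w = (C * torus_char n' (cpt w)) *s s (cpt w)" and n': "\<mu> * torus_char n' (cpt \<tau>) = \<Lambda>"
    using rigid by blast
   have "torus_char (n' - n) (cpt \<tau>) * torus_char n (cpt \<tau>) = torus_char n' (cpt \<tau>)"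
    unfolding torus_char_def exp_add[symmetric] by (simp add: algebra_simps)
   moreover have "torus_char n' (cpt \<tau>) = torus_char n (cpt \<tau>)" using n n' \<mu>0 by (metis mult_left_cancel)
   moreover have "torus_char n (cpt \<tau>) \<noteq> 0" by (simp add: torus_char_def)
   ultimately have "torus_char (n' - n) (cpt \<tau>) = 1" by simp
   then have "n' = n" using irr[of "n' - n"] by auto
   then have "AE w in lebesgue. F w = C *s F0 w" using C by (simp add: F0_def vector_smult_assoc)
   then show ?thesis by blast
  qed
  then show ?thesis unfolding ae_one_dimensional_def
   using F0 by (intro bexI[of _ F0]) (auto simp: eigenspace_within_def measurable_eigensection_def)
 qed
 have analytic: "\<exists>G. measurable_eigensection \<tau> U A \<mu> G \<and> carried_by l G \<and> real_analytic G \<and> (\<forall>w. G w \<noteq> 0) \<and> (AE w in lebesgue. F w = G w)"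
  if F: "measurable_eigensection \<tau> U A \<mu> F" "carried_by l F" for \<mu> F
 proof -
  obtain n C where n: "m = 0" "k = 0" "C \<noteq> 0" "\<mu> * torus_char n (cpt \<tau>) = \<Lambda>" and FC: "AE w in lebesgue. F w = (C * torus_char n (cpt w)) *s s (cpt w)"
   using rigid[OF F] by blast
  have s0: "normal_form \<tau> U A l 0 0 \<Lambda> \<delta> s" using s n(1,2) by simp
  show ?thesis using character_eigensection[OF CP s0 n(3,4)] FC by (intro exI[of _ "\<lambda>w. (C * torus_char n (cpt w)) *s s (cpt w)"]) blast
 qed
 have nb: "norm (base_eigenvalue \<tau> A e' g') = exp (lyapunov_exponent \<tau> A e')" "base_eigenvalue \<tau> A e' g' \<noteq> 0" for e' g'
  by (simp_all add: base_eigenvalue_def)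
 have circle: "realised_eigenvalues \<tau> U A l \<subseteq> sphere 0 (exp (lyapunov_exponent \<tau> A e'))"
   "sphere 0 (exp (lyapunov_exponent \<tau> A e')) \<subseteq> closure (realised_eigenvalues \<tau> U A l)"
  if "first_chern_number U l = 0" "winding_vector \<tau> U A l = 0" "normalized_unit_section U l e' m'"
   "phase_representation (periodic_phase \<tau> A e' m') (winding_vector \<tau> U A l) g'" for e' m' g'
 proof -
  show "realised_eigenvalues \<tau> U A l \<subseteq> sphere 0 (exp (lyapunov_exponent \<tau> A e'))"
   unfolding spectrum[OF that] using nb by (auto simp: norm_mult)
  show "sphere 0 (exp (lyapunov_exponent \<tau> A e')) \<subseteq> closure (realised_eigenvalues \<tau> U A l)"
   using eigenvalues_dense[OF irr nb(2)] unfolding spectrum[OF that] nb(1) .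
 qed
 show ?thesis
  using lines iff spectrum circle simple analytic by (intro conjI impI allI ballI) (assumption | (elim conjE, blast) | blast)+
qed

end
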